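(* Let $n\in\mathbb{Z}$ with $n\geq 1$. For every $r\geq 1$, the $\mathrm{AGL}_r(\mathbb{C})$-character variety $\mathfrak{M}_n(\mathrm{AGL}_r(\mathbb{C}))$ of the $n$-twisted Hopf link is an affine variety which is isomorphic to the $\mathrm{GL}_r(\mathbb{C})$-character variety $\mathfrak{M}_n(\mathrm{GL}_r(\mathbb{C}))$. For $r=2$, its motive in $K_0(\mathbf{Var}_{\mathbb{C}})$ is $$[\mathfrak{M}_n(\mathrm{AGL}_2(\mathbb{C}))] = (q-1)^2\left( \left( \lfloor \tfrac{n}{2}\rfloor +1 \right)q^2 -\lfloor \tfrac{n}{2}\rfloor q + n-\lfloor \tfrac{n}{2}\rfloor \right),$$ where $q=[\mathbb{C}]$.
   Context: The $n$-twisted Hopf link $H_n\subseteq \mathbb{S}^3$ is the 2-component link with $2n$ crossings obtained from the Hopf link by twisting its components $n$ times; the fundamental group of its complement has the presentation $\Gamma_n=\langle a,b \mid [a^n,b]=1\rangle$, where $[x,y]=xyx^{-1}y^{-1}$. For a complex linear algebraic group $G$, the $G$-representation variety is the (reduced) affine variety $\mathfrak{R}_n(G)=\mathrm{Hom}(\Gamma_n,G)=\{(A,B)\in G^2 \mid [A^n,B]=\mathrm{Id}\}$, on which $G$ acts by simultaneous conjugation. The $G$-character variety is the GIT quotient $\mathfrak{M}_n(G)=\mathfrak{R}_n(G)/\!\!/G=\mathrm{Spec}\big(\mathcal{O}(\mathfrak{R}_n(G))^G\big)$, the spectrum of the ring of $G$-invariant regular functions. $\mathrm{AGL}_r(\mathbb{C})$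 is the group of affine transformations of $\mathbb{C}^r$, realized as the group of matrices $\begin{pmatrix}1&0\\ \alpha & A_0\end{pmatrix}$ with $\alpha\in\mathbb{C}^r$, $A_0\in\mathrm{GL}_r(\mathbb{C})$ (it is not reductive). $K_0(\mathbf{Var}_{\mathbb{C}})$ is the Grothendieck ring of complex algebraic varieties: generated by isomorphism classes $[X]$ with relations $[X]=[Y]+[X-Y]$ for $Y\subseteq X$ closed, and product $[X][Y]=[X\times Y]$; $[X]$ is called the motive of $X$. *)

theory Defs
  imports
    "HOL-Analysis.Function_Topology"
    "HOL-Library.Poly_Mapping"
    "Jordan_Normal_Form.Determinant"
begin

section \<open>Spaces with functions\<close>

text \<open>
  Varieties are treated in the classical language of Serre: a topological space of (closed) points
  together with, for every open set \<open>U\<close>, the complex-valued regular functions on \<open>U\<close>. Membership in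
  \<open>reg X U\<close> is only meaningful for open \<open>U\<close>, and in all constructions below it only depends on the
  values of the function on \<open>U\<close>.
\<close>

record 'a fspace =
  top_of :: "'a topology"
  reg :: "'a set \<Rightarrow> ('a \<Rightarrow> complex) set"

abbreviation points :: "'a fspace \<Rightarrow> 'a set" where
  "points X \<equiv> topspace (top_of X)"

definition function_sheaf :: "'a fspace \<Rightarrow> bool" where
  "function_sheaf X \<longleftrightarrow>
     (\<forall>U V f. openin (top_of X) U \<and> openin (top_of X) V \<and> V \<subseteq> U \<and> f \<in> reg X U \<longrightarrow> f \<in> reg X V) \<and>
     (\<forall>U f. openin (top_of X) U \<and>
        (\<forall>x\<in>U. \<exists>V g. openin (top_of X) V \<and> x \<in> V \<and> V \<subseteq> U \<and> g \<in> reg X V \<and> (\<forall>y\<in>V. f y = g y))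
        \<longrightarrow> f \<in> reg X U)"

definition morphism :: "'a fspace \<Rightarrow> 'b fspace \<Rightarrow> ('a \<Rightarrow> 'b) \<Rightarrow> bool" where
  "morphism X Y \<phi> \<longleftrightarrow>
     continuous_map (top_of X) (top_of Y) \<phi> \<and>
     (\<forall>V f. openin (top_of Y) V \<and> f \<in> reg Y V \<longrightarrow> f \<circ> \<phi> \<in> reg X {x \<in> points X. \<phi> x \<in> V})"

definition isomorphic :: "'a fspace \<Rightarrow> 'b fspace \<Rightarrow> bool" where
  "isomorphic X Y \<longleftrightarrow>
     (\<exists>\<phi> \<psi>. morphism X Y \<phi> \<and> morphism Y X \<psi> \<and>
        (\<forall>x\<in>points X. \<psi> (\<phi> x) = x) \<and> (\<forall>y\<in>points Y. \<phi> (\<psi> y) = y))"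

text \<open>
  The structure induced on a subset. For a locally closed subset of a variety this is the
  reduced induced structure.
\<close>

definition subspace :: "'a fspace \<Rightarrow> 'a set \<Rightarrow> 'a fspace" where
  "subspace X S =
     \<lparr>top_of = subtopology (top_of X) S,
      reg = (\<lambda>W. {f. \<forall>x\<in>W. \<exists>U g. openin (top_of X) U \<and> x \<in> U \<and> g \<in> reg X U \<and>
                        (\<forall>y\<in>U \<inter> W. f y = g y)})\<rparr>"

text \<open>
  The set \<open>S\<close> with the Zariski topology and the regular functions (locally quotients) defined by a
  \<open>\<complex>\<close>-algebra \<open>A\<close> of functions on \<open>S\<close>.
\<close>

definition zariski_space :: "'a set \<Rightarrow> ('a \<Rightarrow> complex) set \<Rightarrow> 'a fspace" where
  "zariski_space S A =
     \<lparr>top_of = topology_generated_by ((\<lambda>a. {x \<in> S. a x \<noteq> 0}) ` A),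
      reg = (\<lambda>U. {f. \<forall>x\<in>U. \<exists>a\<in>A. \<exists>b\<in>A. b x \<noteq> 0 \<and> (\<forall>y\<in>U. b y \<noteq> 0 \<longrightarrow> f y = a y / b y)})\<rparr>"

text \<open>
  The product of spaces with functions: basic open sets are the non-vanishing loci in \<open>U \<times> V\<close> of
  finite sums of functions \<open>f x * g y\<close>, and regular functions are locally quotients of such sums.
  On varieties this is the usual product of varieties.
\<close>

definition tensor_functions :: "('a \<Rightarrow> complex) set \<Rightarrow> ('b \<Rightarrow> complex) set \<Rightarrow> ('a \<times> 'b \<Rightarrow> complex) set"
  where "tensor_functions A B =
     {\<lambda>(x, y). \<Sum>i<k. f i x * g i y | (k::nat) f g. (\<forall>i<k. f i \<in> A \<and> g i \<in> B)}"

definition prod_space :: "'a fspace \<Rightarrow> 'b fspace \<Rightarrow> ('a \<times> 'b) fspace" where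
  "prod_space X Y =
     \<lparr>top_of = topology_generated_by
        {{z \<in> U \<times> V. h z \<noteq> 0} | U V h. openin (top_of X) U \<and> openin (top_of Y) V \<and>
            h \<in> tensor_functions (reg X U) (reg Y V)},
      reg = (\<lambda>W. {f. \<forall>z\<in>W. \<exists>U V. openin (top_of X) U \<and> openin (top_of Y) V \<and> z \<in> U \<times> V \<and>
        (\<exists>a\<in>tensor_functions (reg X U) (reg Y V). \<exists>b\<in>tensor_functions (reg X U) (reg Y V).
           b z \<noteq> 0 \<and> (\<forall>w\<in>W \<inter> (U \<times> V). b w \<noteq> 0 \<longrightarrow> f w = a w / b w))})\<rparr>"


section \<open>Algebras of functions, affine varieties, varieties\<close>

text \<open>
  The \<open>\<complex>\<close>-algebra of functions on \<open>S\<close> generated by (the restrictions to \<open>S\<close> of) the functions in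
  \<open>G\<close>. Its members are extensional, so that equality of members is equality of functions on \<open>S\<close>.
\<close>

inductive_set generated_algebra :: "'a set \<Rightarrow> ('a \<Rightarrow> complex) set \<Rightarrow> ('a \<Rightarrow> complex) set"
  for S :: "'a set" and G :: "('a \<Rightarrow> complex) set" where
  const: "(\<lambda>x\<in>S. c) \<in> generated_algebra S G"
| gen: "g \<in> G \<Longrightarrow> restrict g S \<in> generated_algebra S G"
| add: "f \<in> generated_algebra S G \<Longrightarrow> g \<in> generated_algebra S G \<Longrightarrow>
    (\<lambda>x\<in>S. f x + g x) \<in> generated_algebra S G"
| mult: "f \<in> generated_algebra S G \<Longrightarrow> g \<in> generated_algebra S G \<Longrightarrow>
    (\<lambda>x\<in>S. f x * g x) \<in> generated_algebra S G"

definition finitely_generated :: "'a set \<Rightarrow> ('a \<Rightarrow> complex) set \<Rightarrow> bool" where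
  "finitely_generated S A \<longleftrightarrow> (\<exists>F. finite F \<and> F \<subseteq> A \<and> A = generated_algebra S F)"

definition affine_points :: "nat \<Rightarrow> (nat \<Rightarrow> complex) set" where
  "affine_points m = {..<m} \<rightarrow>\<^sub>E UNIV"

definition affine_space :: "nat \<Rightarrow> (nat \<Rightarrow> complex) fspace" where
  "affine_space m =
     zariski_space (affine_points m) (generated_algebra (affine_points m) ((\<lambda>i x. x i) ` {..<m}))"

definition affine_variety :: "'a fspace \<Rightarrow> bool" where
  "affine_variety X \<longleftrightarrow>
     (\<exists>m Z. closedin (top_of (affine_space m)) Z \<and> isomorphic X (subspace (affine_space m) Z))"

text \<open>Varieties are reduced and separated, but neither irreducible nor affine in general.\<close>

definition variety :: "'a fspace \<Rightarrow> bool" where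
  "variety X \<longleftrightarrow>
     function_sheaf X \<and>
     (\<exists>\<U>. finite \<U> \<and> \<Union>\<U> = points X \<and>
        (\<forall>U\<in>\<U>. openin (top_of X) U \<and> affine_variety (subspace X U))) \<and>
     closedin (top_of (prod_space X X)) {(x, x) | x. x \<in> points X}"

text \<open>
  The space of \<open>\<complex>\<close>-points of \<open>Spec A\<close>, for a \<open>\<complex>\<close>-algebra \<open>A\<close> of (extensional) functions on \<open>S\<close>:
  points are the \<open>\<complex>\<close>-algebra homomorphisms \<open>A \<rightarrow> \<complex>\<close>, and \<open>a \<in> A\<close> acts as the function \<open>\<chi> \<mapsto> \<chi> a\<close>.
\<close>

definition characters :: "'a set \<Rightarrow> ('a \<Rightarrow> complex) set \<Rightarrow> (('a \<Rightarrow> complex) \<Rightarrow> complex) set" where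
  "characters S A =
     {\<chi> \<in> extensional A.
        (\<forall>c. \<chi> (\<lambda>x\<in>S. c) = c) \<and>
        (\<forall>f\<in>A. \<forall>g\<in>A. \<chi> (\<lambda>x\<in>S. f x + g x) = \<chi> f + \<chi> g \<and> \<chi> (\<lambda>x\<in>S. f x * g x) = \<chi> f * \<chi> g)}"

definition Spec :: "'a set \<Rightarrow> ('a \<Rightarrow> complex) set \<Rightarrow> (('a \<Rightarrow> complex) \<Rightarrow> complex) fspace" where
  "Spec S A = zariski_space (characters S A) ((\<lambda>a \<chi>. \<chi> a) ` A)"


section \<open>The Grothendieck ring of complex varieties\<close>

text \<open>
  A variety has at most continuum many points, so every variety is isomorphic to one whose points
  have type \<^typ>\<open>nat \<Rightarrow> complex\<close>.
\<close>

typedef cvariety = "{X :: (nat \<Rightarrow> complex) fspace. variety X}"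
  morphisms space_of Abs_cvariety
proof
  let ?E = "\<lparr>top_of = discrete_topology {}, reg = (\<lambda>_. UNIV)\<rparr> :: (nat \<Rightarrow> complex) fspace"
  show "?E \<in> {X. variety X}"
    by (auto simp: variety_def function_sheaf_def intro!: exI[of _ "{}"])
qed

text \<open>
  The commutative ring presented by generators \<open>[X]\<close> and the relations below, as a quotient of the
  polynomial ring over the integers with one variable for each variety. The unit of the ring is the
  class of a point.
\<close>

type_synonym vpoly = "(cvariety \<Rightarrow>\<^sub>0 nat) \<Rightarrow>\<^sub>0 int"

definition var :: "cvariety \<Rightarrow> vpoly" where
  "var X = Poly_Mapping.single (Poly_Mapping.single X 1) 1"

inductive_set K0_ideal :: "vpoly set" where
  iso: "isomorphic (space_of X) (space_of Y) \<Longrightarrow> var X - var Y \<in> K0_ideal"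
| scissor: "closedin (top_of (space_of X)) S \<Longrightarrow>
    isomorphic (space_of Y) (subspace (space_of X) S) \<Longrightarrow>
    isomorphic (space_of Z) (subspace (space_of X) (points (space_of X) - S)) \<Longrightarrow>
    var X - (var Y + var Z) \<in> K0_ideal"
| product: "isomorphic (space_of Z) (prod_space (space_of X) (space_of Y)) \<Longrightarrow>
    var X * var Y - var Z \<in> K0_ideal"
| point: "isomorphic (space_of X) (affine_space 0) \<Longrightarrow> var X - 1 \<in> K0_ideal"
| zero: "0 \<in> K0_ideal"
| add: "p \<in> K0_ideal \<Longrightarrow> p' \<in> K0_ideal \<Longrightarrow> p + p' \<in> K0_ideal"
| mult: "p \<in> K0_ideal \<Longrightarrow> s * p \<in> K0_ideal"

lemma K0_ideal_uminus: "p \<in> K0_ideal \<Longrightarrow> - p \<in> K0_ideal"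
  using K0_ideal.mult[of p "-1"] by simp

definition K0_rel :: "vpoly \<Rightarrow> vpoly \<Rightarrow> bool" where
  "K0_rel p p' \<longleftrightarrow> p - p' \<in> K0_ideal"

quotient_type K0 = vpoly / K0_rel
proof (rule equivpI)
  show "reflp K0_rel"
    by (auto simp: reflp_def K0_rel_def K0_ideal.zero)
  show "symp K0_rel"
    unfolding symp_def K0_rel_def using K0_ideal_uminus by fastforce
  show "transp K0_rel"
    unfolding transp_def K0_rel_def using K0_ideal.add by fastforce
qed

instantiation K0 :: "{comm_ring, comm_monoid_mult}"
begin

lift_definition zero_K0 :: K0 is 0 .
lift_definition one_K0 :: K0 is 1 .
lift_definition plus_K0 :: "K0 \<Rightarrow> K0 \<Rightarrow> K0" is "(+)"
  unfolding K0_rel_def by (metis K0_ideal.add add_diff_add)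
lift_definition uminus_K0 :: "K0 \<Rightarrow> K0" is uminus
  unfolding K0_rel_def by (metis K0_ideal_uminus minus_diff_eq minus_diff_minus)
lift_definition minus_K0 :: "K0 \<Rightarrow> K0 \<Rightarrow> K0" is "(-)"
  unfolding K0_rel_def
proof -
  fix a b c d :: vpoly
  assume "a - b \<in> K0_ideal" "c - d \<in> K0_ideal"
  from K0_ideal.add[OF this(1) K0_ideal_uminus[OF this(2)]]
  show "a - c - (b - d) \<in> K0_ideal" by (simp add: algebra_simps)
qed
lift_definition times_K0 :: "K0 \<Rightarrow> K0 \<Rightarrow> K0" is "(*)"
  unfolding K0_rel_def
proof -
  fix a b c d :: vpoly
  assume "a - b \<in> K0_ideal" "c - d \<in> K0_ideal"
  from K0_ideal.add[OF K0_ideal.mult[OF this(1), of c] K0_ideal.mult[OF this(2), of b]]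
  show "a * c - b * d \<in> K0_ideal" by (simp add: algebra_simps)
qed

instance
  by standard (transfer; simp add: K0_rel_def algebra_simps K0_ideal.zero)+

end

text \<open>
  The canonical ring homomorphism from the integers. (The library's \<^const>\<open>of_int\<close> is not
  available: its type class includes the axiom \<open>0 \<noteq> 1\<close>, which for this ring is a theorem about
  varieties.)
\<close>

lift_definition int_K0 :: "int \<Rightarrow> K0" is of_int .

lemma int_K0_simps:
  "int_K0 0 = 0" "int_K0 1 = 1" "int_K0 (a + b) = int_K0 a + int_K0 b"
  "int_K0 (a - b) = int_K0 a - int_K0 b" "int_K0 (a * b) = int_K0 a * int_K0 b"
  by (transfer; simp add: K0_rel_def K0_ideal.zero)+

lift_definition K0_class :: "cvariety \<Rightarrow> K0" is var .

lemma K0_class_iso: "isomorphic (space_of X) (space_of Y) \<Longrightarrow> K0_class X = K0_class Y"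
  by transfer (simp add: K0_rel_def K0_ideal.iso)

lemma K0_class_scissor:
  "closedin (top_of (space_of X)) S \<Longrightarrow>
   isomorphic (space_of Y) (subspace (space_of X) S) \<Longrightarrow>
   isomorphic (space_of Z) (subspace (space_of X) (points (space_of X) - S)) \<Longrightarrow>
   K0_class X = K0_class Y + K0_class Z"
  by transfer (simp add: K0_rel_def K0_ideal.scissor)

lemma K0_class_product:
  "isomorphic (space_of Z) (prod_space (space_of X) (space_of Y)) \<Longrightarrow>
   K0_class X * K0_class Y = K0_class Z"
  by transfer (simp add: K0_rel_def K0_ideal.product)

lemma K0_class_point: "isomorphic (space_of X) (affine_space 0) \<Longrightarrow> K0_class X = 1"
  by transfer (simp add: K0_rel_def K0_ideal.point)

definition motive :: "'a fspace \<Rightarrow> K0" where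
  "motive X = K0_class (SOME V. isomorphic (space_of V) X)"


section \<open>Representation and character varieties of twisted Hopf links\<close>

definition GL :: "nat \<Rightarrow> complex mat monoid" where
  "GL r = units_of (ring_mat TYPE(complex) r ())"

definition AGL :: "nat \<Rightarrow> complex mat monoid" where
  "AGL r = GL (r + 1)
     \<lparr>carrier := {four_block_mat (1\<^sub>m 1) (0\<^sub>m 1 r) \<alpha> A | \<alpha> A.
                    \<alpha> \<in> carrier_mat r 1 \<and> A \<in> carrier (GL r)}\<rparr>"

lemma group_GL: "group (GL r)"
  unfolding GL_def by (intro monoid.units_group ring.is_monoid ring_mat)

lemma carrier_GL:
  "carrier (GL r) = {A \<in> carrier_mat r r. \<exists>B\<in>carrier_mat r r. A * B = 1\<^sub>m r \<and> B * A = 1\<^sub>m r}"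
  by (auto simp: GL_def units_of_def Units_def ring_mat_def)

lemma GL_simps: "x \<otimes>\<^bsub>GL r\<^esub> y = x * y" "\<one>\<^bsub>GL r\<^esub> = 1\<^sub>m r"
  by (simp_all add: GL_def units_of_def ring_mat_def)

lemma mult_affine_block:
  assumes "\<alpha> \<in> carrier_mat r 1" "\<beta> \<in> carrier_mat r 1" "A \<in> carrier_mat r r" "B \<in> carrier_mat r r"
  shows "four_block_mat (1\<^sub>m 1) (0\<^sub>m 1 r) \<alpha> A * four_block_mat (1\<^sub>m 1) (0\<^sub>m 1 r) \<beta> B =
    four_block_mat (1\<^sub>m 1) (0\<^sub>m 1 r) (\<alpha> + A * \<beta>) (A * (B :: complex mat))"
  using assms by (subst mult_four_block_mat[where ?nr1.0 = 1 and ?n1.0 = 1 and ?n2.0 = r and ?nr2.0 = r]) auto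

lemma affine_block_one: "four_block_mat (1\<^sub>m 1) (0\<^sub>m 1 r) (0\<^sub>m r 1) (1\<^sub>m r) = (1\<^sub>m (r + 1) :: complex mat)"
  by (rule eq_matI) auto

lemma affine_block_inverse:
  assumes "\<alpha> \<in> carrier_mat r 1" "A \<in> carrier_mat r r" "B \<in> carrier_mat r r"
    and AB: "A * B = 1\<^sub>m r" and BA: "B * A = (1\<^sub>m r :: complex mat)"
  shows "four_block_mat (1\<^sub>m 1) (0\<^sub>m 1 r) \<alpha> A * four_block_mat (1\<^sub>m 1) (0\<^sub>m 1 r) (- (B * \<alpha>)) B = 1\<^sub>m (r + 1)"
    "four_block_mat (1\<^sub>m 1) (0\<^sub>m 1 r) (- (B * \<alpha>)) B * four_block_mat (1\<^sub>m 1) (0\<^sub>m 1 r) \<alpha> A = 1\<^sub>m (r + 1)"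
proof -
  have "A * - (B * \<alpha>) = - (A * (B * \<alpha>))" using assms by (intro uminus_mult_right_mat) auto
  also have "A * (B * \<alpha>) = \<alpha>" using assms AB by (simp flip: assoc_mult_mat[of A r r B r \<alpha> 1])
  finally have "\<alpha> + A * - (B * \<alpha>) = 0\<^sub>m r 1" using assms by auto
  moreover have "- (B * \<alpha>) + B * \<alpha> = 0\<^sub>m r 1" using assms by auto
  moreover have "- (B * \<alpha>) \<in> carrier_mat r 1" using assms by auto
  ultimately show "four_block_mat (1\<^sub>m 1) (0\<^sub>m 1 r) \<alpha> A * four_block_mat (1\<^sub>m 1) (0\<^sub>m 1 r) (- (B * \<alpha>)) B = 1\<^sub>m (r + 1)"
    "four_block_mat (1\<^sub>m 1) (0\<^sub>m 1 r) (- (B * \<alpha>)) B * four_block_mat (1\<^sub>m 1) (0\<^sub>m 1 r) \<alpha> A = 1\<^sub>m (r + 1)"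
    using assms by (simp_all only: mult_affine_block affine_block_one)
qed

lemma AGL_subgroup: "subgroup (carrier (AGL r)) (GL (r + 1))"
proof -
  interpret G: group "GL (r + 1)" by (rule group_GL)
  interpret L: group "GL r" by (rule group_GL)
  let ?b = "\<lambda>\<alpha> A. four_block_mat (1\<^sub>m 1) (0\<^sub>m 1 r) \<alpha> A :: complex mat"
  have AGL: "carrier (AGL r) = {?b \<alpha> A | \<alpha> A. \<alpha> \<in> carrier_mat r 1 \<and> A \<in> carrier (GL r)}"
    by (simp add: AGL_def)
  have AGLI: "?b \<alpha> A \<in> carrier (AGL r)" if "\<alpha> \<in> carrier_mat r 1" "A \<in> carrier (GL r)" for \<alpha> A
    unfolding AGL using that by blast
  have inverse: "\<exists>y\<in>carrier (AGL r). x * y = 1\<^sub>m (r + 1) \<and> y * x = 1\<^sub>m (r + 1)"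
    if x: "x \<in> carrier (AGL r)" for x
  proof -
    from x obtain \<alpha> A B where *: "x = ?b \<alpha> A" "\<alpha> \<in> carrier_mat r 1"
      "A \<in> carrier_mat r r" "B \<in> carrier_mat r r" "A * B = 1\<^sub>m r" "B * A = 1\<^sub>m r"
      unfolding AGL carrier_GL by blast
    have "B \<in> carrier (GL r)" using * unfolding carrier_GL by blast
    then have "?b (- (B * \<alpha>)) B \<in> carrier (AGL r)" using * by (intro AGLI) simp_all
    then show ?thesis using affine_block_inverse[OF *(2-6)] *(1) by (intro bexI) simp_all
  qed
  have cm: "carrier (AGL r) \<subseteq> carrier_mat (r + 1) (r + 1)"
  proof
    fix x assume "x \<in> carrier (AGL r)"
    then obtain \<alpha> A where "x = ?b \<alpha> A" "A \<in> carrier_mat r r"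
      unfolding AGL carrier_GL by blast
    then show "x \<in> carrier_mat (r + 1) (r + 1)" by (intro carrier_matI) auto
  qed
  have sub: "carrier (AGL r) \<subseteq> carrier (GL (r + 1))"
    using inverse cm unfolding carrier_GL by blast
  show ?thesis
  proof (rule G.subgroupI)
    show "carrier (AGL r) \<subseteq> carrier (GL (r + 1))" by (rule sub)
    have "?b (0\<^sub>m r 1) (1\<^sub>m r) \<in> carrier (AGL r)"
      using L.one_closed by (intro AGLI) (simp_all add: GL_simps)
    then show "carrier (AGL r) \<noteq> {}" by blast
    show "inv\<^bsub>GL (r + 1)\<^esub> a \<in> carrier (AGL r)" if a: "a \<in> carrier (AGL r)" for a
    proof -
      obtain y where y: "y \<in> carrier (AGL r)" "y * a = 1\<^sub>m (r + 1)" using inverse[OF a] by blast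
      then have "inv\<^bsub>GL (r + 1)\<^esub> a = y" using a sub by (intro G.inv_equality) (auto simp: GL_simps)
      with y show ?thesis by simp
    qed
    show "a \<otimes>\<^bsub>GL (r + 1)\<^esub> b \<in> carrier (AGL r)" if "a \<in> carrier (AGL r)" "b \<in> carrier (AGL r)" for a b
    proof -
      from that obtain \<alpha> A \<beta> B where *: "a = ?b \<alpha> A" "\<alpha> \<in> carrier_mat r 1" "A \<in> carrier (GL r)"
        "b = ?b \<beta> B" "\<beta> \<in> carrier_mat r 1" "B \<in> carrier (GL r)"
        unfolding AGL by auto
      moreover have "A \<in> carrier_mat r r" "B \<in> carrier_mat r r" using * by (auto simp: carrier_GL)
      moreover have "A * B \<in> carrier (GL r)" using L.m_closed[OF *(3,6)] by (simp add: GL_simps)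
      moreover have "\<alpha> + A * \<beta> \<in> carrier_mat r 1" using calculation by auto
      ultimately show ?thesis by (simp only: GL_simps mult_affine_block AGLI)
    qed
  qed
qed

lemma group_AGL: "group (AGL r)"
  using subgroup.subgroup_is_group[OF AGL_subgroup group_GL] by (simp add: AGL_def)

text \<open>Pairs \<open>(A, B)\<close> with \<open>[A\<^sup>n, B] = 1\<close>, i.e. homomorphisms from \<open>\<langle>a, b | [a\<^sup>n, b] = 1\<rangle>\<close> to \<open>G\<close>.\<close>

definition rep_variety :: "nat \<Rightarrow> complex mat monoid \<Rightarrow> (complex mat \<times> complex mat) set" where
  "rep_variety n G =
     {(A, B) \<in> carrier G \<times> carrier G.
        (A [^]\<^bsub>G\<^esub> n) \<otimes>\<^bsub>G\<^esub> B \<otimes>\<^bsub>G\<^esub> inv\<^bsub>G\<^esub> (A [^]\<^bsub>G\<^esub> n) \<otimes>\<^bsub>G\<^esub> inv\<^bsub>G\<^esub> B = \<one>\<^bsub>G\<^esub>}"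

text \<open>
  For a closed subgroup \<open>G\<close> of \<open>GL N\<close>, the coordinate ring of the representation variety, which is
  closed in \<open>GL N \<times> GL N\<close>, is generated by the matrix entries and the inverse determinants.
\<close>

definition rep_ring :: "nat \<Rightarrow> nat \<Rightarrow> complex mat monoid \<Rightarrow> (complex mat \<times> complex mat \<Rightarrow> complex) set"
  where "rep_ring n N G = generated_algebra (rep_variety n G)
     ({\<lambda>(A, B). A $$ (i, j) | i j. i < N \<and> j < N} \<union> {\<lambda>(A, B). B $$ (i, j) | i j. i < N \<and> j < N} \<union>
      {\<lambda>(A, B). 1 / det A, \<lambda>(A, B). 1 / det B})"

definition invariant_ring ::
  "nat \<Rightarrow> nat \<Rightarrow> complex mat monoid \<Rightarrow> (complex mat \<times> complex mat \<Rightarrow> complex) set" where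
  "invariant_ring n N G =
     {f \<in> rep_ring n N G. \<forall>g\<in>carrier G. \<forall>(A, B)\<in>rep_variety n G.
        f (g \<otimes>\<^bsub>G\<^esub> A \<otimes>\<^bsub>G\<^esub> inv\<^bsub>G\<^esub> g, g \<otimes>\<^bsub>G\<^esub> B \<otimes>\<^bsub>G\<^esub> inv\<^bsub>G\<^esub> g) = f (A, B)}"

definition character_variety ::
  "nat \<Rightarrow> nat \<Rightarrow> complex mat monoid \<Rightarrow> ((complex mat \<times> complex mat \<Rightarrow> complex) \<Rightarrow> complex) fspace"
  where "character_variety n N G = Spec (rep_variety n G) (invariant_ring n N G)"

end

theory Submission
  imports Defs
    "HOL-Library.Function_Algebras"
    "HOL-Computational_Algebra.Polynomial"
begin

text \<open>
  Conjugation by a homothety of ratio \<open>t\<close> multiplies translation parts by \<open>t\<close>, so for \<open>t \<rightarrow> 0\<close> an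
  \<open>AGL r\<close>-invariant regular function is determined by the linear parts. Hence taking linear parts
  identifies the two invariant rings, and finite generation reduces to Hilbert's theorem for \<open>GL r\<close>;
  there, the Reynolds operator is replaced by an orthogonality argument for a group of matrices
  closed under adjoints.

  For pairs \<open>(A, B)\<close> of \<open>2 \<times> 2\<close> matrices the invariants are generated by \<open>x = tr A\<close>, \<open>d = det A\<close>,
  \<open>y = tr B\<close>, \<open>e = det B\<close>, \<open>z = tr (A * B)\<close> and \<open>1 / d\<close>, \<open>1 / e\<close>. Since \<open>A\<^sup>n = u A + c\<close> for scalars \<open>u, c\<close>,
  where \<open>u = 0\<close> means that the eigenvalues of \<open>A\<close> differ and their ratio is an \<open>n\<close>-th root of unity,
  the relation \<open>[A\<^sup>n, B] = 1\<close> says that \<open>u = 0\<close> or that \<open>A\<close> and \<open>B\<close> commute. So the character variety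
  is the union of the locus \<open>tr [A, B] = 2\<close> of reducible pairs, with motive \<open>(q - 1)\<^sup>2 (q\<^sup>2 + 1)\<close>, and of
  the irreducible parts of the hypersurfaces \<open>x\<^sup>2 = c d\<close>, one for each pair \<open>{\<zeta>, 1 / \<zeta>}\<close> of roots of
  unity \<open>\<zeta> \<noteq> 1\<close>, where \<open>c = 2 + \<zeta> + 1 / \<zeta>\<close>; their motives are \<open>(q - 1)\<^sup>2 (q\<^sup>2 - q + 1)\<close>, except for
  \<open>(q - 1)\<^sup>2 (q\<^sup>2 - q)\<close> when \<open>\<zeta> = - 1\<close>.
\<close>

section \<open>Zariski spaces and their morphisms\<close>

text \<open>Why orthogonality can replace averaging: the coefficients of a polynomial function on
  the representation variety are not unique, and their ambiguity is a linear subspace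
  \<open>K\<close>. Conjugation moves the coefficients of an invariant function only inside
  \<open>K\<close>; as the matrices are closed under adjoints, the component orthogonal to
  \<open>K\<close> does not move at all. So an invariant function has invariant coefficients. This
  serves twice: in Hilbert's induction on the degree, and for \<open>r = 2\<close> to extend an
  invariant from the representation variety to all pairs of matrices, where pairs may be perturbed
  freely. A fibration whose fibres involve square roots need not be a product. The strata are
  therefore written in the discriminants \<open>D = x^2 - 4 d\<close>, \<open>E = y^2 - 4 e\<close>
  and \<open>w = 2 z - x y\<close>, in which reducibility reads \<open>w^2 = D E\<close>, and are
  cut until each piece has a rational parametrisation. On \<open>x^2 = c d\<close> with
  \<open>c \<noteq> 0\<close>, \<open>D\<close> is a constant times \<open>x^2\<close>, hence a
  square; for \<open>c = 0\<close> it is not, and that stratum needs a calculation of its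
  own.\<close>

definition falg :: "'a set \<Rightarrow> ('a \<Rightarrow> complex) set \<Rightarrow> bool" where
  "falg S A \<longleftrightarrow> (\<forall>c. \<exists>a\<in>A. \<forall>x\<in>S. a x = c) \<and>
     (\<forall>f\<in>A. \<forall>g\<in>A. (\<exists>h\<in>A. \<forall>x\<in>S. h x = f x + g x) \<and> (\<exists>h\<in>A. \<forall>x\<in>S. h x = f x * g x))"

lemma falgD:
  assumes "falg S A"
  shows "\<exists>a\<in>A. \<forall>x\<in>S. a x = c"
    and "f \<in> A \<Longrightarrow> g \<in> A \<Longrightarrow> \<exists>h\<in>A. \<forall>x\<in>S. h x = f x + g x"
    and "f \<in> A \<Longrightarrow> g \<in> A \<Longrightarrow> \<exists>h\<in>A. \<forall>x\<in>S. h x = f x * g x"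
  using assms unfolding falg_def by blast+

text \<open>This is why \<open>falg\<close> asks for the operations only up to values on the point
  set: the same functions serve on every subset, without being restricted.\<close>

lemma falg_subset: "falg S A \<Longrightarrow> T \<subseteq> S \<Longrightarrow> falg T A"
  unfolding falg_def subset_iff by (intro conjI allI ballI) metis+

lemma falg_generated: "falg S (generated_algebra S G)"
  unfolding falg_def
proof (intro conjI allI ballI)
  fix c show "\<exists>a\<in>generated_algebra S G. \<forall>x\<in>S. a x = c"
    by (rule bexI[OF _ generated_algebra.const[where c = c]]) simp
next
  fix f g assume *: "f \<in> generated_algebra S G" "g \<in> generated_algebra S G"
  show "\<exists>h\<in>generated_algebra S G. \<forall>x\<in>S. h x = f x + g x"
    by (rule bexI[OF _ generated_algebra.add[OF *]]) simp
  show "\<exists>h\<in>generated_algebra S G. \<forall>x\<in>S. h x = f x * g x"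
    by (rule bexI[OF _ generated_algebra.mult[OF *]]) simp
qed

lemma reg_zariski:
  "f \<in> reg (zariski_space S A) U \<longleftrightarrow>
     (\<forall>x\<in>U. \<exists>a\<in>A. \<exists>b\<in>A. b x \<noteq> 0 \<and> (\<forall>y\<in>U. b y \<noteq> 0 \<longrightarrow> f y = a y / b y))"
  by (simp add: zariski_space_def)

text \<open>Products make the nonvanishing loci closed under finite intersections, so they are a
  base of the generated topology and openness can be tested with one function per point.\<close>

lemma openin_zariski:
  assumes "falg S A"
  shows "openin (top_of (zariski_space S A)) U \<longleftrightarrow>
    U \<subseteq> S \<and> (\<forall>x\<in>U. \<exists>a\<in>A. a x \<noteq> 0 \<and> (\<forall>y\<in>S. a y \<noteq> 0 \<longrightarrow> y \<in> U))" (is "?L \<longleftrightarrow> ?R U")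
proof
  assume ?L
  then have "generate_topology_on ((\<lambda>a. {x \<in> S. a x \<noteq> 0}) ` A) U"
    by (simp add: zariski_space_def openin_topology_generated_by_iff)
  then show "?R U"
  proof induction
    case Empty then show ?case by simp
  next
    case (Int U V)
    show ?case
    proof (intro conjI ballI)
      show "U \<inter> V \<subseteq> S" using Int by blast
      fix x assume x: "x \<in> U \<inter> V"
      obtain a where a: "a \<in> A" "a x \<noteq> 0" "\<forall>y\<in>S. a y \<noteq> 0 \<longrightarrow> y \<in> U" using Int x by blast
      obtain b where b: "b \<in> A" "b x \<noteq> 0" "\<forall>y\<in>S. b y \<noteq> 0 \<longrightarrow> y \<in> V" using Int x by blast
      obtain c where c: "c \<in> A" "\<forall>y\<in>S. c y = a y * b y" using falgD(3)[OF assms a(1) b(1)] by blast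
      have "x \<in> S" using x Int by blast
      then show "\<exists>a\<in>A. a x \<noteq> 0 \<and> (\<forall>y\<in>S. a y \<noteq> 0 \<longrightarrow> y \<in> U \<inter> V)"
        using a b c by (intro bexI[of _ c]) auto
    qed
  next
    case (UN K)
    show ?case
    proof (intro conjI ballI)
      show "\<Union> K \<subseteq> S" using UN by blast
      fix x assume "x \<in> \<Union> K"
      then obtain k where k: "k \<in> K" "x \<in> k" by blast
      then obtain a where "a \<in> A" "a x \<noteq> 0" "\<forall>y\<in>S. a y \<noteq> 0 \<longrightarrow> y \<in> k" using UN by blast
      then show "\<exists>a\<in>A. a x \<noteq> 0 \<and> (\<forall>y\<in>S. a y \<noteq> 0 \<longrightarrow> y \<in> \<Union> K)" using k by blast
    qed
  next
    case (Basis s) then show ?case by auto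
  qed
next
  assume R: "?R U"
  have "U = \<Union> {V \<in> (\<lambda>a. {x \<in> S. a x \<noteq> 0}) ` A. V \<subseteq> U}"
  proof (intro equalityI subsetI)
    fix x assume x: "x \<in> U"
    then obtain a where "a \<in> A" "a x \<noteq> 0" "\<forall>y\<in>S. a y \<noteq> 0 \<longrightarrow> y \<in> U" using R by blast
    then show "x \<in> \<Union> {V \<in> (\<lambda>a. {x \<in> S. a x \<noteq> 0}) ` A. V \<subseteq> U}"
      using x R by (intro UnionI[of "{x \<in> S. a x \<noteq> 0}"]) auto
  qed blast
  moreover have "openin (top_of (zariski_space S A)) (\<Union> {V \<in> (\<lambda>a. {x \<in> S. a x \<noteq> 0}) ` A. V \<subseteq> U})"
    by (rule openin_Union) (auto simp: zariski_space_def intro: topology_generated_by_Basis)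
  ultimately show ?L by simp
qed

lemma topspace_zariski:
  assumes "falg S A" shows "points (zariski_space S A) = S"
proof
  show "points (zariski_space S A) \<subseteq> S"
    using openin_topspace openin_zariski[OF assms] by blast
  obtain a where "a \<in> A" "\<forall>x\<in>S. a x = 1" using falgD(1)[OF assms] by blast
  then have "openin (top_of (zariski_space S A)) S"
    unfolding openin_zariski[OF assms] by (intro conjI ballI bexI[of _ a]) auto
  then show "S \<subseteq> points (zariski_space S A)" by (rule openin_subset)
qed

lemma openin_zariski_space: "falg S A \<Longrightarrow> openin (top_of (zariski_space S A)) S"
  using openin_topspace[of "top_of (zariski_space S A)"] by (simp add: topspace_zariski)

lemma openin_zariski_nonzero:
  "falg S A \<Longrightarrow> a \<in> A \<Longrightarrow> openin (top_of (zariski_space S A)) {x\<in>S. a x \<noteq> 0}"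
  unfolding openin_zariski by blast

lemma reg_zariskiI:
  assumes "falg S A" "U \<subseteq> S" "a \<in> A" shows "a \<in> reg (zariski_space S A) U"
proof -
  obtain u where "u \<in> A" "\<forall>x\<in>S. u x = 1" using falgD(1)[OF assms(1)] by blast
  then show ?thesis unfolding reg_zariski using assms by (intro ballI bexI[of _ a] bexI[of _ u]) auto
qed

lemma function_sheaf_zariski:
  assumes A: "falg S A" shows "function_sheaf (zariski_space S A)"
  unfolding function_sheaf_def
proof (intro conjI allI impI, goal_cases)
  case (1 U V f)
  show ?case unfolding reg_zariski
  proof
    fix x assume "x \<in> V"
    then obtain a b where "a \<in> A" "b \<in> A" "b x \<noteq> 0" "\<forall>y\<in>U. b y \<noteq> 0 \<longrightarrow> f y = a y / b y"
      using 1 unfolding reg_zariski by blast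
    then show "\<exists>a\<in>A. \<exists>b\<in>A. b x \<noteq> 0 \<and> (\<forall>y\<in>V. b y \<noteq> 0 \<longrightarrow> f y = a y / b y)"
      using 1 by blast
  qed
next
  case (2 U f)
  show ?case unfolding reg_zariski
  proof
    fix x assume x: "x \<in> U"
    then obtain V g where V: "openin (top_of (zariski_space S A)) V" "x \<in> V" "V \<subseteq> U"
      "g \<in> reg (zariski_space S A) V" "\<forall>y\<in>V. f y = g y" using 2 by blast
    obtain a b where ab: "a \<in> A" "b \<in> A" "b x \<noteq> 0" "\<forall>y\<in>V. b y \<noteq> 0 \<longrightarrow> g y = a y / b y"
      using V by (auto simp: reg_zariski)
    \<comment> \<open>Multiplying numerator and denominator by \<open>c\<close> confines the
      nonvanishing of the denominator to \<open>V\<close>, where the local formula for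
      \<open>f\<close> holds.\<close>
    obtain c where c: "c \<in> A" "c x \<noteq> 0" "\<forall>y\<in>S. c y \<noteq> 0 \<longrightarrow> y \<in> V"
      using V openin_zariski[OF A] by blast
    obtain a' where a': "a' \<in> A" "\<forall>y\<in>S. a' y = a y * c y" using falgD(3)[OF A ab(1) c(1)] by blast
    obtain b' where b': "b' \<in> A" "\<forall>y\<in>S. b' y = b y * c y" using falgD(3)[OF A ab(2) c(1)] by blast
    have US: "U \<subseteq> S" using 2 openin_zariski[OF A] by blast
    show "\<exists>a\<in>A. \<exists>b\<in>A. b x \<noteq> 0 \<and> (\<forall>y\<in>U. b y \<noteq> 0 \<longrightarrow> f y = a y / b y)"
    proof (rule bexI[of _ a'], rule bexI[of _ b'], intro conjI ballI impI)
      show "b' x \<noteq> 0" using b' ab c x US by auto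
      fix y assume y: "y \<in> U" "b' y \<noteq> 0"
      then have "y \<in> S" "b y \<noteq> 0" "c y \<noteq> 0" using b' US by auto
      then show "f y = a' y / b' y" using a' b' c V ab by simp
    qed (use a' b' in auto)
  qed
qed

text \<open>Global fractions are allowed in \<open>pb\<close> so that polynomials can serve as the
  algebra on loci where some of them are invertible. A regular function is locally
  \<open>a / b\<close>, and its pullback is a quotient of two such fractions.\<close>

lemma morphism_zariskiI:
  assumes A: "falg S A" and B: "falg T B" and \<phi>: "\<And>x. x \<in> S \<Longrightarrow> \<phi> x \<in> T"
    and pb: "\<And>b. b \<in> B \<Longrightarrow> \<exists>a\<in>A. \<exists>c\<in>A. \<forall>x\<in>S. c x \<noteq> 0 \<and> b (\<phi> x) = a x / c x"
  shows "morphism (zariski_space S A) (zariski_space T B) \<phi>"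
  unfolding morphism_def
proof (intro conjI allI impI)
  show "continuous_map (top_of (zariski_space S A)) (top_of (zariski_space T B)) \<phi>"
    unfolding continuous_map_def topspace_zariski[OF A] topspace_zariski[OF B]
  proof (intro conjI allI impI)
    show "\<phi> \<in> S \<rightarrow> T" using \<phi> by auto
    fix U assume U: "openin (top_of (zariski_space T B)) U"
    show "openin (top_of (zariski_space S A)) {x\<in>S. \<phi> x \<in> U}"
      unfolding openin_zariski[OF A]
    proof (intro conjI ballI)
      fix x assume x: "x \<in> {x\<in>S. \<phi> x \<in> U}"
      obtain b where b: "b \<in> B" "b (\<phi> x) \<noteq> 0" "\<forall>y\<in>T. b y \<noteq> 0 \<longrightarrow> y \<in> U"
        using U x unfolding openin_zariski[OF B] by blast
      obtain a c where ac: "a \<in> A" "c \<in> A" "\<forall>x\<in>S. c x \<noteq> 0 \<and> b (\<phi> x) = a x / c x" using pb[OF b(1)] by blast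
      then show "\<exists>a\<in>A. a x \<noteq> 0 \<and> (\<forall>y\<in>S. a y \<noteq> 0 \<longrightarrow> y \<in> {x\<in>S. \<phi> x \<in> U})"
        using b x \<phi> by (intro bexI[of _ a]) auto
    qed auto
  qed
next
  fix V f assume V: "openin (top_of (zariski_space T B)) V \<and> f \<in> reg (zariski_space T B) V"
  show "f \<circ> \<phi> \<in> reg (zariski_space S A) {x \<in> points (zariski_space S A). \<phi> x \<in> V}"
    unfolding topspace_zariski[OF A] reg_zariski
  proof
    fix x assume x: "x \<in> {x\<in>S. \<phi> x \<in> V}"
    obtain a b where ab: "a \<in> B" "b \<in> B" "b (\<phi> x) \<noteq> 0" "\<forall>y\<in>V. b y \<noteq> 0 \<longrightarrow> f y = a y / b y"
      using V x by (auto simp: reg_zariski)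
    obtain a1 a2 where 1: "a1 \<in> A" "a2 \<in> A" "\<forall>x\<in>S. a2 x \<noteq> 0 \<and> a (\<phi> x) = a1 x / a2 x" using pb[OF ab(1)] by blast
    obtain b1 b2 where 2: "b1 \<in> A" "b2 \<in> A" "\<forall>x\<in>S. b2 x \<noteq> 0 \<and> b (\<phi> x) = b1 x / b2 x" using pb[OF ab(2)] by blast
    obtain c where c: "c \<in> A" "\<forall>x\<in>S. c x = a1 x * b2 x" using falgD(3)[OF A 1(1) 2(2)] by blast
    obtain d where d: "d \<in> A" "\<forall>x\<in>S. d x = a2 x * b1 x" using falgD(3)[OF A 1(2) 2(1)] by blast
    show "\<exists>a\<in>A. \<exists>b\<in>A. b x \<noteq> 0 \<and> (\<forall>y\<in>{x\<in>S. \<phi> x \<in> V}. b y \<noteq> 0 \<longrightarrow> (f \<circ> \<phi>) y = a y / b y)"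
    proof (rule bexI[of _ c], rule bexI[of _ d], intro conjI ballI impI)
      show "d x \<noteq> 0" using d 1 2 ab x by auto
      fix y assume y: "y \<in> {x\<in>S. \<phi> x \<in> V}" "d y \<noteq> 0"
      then have "b1 y \<noteq> 0" "b (\<phi> y) \<noteq> 0" using d 2 by auto
      then have "f (\<phi> y) = a (\<phi> y) / b (\<phi> y)" using ab y by auto
      then show "(f \<circ> \<phi>) y = c y / d y" using c d 1 2 y by simp
    qed (use c d in auto)
  qed
qed

section \<open>Isomorphisms of spaces with functions\<close>

lemma isomorphic_sym: "isomorphic X Y \<Longrightarrow> isomorphic Y X"
  unfolding isomorphic_def by blast

lemma isomorphicI:
  assumes "morphism X Y \<phi>" "morphism Y X \<psi>"
    "\<And>x. x \<in> points X \<Longrightarrow> \<psi> (\<phi> x) = x" "\<And>y. y \<in> points Y \<Longrightarrow> \<phi> (\<psi> y) = y"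
  shows "isomorphic X Y"
  using assms unfolding isomorphic_def by blast

lemma morphism_comp:
  assumes "morphism X Y \<phi>" "morphism Y Z \<psi>" shows "morphism X Z (\<psi> \<circ> \<phi>)"
  unfolding morphism_def
proof (intro conjI allI impI)
  have c: "continuous_map (top_of X) (top_of Y) \<phi>" "continuous_map (top_of Y) (top_of Z) \<psi>"
    using assms by (auto simp: morphism_def)
  then show "continuous_map (top_of X) (top_of Z) (\<psi> \<circ> \<phi>)" by (rule continuous_map_compose)
  fix V f assume V: "openin (top_of Z) V \<and> f \<in> reg Z V"
  let ?W = "{y \<in> points Y. \<psi> y \<in> V}"
  have "f \<circ> \<psi> \<in> reg Y ?W" using V assms by (auto simp: morphism_def)
  moreover have "openin (top_of Y) ?W" using c V by (auto simp: continuous_map_def)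
  ultimately have "(f \<circ> \<psi>) \<circ> \<phi> \<in> reg X {x \<in> points X. \<phi> x \<in> ?W}"
    using assms(1) unfolding morphism_def by blast
  moreover have "{x \<in> points X. \<phi> x \<in> ?W} = {x \<in> points X. (\<psi> \<circ> \<phi>) x \<in> V}"
    using c by (auto simp: continuous_map_def Pi_iff)
  ultimately show "f \<circ> (\<psi> \<circ> \<phi>) \<in> reg X {x \<in> points X. (\<psi> \<circ> \<phi>) x \<in> V}" by (simp add: comp_assoc)
qed

lemma isomorphic_trans:
  assumes "isomorphic X Y" "isomorphic Y Z" shows "isomorphic X Z"
proof -
  obtain \<phi> \<psi> where 1: "morphism X Y \<phi>" "morphism Y X \<psi>"
    "\<forall>x\<in>points X. \<psi> (\<phi> x) = x" "\<forall>y\<in>points Y. \<phi> (\<psi> y) = y"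
    using assms unfolding isomorphic_def by blast
  obtain \<phi>' \<psi>' where 2: "morphism Y Z \<phi>'" "morphism Z Y \<psi>'"
    "\<forall>x\<in>points Y. \<psi>' (\<phi>' x) = x" "\<forall>y\<in>points Z. \<phi>' (\<psi>' y) = y"
    using assms unfolding isomorphic_def by blast
  show ?thesis
  proof (rule isomorphicI[OF morphism_comp[OF 1(1) 2(1)] morphism_comp[OF 2(2) 1(2)]])
    show "(\<psi> \<circ> \<psi>') ((\<phi>' \<circ> \<phi>) x) = x" if "x \<in> points X" for x
      using 1 2 that by (auto simp: morphism_def continuous_map_def Pi_iff)
    show "(\<phi>' \<circ> \<phi>) ((\<psi> \<circ> \<psi>') x) = x" if "x \<in> points Z" for x
      using 1 2 that by (auto simp: morphism_def continuous_map_def Pi_iff)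
  qed
qed

text \<open>Regularity is compared on open sets only, because the values of \<open>reg\<close>
  elsewhere are arbitrary.\<close>

lemma isomorphic_cong:
  assumes "top_of X = top_of Y" and "\<And>U. openin (top_of Y) U \<Longrightarrow> reg X U = reg Y U"
  shows "isomorphic X Y"
proof -
  have "{x \<in> points Y. x \<in> V} = V" if "openin (top_of Y) V" for V
    using openin_subset[OF that] by blast
  then have "morphism X Y id" "morphism Y X id" using assms
    by (auto simp: morphism_def)
  then show ?thesis by (rule isomorphicI) auto
qed

lemma isomorphic_zariskiI:
  assumes "falg S A" "falg T B"
    and "\<And>x. x \<in> S \<Longrightarrow> \<phi> x \<in> T" "\<And>y. y \<in> T \<Longrightarrow> \<psi> y \<in> S"
    and "\<And>x. x \<in> S \<Longrightarrow> \<psi> (\<phi> x) = x" "\<And>y. y \<in> T \<Longrightarrow> \<phi> (\<psi> y) = y"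
    and "\<And>b. b \<in> B \<Longrightarrow> \<exists>a\<in>A. \<exists>c\<in>A. \<forall>x\<in>S. c x \<noteq> 0 \<and> b (\<phi> x) = a x / c x"
    and "\<And>a. a \<in> A \<Longrightarrow> \<exists>b\<in>B. \<exists>c\<in>B. \<forall>x\<in>T. c x \<noteq> 0 \<and> a (\<psi> x) = b x / c x"
  shows "isomorphic (zariski_space S A) (zariski_space T B)"
  using assms by (intro isomorphicI[of _ _ \<phi> \<psi>] morphism_zariskiI) (auto simp: topspace_zariski)

lemma subspace_zariski:
  assumes A: "falg S A" and TS: "T \<subseteq> S"
  shows "isomorphic (subspace (zariski_space S A) T) (zariski_space T A)"
proof (rule isomorphic_cong)
  have AT: "falg T A" using falg_subset[OF assms] .
  let ?X = "zariski_space S A"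
  show "top_of (subspace ?X T) = top_of (zariski_space T A)"
    unfolding topology_eq
  proof (rule allI, rule iffI)
    fix U assume "openin (top_of (subspace ?X T)) U"
    then obtain V where V: "openin (top_of ?X) V" "U = V \<inter> T" by (auto simp: subspace_def openin_subtopology)
    show "openin (top_of (zariski_space T A)) U" unfolding openin_zariski[OF AT]
    proof (intro conjI ballI)
      show "U \<subseteq> T" using V by blast
      fix x assume "x \<in> U"
      then obtain a where "a \<in> A" "a x \<noteq> 0" "\<forall>y\<in>S. a y \<noteq> 0 \<longrightarrow> y \<in> V"
        using V openin_zariski[OF A] by blast
      then show "\<exists>a\<in>A. a x \<noteq> 0 \<and> (\<forall>y\<in>T. a y \<noteq> 0 \<longrightarrow> y \<in> U)"
        using V TS by (intro bexI[of _ a]) auto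
    qed
  next
    fix U assume U: "openin (top_of (zariski_space T A)) U"
    define V where "V = \<Union>{D. openin (top_of ?X) D \<and> D \<inter> T \<subseteq> U}"
    have "openin (top_of ?X) V" unfolding V_def by (rule openin_Union) auto
    moreover have "U \<subseteq> V \<inter> T"
    proof
      fix x assume x: "x \<in> U"
      then obtain a where a: "a \<in> A" "a x \<noteq> 0" "\<forall>y\<in>T. a y \<noteq> 0 \<longrightarrow> y \<in> U" "x \<in> T"
        using U openin_zariski[OF AT] by blast
      then have "{y\<in>S. a y \<noteq> 0} \<subseteq> V" using openin_zariski_nonzero[OF A a(1)] by (auto simp: V_def)
      then show "x \<in> V \<inter> T" using a TS by blast
    qed
    moreover have "V \<inter> T \<subseteq> U" by (auto simp: V_def)
    ultimately have "openin (top_of ?X) V" "U = V \<inter> T" by auto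
    then show "openin (top_of (subspace ?X T)) U" by (auto simp: subspace_def openin_subtopology)
  qed
  fix W assume "openin (top_of (zariski_space T A)) W"
  then have WT: "W \<subseteq> T" using openin_zariski[OF AT] by blast
  show "reg (subspace ?X T) W = reg (zariski_space T A) W"
  proof (intro equalityI subsetI)
    fix f assume f: "f \<in> reg (subspace ?X T) W"
    show "f \<in> reg (zariski_space T A) W" unfolding reg_zariski
    proof
      fix x assume x: "x \<in> W"
      then obtain U g where U: "openin (top_of ?X) U" "x \<in> U" "g \<in> reg ?X U" "\<forall>y\<in>U \<inter> W. f y = g y"
        using f by (auto simp: subspace_def)
      obtain a b where ab: "a \<in> A" "b \<in> A" "b x \<noteq> 0" "\<forall>y\<in>U. b y \<noteq> 0 \<longrightarrow> g y = a y / b y"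
        using U by (auto simp: reg_zariski)
      obtain c where c: "c \<in> A" "c x \<noteq> 0" "\<forall>y\<in>S. c y \<noteq> 0 \<longrightarrow> y \<in> U" using U openin_zariski[OF A] by blast
      obtain a' where a': "a' \<in> A" "\<forall>y\<in>S. a' y = a y * c y" using falgD(3)[OF A ab(1) c(1)] by blast
      obtain b' where b': "b' \<in> A" "\<forall>y\<in>S. b' y = b y * c y" using falgD(3)[OF A ab(2) c(1)] by blast
      show "\<exists>a\<in>A. \<exists>b\<in>A. b x \<noteq> 0 \<and> (\<forall>y\<in>W. b y \<noteq> 0 \<longrightarrow> f y = a y / b y)"
      proof (rule bexI[of _ a'], rule bexI[of _ b'], intro conjI ballI impI)
        show "b' x \<noteq> 0" using b' ab c x WT TS by auto
        fix y assume y: "y \<in> W" "b' y \<noteq> 0"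
        then have "y \<in> S" "b y \<noteq> 0" "c y \<noteq> 0" using b' WT TS by auto
        then show "f y = a' y / b' y" using a' b' c U ab y by simp
      qed (use a' b' in auto)
    qed
  next
    fix f assume f: "f \<in> reg (zariski_space T A) W"
    show "f \<in> reg (subspace ?X T) W" unfolding subspace_def
    proof (simp, intro ballI)
      fix x assume x: "x \<in> W"
      then obtain a b where ab: "a \<in> A" "b \<in> A" "b x \<noteq> 0" "\<forall>y\<in>W. b y \<noteq> 0 \<longrightarrow> f y = a y / b y"
        using f by (auto simp: reg_zariski)
      show "\<exists>U. openin (top_of ?X) U \<and> x \<in> U \<and> (\<exists>g. g \<in> reg ?X U \<and> (\<forall>y\<in>U \<inter> W. f y = g y))"
      proof (intro exI[of _ "{x\<in>S. b x \<noteq> 0}"] conjI exI[of _ "\<lambda>y. a y / b y"])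
        show "openin (top_of ?X) {x\<in>S. b x \<noteq> 0}" by (rule openin_zariski_nonzero[OF A ab(2)])
        show "(\<lambda>y. a y / b y) \<in> reg ?X {x\<in>S. b x \<noteq> 0}" unfolding reg_zariski using ab by auto
      qed (use ab x WT TS in auto)
    qed
  qed
qed

section \<open>Products of Zariski spaces\<close>

lemma tensor_functions_ten:
  "h \<in> tensor_functions A B \<longleftrightarrow>
    (\<exists>(k::nat) f g. (\<forall>i<k. f i \<in> A \<and> g i \<in> B) \<and> h = (\<lambda>z. \<Sum>i<k. f i (fst z) * g i (snd z)))"
  unfolding tensor_functions_def by (auto simp: case_prod_unfold)

lemma tensor_functions_single:
  "f \<in> A \<Longrightarrow> g \<in> B \<Longrightarrow> (\<lambda>z. f (fst z) * g (snd z)) \<in> tensor_functions A B"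
  unfolding tensor_functions_ten
  by (rule exI[of _ 1], rule exI[of _ "\<lambda>_. f"], rule exI[of _ "\<lambda>_. g"]) simp

lemma tensor_functions_zero: "(\<lambda>z. 0) \<in> tensor_functions A B"
  unfolding tensor_functions_ten by (rule exI[of _ 0]) simp

lemma tensor_functions_add:
  assumes "h \<in> tensor_functions A B" "h' \<in> tensor_functions A B"
  shows "(\<lambda>z. h z + h' z) \<in> tensor_functions A B"
proof -
  obtain k f g where 1: "\<forall>i<k::nat. f i \<in> A \<and> g i \<in> B" "h = (\<lambda>z. \<Sum>i<k. f i (fst z) * g i (snd z))"
    using assms(1) unfolding tensor_functions_ten by blast
  obtain k' f' g' where 2: "\<forall>i<k'::nat. f' i \<in> A \<and> g' i \<in> B" "h' = (\<lambda>z. \<Sum>i<k'. f' i (fst z) * g' i (snd z))"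
    using assms(2) unfolding tensor_functions_ten by blast
  have split: "(\<Sum>i<k+l. if i < k then F i else G (i - k)) = (\<Sum>i<k. F i) + (\<Sum>i<l. G i)"
    for F G :: "nat \<Rightarrow> complex" and l
    by (induction l) (auto simp: add.assoc)
  show ?thesis unfolding tensor_functions_ten
  proof (intro exI conjI)
    show "\<forall>i<k+k'. (if i < k then f i else f' (i - k)) \<in> A \<and> (if i < k then g i else g' (i - k)) \<in> B"
      using 1 2 by auto
    show "(\<lambda>z. h z + h' z) = (\<lambda>z. \<Sum>i<k+k'. (if i < k then f i else f' (i - k)) (fst z) *
        (if i < k then g i else g' (i - k)) (snd z))"
    proof
      fix z
      have "(\<Sum>i<k+k'. (if i < k then f i else f' (i - k)) (fst z) * (if i < k then g i else g' (i - k)) (snd z))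
        = (\<Sum>i<k+k'. if i < k then f i (fst z) * g i (snd z) else (\<lambda>i. f' i (fst z) * g' i (snd z)) (i - k))"
        by (rule sum.cong) auto
      also have "\<dots> = h z + h' z" 
        unfolding split[where G = "\<lambda>i. f' i (fst z) * g' i (snd z)"] 1 2 ..
      finally show "h z + h' z = (\<Sum>i<k+k'. (if i < k then f i else f' (i - k)) (fst z) *
          (if i < k then g i else g' (i - k)) (snd z))" ..
    qed
  qed
qed

lemma tensor_functions_sum:
  assumes "\<And>i. i < k \<Longrightarrow> \<exists>h\<in>tensor_functions A B. \<forall>z\<in>Z. h z = F i z"
  shows "\<exists>h\<in>tensor_functions A B. \<forall>z\<in>Z. h z = (\<Sum>i<(k::nat). F i z)"
  using assms
proof (induction k)
  case 0 show ?case by (rule bexI[OF _ tensor_functions_zero]) simp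
next
  case (Suc k)
  then obtain h where "h \<in> tensor_functions A B" "\<forall>z\<in>Z. h z = (\<Sum>i<k. F i z)" by force
  moreover obtain h' where "h' \<in> tensor_functions A B" "\<forall>z\<in>Z. h' z = F k z" using Suc by blast
  ultimately show ?case by (intro bexI[OF _ tensor_functions_add[of h A B h']]) auto
qed

lemma falg_tensor:
  assumes A: "falg S A" and B: "falg T B" shows "falg (S \<times> T) (tensor_functions A B)"
  unfolding falg_def
proof (intro conjI allI ballI)
  fix c
  obtain a where "a \<in> A" "\<forall>x\<in>S. a x = c" using falgD(1)[OF A] by blast
  moreover obtain b where "b \<in> B" "\<forall>x\<in>T. b x = 1" using falgD(1)[OF B] by blast
  ultimately show "\<exists>a\<in>tensor_functions A B. \<forall>x\<in>S \<times> T. a x = c"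
    by (intro bexI[OF _ tensor_functions_single[of a A b B]]) auto
next
  fix h h' assume h: "h \<in> tensor_functions A B" "h' \<in> tensor_functions A B"
  show "\<exists>f\<in>tensor_functions A B. \<forall>x\<in>S \<times> T. f x = h x + h' x"
    by (intro bexI[OF _ tensor_functions_add[OF h]]) auto
  obtain k f g where 1: "\<forall>i<k::nat. f i \<in> A \<and> g i \<in> B" "h = (\<lambda>z. \<Sum>i<k. f i (fst z) * g i (snd z))"
    using h(1) unfolding tensor_functions_ten by blast
  obtain k' f' g' where 2: "\<forall>i<k'::nat. f' i \<in> A \<and> g' i \<in> B" "h' = (\<lambda>z. \<Sum>i<k'. f' i (fst z) * g' i (snd z))"
    using h(2) unfolding tensor_functions_ten by blast
  have "\<exists>F\<in>tensor_functions A B. \<forall>z\<in>S \<times> T. F z =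
    (\<Sum>i<k. \<Sum>j<k'. f i (fst z) * g i (snd z) * (f' j (fst z) * g' j (snd z)))"
  proof (intro tensor_functions_sum)
    fix i j assume ij: "i < k" "j < k'"
    obtain a where a: "a \<in> A" "\<forall>x\<in>S. a x = f i x * f' j x" using falgD(3)[OF A] 1 2 ij by blast
    obtain b where b: "b \<in> B" "\<forall>x\<in>T. b x = g i x * g' j x" using falgD(3)[OF B] 1 2 ij by blast
    show "\<exists>h\<in>tensor_functions A B. \<forall>z\<in>S \<times> T. h z = f i (fst z) * g i (snd z) * (f' j (fst z) * g' j (snd z))"
      using a b by (intro bexI[OF _ tensor_functions_single[of a A b B]]) auto
  qed
  then show "\<exists>F\<in>tensor_functions A B. \<forall>z\<in>S \<times> T. F z = h z * h' z"
    by (simp add: 1 2 sum_product)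
qed

text \<open>Sections over \<open>U\<close> and \<open>V\<close> are themselves only locally
  fractions. Near \<open>z\<close> the finitely many that occur have a common denominator, so a sum
  of products of sections becomes one fraction of members of \<open>tensor_functions A B\<close>.
  The product structure, defined through all sections, is thus governed by the two algebras.\<close>

lemma tensor_reg_local:
  assumes A: "falg S A" and B: "falg T B" and "U \<subseteq> S" "V \<subseteq> T" "z \<in> U \<times> V"
    and "h \<in> tensor_functions (reg (zariski_space S A) U) (reg (zariski_space T B) V)"
  shows "\<exists>c\<in>tensor_functions A B. \<exists>d\<in>tensor_functions A B. d z \<noteq> 0 \<and>
    (\<forall>w\<in>U \<times> V. d w \<noteq> 0 \<longrightarrow> h w = c w / d w)"
proof -
  let ?C = "tensor_functions A B"
  note C = falg_tensor[OF A B]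
  have UV: "U \<times> V \<subseteq> S \<times> T" using assms by blast
  obtain k f g where 1: "\<forall>i<k::nat. f i \<in> reg (zariski_space S A) U \<and> g i \<in> reg (zariski_space T B) V"
    "h = (\<lambda>z. \<Sum>i<k. f i (fst z) * g i (snd z))"
    using assms(6) unfolding tensor_functions_ten by blast
  have "\<exists>c\<in>?C. \<exists>d\<in>?C. d z \<noteq> 0 \<and> (\<forall>w\<in>U \<times> V. d w \<noteq> 0 \<longrightarrow> (\<Sum>i<l. f i (fst w) * g i (snd w)) = c w / d w)"
    if "l \<le> k" for l
    using that
  proof (induction l)
    case 0
    obtain u where "u \<in> ?C" "\<forall>x\<in>S\<times>T. u x = 1" using falgD(1)[OF C] by blast
    then show ?case using UV assms(5) tensor_functions_zero by (intro bexI[of _ "\<lambda>_. 0"] bexI[of _ u]) auto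
  next
    case (Suc l)
    then obtain c d where cd: "c \<in> ?C" "d \<in> ?C" "d z \<noteq> 0"
      "\<forall>w\<in>U \<times> V. d w \<noteq> 0 \<longrightarrow> (\<Sum>i<l. f i (fst w) * g i (snd w)) = c w / d w" by force
    have fg: "f l \<in> reg (zariski_space S A) U" "g l \<in> reg (zariski_space T B) V" using 1 Suc by auto
    obtain a1 a2 where a: "a1 \<in> A" "a2 \<in> A" "a2 (fst z) \<noteq> 0" "\<forall>y\<in>U. a2 y \<noteq> 0 \<longrightarrow> f l y = a1 y / a2 y"
      using fg(1) assms(5) unfolding reg_zariski by fastforce
    obtain b1 b2 where b: "b1 \<in> B" "b2 \<in> B" "b2 (snd z) \<noteq> 0" "\<forall>y\<in>V. b2 y \<noteq> 0 \<longrightarrow> g l y = b1 y / b2 y"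
      using fg(2) assms(5) unfolding reg_zariski by fastforce
    let ?n = "\<lambda>z. a1 (fst z) * b1 (snd z)" and ?m = "\<lambda>z. a2 (fst z) * b2 (snd z)"
    have n: "?n \<in> ?C" and m: "?m \<in> ?C" using a b by (auto intro: tensor_functions_single)
    obtain e1 where e1: "e1 \<in> ?C" "\<forall>w\<in>S\<times>T. e1 w = c w * ?m w" using falgD(3)[OF C cd(1) m] by blast
    obtain e2 where e2: "e2 \<in> ?C" "\<forall>w\<in>S\<times>T. e2 w = d w * ?n w" using falgD(3)[OF C cd(2) n] by blast
    obtain e3 where e3: "e3 \<in> ?C" "\<forall>w\<in>S\<times>T. e3 w = d w * ?m w" using falgD(3)[OF C cd(2) m] by blast
    obtain e4 where e4: "e4 \<in> ?C" "\<forall>w\<in>S\<times>T. e4 w = e1 w + e2 w" using falgD(2)[OF C e1(1) e2(1)] by blast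
    show ?case
    proof (rule bexI[of _ e4], rule bexI[of _ e3], intro conjI ballI impI)
      have "z \<in> S \<times> T" using UV assms(5) by blast
      then have "e3 z = d z * (a2 (fst z) * b2 (snd z))" using e3 by blast
      then show "e3 z \<noteq> 0" using cd a b by simp
      fix w assume w: "w \<in> U \<times> V" "e3 w \<noteq> 0"
      have wS: "w \<in> S \<times> T" using UV w by blast
      then have "e3 w = d w * (a2 (fst w) * b2 (snd w))" using e3 by blast
      then have punctured_line: "d w \<noteq> 0" "a2 (fst w) \<noteq> 0" "b2 (snd w) \<noteq> 0" using w by auto
      have wUV: "fst w \<in> U" "snd w \<in> V" using w by auto
      have "(\<Sum>i<l. f i (fst w) * g i (snd w)) = c w / d w" using cd w punctured_line by blast
      moreover have "f l (fst w) = a1 (fst w) / a2 (fst w)" "g l (snd w) = b1 (snd w) / b2 (snd w)"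
        using a b wUV punctured_line by blast+
      ultimately have "(\<Sum>i<Suc l. f i (fst w) * g i (snd w)) =
          c w / d w + a1 (fst w) / a2 (fst w) * (b1 (snd w) / b2 (snd w))" by simp
      moreover have "e1 w = c w * (a2 (fst w) * b2 (snd w))" "e2 w = d w * (a1 (fst w) * b1 (snd w))"
        "e3 w = d w * (a2 (fst w) * b2 (snd w))" "e4 w = e1 w + e2 w" using wS e1 e2 e3 e4 by blast+
      ultimately show "(\<Sum>i<Suc l. f i (fst w) * g i (snd w)) = e4 w / e3 w"
        using punctured_line by (simp add: field_simps)
    qed (use e3 e4 in auto)
  qed
  from this[of k] show ?thesis by (simp add: 1)
qed

lemma prod_zariski:
  assumes A: "falg S A" and B: "falg T B"
  shows "isomorphic (prod_space (zariski_space S A) (zariski_space T B))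
    (zariski_space (S \<times> T) (tensor_functions A B))"
proof (rule isomorphic_cong)
  let ?X = "zariski_space S A" and ?Y = "zariski_space T B" and ?C = "tensor_functions A B"
  note C = falg_tensor[OF A B]
  have sub: "c \<in> tensor_functions (reg ?X S) (reg ?Y T)" if "c \<in> ?C" for c
    using that reg_zariskiI[OF A subset_refl] reg_zariskiI[OF B subset_refl]
    unfolding tensor_functions_ten by blast
  have nbh: "\<exists>e\<in>?C. e z \<noteq> 0 \<and> (\<forall>w\<in>S\<times>T. e w \<noteq> 0 \<longrightarrow> w \<in> U \<times> V)"
    if UV: "openin (top_of ?X) U" "openin (top_of ?Y) V" "z \<in> U \<times> V" for U V z
  proof -
    obtain a where "a \<in> A" "a (fst z) \<noteq> 0" "\<forall>y\<in>S. a y \<noteq> 0 \<longrightarrow> y \<in> U" using UV openin_zariski[OF A] by force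
    moreover obtain b where "b \<in> B" "b (snd z) \<noteq> 0" "\<forall>y\<in>T. b y \<noteq> 0 \<longrightarrow> y \<in> V" using UV openin_zariski[OF B] by force
    ultimately show ?thesis by (intro bexI[OF _ tensor_functions_single[of a A b B]]) auto
  qed
  show top: "top_of (prod_space ?X ?Y) = top_of (zariski_space (S \<times> T) ?C)"
    unfolding topology_eq
  proof (rule allI, rule iffI)
    fix W assume "openin (top_of (prod_space ?X ?Y)) W"
    then have "generate_topology_on {{z \<in> U \<times> V. h z \<noteq> 0} | U V h. openin (top_of ?X) U \<and> openin (top_of ?Y) V \<and>
            h \<in> tensor_functions (reg ?X U) (reg ?Y V)} W"
      by (simp add: prod_space_def openin_topology_generated_by_iff)
    then show "openin (top_of (zariski_space (S \<times> T) ?C)) W"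
    proof induction
      case (Basis s)
      then obtain U V h where s: "s = {z \<in> U \<times> V. h z \<noteq> 0}" "openin (top_of ?X) U" "openin (top_of ?Y) V"
        "h \<in> tensor_functions (reg ?X U) (reg ?Y V)" by blast
      have UV: "U \<subseteq> S" "V \<subseteq> T" using s openin_zariski A B by blast+
      show ?case unfolding openin_zariski[OF C]
      proof (intro conjI ballI)
        show "s \<subseteq> S \<times> T" using s UV by auto
        fix z assume z: "z \<in> s"
        then have zUV: "z \<in> U \<times> V" and hz: "h z \<noteq> 0" using s by auto
        obtain c d where cd: "c \<in> ?C" "d \<in> ?C" "d z \<noteq> 0" "\<forall>w\<in>U \<times> V. d w \<noteq> 0 \<longrightarrow> h w = c w / d w"
          using tensor_reg_local[OF A B UV zUV s(4)] by blast
        obtain e where e: "e \<in> ?C" "e z \<noteq> 0" "\<forall>w\<in>S\<times>T. e w \<noteq> 0 \<longrightarrow> w \<in> U \<times> V" using nbh[OF s(2,3) zUV] by blast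
        obtain e1 where e1: "e1 \<in> ?C" "\<forall>w\<in>S\<times>T. e1 w = c w * d w" using falgD(3)[OF C cd(1,2)] by blast
        obtain e2 where e2: "e2 \<in> ?C" "\<forall>w\<in>S\<times>T. e2 w = e1 w * e w" using falgD(3)[OF C e1(1) e(1)] by blast
        have zST: "z \<in> S \<times> T" using zUV UV by blast
        show "\<exists>a\<in>?C. a z \<noteq> 0 \<and> (\<forall>y\<in>S \<times> T. a y \<noteq> 0 \<longrightarrow> y \<in> s)"
        proof (intro bexI[of _ e2] conjI ballI impI)
          have "c z \<noteq> 0" using cd zUV hz by auto
          then show "e2 z \<noteq> 0" using zST cd e e1 e2 by auto
          fix y assume y: "y \<in> S \<times> T" "e2 y \<noteq> 0"
          then have "e y \<noteq> 0" "c y \<noteq> 0" "d y \<noteq> 0" using e1 e2 by auto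
          then show "y \<in> s" using y e cd s by auto
        qed (rule e2)
      qed
    qed auto
  next
    fix W assume W: "openin (top_of (zariski_space (S \<times> T) ?C)) W"
    have base: "openin (top_of (prod_space ?X ?Y)) {x \<in> S \<times> T. c x \<noteq> 0}" if "c \<in> ?C" for c
      unfolding prod_space_def using sub[OF that] openin_zariski_space[OF A] openin_zariski_space[OF B]
      by (auto intro!: topology_generated_by_Basis)
    have "generate_topology_on ((\<lambda>a. {x \<in> S \<times> T. a x \<noteq> 0}) ` ?C) W"
      using W by (simp add: zariski_space_def openin_topology_generated_by_iff)
    then show "openin (top_of (prod_space ?X ?Y)) W"
    proof induction
      case (Basis s) then show ?case using base by blast
    qed auto
  qed
  fix W assume W: "openin (top_of (zariski_space (S \<times> T) ?C)) W"
  then have WST: "W \<subseteq> S \<times> T" using openin_zariski[OF C] by blast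
  show "reg (prod_space ?X ?Y) W = reg (zariski_space (S \<times> T) ?C) W"
  proof (intro equalityI subsetI)
    fix f assume f: "f \<in> reg (prod_space ?X ?Y) W"
    show "f \<in> reg (zariski_space (S \<times> T) ?C) W" unfolding reg_zariski
    proof
      fix z assume z: "z \<in> W"
      obtain U V a b where UV: "openin (top_of ?X) U" "openin (top_of ?Y) V" "z \<in> U \<times> V"
        "a\<in>tensor_functions (reg ?X U) (reg ?Y V)" "b\<in>tensor_functions (reg ?X U) (reg ?Y V)"
        "b z \<noteq> 0" "\<forall>w\<in>W \<inter> (U \<times> V). b w \<noteq> 0 \<longrightarrow> f w = a w / b w"
        using f z unfolding prod_space_def by auto
      have UVs: "U \<subseteq> S" "V \<subseteq> T" using UV openin_zariski A B by blast+
      obtain c d where cd: "c \<in> ?C" "d \<in> ?C" "d z \<noteq> 0" "\<forall>w\<in>U \<times> V. d w \<noteq> 0 \<longrightarrow> a w = c w / d w"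
        using tensor_reg_local[OF A B UVs UV(3,4)] by blast
      obtain c' d' where cd': "c' \<in> ?C" "d' \<in> ?C" "d' z \<noteq> 0" "\<forall>w\<in>U \<times> V. d' w \<noteq> 0 \<longrightarrow> b w = c' w / d' w"
        using tensor_reg_local[OF A B UVs UV(3,5)] by blast
      obtain e where e: "e \<in> ?C" "e z \<noteq> 0" "\<forall>w\<in>S\<times>T. e w \<noteq> 0 \<longrightarrow> w \<in> U \<times> V" using nbh[OF UV(1,2,3)] by blast
      \<comment> \<open>On \<open>U \<times> V\<close> the function is
        \<open>(c * d') / (d * c')\<close>. Both terms are multiplied by \<open>m = e * d'\<close>:
        the factor \<open>e\<close> confines a nonzero denominator to \<open>U \<times> V\<close>,
        and \<open>d'\<close> makes the formula \<open>b = c' / d'\<close> available there.\<close>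
      obtain m where m: "m \<in> ?C" "\<forall>w\<in>S\<times>T. m w = e w * d' w" using falgD(3)[OF C e(1) cd'(2)] by blast
      obtain n1 where n1: "n1 \<in> ?C" "\<forall>w\<in>S\<times>T. n1 w = m w * d' w" using falgD(3)[OF C m(1) cd'(2)] by blast
      obtain n where n: "n \<in> ?C" "\<forall>w\<in>S\<times>T. n w = n1 w * c w" using falgD(3)[OF C n1(1) cd(1)] by blast
      obtain l1 where l1: "l1 \<in> ?C" "\<forall>w\<in>S\<times>T. l1 w = m w * c' w" using falgD(3)[OF C m(1) cd'(1)] by blast
      obtain l where l: "l \<in> ?C" "\<forall>w\<in>S\<times>T. l w = l1 w * d w" using falgD(3)[OF C l1(1) cd(2)] by blast
      have zST: "z \<in> S \<times> T" using z WST by blast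
      show "\<exists>a\<in>?C. \<exists>b\<in>?C. b z \<noteq> 0 \<and> (\<forall>y\<in>W. b y \<noteq> 0 \<longrightarrow> f y = a y / b y)"
      proof (rule bexI[of _ n], rule bexI[of _ l], intro conjI ballI impI)
        have "c' z \<noteq> 0" using cd' UV by auto
        then show "l z \<noteq> 0" using zST e m l1 l cd cd' by auto
        fix y assume y: "y \<in> W" "l y \<noteq> 0"
        then have yST: "y \<in> S \<times> T" using WST by blast
        then have punctured_line: "e y \<noteq> 0" "d' y \<noteq> 0" "c' y \<noteq> 0" "d y \<noteq> 0" using y e m l1 l by auto
        then have yUV: "y \<in> U \<times> V" using e yST by blast
        have "b y = c' y / d' y" "a y = c y / d y" using punctured_line yUV cd cd' by auto
        moreover from this have "b y \<noteq> 0" using punctured_line by simp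
        ultimately have "f y = (c y / d y) / (c' y / d' y)" using UV y yUV by auto
        moreover have "m y = e y * d' y" "n1 y = m y * d' y" "n y = n1 y * c y" "l1 y = m y * c' y" "l y = l1 y * d y"
          using yST m l1 l n1 n by blast+
        ultimately show "f y = n y / l y" using punctured_line by (simp add: field_simps)
      qed (use n l in auto)
    qed
  next
    fix f assume f: "f \<in> reg (zariski_space (S \<times> T) ?C) W"
    show "f \<in> reg (prod_space ?X ?Y) W" unfolding prod_space_def
    proof (simp, intro ballI)
      fix z assume z: "z \<in> W"
      then obtain a b where ab: "a\<in>?C" "b\<in>?C" "b z \<noteq> 0" "\<forall>y\<in>W. b y \<noteq> 0 \<longrightarrow> f y = a y / b y"
        using f unfolding reg_zariski by blast
      then show "\<exists>U. openin (top_of ?X) U \<and> (\<exists>V. openin (top_of ?Y) V \<and> z \<in> U \<times> V \<and>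
         (\<exists>a\<in>tensor_functions (reg ?X U) (reg ?Y V). \<exists>b\<in>tensor_functions (reg ?X U) (reg ?Y V).
           b z \<noteq> 0 \<and> (\<forall>w\<in>W \<inter> U \<times> V. b w \<noteq> 0 \<longrightarrow> f w = a w / b w)))"
        using sub z WST openin_zariski_space[OF A] openin_zariski_space[OF B]
        by (intro exI[of _ S] conjI exI[of _ T] bexI[of _ a] bexI[of _ b]) auto
    qed
  qed
qed

section \<open>Spectra of function algebras\<close>

text \<open>Here, unlike in \<open>falg\<close>, the operations are closed on the nose, with
  extensional functions, because \<open>characters\<close> evaluates a character at these very
  functions.\<close>

definition subalg :: "'a set \<Rightarrow> ('a \<Rightarrow> complex) set \<Rightarrow> bool" where
  "subalg S A \<longleftrightarrow> A \<subseteq> extensional S \<and> (\<forall>c. (\<lambda>x\<in>S. c) \<in> A) \<and>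
     (\<forall>f\<in>A. \<forall>g\<in>A. (\<lambda>x\<in>S. f x + g x) \<in> A \<and> (\<lambda>x\<in>S. f x * g x) \<in> A)"

lemma subalgD:
  assumes "subalg S A"
  shows "f \<in> A \<Longrightarrow> f \<in> extensional S" "(\<lambda>x\<in>S. c) \<in> A"
    "f \<in> A \<Longrightarrow> g \<in> A \<Longrightarrow> (\<lambda>x\<in>S. f x + g x) \<in> A"
    "f \<in> A \<Longrightarrow> g \<in> A \<Longrightarrow> (\<lambda>x\<in>S. f x * g x) \<in> A"
  using assms unfolding subalg_def by blast+

lemma generated_algebra_extensional: "f \<in> generated_algebra S G \<Longrightarrow> f \<in> extensional S"
  by (induction rule: generated_algebra.induct) (simp_all del: restrict_apply)

lemma subalg_generated: "subalg S (generated_algebra S G)"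
  unfolding subalg_def
  using generated_algebra_extensional generated_algebra.const generated_algebra.add generated_algebra.mult
  by fast

lemma generated_algebra_subset:
  assumes "subalg S A" "G \<subseteq> A" shows "generated_algebra S G \<subseteq> A"
proof
  fix f assume "f \<in> generated_algebra S G"
  then show "f \<in> A"
  proof (induction rule: generated_algebra.induct)
    case (gen g)
    then have "g \<in> A" using assms by blast
    then show ?case using subalgD(1)[OF assms(1)] extensional_restrict by metis
  qed (use subalgD[OF assms(1)] in \<open>simp_all del: restrict_apply\<close>)
qed

lemma falg_characters:
  assumes "subalg S A" shows "falg (characters S A) ((\<lambda>a \<chi>. \<chi> a) ` A)"
  unfolding falg_def
proof (intro conjI allI ballI)
  fix c show "\<exists>a\<in>(\<lambda>a \<chi>. \<chi> a) ` A. \<forall>\<chi>\<in>characters S A. a \<chi> = c"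
    using subalgD(2)[OF assms] by (intro bexI[OF _ imageI[of "\<lambda>x\<in>S. c"]]) (auto simp: characters_def)
next
  fix f g :: "(('a \<Rightarrow> complex) \<Rightarrow> complex) \<Rightarrow> complex"
  assume "f \<in> (\<lambda>a \<chi>. \<chi> a) ` A" "g \<in> (\<lambda>a \<chi>. \<chi> a) ` A"
  then obtain a b where ab: "a \<in> A" "b \<in> A" "f = (\<lambda>\<chi>. \<chi> a)" "g = (\<lambda>\<chi>. \<chi> b)" by blast
  show "\<exists>h\<in>(\<lambda>a \<chi>. \<chi> a) ` A. \<forall>\<chi>\<in>characters S A. h \<chi> = f \<chi> + g \<chi>"
    using subalgD(3)[OF assms ab(1,2)] ab
    by (intro bexI[OF _ imageI[of "\<lambda>x\<in>S. a x + b x"]]) (auto simp: characters_def)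
  show "\<exists>h\<in>(\<lambda>a \<chi>. \<chi> a) ` A. \<forall>\<chi>\<in>characters S A. h \<chi> = f \<chi> * g \<chi>"
    using subalgD(4)[OF assms ab(1,2)] ab
    by (intro bexI[OF _ imageI[of "\<lambda>x\<in>S. a x * b x"]]) (auto simp: characters_def)
qed

lemma isomorphic_zariski_algI:
  assumes A: "falg S A" and B: "falg T B"
    and "\<And>x. x \<in> S \<Longrightarrow> \<phi> x \<in> T" "\<And>y. y \<in> T \<Longrightarrow> \<psi> y \<in> S"
    and "\<And>x. x \<in> S \<Longrightarrow> \<psi> (\<phi> x) = x" "\<And>y. y \<in> T \<Longrightarrow> \<phi> (\<psi> y) = y"
    and *: "\<And>b. b \<in> B \<Longrightarrow> \<exists>a\<in>A. \<forall>x\<in>S. b (\<phi> x) = a x"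
    and **: "\<And>a. a \<in> A \<Longrightarrow> \<exists>b\<in>B. \<forall>x\<in>T. a (\<psi> x) = b x"
  shows "isomorphic (zariski_space S A) (zariski_space T B)"
proof (rule isomorphic_zariskiI[OF A B assms(3-6)])
  obtain u where u: "u \<in> A" "\<forall>x\<in>S. u x = 1" using falgD(1)[OF A] by blast
  obtain v where v: "v \<in> B" "\<forall>x\<in>T. v x = 1" using falgD(1)[OF B] by blast
  show "\<exists>a\<in>A. \<exists>c\<in>A. \<forall>x\<in>S. c x \<noteq> 0 \<and> b (\<phi> x) = a x / c x" if b: "b \<in> B" for b
  proof -
    obtain a where "a \<in> A" "\<forall>x\<in>S. b (\<phi> x) = a x" using *[OF b] by blast
    then show ?thesis using u by (intro bexI[of _ a] bexI[of _ u]) auto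
  qed
  show "\<exists>b\<in>B. \<exists>c\<in>B. \<forall>x\<in>T. c x \<noteq> 0 \<and> a (\<psi> x) = b x / c x" if a: "a \<in> A" for a
  proof -
    obtain b where "b \<in> B" "\<forall>x\<in>T. a (\<psi> x) = b x" using **[OF a] by blast
    then show ?thesis using v by (intro bexI[of _ b] bexI[of _ v]) auto
  qed
qed

definition pullback :: "'a set \<Rightarrow> ('a \<Rightarrow> 'b) \<Rightarrow> ('b \<Rightarrow> complex) \<Rightarrow> ('a \<Rightarrow> complex)" where
  "pullback S u b = (\<lambda>s\<in>S. b (u s))"

lemma pullback_character:
  assumes "subalg S A" "subalg T B" "\<And>s. s \<in> S \<Longrightarrow> u s \<in> T" "\<And>b. b \<in> B \<Longrightarrow> pullback S u b \<in> A"
    and "\<chi> \<in> characters S A"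
  shows "(\<lambda>b\<in>B. \<chi> (pullback S u b)) \<in> characters T B"
  unfolding characters_def
proof (intro CollectI conjI allI ballI)
  fix c
  have "pullback S u (\<lambda>x\<in>T. c) = (\<lambda>x\<in>S. c)" using assms(3) by (auto simp: pullback_def)
  then show "(\<lambda>b\<in>B. \<chi> (pullback S u b)) (\<lambda>x\<in>T. c) = c"
    using assms(5) subalgD(2)[OF assms(2)] by (simp add: characters_def)
next
  fix f g assume fg: "f \<in> B" "g \<in> B"
  have "pullback S u (\<lambda>x\<in>T. f x + g x) = (\<lambda>x\<in>S. pullback S u f x + pullback S u g x)"
    using assms(3) by (auto simp: pullback_def)
  then show "(\<lambda>b\<in>B. \<chi> (pullback S u b)) (\<lambda>x\<in>T. f x + g x) =
      (\<lambda>b\<in>B. \<chi> (pullback S u b)) f + (\<lambda>b\<in>B. \<chi> (pullback S u b)) g"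
    using assms(4,5) fg subalgD(3)[OF assms(2) fg] by (simp add: characters_def)
  have "pullback S u (\<lambda>x\<in>T. f x * g x) = (\<lambda>x\<in>S. pullback S u f x * pullback S u g x)"
    using assms(3) by (auto simp: pullback_def)
  then show "(\<lambda>b\<in>B. \<chi> (pullback S u b)) (\<lambda>x\<in>T. f x * g x) =
      (\<lambda>b\<in>B. \<chi> (pullback S u b)) f * (\<lambda>b\<in>B. \<chi> (pullback S u b)) g"
    using assms(4,5) fg subalgD(4)[OF assms(2) fg] by (simp add: characters_def)
qed auto

lemma pullback_pullback:
  assumes "subalg S A" "\<And>s. s \<in> S \<Longrightarrow> u s \<in> T" "\<And>s. s \<in> S \<Longrightarrow> a (v (u s)) = a s" "a \<in> A"
  shows "pullback S u (pullback T v a) = a"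
proof
  fix s show "pullback S u (pullback T v a) s = a s"
    using assms subalgD(1)[OF assms(1,4)] by (cases "s \<in> S") (simp_all add: pullback_def extensional_def)
qed

text \<open>\<open>u\<close> and \<open>v\<close> are inverse to each other only as seen by the
  functions: those in \<open>A\<close> cannot tell \<open>v (u s)\<close> from \<open>s\<close>, and
  those in \<open>B\<close> cannot tell \<open>u (v t)\<close> from \<open>t\<close>. A character is
  a functional on the algebra, so nothing else about the points matters. This covers both forgetting
  translation parts and choosing an arbitrary pair of matrices with given traces.\<close>

lemma Spec_pullback:
  assumes A: "subalg S A" and B: "subalg T B"
    and u: "\<And>s. s \<in> S \<Longrightarrow> u s \<in> T" and v: "\<And>t. t \<in> T \<Longrightarrow> v t \<in> S"
    and pu: "\<And>b. b \<in> B \<Longrightarrow> pullback S u b \<in> A" and pv: "\<And>a. a \<in> A \<Longrightarrow> pullback T v a \<in> B"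
    and vu: "\<And>a s. a \<in> A \<Longrightarrow> s \<in> S \<Longrightarrow> a (v (u s)) = a s"
    and uv: "\<And>b t. b \<in> B \<Longrightarrow> t \<in> T \<Longrightarrow> b (u (v t)) = b t"
  shows "isomorphic (Spec S A) (Spec T B)"
    and "finitely_generated T B \<Longrightarrow> finitely_generated S A"
proof -
  have 1: "pullback S u (pullback T v a) = a" if "a \<in> A" for a
    by (rule pullback_pullback[OF A u vu[OF that] that])
  have 2: "pullback T v (pullback S u b) = b" if "b \<in> B" for b
    by (rule pullback_pullback[OF B v uv[OF that] that])
  show "isomorphic (Spec S A) (Spec T B)" unfolding Spec_def
  proof (rule isomorphic_zariski_algI[OF falg_characters[OF A] falg_characters[OF B],
        where \<phi> = "\<lambda>\<chi>. \<lambda>b\<in>B. \<chi> (pullback S u b)" and \<psi> = "\<lambda>\<chi>. \<lambda>a\<in>A. \<chi> (pullback T v a)"])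
    show "(\<lambda>b\<in>B. \<chi> (pullback S u b)) \<in> characters T B" if "\<chi> \<in> characters S A" for \<chi>
      by (rule pullback_character[OF A B u pu that])
    show "(\<lambda>a\<in>A. \<chi> (pullback T v a)) \<in> characters S A" if "\<chi> \<in> characters T B" for \<chi>
      by (rule pullback_character[OF B A v pv that])
    show "(\<lambda>a\<in>A. (\<lambda>b\<in>B. \<chi> (pullback S u b)) (pullback T v a)) = \<chi>" if \<chi>: "\<chi> \<in> characters S A" for \<chi>
    proof
      fix a show "(\<lambda>a\<in>A. (\<lambda>b\<in>B. \<chi> (pullback S u b)) (pullback T v a)) a = \<chi> a"
        using \<chi> pv[of a] 1[of a] by (cases "a \<in> A") (simp_all add: characters_def extensional_def)
    qed
    show "(\<lambda>b\<in>B. (\<lambda>a\<in>A. \<chi> (pullback T v a)) (pullback S u b)) = \<chi>" if \<chi>: "\<chi> \<in> characters T B" for \<chi>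
    proof
      fix b show "(\<lambda>b\<in>B. (\<lambda>a\<in>A. \<chi> (pullback T v a)) (pullback S u b)) b = \<chi> b"
        using \<chi> pu[of b] 2[of b] by (cases "b \<in> B") (simp_all add: characters_def extensional_def)
    qed
    show "\<exists>a\<in>(\<lambda>a \<chi>. \<chi> a) ` A. \<forall>\<chi>\<in>characters S A. b (\<lambda>b\<in>B. \<chi> (pullback S u b)) = a \<chi>"
      if "b \<in> (\<lambda>a \<chi>. \<chi> a) ` B" for b
      using that pu by auto
    show "\<exists>b\<in>(\<lambda>a \<chi>. \<chi> a) ` B. \<forall>\<chi>\<in>characters T B. a (\<lambda>a\<in>A. \<chi> (pullback T v a)) = b \<chi>"
      if "a \<in> (\<lambda>a \<chi>. \<chi> a) ` A" for a
      using that pv by auto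
  qed
  assume "finitely_generated T B"
  then obtain F where F: "finite F" "F \<subseteq> B" "B = generated_algebra T F" by (auto simp: finitely_generated_def)
  have gen: "pullback S u b \<in> generated_algebra S (pullback S u ` F)" if "b \<in> generated_algebra T F" for b
    using that
  proof (induction rule: generated_algebra.induct)
    case (const c)
    have "pullback S u (\<lambda>x\<in>T. c) = (\<lambda>x\<in>S. c)" using u by (auto simp: pullback_def)
    then show "pullback S u (\<lambda>x\<in>T. c) \<in> generated_algebra S (pullback S u ` F)"
      by (simp add: generated_algebra.const)
  next
    case (gen g)
    have "pullback S u (restrict g T) = restrict (pullback S u g) S" using u by (auto simp: pullback_def)
    then show "pullback S u (restrict g T) \<in> generated_algebra S (pullback S u ` F)"
      using gen by (simp add: generated_algebra.gen)
  next
    case (add f g)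
    have "pullback S u (\<lambda>x\<in>T. f x + g x) = (\<lambda>x\<in>S. pullback S u f x + pullback S u g x)"
      using u by (auto simp: pullback_def)
    then show "pullback S u (\<lambda>x\<in>T. f x + g x) \<in> generated_algebra S (pullback S u ` F)"
      using add by (simp add: generated_algebra.add)
  next
    case (mult f g)
    have "pullback S u (\<lambda>x\<in>T. f x * g x) = (\<lambda>x\<in>S. pullback S u f x * pullback S u g x)"
      using u by (auto simp: pullback_def)
    then show "pullback S u (\<lambda>x\<in>T. f x * g x) \<in> generated_algebra S (pullback S u ` F)"
      using mult by (simp add: generated_algebra.mult)
  qed
  have "pullback S u ` F \<subseteq> A" using F pu by auto
  moreover have "A \<subseteq> generated_algebra S (pullback S u ` F)"
  proof
    fix a assume a: "a \<in> A"
    then show "a \<in> generated_algebra S (pullback S u ` F)" using gen[of "pullback T v a"] pv[OF a] 1[OF a] F by simp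
  qed
  ultimately show "finitely_generated S A" unfolding finitely_generated_def
    using F generated_algebra_subset[OF A] by (intro exI[of _ "pullback S u ` F"]) blast
qed

text \<open>For algebras whose characters are known explicitly: by \<open>pt\<close> and
  \<open>sep\<close>, evaluation is a bijection from \<open>T\<close> onto the characters.\<close>

lemma Spec_points:
  assumes B: "subalg T B" and pt: "\<And>\<chi>. \<chi> \<in> characters T B \<Longrightarrow> \<exists>t\<in>T. \<forall>b\<in>B. \<chi> b = b t"
    and sep: "\<And>t t'. t \<in> T \<Longrightarrow> t' \<in> T \<Longrightarrow> (\<And>b. b \<in> B \<Longrightarrow> b t = b t') \<Longrightarrow> t = t'"
  shows "isomorphic (Spec T B) (zariski_space T B)"
proof -
  define p where "p \<chi> = (SOME t. t \<in> T \<and> (\<forall>b\<in>B. \<chi> b = b t))" for \<chi>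
  have p: "p \<chi> \<in> T" "\<And>b. b \<in> B \<Longrightarrow> \<chi> b = b (p \<chi>)" if \<chi>: "\<chi> \<in> characters T B" for \<chi>
  proof -
    obtain t where t: "t \<in> T" "\<forall>b\<in>B. \<chi> b = b t" using pt[OF \<chi>] by blast
    have "p \<chi> \<in> T \<and> (\<forall>b\<in>B. \<chi> b = b (p \<chi>))"
      unfolding p_def by (rule someI[of _ t]) (use t in simp)
    then show "p \<chi> \<in> T" "\<And>b. b \<in> B \<Longrightarrow> \<chi> b = b (p \<chi>)" by blast+
  qed
  have e: "(\<lambda>b\<in>B. b t) \<in> characters T B" if "t \<in> T" for t
    using that subalgD[OF B] by (auto simp: characters_def)
  have fT: "falg T B"
    unfolding falg_def
  proof (intro conjI allI ballI)
    fix c show "\<exists>a\<in>B. \<forall>x\<in>T. a x = c" using subalgD(2)[OF B, of c] by (intro bexI[of _ "\<lambda>x\<in>T. c"]) auto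
  next
    fix f g assume "f \<in> B" "g \<in> B"
    note * = subalgD(3,4)[OF B this]
    show "\<exists>h\<in>B. \<forall>x\<in>T. h x = f x + g x" by (rule bexI[OF _ *(1)]) auto
    show "\<exists>h\<in>B. \<forall>x\<in>T. h x = f x * g x" by (rule bexI[OF _ *(2)]) auto
  qed
  show ?thesis unfolding Spec_def
  proof (rule isomorphic_zariski_algI[OF falg_characters[OF B] fT, where \<phi> = p and \<psi> = "\<lambda>t. \<lambda>b\<in>B. b t"])
    show "(\<lambda>b\<in>B. b (p \<chi>)) = \<chi>" if \<chi>: "\<chi> \<in> characters T B" for \<chi>
    proof
      fix b show "(\<lambda>b\<in>B. b (p \<chi>)) b = \<chi> b"
        using p(2)[OF \<chi>, of b] \<chi> by (cases "b \<in> B") (auto simp: characters_def extensional_def)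
    qed
    show "p (\<lambda>b\<in>B. b t) = t" if t: "t \<in> T" for t
    proof (rule sep[OF p(1)[OF e[OF t]] t])
      fix b assume "b \<in> B"
      then show "b (p (\<lambda>b\<in>B. b t)) = b t" using p(2)[OF e[OF t], of b] by simp
    qed
    show "\<exists>a\<in>(\<lambda>a \<chi>. \<chi> a) ` B. \<forall>\<chi>\<in>characters T B. b (p \<chi>) = a \<chi>" if "b \<in> B" for b
    proof (rule bexI[OF _ imageI[OF that]], rule ballI)
      fix \<chi> assume "\<chi> \<in> characters T B"
      then show "b (p \<chi>) = \<chi> b" using p(2)[of \<chi> b] that by simp
    qed
    show "\<exists>b\<in>B. \<forall>t\<in>T. a (\<lambda>b\<in>B. b t) = b t" if "a \<in> (\<lambda>a \<chi>. \<chi> a) ` B" for a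
      using that by auto
  qed (use p e in auto)
qed

section \<open>Affine varieties and spectra of finitely generated algebras\<close>

abbreviation polyfun :: "nat \<Rightarrow> ((nat \<Rightarrow> complex) \<Rightarrow> complex) set" where
  "polyfun k \<equiv> generated_algebra (affine_points k) ((\<lambda>i x. x i) ` {..<k})"

lemma falg_polyfun: "falg (affine_points k) (polyfun k)"
  by (rule falg_generated)

text \<open>Each point outside \<open>Z\<close> is separated from it by one member of
  \<open>P\<close>, whose nonvanishing locus is an open neighbourhood; \<open>P\<close> will be a
  whole vanishing ideal.\<close>

lemma closedin_affine_space:
  assumes "\<And>y. y \<in> Z \<longleftrightarrow> y \<in> affine_points k \<and> (\<forall>p\<in>P. p y = 0)" "P \<subseteq> polyfun k"
  shows "closedin (top_of (affine_space k)) Z"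
  unfolding closedin_def affine_space_def topspace_zariski[OF falg_polyfun] openin_zariski[OF falg_polyfun]
proof (intro conjI ballI)
  fix x assume "x \<in> affine_points k - Z"
  then obtain p where "p \<in> P" "p x \<noteq> 0" using assms(1) by blast
  then show "\<exists>a\<in>polyfun k. a x \<noteq> 0 \<and> (\<forall>y\<in>affine_points k. a y \<noteq> 0 \<longrightarrow> y \<in> affine_points k - Z)"
    using assms by (intro bexI[of _ p]) auto
qed (use assms in auto)

lemma affine_variety_zariski:
  assumes "closedin (top_of (affine_space k)) Z" "isomorphic X (zariski_space Z (polyfun k))"
  shows "affine_variety X"
proof -
  have "Z \<subseteq> affine_points k"
    using closedin_subset[OF assms(1)] by (simp add: affine_space_def topspace_zariski[OF falg_polyfun])
  then have "isomorphic X (subspace (affine_space k) Z)"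
    unfolding affine_space_def
    using isomorphic_trans[OF assms(2) isomorphic_sym[OF subspace_zariski[OF falg_polyfun]]] by blast
  then show ?thesis using assms(1) unfolding affine_variety_def by blast
qed

text \<open>A character is determined by its values on the finitely many generators
  \<open>fs\<close>. The points of affine space that arise are those that satisfy all polynomial
  relations between the generators, which is a closed condition. Coordinate functions correspond to
  generators, so the two structures agree.\<close>

lemma affine_variety_Spec:
  assumes "finitely_generated S A" shows "affine_variety (Spec S A)"
proof -
  obtain F where F: "finite F" "F \<subseteq> A" "A = generated_algebra S F" using assms by (auto simp: finitely_generated_def)
  obtain fs where fs: "set fs = F" using finite_list[OF F(1)] by blast
  define m where "m = length fs"
  define ev where "ev s = (\<lambda>i\<in>{..<m}. (fs ! i) s)" for s
  define \<phi> where "\<phi> \<chi> = (\<lambda>i\<in>{..<m}. \<chi> (fs ! i))" for \<chi> :: "('a \<Rightarrow> complex) \<Rightarrow> complex"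
  have A: "subalg S A" using F subalg_generated by simp
  have ev: "ev s \<in> affine_points m" for s by (auto simp: ev_def affine_points_def)
  have evi: "ev s i = (fs ! i) s" if "i < m" for s i using that by (simp add: ev_def)
  have \<phi>m: "\<phi> \<chi> \<in> affine_points m" for \<chi> by (auto simp: \<phi>_def affine_points_def)
  have fsA: "fs ! i \<in> A" if "i < m" for i using that fs F by (auto simp: m_def)
  have val: "pullback S ev p \<in> A \<and> (\<forall>\<chi>\<in>characters S A. \<chi> (pullback S ev p) = p (\<phi> \<chi>))" if "p \<in> polyfun m" for p
    using that
  proof (induction rule: generated_algebra.induct)
    case (const c)
    have "pullback S ev (\<lambda>x\<in>affine_points m. c) = (\<lambda>x\<in>S. c)" using ev by (auto simp: pullback_def)
    then show "pullback S ev (\<lambda>x\<in>affine_points m. c) \<in> A \<and>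
        (\<forall>\<chi>\<in>characters S A. \<chi> (pullback S ev (\<lambda>x\<in>affine_points m. c)) = (\<lambda>x\<in>affine_points m. c) (\<phi> \<chi>))"
      using subalgD(2)[OF A] \<phi>m by (simp add: characters_def)
  next
    case (gen g)
    then obtain i where i: "i < m" "g = (\<lambda>x. x i)" by auto
    have "pullback S ev (restrict g (affine_points m)) = fs ! i"
      using subalgD(1)[OF A fsA[OF i(1)]] i ev by (auto simp: pullback_def ev_def extensional_def)
    moreover have "restrict g (affine_points m) (\<phi> \<chi>) = \<chi> (fs ! i)" for \<chi> :: "('a \<Rightarrow> complex) \<Rightarrow> complex"
      using \<phi>m[of \<chi>] i by (simp add: \<phi>_def)
    ultimately show "pullback S ev (restrict g (affine_points m)) \<in> A \<and> (\<forall>\<chi>\<in>characters S A.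
        \<chi> (pullback S ev (restrict g (affine_points m))) = restrict g (affine_points m) (\<phi> \<chi>))"
      using fsA i by simp
  next
    case (add f g)
    have "pullback S ev (\<lambda>x\<in>affine_points m. f x + g x) = (\<lambda>x\<in>S. pullback S ev f x + pullback S ev g x)"
      using ev by (auto simp: pullback_def)
    then show "pullback S ev (\<lambda>x\<in>affine_points m. f x + g x) \<in> A \<and> (\<forall>\<chi>\<in>characters S A.
        \<chi> (pullback S ev (\<lambda>x\<in>affine_points m. f x + g x)) = (\<lambda>x\<in>affine_points m. f x + g x) (\<phi> \<chi>))"
      using add \<phi>m subalgD(3)[OF A] by (simp add: characters_def)
  next
    case (mult f g)
    have "pullback S ev (\<lambda>x\<in>affine_points m. f x * g x) = (\<lambda>x\<in>S. pullback S ev f x * pullback S ev g x)"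
      using ev by (auto simp: pullback_def)
    then show "pullback S ev (\<lambda>x\<in>affine_points m. f x * g x) \<in> A \<and> (\<forall>\<chi>\<in>characters S A.
        \<chi> (pullback S ev (\<lambda>x\<in>affine_points m. f x * g x)) = (\<lambda>x\<in>affine_points m. f x * g x) (\<phi> \<chi>))"
      using mult \<phi>m subalgD(4)[OF A] by (simp add: characters_def)
  qed
  have rep: "\<exists>p\<in>polyfun m. pullback S ev p = a" if "a \<in> A" for a
    using that unfolding F(3)
  proof (induction rule: generated_algebra.induct)
    case (const c)
    show ?case by (rule bexI[OF _ generated_algebra.const[where c = c]]) (use ev in \<open>auto simp: pullback_def\<close>)
  next
    case (gen g)
    then obtain i where "i < m" "g = fs ! i" using fs by (metis in_set_conv_nth m_def)
    then show ?case
      by (intro bexI[OF _ generated_algebra.gen[of "\<lambda>x. x i"]]) (use ev evi in \<open>auto simp: pullback_def\<close>)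
  next
    case (add f g)
    then obtain p q where "p \<in> polyfun m" "q \<in> polyfun m" "pullback S ev p = f" "pullback S ev q = g" by blast
    then show ?case
      by (intro bexI[OF _ generated_algebra.add[of p _ _ q]]) (use ev in \<open>auto simp: pullback_def\<close>)
  next
    case (mult f g)
    then obtain p q where "p \<in> polyfun m" "q \<in> polyfun m" "pullback S ev p = f" "pullback S ev q = g" by blast
    then show ?case
      by (intro bexI[OF _ generated_algebra.mult[of p _ _ q]]) (use ev in \<open>auto simp: pullback_def\<close>)
  qed
  define P where "P = {p \<in> polyfun m. \<forall>s\<in>S. p (ev s) = 0}"
  define Z where "Z = \<phi> ` characters S A"
  have Z: "y \<in> Z \<longleftrightarrow> y \<in> affine_points m \<and> (\<forall>p\<in>P. p y = 0)" for y
  proof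
    assume "y \<in> Z"
    then obtain \<chi> where \<chi>: "\<chi> \<in> characters S A" "y = \<phi> \<chi>" by (auto simp: Z_def)
    have "p y = 0" if "p \<in> P" for p
    proof -
      have "pullback S ev p = (\<lambda>x\<in>S. 0)" using that by (auto simp: P_def pullback_def)
      moreover have "\<chi> (\<lambda>x\<in>S. 0) = 0" using \<chi> by (auto simp: characters_def)
      ultimately show ?thesis using val[of p] that \<chi> by (simp add: P_def)
    qed
    then show "y \<in> affine_points m \<and> (\<forall>p\<in>P. p y = 0)" using \<chi> \<phi>m by blast
  next
    assume y: "y \<in> affine_points m \<and> (\<forall>p\<in>P. p y = 0)"
    \<comment> \<open>Two polynomials that represent the same member of \<open>A\<close> differ by a
      relation, so they agree at \<open>y\<close>. Hence evaluation at \<open>y\<close> is well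
      defined on \<open>A\<close>, and it is the character sought.\<close>
    have uniq: "p y = q y" if "p \<in> polyfun m" "q \<in> polyfun m" "pullback S ev p = pullback S ev q" for p q
    proof -
      have "(\<lambda>x\<in>affine_points m. -1) \<in> polyfun m" by (rule generated_algebra.const)
      from generated_algebra.add[OF that(1) generated_algebra.mult[OF this that(2)]]
      have *: "(\<lambda>x\<in>affine_points m. p x - q x) \<in> polyfun m"
        by (rule back_subst[of "\<lambda>f. f \<in> polyfun m"]) auto
      have "p (ev s) = q (ev s)" if "s \<in> S" for s
        using fun_cong[OF \<open>pullback S ev p = pullback S ev q\<close>, of s] that by (simp add: pullback_def)
      then have "(\<lambda>x\<in>affine_points m. p x - q x) \<in> P" using * ev by (simp add: P_def)
      then have "(\<lambda>x\<in>affine_points m. p x - q x) y = 0" using y by blast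
      then show ?thesis using y by simp
    qed
    define rp where "rp a = (SOME p. p \<in> polyfun m \<and> pullback S ev p = a)" for a
    have rp: "rp a \<in> polyfun m" "pullback S ev (rp a) = a" if a: "a \<in> A" for a
    proof -
      have "\<exists>p. p \<in> polyfun m \<and> pullback S ev p = a" using rep[OF a] by blast
      then have "rp a \<in> polyfun m \<and> pullback S ev (rp a) = a"
        unfolding rp_def by (rule someI_ex)
      then show "rp a \<in> polyfun m" "pullback S ev (rp a) = a" by blast+
    qed
    define \<chi> where "\<chi> = (\<lambda>a\<in>A. rp a y)"
    have \<chi>: "\<chi> (pullback S ev p) = p y" if "p \<in> polyfun m" for p
      using val[OF that] rp[of "pullback S ev p"] uniq[of "rp (pullback S ev p)" p] that by (simp add: \<chi>_def)
    have "\<chi> \<in> characters S A" unfolding characters_def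
    proof (intro CollectI conjI allI ballI)
      show "\<chi> \<in> extensional A" by (simp add: \<chi>_def)
      fix c
      have "pullback S ev (\<lambda>x\<in>affine_points m. c) = (\<lambda>x\<in>S. c)" using ev by (auto simp: pullback_def)
      then show "\<chi> (\<lambda>x\<in>S. c) = c"
        using \<chi>[OF generated_algebra.const[where c = c]] y by simp
    next
      fix f g assume "f \<in> A" "g \<in> A"
      then obtain p q where pq: "p \<in> polyfun m" "q \<in> polyfun m" "pullback S ev p = f" "pullback S ev q = g"
        using rep by meson
      have "pullback S ev (\<lambda>x\<in>affine_points m. p x + q x) = (\<lambda>x\<in>S. f x + g x)"
        using ev pq(3,4) by (auto simp: pullback_def)
      then show "\<chi> (\<lambda>x\<in>S. f x + g x) = \<chi> f + \<chi> g"
        using \<chi>[OF generated_algebra.add[OF pq(1,2)]] \<chi>[OF pq(1)] \<chi>[OF pq(2)] pq(3,4) y by simp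
      have "pullback S ev (\<lambda>x\<in>affine_points m. p x * q x) = (\<lambda>x\<in>S. f x * g x)"
        using ev pq(3,4) by (auto simp: pullback_def)
      then show "\<chi> (\<lambda>x\<in>S. f x * g x) = \<chi> f * \<chi> g"
        using \<chi>[OF generated_algebra.mult[OF pq(1,2)]] \<chi>[OF pq(1)] \<chi>[OF pq(2)] pq(3,4) y by simp
    qed
    moreover have "\<phi> \<chi> = y"
    proof
      fix i show "\<phi> \<chi> i = y i"
      proof (cases "i < m")
        case True
        then have g: "restrict (\<lambda>x. x i) (affine_points m) \<in> polyfun m" by (intro generated_algebra.gen) auto
        have "pullback S ev (restrict (\<lambda>x. x i) (affine_points m)) = fs ! i"
          using subalgD(1)[OF A fsA[OF True]] True ev by (auto simp: pullback_def ev_def extensional_def)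
        then show ?thesis using \<chi>[OF g] y True by (simp add: \<phi>_def)
      next
        case False then show ?thesis using y by (auto simp: \<phi>_def affine_points_def PiE_def extensional_def)
      qed
    qed
    ultimately show "y \<in> Z" by (auto simp: Z_def)
  qed
  have inj: "inj_on \<phi> (characters S A)"
  proof (rule inj_onI)
    fix \<chi> \<chi>' assume c: "\<chi> \<in> characters S A" "\<chi>' \<in> characters S A" "\<phi> \<chi> = \<phi> \<chi>'"
    have "\<chi> a = \<chi>' a" if a: "a \<in> A" for a
    proof -
      obtain p where "p \<in> polyfun m" "pullback S ev p = a" using rep[OF a] by blast
      then show ?thesis using val[of p] c by metis
    qed
    then show "\<chi> = \<chi>'" using c by (auto simp: characters_def intro: extensionalityI)
  qed
  have "isomorphic (Spec S A) (zariski_space Z (polyfun m))" unfolding Spec_def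
  proof (rule isomorphic_zariski_algI[where \<phi> = \<phi> and \<psi> = "inv_into (characters S A) \<phi>"])
    show "falg (characters S A) ((\<lambda>a \<chi>. \<chi> a) ` A)" by (rule falg_characters[OF A])
    show "falg Z (polyfun m)" by (rule falg_subset[OF falg_polyfun]) (use Z in blast)
    show "\<exists>a\<in>(\<lambda>a \<chi>. \<chi> a) ` A. \<forall>\<chi>\<in>characters S A. b (\<phi> \<chi>) = a \<chi>" if "b \<in> polyfun m" for b
      using val[OF that] by (intro bexI[OF _ imageI[of "pullback S ev b"]]) auto
    show "\<exists>b\<in>polyfun m. \<forall>y\<in>Z. a (inv_into (characters S A) \<phi> y) = b y" if aA: "a \<in> (\<lambda>a \<chi>. \<chi> a) ` A" for a
    proof -
      obtain a' where a': "a' \<in> A" "a = (\<lambda>\<chi>. \<chi> a')" using aA by blast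
      obtain p where p: "p \<in> polyfun m" "pullback S ev p = a'" using rep[OF a'(1)] by blast
      show ?thesis
      proof (rule bexI[OF _ p(1)], rule ballI)
        fix y assume y: "y \<in> Z"
        then have "inv_into (characters S A) \<phi> y \<in> characters S A" "\<phi> (inv_into (characters S A) \<phi> y) = y"
          unfolding Z_def by (auto simp: inv_into_into f_inv_into_f)
        then show "a (inv_into (characters S A) \<phi> y) = p y" using val[OF p(1)] p(2) a'(2) by metis
      qed
    qed
  qed (use inj in \<open>auto simp: Z_def f_inv_into_f inv_into_into\<close>)
  moreover have "closedin (top_of (affine_space m)) Z"
    by (rule closedin_affine_space[OF Z]) (auto simp: P_def)
  ultimately show ?thesis by (intro affine_variety_zariski)
qed

section \<open>Motives of locally closed sets in coordinate spaces\<close>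

text \<open>Nested products of \<open>complex\<close> model coordinate spaces, so that strata can be
  written as sets of tuples. The axioms say that the coordinates identify the type with the affine
  space of dimension \<open>length coords\<close>.\<close>

class affine_coords =
  fixes coords :: "('a \<Rightarrow> complex) list"
  assumes coords_inj: "(\<And>i. i < length coords \<Longrightarrow> (coords ! i) x = (coords ! i) y) \<Longrightarrow> x = y"
    and coords_surj: "\<exists>x. \<forall>i<length coords. (coords ! i) x = v i"

instantiation complex :: affine_coords
begin
definition coords_complex :: "(complex \<Rightarrow> complex) list" where "coords_complex = [\<lambda>x. x]"
instance by standard (auto simp: coords_complex_def)
end

instantiation prod :: (affine_coords, affine_coords) affine_coords
begin
definition coords_prod :: "('a \<times> 'b \<Rightarrow> complex) list" where
  "coords_prod = map (\<lambda>g x. g (fst x)) coords @ map (\<lambda>g x. g (snd x)) coords"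
instance
proof
  let ?a = "coords :: ('a \<Rightarrow> complex) list" and ?b = "coords :: ('b \<Rightarrow> complex) list"
  fix x y :: "'a \<times> 'b"
  assume *: "(coords ! i) x = (coords ! i) y" if "i < length (coords :: ('a \<times> 'b \<Rightarrow> complex) list)" for i
  have "(?a ! i) (fst x) = (?a ! i) (fst y)" if "i < length ?a" for i
    using *[of i] that by (simp add: coords_prod_def nth_append)
  then have "fst x = fst y" by (rule coords_inj)
  moreover have "(?b ! i) (snd x) = (?b ! i) (snd y)" if "i < length ?b" for i
    using *[of "length ?a + i"] that by (simp add: coords_prod_def nth_append)
  then have "snd x = snd y" by (rule coords_inj)
  ultimately show "x = y" by (rule prod_eqI)
next
  let ?a = "coords :: ('a \<Rightarrow> complex) list" and ?b = "coords :: ('b \<Rightarrow> complex) list"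
  fix v :: "nat \<Rightarrow> complex"
  obtain x where "\<forall>i<length ?a. (?a ! i) x = v i" using coords_surj by blast
  moreover obtain y where "\<forall>i<length ?b. (?b ! i) y = v (length ?a + i)"
    using coords_surj[of "\<lambda>i. v (length ?a + i)"] by blast
  ultimately have "\<forall>i<length (coords :: ('a \<times> 'b \<Rightarrow> complex) list). (coords ! i) (x, y) = v i"
    by (auto simp: coords_prod_def nth_append)
  then show "\<exists>x::'a \<times> 'b. \<forall>i<length (coords :: ('a \<times> 'b \<Rightarrow> complex) list). (coords ! i) x = v i"
    by (rule exI[of _ "(x, y)"])
qed
end

section \<open>Polynomial functions and rational maps on coordinate spaces\<close>

definition polys :: "('a::affine_coords \<Rightarrow> complex) set" where
  "polys = generated_algebra UNIV (set coords)"

lemma polys_intros: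
  "(\<lambda>x. c) \<in> polys" "g \<in> set coords \<Longrightarrow> g \<in> polys"
  "f \<in> polys \<Longrightarrow> f' \<in> polys \<Longrightarrow> (\<lambda>x. f x + f' x) \<in> polys"
  "f \<in> polys \<Longrightarrow> f' \<in> polys \<Longrightarrow> (\<lambda>x. f x * f' x) \<in> polys"
  unfolding polys_def
  using generated_algebra.const[of c UNIV] generated_algebra.gen[of g _ UNIV]
    generated_algebra.add[of f UNIV _ f'] generated_algebra.mult[of f UNIV _ f']
  by (simp_all add: restrict_def)

lemma polys_induct [consumes 1, case_names const gen add mult]:
  assumes "f \<in> polys"
    and "\<And>c. P (\<lambda>x. c)"
    and "\<And>g. g \<in> set coords \<Longrightarrow> P g"
    and "\<And>f g. f \<in> polys \<Longrightarrow> P f \<Longrightarrow> g \<in> polys \<Longrightarrow> P g \<Longrightarrow> P (\<lambda>x. f x + g x)"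
    and "\<And>f g. f \<in> polys \<Longrightarrow> P f \<Longrightarrow> g \<in> polys \<Longrightarrow> P g \<Longrightarrow> P (\<lambda>x. f x * g x)"
  shows "P f"
  using assms(1) unfolding polys_def
proof (induction rule: generated_algebra.induct)
  case (const c)
  show ?case using assms(2) by (simp add: restrict_def)
next
  case (gen g)
  then show ?case using assms(3)[of g] by (simp add: restrict_def)
next
  case (add f g)
  then show ?case using assms(4)[of f g] by (simp add: restrict_def polys_def)
next
  case (mult f g)
  then show ?case using assms(5)[of f g] by (simp add: restrict_def polys_def)
qed

lemma polys_diff: "f \<in> polys \<Longrightarrow> g \<in> polys \<Longrightarrow> (\<lambda>x. f x - g x) \<in> polys"
  using polys_intros(3)[OF _ polys_intros(4)[OF polys_intros(1)[of "-1"]], of f g] by simp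

lemma polys_sum: "(\<And>i. i \<in> I \<Longrightarrow> f i \<in> polys) \<Longrightarrow> (\<lambda>x. \<Sum>i\<in>I. f i x) \<in> polys"
  by (induction I rule: infinite_finite_induct) (auto intro: polys_intros)

lemma falg_polys: "falg S polys"
  unfolding falg_def
proof (intro conjI allI ballI)
  fix c show "\<exists>a\<in>polys. \<forall>x\<in>S. a x = c" by (rule bexI[OF _ polys_intros(1)[of c]]) simp
next
  fix f g :: "'a \<Rightarrow> complex" assume fg: "f \<in> polys" "g \<in> polys"
  show "\<exists>h\<in>polys. \<forall>x\<in>S. h x = f x + g x" by (rule bexI[OF _ polys_intros(3)[OF fg]]) simp
  show "\<exists>h\<in>polys. \<forall>x\<in>S. h x = f x * g x" by (rule bexI[OF _ polys_intros(4)[OF fg]]) simp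
qed

text \<open>One fraction valid on all of \<open>S\<close>, where regularity would only ask for local
  ones. This can be read off from the shape of a formula, and it covers every change of coordinates
  below.\<close>

definition regfun :: "'a::affine_coords set \<Rightarrow> ('a \<Rightarrow> complex) \<Rightarrow> bool" where
  "regfun S f \<longleftrightarrow> (\<exists>a\<in>polys. \<exists>c\<in>polys. \<forall>x\<in>S. c x \<noteq> 0 \<and> f x = a x / c x)"

definition regmap :: "'a::affine_coords set \<Rightarrow> ('a \<Rightarrow> 'b::affine_coords) \<Rightarrow> bool" where
  "regmap S \<phi> \<longleftrightarrow> (\<forall>g\<in>set coords. regfun S (\<lambda>x. g (\<phi> x)))"

lemma regfunI: "a \<in> polys \<Longrightarrow> c \<in> polys \<Longrightarrow> (\<And>x. x \<in> S \<Longrightarrow> c x \<noteq> 0 \<and> f x = a x / c x) \<Longrightarrow> regfun S f"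
  unfolding regfun_def by blast

lemma regfun_poly: "f \<in> polys \<Longrightarrow> regfun S f"
  by (rule regfunI[OF _ polys_intros(1)[of 1]]) auto

lemma regfun_add: assumes "regfun S f" "regfun S g" shows "regfun S (\<lambda>x. f x + g x)"
proof -
  obtain a c where 1: "a \<in> polys" "c \<in> polys" "\<And>x. x \<in> S \<Longrightarrow> c x \<noteq> 0 \<and> f x = a x / c x"
    using assms(1) unfolding regfun_def by blast
  obtain b d where 2: "b \<in> polys" "d \<in> polys" "\<And>x. x \<in> S \<Longrightarrow> d x \<noteq> 0 \<and> g x = b x / d x"
    using assms(2) unfolding regfun_def by blast
  show ?thesis
  proof (rule regfunI)
    show "(\<lambda>x. a x * d x + b x * c x) \<in> polys" "(\<lambda>x. c x * d x) \<in> polys" using 1 2 by (auto intro: polys_intros)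
  qed (use 1 2 in \<open>simp add: add_frac_eq\<close>)
qed

lemma regfun_mult: assumes "regfun S f" "regfun S g" shows "regfun S (\<lambda>x. f x * g x)"
proof -
  obtain a c where 1: "a \<in> polys" "c \<in> polys" "\<And>x. x \<in> S \<Longrightarrow> c x \<noteq> 0 \<and> f x = a x / c x"
    using assms(1) unfolding regfun_def by blast
  obtain b d where 2: "b \<in> polys" "d \<in> polys" "\<And>x. x \<in> S \<Longrightarrow> d x \<noteq> 0 \<and> g x = b x / d x"
    using assms(2) unfolding regfun_def by blast
  show ?thesis
  proof (rule regfunI)
    show "(\<lambda>x. a x * b x) \<in> polys" "(\<lambda>x. c x * d x) \<in> polys" using 1 2 by (auto intro: polys_intros)
  qed (use 1 2 in simp)
qed

lemma regfun_divide:
  assumes "regfun S f" "regfun S g" "\<And>x. x \<in> S \<Longrightarrow> g x \<noteq> 0" shows "regfun S (\<lambda>x. f x / g x)"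
proof -
  obtain a c where 1: "a \<in> polys" "c \<in> polys" "\<And>x. x \<in> S \<Longrightarrow> c x \<noteq> 0 \<and> f x = a x / c x"
    using assms(1) unfolding regfun_def by blast
  obtain b d where 2: "b \<in> polys" "d \<in> polys" "\<And>x. x \<in> S \<Longrightarrow> d x \<noteq> 0 \<and> g x = b x / d x"
    using assms(2) unfolding regfun_def by blast
  show ?thesis
  proof (rule regfunI)
    show "(\<lambda>x. a x * d x) \<in> polys" "(\<lambda>x. c x * b x) \<in> polys" using 1 2 by (auto intro: polys_intros)
    fix x assume x: "x \<in> S"
    have "b x \<noteq> 0" using 2(3)[OF x] assms(3)[OF x] by auto
    then show "c x * b x \<noteq> 0 \<and> f x / g x = a x * d x / (c x * b x)" using 1(3)[OF x] 2(3)[OF x] by simp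
  qed
qed

lemma regmap_polys:
  assumes "regmap S \<phi>" "p \<in> polys" shows "regfun S (\<lambda>x. p (\<phi> x))"
  using assms(2)
proof (induction rule: polys_induct)
  case (const c) show ?case by (rule regfun_poly[OF polys_intros(1)])
next
  case (gen g) then show ?case using assms(1) by (simp add: regmap_def)
qed (auto intro: regfun_add regfun_mult)

lemma regmap_complex: "regmap S f \<longleftrightarrow> regfun S (f :: _ \<Rightarrow> complex)"
  by (simp add: regmap_def coords_complex_def)

lemma regmap_id: "regmap S (\<lambda>x. x)"
  by (auto simp: regmap_def intro: regfun_poly polys_intros)

lemma regmap_const: "regmap S (\<lambda>x. c)"
  by (auto simp: regmap_def intro: regfun_poly polys_intros)

lemma regmap_fst: "regmap S f \<Longrightarrow> regmap S (\<lambda>x. fst (f x))"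
  by (auto simp: regmap_def coords_prod_def)

lemma regmap_snd: "regmap S f \<Longrightarrow> regmap S (\<lambda>x. snd (f x))"
  by (auto simp: regmap_def coords_prod_def)

lemma regmap_Pair: "regmap S f \<Longrightarrow> regmap S g \<Longrightarrow> regmap S (\<lambda>x. (f x, g x))"
  by (auto simp: regmap_def coords_prod_def)

context
  fixes f g :: "'a::affine_coords \<Rightarrow> complex" and S :: "'a set"
  assumes f: "regmap S f"
begin

lemma regmap_add: "regmap S g \<Longrightarrow> regmap S (\<lambda>x. f x + g x)"
  using f by (simp add: regmap_complex regfun_add)

lemma regmap_mult: "regmap S g \<Longrightarrow> regmap S (\<lambda>x. f x * g x)"
  using f by (simp add: regmap_complex regfun_mult)

lemma regmap_uminus: "regmap S (\<lambda>x. - f x)"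
  using regfun_mult[OF regfun_poly[OF polys_intros(1)[of "-1"]], of S f] f by (simp add: regmap_complex)

lemma regmap_power: "regmap S (\<lambda>x. f x ^ k)"
  by (induction k) (use f in \<open>auto simp: regmap_complex intro: regfun_mult regfun_poly polys_intros(1)\<close>)

lemma regmap_divide: "regmap S g \<Longrightarrow> (\<And>x. x \<in> S \<Longrightarrow> g x \<noteq> 0) \<Longrightarrow> regmap S (\<lambda>x. f x / g x)"
  using f by (simp add: regmap_complex regfun_divide)

end

lemma regmap_diff:
  assumes "regmap S f" "regmap S (g :: _ \<Rightarrow> complex)" shows "regmap S (\<lambda>x. f x - g x)"
  using regmap_add[OF assms(1) regmap_uminus[OF assms(2)]] by simp

lemmas regmap_intros = regmap_Pair regmap_add regmap_diff regmap_mult regmap_uminus regmap_power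
  regmap_divide regmap_const regmap_fst regmap_snd regmap_id

definition zar :: "'a::affine_coords set \<Rightarrow> 'a fspace" where
  "zar S = zariski_space S polys"

lemma zar_isoI:
  assumes "regmap S \<phi>" "regmap T \<psi>" "\<And>x. x \<in> S \<Longrightarrow> \<phi> x \<in> T" "\<And>y. y \<in> T \<Longrightarrow> \<psi> y \<in> S"
    and "\<And>x. x \<in> S \<Longrightarrow> \<psi> (\<phi> x) = x" "\<And>y. y \<in> T \<Longrightarrow> \<phi> (\<psi> y) = y"
  shows "isomorphic (zar S) (zar T)"
  unfolding zar_def
  by (rule isomorphic_zariskiI[OF falg_polys falg_polys, where \<phi> = \<phi> and \<psi> = \<psi>])
    (use assms regmap_polys[OF assms(1)] regmap_polys[OF assms(2)] in \<open>auto simp: regfun_def\<close>)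

section \<open>Comparison with standard affine space\<close>

definition emb :: "'a::affine_coords \<Rightarrow> nat \<Rightarrow> complex" where
  "emb x = (\<lambda>i\<in>{..<length (coords :: ('a \<Rightarrow> complex) list)}. (coords ! i) x)"

definition unemb :: "(nat \<Rightarrow> complex) \<Rightarrow> 'a::affine_coords" where
  "unemb = inv_into UNIV emb"

abbreviation cdim :: "'a::affine_coords itself \<Rightarrow> nat" where
  "cdim _ \<equiv> length (coords :: ('a \<Rightarrow> complex) list)"

lemma emb_in: "emb (x::'a::affine_coords) \<in> affine_points (cdim TYPE('a))"
  by (auto simp: emb_def affine_points_def)

lemma inj_emb: "inj emb"
proof (rule injI)
  fix x y :: 'a assume e: "emb x = emb y"
  show "x = y"
  proof (rule coords_inj)
    fix i assume "i < cdim TYPE('a)"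
    then show "(coords ! i) x = (coords ! i) y" using fun_cong[OF e, of i] by (simp add: emb_def)
  qed
qed

lemma unemb_emb [simp]: "unemb (emb x) = x"
  by (simp add: unemb_def inj_emb)

lemma emb_unemb: "y \<in> affine_points (cdim TYPE('a::affine_coords)) \<Longrightarrow> emb (unemb y :: 'a) = y"
proof -
  assume y: "y \<in> affine_points (cdim TYPE('a))"
  obtain x :: 'a where x: "\<forall>i<cdim TYPE('a). (coords ! i) x = y i" using coords_surj by blast
  have "emb x = y"
  proof
    fix i show "emb x i = y i"
      using x y by (cases "i < cdim TYPE('a)") (auto simp: emb_def affine_points_def PiE_def extensional_def)
  qed
  then show ?thesis by (metis unemb_emb)
qed

lemma polys_emb:
  assumes "p \<in> (polys :: ('a::affine_coords \<Rightarrow> complex) set)"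
  shows "\<exists>p'\<in>polyfun (cdim TYPE('a)). \<forall>x. p' (emb x) = p x"
  using assms
proof (induction rule: polys_induct)
  case (const c)
  show ?case by (intro bexI[OF _ generated_algebra.const[where c = c]]) (simp add: emb_in)
next
  case (gen g)
  then obtain i where "i < cdim TYPE('a)" "g = coords ! i" by (metis in_set_conv_nth)
  moreover from this have "restrict (\<lambda>x. x i) (affine_points (cdim TYPE('a))) (emb x) = g x" for x :: 'a
    using emb_in[of x] by (simp add: emb_def)
  ultimately show ?case
    by (intro bexI[OF _ generated_algebra.gen[of "\<lambda>x. x i"]]) auto
next
  case (add f g)
  then obtain f' g' where *: "f' \<in> polyfun (cdim TYPE('a))" "g' \<in> polyfun (cdim TYPE('a))"
    "\<forall>x. f' (emb x) = f x" "\<forall>x. g' (emb x) = g x" by blast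
  then show ?case by (intro bexI[OF _ generated_algebra.add[OF *(1,2)]]) (simp add: emb_in)
next
  case (mult f g)
  then obtain f' g' where *: "f' \<in> polyfun (cdim TYPE('a))" "g' \<in> polyfun (cdim TYPE('a))"
    "\<forall>x. f' (emb x) = f x" "\<forall>x. g' (emb x) = g x" by blast
  then show ?case by (intro bexI[OF _ generated_algebra.mult[OF *(1,2)]]) (simp add: emb_in)
qed

lemma polyfun_emb:
  assumes "p \<in> polyfun (cdim TYPE('a::affine_coords))" shows "(\<lambda>x::'a. p (emb x)) \<in> polys"
  using assms
proof (induction rule: generated_algebra.induct)
  case (const c) then show ?case by (simp add: emb_in polys_intros)
next
  case (gen g)
  then obtain i where i: "i < cdim TYPE('a)" "g = (\<lambda>x. x i)" by auto
  then have "(\<lambda>x::'a. restrict g (affine_points (cdim TYPE('a))) (emb x)) = coords ! i"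
    using emb_in by (simp add: fun_eq_iff emb_in) (simp add: emb_def)
  then show "(\<lambda>x::'a. restrict g (affine_points (cdim TYPE('a))) (emb x)) \<in> polys"
    using i by (simp add: polys_intros(2))
qed (simp_all add: emb_in polys_intros)

lemma falg_emb: "falg (emb ` (S::'a::affine_coords set)) (polyfun (cdim TYPE('a)))"
  by (rule falg_subset[OF falg_polyfun]) (auto simp: emb_in)

lemma zar_emb: "isomorphic (zar (S::'a::affine_coords set)) (zariski_space (emb ` S) (polyfun (cdim TYPE('a))))"
  unfolding zar_def
proof (rule isomorphic_zariski_algI[OF falg_polys falg_emb, where \<phi> = emb and \<psi> = unemb])
  show "\<exists>a\<in>polys. \<forall>x\<in>S. b (emb x) = a x" if "b \<in> polyfun (cdim TYPE('a))" for b
    by (rule bexI[OF _ polyfun_emb[OF that]]) simp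
  show "\<exists>b\<in>polyfun (cdim TYPE('a)). \<forall>x\<in>emb ` S. a (unemb x) = b x" if a: "a \<in> polys" for a :: "'a \<Rightarrow> complex"
  proof -
    obtain p where "p \<in> polyfun (cdim TYPE('a))" "\<forall>x. p (emb x) = a x" using polys_emb[OF a] by blast
    then show ?thesis by (intro bexI[of _ p]) auto
  qed
qed auto

text \<open>Locally closed sets cut out with a single inequation. Such sets are affine, and they are
  stable under products and under splitting by the vanishing of a function, the two ways in which
  strata are built and cut.\<close>

definition loc_closed :: "'a::affine_coords set \<Rightarrow> bool" where
  "loc_closed S \<longleftrightarrow> (\<exists>E\<subseteq>polys. \<exists>h\<in>polys. S = {x. (\<forall>p\<in>E. p x = 0) \<and> h x \<noteq> 0})"

lemma loc_closed_UNIV: "loc_closed UNIV"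
  unfolding loc_closed_def
  by (rule exI[of _ "{}"]) (auto intro: bexI[of _ "\<lambda>_. 1"] polys_intros(1))

lemma loc_closed_zero:
  assumes "loc_closed S" "regmap S f" shows "loc_closed {x\<in>S. f x = (0::complex)}"
proof -
  obtain E h where 1: "E \<subseteq> polys" "h \<in> polys" "S = {x. (\<forall>p\<in>E. p x = 0) \<and> h x \<noteq> 0}"
    using assms(1) unfolding loc_closed_def by blast
  obtain a c where 2: "a \<in> polys" "c \<in> polys" "\<forall>x\<in>S. c x \<noteq> 0 \<and> f x = a x / c x"
    using assms(2) unfolding regmap_complex regfun_def by blast
  have "{x\<in>S. f x = 0} = {x. (\<forall>p\<in>insert a E. p x = 0) \<and> h x \<noteq> 0}" using 1(3) 2 by auto
  then show ?thesis unfolding loc_closed_def using 1 2 by (intro exI[of _ "insert a E"]) auto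
qed

lemma loc_closed_nonzero:
  assumes "loc_closed S" "regmap S f" shows "loc_closed {x\<in>S. f x \<noteq> (0::complex)}"
proof -
  obtain E h where 1: "E \<subseteq> polys" "h \<in> polys" "S = {x. (\<forall>p\<in>E. p x = 0) \<and> h x \<noteq> 0}"
    using assms(1) unfolding loc_closed_def by blast
  obtain a c where 2: "a \<in> polys" "c \<in> polys" "\<forall>x\<in>S. c x \<noteq> 0 \<and> f x = a x / c x"
    using assms(2) unfolding regmap_complex regfun_def by blast
  have "{x\<in>S. f x \<noteq> 0} = {x. (\<forall>p\<in>E. p x = 0) \<and> h x * a x \<noteq> 0}" using 1(3) 2 by auto
  then show ?thesis unfolding loc_closed_def using 1 2 polys_intros(4)[OF 1(2) 2(1)]
    by (intro exI[of _ E] conjI bexI[of _ "\<lambda>x. h x * a x"]) auto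
qed

lemma polys_fst: "p \<in> polys \<Longrightarrow> (\<lambda>x. p (fst x)) \<in> polys"
  by (induction rule: polys_induct) (auto intro: polys_intros simp: coords_prod_def)

lemma polys_snd: "p \<in> polys \<Longrightarrow> (\<lambda>x. p (snd x)) \<in> polys"
  by (induction rule: polys_induct) (auto intro: polys_intros simp: coords_prod_def)

lemma loc_closed_Times:
  assumes "loc_closed S" "loc_closed T" shows "loc_closed (S \<times> T)"
proof -
  obtain E h where 1: "E \<subseteq> polys" "h \<in> polys" "S = {x. (\<forall>p\<in>E. p x = 0) \<and> h x \<noteq> 0}"
    using assms(1) unfolding loc_closed_def by blast
  obtain F k where 2: "F \<subseteq> polys" "k \<in> polys" "T = {x. (\<forall>p\<in>F. p x = 0) \<and> k x \<noteq> 0}"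
    using assms(2) unfolding loc_closed_def by blast
  let ?E = "(\<lambda>p x. p (fst x)) ` E \<union> (\<lambda>p x. p (snd x)) ` F"
  have "S \<times> T = {x. (\<forall>p\<in>?E. p x = 0) \<and> h (fst x) * k (snd x) \<noteq> 0}"
    unfolding 1(3) 2(3) by (auto simp: ball_Un)
  moreover have "?E \<subseteq> polys" using 1 2 polys_fst polys_snd by blast
  moreover have "(\<lambda>x. h (fst x) * k (snd x)) \<in> polys" by (intro polys_intros(4) polys_fst polys_snd 1 2)
  ultimately show ?thesis unfolding loc_closed_def
    by (intro exI[of _ ?E] conjI bexI[of _ "\<lambda>x. h (fst x) * k (snd x)"])
qed

text \<open>The trick of Rabinowitsch: inverting \<open>h\<close> is the same as adding a coordinate \<open>t\<close> with \<open>t * h = 1\<close>.\<close>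

lemma affine_variety_zar:
  assumes "loc_closed (S::'a::affine_coords set)" shows "affine_variety (zar S)"
proof -
  obtain E h where 1: "E \<subseteq> polys" "h \<in> polys" "S = {x. (\<forall>p\<in>E. p x = 0) \<and> h x \<noteq> 0}"
    using assms(1) unfolding loc_closed_def by blast
  let ?E = "insert (\<lambda>x. h (fst x) * snd x - 1) ((\<lambda>p x. p (fst x)) ` E)"
  define Z :: "('a \<times> complex) set" where "Z = {x. \<forall>p\<in>?E. p x = 0}"
  let ?k = "cdim TYPE('a \<times> complex)"
  have "(\<lambda>x. snd x) \<in> (polys :: ('a \<times> complex \<Rightarrow> complex) set)"
    by (rule polys_intros(2)) (auto simp: coords_prod_def coords_complex_def)
  then have "(\<lambda>x. h (fst x) * snd x - 1) \<in> (polys :: ('a \<times> complex \<Rightarrow> complex) set)"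
    by (intro polys_diff polys_intros(1,4) polys_fst 1)
  then have E: "?E \<subseteq> polys" using 1 polys_fst by blast
  have h: "regmap S h" using 1 by (auto simp: regmap_complex intro: regfun_poly)
  have "isomorphic (zar S) (zar Z)"
  proof (rule zar_isoI[where \<phi> = "\<lambda>x. (x, 1 / h x)" and \<psi> = fst])
    show "regmap S (\<lambda>x. (x, 1 / h x))" using 1 h by (intro regmap_intros) auto
    show "regmap Z fst" by (intro regmap_intros)
  qed (auto simp: 1 Z_def divide_eq_eq mult.commute split: if_splits)
  then have iso: "isomorphic (zar S) (zariski_space (emb ` Z) (polyfun ?k))"
    using zar_emb isomorphic_trans by blast
  define P where "P = {p \<in> polyfun ?k. \<forall>x\<in>Z. p (emb x) = 0}"
  have "closedin (top_of (affine_space ?k)) (emb ` Z)"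
  proof (rule closedin_affine_space)
    show "P \<subseteq> polyfun ?k" by (auto simp: P_def)
    fix y show "y \<in> emb ` Z \<longleftrightarrow> y \<in> affine_points ?k \<and> (\<forall>p\<in>P. p y = 0)"
    proof
      assume "y \<in> emb ` Z" then show "y \<in> affine_points ?k \<and> (\<forall>p\<in>P. p y = 0)" by (auto simp: P_def emb_in)
    next
      assume y: "y \<in> affine_points ?k \<and> (\<forall>p\<in>P. p y = 0)"
      have "p (unemb y) = 0" if p: "p \<in> ?E" for p
      proof -
        have pp: "p \<in> polys" using p E by blast
        obtain p' where p': "p' \<in> polyfun ?k" "\<forall>x. p' (emb x) = p x" using polys_emb[OF pp] by blast
        have "p' \<in> P" using p' p by (auto simp: P_def Z_def)
        then have "p' y = 0" using y by blast
        then show ?thesis using p' emb_unemb y by metis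
      qed
      then have "unemb y \<in> Z" unfolding Z_def by blast
      then show "y \<in> emb ` Z" using emb_unemb y by (metis image_eqI)
    qed
  qed
  then show ?thesis using iso by (rule affine_variety_zariski)
qed

lemma affine_variety_iso: "affine_variety X \<Longrightarrow> isomorphic Y X \<Longrightarrow> affine_variety Y"
  unfolding affine_variety_def using isomorphic_trans by blast

text \<open>The complement of the diagonal is the union of the loci where the \<open>i\<close>-th
  coordinates differ, and the difference of these coordinates is a sum of two products of functions
  of one point each.\<close>

lemma separated_zariski:
  assumes S: "S \<subseteq> affine_points k"
  defines "X \<equiv> zariski_space S (polyfun k)"
  shows "closedin (top_of (prod_space X X)) {(x, x) | x. x \<in> points X}"
proof -
  have A: "falg S (polyfun k)" by (rule falg_subset[OF falg_polyfun S])
  let ?B = "{{z \<in> U \<times> V. h z \<noteq> 0} | U V h. openin (top_of X) U \<and> openin (top_of X) V \<and>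
      h \<in> tensor_functions (reg X U) (reg X V)}"
  have tp: "top_of (prod_space X X) = topology_generated_by ?B" by (simp add: prod_space_def)
  have pX: "points X = S" unfolding X_def by (rule topspace_zariski[OF A])
  have op: "openin (top_of (prod_space X X)) {z \<in> S \<times> S. h z \<noteq> 0}"
    if h: "h \<in> tensor_functions (polyfun k) (polyfun k)" for h
  proof -
    have "h \<in> tensor_functions (reg X S) (reg X S)"
      using h reg_zariskiI[OF A subset_refl] unfolding tensor_functions_ten X_def by blast
    then show ?thesis unfolding tp using openin_zariski_space[OF A]
      by (intro topology_generated_by_Basis) (auto simp: X_def)
  qed
  obtain one where one: "one \<in> polyfun k" "\<And>x. x \<in> S \<Longrightarrow> one x = 1" using falgD(1)[OF A, of 1] by blast
  obtain mone where mone: "mone \<in> polyfun k" "\<And>x. x \<in> S \<Longrightarrow> mone x = -1" using falgD(1)[OF A, of "-1"] by blast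
  have "openin (top_of (prod_space X X)) (S \<times> S)"
  proof -
    have "{z \<in> S \<times> S. one (fst z) * one (snd z) \<noteq> 0} = S \<times> S" using one by auto
    then show ?thesis using op[OF tensor_functions_single[OF one(1) one(1)]] by simp
  qed
  moreover have "points (prod_space X X) \<subseteq> S \<times> S"
  proof -
    have "\<Union>?B \<subseteq> S \<times> S" using openin_subset pX by fastforce
    then show ?thesis unfolding tp by (simp add: topology_generated_by_topspace)
  qed
  ultimately have pts: "points (prod_space X X) = S \<times> S" using openin_subset by blast
  have "openin (top_of (prod_space X X)) {z \<in> S \<times> S. fst z i \<noteq> snd z i}" if i: "i < k" for i
  proof -
    define c where "c = restrict (\<lambda>x::nat\<Rightarrow>complex. x i) (affine_points k)"
    have c: "c \<in> polyfun k" unfolding c_def using i by (intro generated_algebra.gen) auto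
    obtain d where d: "d \<in> polyfun k" "\<And>x. x \<in> S \<Longrightarrow> d x = mone x * c x" using falgD(3)[OF A mone(1) c] by blast
    have "{z \<in> S \<times> S. c (fst z) * one (snd z) + one (fst z) * d (snd z) \<noteq> 0} = {z \<in> S \<times> S. fst z i \<noteq> snd z i}"
      using one mone d S by (auto simp: c_def)
    then show ?thesis
      using op[OF tensor_functions_add[OF tensor_functions_single[OF c one(1)] tensor_functions_single[OF one(1) d(1)]]]
      by simp
  qed
  then have "openin (top_of (prod_space X X)) (\<Union>i\<in>{..<k}. {z \<in> S \<times> S. fst z i \<noteq> snd z i})"
    by (intro openin_Union) auto
  moreover have "(\<Union>i\<in>{..<k}. {z \<in> S \<times> S. fst z i \<noteq> snd z i}) = S \<times> S - {(x, x) | x. x \<in> S}"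
  proof (intro equalityI subsetI)
    fix z assume z: "z \<in> S \<times> S - {(x, x) | x. x \<in> S}"
    then have ne: "fst z \<noteq> snd z" "fst z \<in> S" "snd z \<in> S" by (auto simp: prod_eq_iff)
    have "\<exists>i<k. fst z i \<noteq> snd z i"
    proof (rule ccontr)
      assume "\<not> ?thesis"
      then have "fst z = snd z" using ne S
        by (intro PiE_ext[of _ "{..<k}" "\<lambda>_. UNIV"]) (auto simp: affine_points_def)
      then show False using ne by simp
    qed
    then show "z \<in> (\<Union>i\<in>{..<k}. {z \<in> S \<times> S. fst z i \<noteq> snd z i})" using z by auto
  qed auto
  ultimately show ?thesis unfolding closedin_def pts pX by auto
qed

text \<open>These spaces are affine, so the whole space alone is an affine cover.\<close>

lemma variety_zariski_emb:
  fixes S :: "'a::affine_coords set"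
  assumes "loc_closed S" shows "variety (zariski_space (emb ` S) (polyfun (cdim TYPE('a))))"
  unfolding variety_def
proof (intro conjI)
  let ?X = "zariski_space (emb ` S) (polyfun (cdim TYPE('a)))"
  show "function_sheaf ?X" by (rule function_sheaf_zariski[OF falg_emb])
  have "isomorphic (subspace ?X (emb ` S)) ?X" by (rule subspace_zariski[OF falg_emb]) simp
  then have "affine_variety (subspace ?X (emb ` S))"
    using affine_variety_iso[OF affine_variety_zar[OF assms]] isomorphic_trans isomorphic_sym zar_emb by blast
  then show "\<exists>\<U>. finite \<U> \<and> \<Union>\<U> = points ?X \<and>
      (\<forall>U\<in>\<U>. openin (top_of ?X) U \<and> affine_variety (subspace ?X U))"
    using openin_zariski_space[OF falg_emb] topspace_zariski[OF falg_emb]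
    by (intro exI[of _ "{emb ` S}"]) auto
  show "closedin (top_of (prod_space ?X ?X)) {(x, x) |x. x \<in> points ?X}"
    by (rule separated_zariski) (auto simp: emb_in)
qed

section \<open>Classes in the Grothendieck ring\<close>

lemma motive_cong:
  assumes "isomorphic X Y" shows "motive X = motive Y"
proof -
  have "isomorphic (space_of V) X \<longleftrightarrow> isomorphic (space_of V) Y" for V
    using isomorphic_trans[OF _ assms] isomorphic_trans[OF _ isomorphic_sym[OF assms]] by blast
  then show ?thesis by (simp add: motive_def)
qed

lemma motive_eqI:
  assumes "isomorphic (space_of V) X" shows "motive X = K0_class V"
proof -
  have "isomorphic (space_of (SOME V. isomorphic (space_of V) X)) X" using assms by (rule someI)
  then show ?thesis unfolding motive_def
    by (intro K0_class_iso isomorphic_trans[OF _ isomorphic_sym[OF assms]])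
qed

definition coord_cvariety :: "'a::affine_coords set \<Rightarrow> cvariety" where
  "coord_cvariety S = Abs_cvariety (zariski_space (emb ` S) (polyfun (cdim TYPE('a))))"

lemma space_of_coord_cvariety:
  fixes S :: "'a::affine_coords set"
  shows "loc_closed S \<Longrightarrow> space_of (coord_cvariety S) = zariski_space (emb ` S) (polyfun (cdim TYPE('a)))"
  unfolding coord_cvariety_def by (intro Abs_cvariety_inverse CollectI variety_zariski_emb)

definition mot :: "'a::affine_coords set \<Rightarrow> K0" where
  "mot S = motive (zar S)"

lemma mot_coord_cvariety: "loc_closed S \<Longrightarrow> mot S = K0_class (coord_cvariety S)"
  unfolding mot_def by (rule motive_eqI) (simp add: space_of_coord_cvariety isomorphic_sym[OF zar_emb])

lemma mot_iso:
  assumes "regmap S \<phi>" "regmap T \<psi>" "\<And>x. x \<in> S \<Longrightarrow> \<phi> x \<in> T" "\<And>y. y \<in> T \<Longrightarrow> \<psi> y \<in> S"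
    and "\<And>x. x \<in> S \<Longrightarrow> \<psi> (\<phi> x) = x" "\<And>y. y \<in> T \<Longrightarrow> \<phi> (\<psi> y) = y"
  shows "mot S = mot T"
  unfolding mot_def by (rule motive_cong[OF zar_isoI[OF assms]])

text \<open>The scissor relation for \<open>f = 0\<close>: writing \<open>f = a / c\<close> on
  \<open>S\<close> exhibits the complement of the zero set as the nonvanishing locus of the
  polynomial \<open>a\<close>, hence as open.\<close>

lemma mot_split:
  fixes S :: "'a::affine_coords set"
  assumes S: "loc_closed S" and f: "regmap S f"
  shows "mot S = mot {x\<in>S. f x = (0::complex)} + mot {x\<in>S. f x \<noteq> 0}"
proof -
  let ?Z = "{x\<in>S. f x = 0}" and ?U = "{x\<in>S. f x \<noteq> 0}" and ?P = "polyfun (cdim TYPE('a))"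
  have Z: "loc_closed ?Z" and U: "loc_closed ?U" by (rule loc_closed_zero[OF S f], rule loc_closed_nonzero[OF S f])
  have img: "emb ` S - emb ` ?Z = emb ` ?U" by (auto dest: injD[OF inj_emb])
  have pts: "points (space_of (coord_cvariety S)) = emb ` S" by (simp add: space_of_coord_cvariety[OF S] topspace_zariski[OF falg_emb])
  have "K0_class (coord_cvariety S) = K0_class (coord_cvariety ?Z) + K0_class (coord_cvariety ?U)"
  proof (rule K0_class_scissor[where S = "emb ` ?Z"])
    show "isomorphic (space_of (coord_cvariety ?Z)) (subspace (space_of (coord_cvariety S)) (emb ` ?Z))"
      unfolding space_of_coord_cvariety[OF S] space_of_coord_cvariety[OF Z]
      by (rule isomorphic_sym[OF subspace_zariski[OF falg_emb]]) auto
    show "isomorphic (space_of (coord_cvariety ?U)) (subspace (space_of (coord_cvariety S)) (points (space_of (coord_cvariety S)) - emb ` ?Z))"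
      unfolding pts img unfolding space_of_coord_cvariety[OF S] space_of_coord_cvariety[OF U]
      by (rule isomorphic_sym[OF subspace_zariski[OF falg_emb]]) auto
    obtain a c where ac: "a \<in> polys" "c \<in> polys" "\<forall>x\<in>S. c x \<noteq> 0 \<and> f x = a x / c x"
      using f unfolding regmap_complex regfun_def by blast
    obtain a' where a': "a' \<in> ?P" "\<forall>x. a' (emb x) = a x" using polys_emb[OF ac(1)] by blast
    have "openin (top_of (zariski_space (emb ` S) ?P)) {y \<in> emb ` S. a' y \<noteq> 0}"
      by (rule openin_zariski_nonzero[OF falg_emb a'(1)])
    moreover have "{y \<in> emb ` S. a' y \<noteq> 0} = emb ` S - emb ` ?Z" unfolding img using a'(2) ac(3) by auto
    ultimately show "closedin (top_of (space_of (coord_cvariety S))) (emb ` ?Z)"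
      unfolding closedin_def pts by (auto simp: space_of_coord_cvariety[OF S])
  qed
  then show ?thesis by (simp only: mot_coord_cvariety S Z U)
qed

lemma mot_Times:
  fixes S :: "'a::affine_coords set" and T :: "'b::affine_coords set"
  assumes S: "loc_closed S" and T: "loc_closed T"
  shows "mot (S \<times> T) = mot S * mot T"
proof -
  let ?P = "polyfun (cdim TYPE('a))" and ?Q = "polyfun (cdim TYPE('b))"
  note ST = loc_closed_Times[OF S T]
  let ?C = "tensor_functions ?P ?Q"
  have C: "falg (emb ` S \<times> emb ` T) ?C" by (rule falg_tensor[OF falg_emb falg_emb])
  \<comment> \<open>A polynomial in two groups of variables is a sum of products of polynomials in
    each group. This matches the coordinates of the product type with the tensors that define
    \<open>prod_space\<close>.\<close>
  have lift: "\<exists>c\<in>?C. \<forall>x y. c (emb x, emb y) = p (x, y)" if "p \<in> polys" for p :: "'a \<times> 'b \<Rightarrow> complex"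
    using that
  proof (induction rule: polys_induct)
    case (const c)
    obtain u where "u \<in> ?C" "\<forall>z\<in>emb ` (UNIV::'a set) \<times> emb ` (UNIV::'b set). u z = c"
      using falgD(1)[OF falg_tensor[OF falg_emb falg_emb]] by blast
    then show ?case by (intro bexI[of _ u]) auto
  next
    case (gen g)
    obtain one where one: "one \<in> ?P" "\<forall>z\<in>emb ` (UNIV::'a set). one z = 1" using falgD(1)[OF falg_emb] by blast
    obtain one' where one': "one' \<in> ?Q" "\<forall>z\<in>emb ` (UNIV::'b set). one' z = 1" using falgD(1)[OF falg_emb] by blast
    consider h where "h \<in> set coords" "g = (\<lambda>x. h (fst x))" | h where "h \<in> set coords" "g = (\<lambda>x. h (snd x))"
      using gen by (auto simp: coords_prod_def)
    then show ?case
    proof cases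
      case 1
      obtain h' where h': "h' \<in> ?P" "\<forall>x. h' (emb x) = h x" using polys_emb[OF polys_intros(2)[OF 1(1)]] by blast
      show ?thesis by (rule bexI[OF _ tensor_functions_single[OF h'(1) one'(1)]]) (use 1 h' one' in auto)
    next
      case 2
      obtain h' where h': "h' \<in> ?Q" "\<forall>x. h' (emb x) = h x" using polys_emb[OF polys_intros(2)[OF 2(1)]] by blast
      show ?thesis by (rule bexI[OF _ tensor_functions_single[OF one(1) h'(1)]]) (use 2 h' one in auto)
    qed
  next
    case (add f g)
    then obtain a b where ab: "a \<in> ?C" "b \<in> ?C" "\<forall>x y. a (emb x, emb y) = f (x, y)" "\<forall>x y. b (emb x, emb y) = g (x, y)" by blast
    show ?case by (rule bexI[OF _ tensor_functions_add[OF ab(1,2)]]) (use ab in auto)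
  next
    case (mult f g)
    then obtain a b where ab: "a \<in> ?C" "b \<in> ?C" "\<forall>x y. a (emb x, emb y) = f (x, y)" "\<forall>x y. b (emb x, emb y) = g (x, y)" by blast
    obtain c where c: "c \<in> ?C" "\<forall>z\<in>emb ` (UNIV::'a set) \<times> emb ` (UNIV::'b set). c z = a z * b z"
      using falgD(3)[OF falg_tensor[OF falg_emb falg_emb] ab(1,2)] by blast
    show ?case by (rule bexI[OF _ c(1)]) (use ab c in auto)
  qed
  have "isomorphic (zar (S \<times> T)) (zariski_space (emb ` S \<times> emb ` T) ?C)" unfolding zar_def
  proof (rule isomorphic_zariski_algI[OF falg_polys C,
        where \<phi> = "\<lambda>z. (emb (fst z), emb (snd z))" and \<psi> = "\<lambda>z. (unemb (fst z), unemb (snd z))"])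
    show "\<exists>b\<in>?C. \<forall>z\<in>emb ` S \<times> emb ` T. a (unemb (fst z), unemb (snd z)) = b z" if a: "a \<in> polys" for a :: "'a \<times> 'b \<Rightarrow> complex"
    proof -
      obtain c where "c \<in> ?C" "\<forall>x y. c (emb x, emb y) = a (x, y)" using lift[OF a] by blast
      then show ?thesis by (intro bexI[of _ c]) auto
    qed
    show "\<exists>a\<in>polys. \<forall>x\<in>S \<times> T. b (emb (fst x), emb (snd x)) = a x" if b: "b \<in> ?C" for b
    proof -
      obtain k f g where fg: "\<forall>i<k::nat. f i \<in> ?P \<and> g i \<in> ?Q" "b = (\<lambda>z. \<Sum>i<k. f i (fst z) * g i (snd z))"
        using b unfolding tensor_functions_ten by blast
      have "(\<lambda>x::'a\<times>'b. \<Sum>i<k. f i (emb (fst x)) * g i (emb (snd x))) \<in> polys"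
        using fg by (intro polys_sum polys_intros(4) polys_fst[OF polyfun_emb] polys_snd[OF polyfun_emb]) auto
      then show ?thesis by (rule rev_bexI) (simp add: fg)
    qed
  qed auto
  also have "isomorphic (zariski_space (emb ` S \<times> emb ` T) ?C) (prod_space (space_of (coord_cvariety S)) (space_of (coord_cvariety T)))"
    unfolding space_of_coord_cvariety[OF S] space_of_coord_cvariety[OF T]
    by (rule isomorphic_sym[OF prod_zariski[OF falg_emb falg_emb]])
  finally (isomorphic_trans) have "isomorphic (space_of (coord_cvariety (S \<times> T))) (prod_space (space_of (coord_cvariety S)) (space_of (coord_cvariety T)))"
    unfolding space_of_coord_cvariety[OF ST] by (rule isomorphic_trans[OF isomorphic_sym[OF zar_emb]])
  from K0_class_product[OF this] show ?thesis by (simp only: mot_coord_cvariety S T ST)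
qed

lemma motive_affine_line: "motive (affine_space 1) = mot (UNIV :: complex set)"
proof -
  have c: "cdim TYPE(complex) = 1" by (simp add: coords_complex_def)
  have "emb ` (UNIV :: complex set) = affine_points 1"
  proof (intro equalityI subsetI)
    fix y :: "nat \<Rightarrow> complex" assume "y \<in> affine_points 1"
    then have "emb (unemb y :: complex) = y" using emb_unemb[where 'a = complex] c by metis
    then show "y \<in> emb ` (UNIV :: complex set)" by (metis rangeI)
  qed (use emb_in[where 'a = complex] c in auto)
  then have "isomorphic (zar (UNIV :: complex set)) (affine_space 1)"
    using zar_emb[of "UNIV :: complex set"] unfolding c affine_space_def by simp
  then show ?thesis unfolding mot_def by (rule motive_cong[OF isomorphic_sym])
qed

lemma mot_singleton: "mot {a :: complex} = 1"
proof -
  have "{x. x - a = 0} = {a}" by auto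
  moreover have "regmap UNIV (\<lambda>x. x - a)" by (intro regmap_intros)
  ultimately have l: "loc_closed {a}" using loc_closed_zero[OF loc_closed_UNIV, of "\<lambda>x. x - a"] by simp
  have 0: "falg (affine_points 0) (polyfun 0)" by (rule falg_polyfun)
  have "isomorphic (zar {a}) (affine_space 0)" unfolding zar_def affine_space_def
  \<comment> \<open>The only extensional function on the empty index set is constantly
    \<open>undefined\<close>; it is the point of \<open>affine_space 0\<close>.\<close>
  proof (rule isomorphic_zariski_algI[OF falg_polys 0, where \<phi> = "\<lambda>_. \<lambda>_. undefined" and \<psi> = "\<lambda>_. a"])
    show "\<exists>f\<in>polys. \<forall>x\<in>{a}. b (\<lambda>_. undefined) = f x" for b :: "(nat \<Rightarrow> complex) \<Rightarrow> complex"
      by (rule bexI[OF _ polys_intros(1)]) simp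
    show "\<exists>b\<in>polyfun 0. \<forall>x\<in>affine_points 0. f a = b x" for f :: "complex \<Rightarrow> complex"
      using falgD(1)[OF 0, of "f a"] by metis
  qed (auto simp: affine_points_def)
  then have "isomorphic (space_of (coord_cvariety {a})) (affine_space 0)"
    unfolding space_of_coord_cvariety[OF l] by (rule isomorphic_trans[OF isomorphic_sym[OF zar_emb]])
  then show ?thesis using K0_class_point by (simp add: mot_coord_cvariety[OF l])
qed

section \<open>Motives of the strata\<close>

text \<open>Shaped for \<open>intro\<close>: the conditions that define a stratum are peeled off one
  conjunct at a time.\<close>

lemma loc_closed_Collect:
  "regmap UNIV f \<Longrightarrow> loc_closed {v. P v} \<Longrightarrow> loc_closed {v. f v \<noteq> (0::complex) \<and> P v}"
  "regmap UNIV f \<Longrightarrow> loc_closed {v. P v} \<Longrightarrow> loc_closed {v. f v = (0::complex) \<and> P v}"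
  "regmap UNIV f \<Longrightarrow> loc_closed {v. f v \<noteq> (0::complex)}"
  "regmap UNIV f \<Longrightarrow> loc_closed {v. f v = (0::complex)}"
proof -
  have mono: "regmap S f" if "regmap UNIV f" for S and f :: "'a \<Rightarrow> complex"
    using that unfolding regmap_complex regfun_def by blast
  show "loc_closed {v. f v \<noteq> (0::complex) \<and> P v}" if "regmap UNIV f" "loc_closed {v. P v}"
    using loc_closed_nonzero[OF that(2) mono[OF that(1)]] by (simp add: conj_commute)
  show "loc_closed {v. f v = (0::complex) \<and> P v}" if "regmap UNIV f" "loc_closed {v. P v}"
    using loc_closed_zero[OF that(2) mono[OF that(1)]] by (simp add: conj_commute)
  show "loc_closed {v. f v \<noteq> (0::complex)}" if "regmap UNIV f"
    using loc_closed_nonzero[OF loc_closed_UNIV that] by simp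
  show "loc_closed {v. f v = (0::complex)}" if "regmap UNIV f"
    using loc_closed_zero[OF loc_closed_UNIV that] by simp
qed

lemma mot_splitI:
  assumes "loc_closed S" "regmap S f" "A = {x\<in>S. f x = (0::complex)}" "B = {x\<in>S. f x \<noteq> 0}"
  shows "mot S = mot A + mot B"
  unfolding assms(3,4) by (rule mot_split[OF assms(1,2)])

abbreviation punctured_line :: "complex set" where "punctured_line \<equiv> {x. x \<noteq> 0}"
abbreviation affine_line :: "complex set" where "affine_line \<equiv> UNIV"
abbreviation \<L> :: K0 where "\<L> \<equiv> mot affine_line"
abbreviation \<T> :: K0 where "\<T> \<equiv> \<L> - 1"

lemma loc_closed_punctured_line: "loc_closed punctured_line"
  by (intro loc_closed_Collect regmap_intros)

lemma mot_punctured_line: "mot punctured_line = \<T>"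
proof -
  have "\<L> = mot {0::complex} + mot punctured_line"
    by (rule mot_splitI[OF loc_closed_UNIV regmap_id]) auto
  then show ?thesis by (simp add: mot_singleton)
qed

lemmas lc_simps = loc_closed_UNIV loc_closed_punctured_line loc_closed_Times

text \<open>The shear by \<open>y^2\<close> straightens the parabola, and its complement becomes a
  product.\<close>

lemma mot_off_parabola: "mot {(y::complex, E::complex). E - y^2 \<noteq> 0} = \<L> * \<T>"
proof -
  have "mot {(y::complex, E::complex). E - y^2 \<noteq> 0} = mot (affine_line \<times> punctured_line)"
    by (rule mot_iso[where \<phi> = "\<lambda>(y::complex, E::complex). (y, E - y^2)" and \<psi> = "\<lambda>(y::complex, E::complex). (y, E + y^2)"])
      (auto simp only: case_prod_unfold intro!: regmap_intros, auto)
  then show ?thesis by (simp only: mot_Times lc_simps mot_punctured_line)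
qed

text \<open>The part removed from a line times a punctured line is a parabola without its vertex,
  that is, a punctured line.\<close>

lemma mot_parabola_base: "mot {(x::complex, D::complex). D \<noteq> 0 \<and> D - x^2 \<noteq> 0} = \<T> * \<T>"
proof -
  have "mot (affine_line \<times> punctured_line) = mot {(x::complex, D::complex). D \<noteq> 0 \<and> D - x^2 = 0} + mot {(x::complex, D::complex). D \<noteq> 0 \<and> D - x^2 \<noteq> 0}"
    by (rule mot_splitI[where f = "\<lambda>(x::complex, D::complex). D - x^2"])
      (simp_all only: case_prod_unfold, auto intro!: regmap_intros simp: lc_simps)
  moreover have "mot {(x::complex, D::complex). D \<noteq> 0 \<and> D - x^2 = 0} = mot punctured_line"
    by (rule mot_iso[where \<phi> = fst and \<psi> = "\<lambda>x. (x, x^2)"]) (auto intro!: regmap_intros)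
  ultimately have "\<L> * \<T> = \<T> + mot {(x::complex, D::complex). D \<noteq> 0 \<and> D - x^2 \<noteq> 0}"
    by (simp only: mot_Times lc_simps mot_punctured_line)
  then show ?thesis by (simp add: algebra_simps)
qed

text \<open>Where \<open>v \<noteq> 0\<close> the lines \<open>v = x\<close> and
  \<open>v = - x\<close> do not meet, and each removes a punctured line.\<close>

lemma mot_off_lines: "mot {(x::complex, v::complex). v \<noteq> 0 \<and> v^2 - x^2 \<noteq> 0} = \<L> * \<T> - \<T> - \<T>"
proof -
  have "mot (affine_line \<times> punctured_line) = mot {(x::complex, v::complex). v \<noteq> 0 \<and> v^2 - x^2 = 0} + mot {(x::complex, v::complex). v \<noteq> 0 \<and> v^2 - x^2 \<noteq> 0}"
    by (rule mot_splitI[where f = "\<lambda>(x::complex, v::complex). v^2 - x^2"])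
      (simp_all only: case_prod_unfold, auto intro!: regmap_intros simp: lc_simps)
  moreover have "mot {(x::complex, v::complex). v \<noteq> 0 \<and> v^2 - x^2 = 0} =
      mot {(x::complex, v::complex). v \<noteq> 0 \<and> v - x = 0} + mot {(x::complex, v::complex). v \<noteq> 0 \<and> v + x = 0}"
  proof (rule mot_splitI[where f = "\<lambda>(x::complex, v::complex). v - x"])
    show "loc_closed {(x::complex, v::complex). v \<noteq> 0 \<and> v^2 - x^2 = 0}"
      by (simp only: case_prod_unfold, intro loc_closed_Collect regmap_intros)
    show "regmap {(x::complex, v::complex). v \<noteq> 0 \<and> v^2 - x^2 = 0} (\<lambda>(x::complex, v::complex). v - x)"
      by (simp only: case_prod_unfold, intro regmap_intros)
    have sq: "v^2 - x^2 = (v - x) * (v + x)" for v x :: complex by (simp add: power2_eq_square algebra_simps)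
    show "{(x::complex, v::complex). v \<noteq> 0 \<and> v - x = 0} =
      {z \<in> {(x::complex, v::complex). v \<noteq> 0 \<and> v^2 - x^2 = 0}. (case z of (x, v) \<Rightarrow> v - x) = 0}" by auto
    show "{(x::complex, v::complex). v \<noteq> 0 \<and> v + x = 0} =
      {z \<in> {(x::complex, v::complex). v \<noteq> 0 \<and> v^2 - x^2 = 0}. (case z of (x, v) \<Rightarrow> v - x) \<noteq> 0}"
      unfolding sq by (auto simp: add_eq_0_iff)
  qed
  moreover have "mot {(x::complex, v::complex). v \<noteq> 0 \<and> v - x = 0} = mot punctured_line"
    by (rule mot_iso[where \<phi> = snd and \<psi> = "\<lambda>v. (v, v)"]) (auto intro!: regmap_intros)
  moreover have "mot {(x::complex, v::complex). v \<noteq> 0 \<and> v + x = 0} = mot punctured_line"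
    by (rule mot_iso[where \<phi> = snd and \<psi> = "\<lambda>v. (-v, v)"]) (auto intro!: regmap_intros simp: add_eq_0_iff)
  ultimately have "\<L> * \<T> = \<T> + \<T> + mot {(x::complex, v::complex). v \<noteq> 0 \<and> v^2 - x^2 \<noteq> 0}"
    by (simp only: mot_Times lc_simps mot_punctured_line)
  then show ?thesis by (simp add: algebra_simps)
qed

text \<open>On the complementary locus \<open>y^2 = D * w^2\<close>, either
  \<open>w = y = 0\<close>, or \<open>y / w\<close> is a square root of \<open>D\<close> and can
  replace \<open>D\<close> as a coordinate. No root has to be extracted: the equation itself
  provides it.\<close>

lemma mot_quadric_cone:
  "mot {(x::complex, D::complex, y::complex, w::complex). D \<noteq> 0 \<and> D - x^2 \<noteq> 0 \<and> y^2 - D * w^2 \<noteq> 0} = \<T> * \<T> * (\<L> * \<L> - \<L> + 1)"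
proof -
  let ?B = "{(x::complex, D::complex). D \<noteq> 0 \<and> D - x^2 \<noteq> 0}"
  let ?T = "{(x::complex, D::complex, y::complex, w::complex). D \<noteq> 0 \<and> D - x^2 \<noteq> 0}"
  let ?V = "{(x::complex, D::complex, y::complex, w::complex). y^2 - D * w^2 = 0 \<and> D \<noteq> 0 \<and> D - x^2 \<noteq> 0}"
  let ?T1 = "{(x::complex, D::complex, y::complex, w::complex). D \<noteq> 0 \<and> D - x^2 \<noteq> 0 \<and> y^2 - D * w^2 \<noteq> 0}"
  have lcT: "loc_closed ?T" by (simp only: case_prod_unfold, intro loc_closed_Collect regmap_intros)
  have lcB: "loc_closed ?B" by (simp only: case_prod_unfold, intro loc_closed_Collect regmap_intros)
  have lcV: "loc_closed ?V" by (simp only: case_prod_unfold, intro loc_closed_Collect regmap_intros)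
  have 1: "mot ?T = mot ?V + mot ?T1"
    by (rule mot_splitI[OF lcT, where f = "\<lambda>(x::complex, D::complex, y::complex, w::complex). y^2 - D * w^2"])
      (simp_all only: case_prod_unfold, auto intro!: regmap_intros)
  have "mot ?T = mot (?B \<times> (affine_line \<times> affine_line))"
    by (rule mot_iso[where \<phi> = "\<lambda>(x::complex, D::complex, y::complex, w::complex). ((x, D), (y, w))" and \<psi> = "\<lambda>((x::complex, D::complex), (y::complex, w::complex)). (x, D, y, w)"])
      (auto simp only: case_prod_unfold intro!: regmap_intros, auto)
  then have 2: "mot ?T = \<T> * \<T> * (\<L> * \<L>)" by (simp only: mot_Times lc_simps lcB mot_parabola_base)
  have 3: "mot ?V = mot {(x::complex, D::complex, y::complex, w::complex). w = 0 \<and> y = 0 \<and> D \<noteq> 0 \<and> D - x^2 \<noteq> 0} +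
      mot {(x::complex, D::complex, y::complex, w::complex). w \<noteq> 0 \<and> y^2 - D * w^2 = 0 \<and> D \<noteq> 0 \<and> D - x^2 \<noteq> 0}"
    by (rule mot_splitI[OF lcV, where f = "\<lambda>(x::complex, D::complex, y::complex, w::complex). w"])
      (simp_all only: case_prod_unfold, auto intro!: regmap_intros)
  have "mot {(x::complex, D::complex, y::complex, w::complex). w = 0 \<and> y = 0 \<and> D \<noteq> 0 \<and> D - x^2 \<noteq> 0} = mot ?B"
    by (rule mot_iso[where \<phi> = "\<lambda>(x::complex, D::complex, y::complex, w::complex). (x, D)" and \<psi> = "\<lambda>(x::complex, D::complex). (x, D, 0::complex, 0::complex)"])
      (auto simp only: case_prod_unfold intro!: regmap_intros, auto)
  then have 4: "mot {(x::complex, D::complex, y::complex, w::complex). w = 0 \<and> y = 0 \<and> D \<noteq> 0 \<and> D - x^2 \<noteq> 0} = \<T> * \<T>"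
    by (simp only: mot_parabola_base)
  let ?L = "{(x::complex, v::complex). v \<noteq> 0 \<and> v^2 - x^2 \<noteq> 0}"
  have lcL: "loc_closed ?L" by (simp only: case_prod_unfold, intro loc_closed_Collect regmap_intros)
  have "mot {(x::complex, D::complex, y::complex, w::complex). w \<noteq> 0 \<and> y^2 - D * w^2 = 0 \<and> D \<noteq> 0 \<and> D - x^2 \<noteq> 0} = mot (punctured_line \<times> ?L)"
  proof (rule mot_iso[where \<phi> = "\<lambda>(x::complex, D::complex, y::complex, w::complex). (w, (x, y / w))" and \<psi> = "\<lambda>(w::complex, (x::complex, v::complex)). (x, v^2, v * w, w)"])
    show "regmap {(x::complex, D::complex, y::complex, w::complex). w \<noteq> 0 \<and> y^2 - D * w^2 = 0 \<and> D \<noteq> 0 \<and> D - x^2 \<noteq> 0} (\<lambda>(x::complex, D::complex, y::complex, w::complex). (w, (x, y / w)))"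
      by (simp only: case_prod_unfold, intro regmap_intros) auto
    show "regmap (punctured_line \<times> ?L) (\<lambda>(w::complex, (x::complex, v::complex)). (x, v^2, v * w, w))"
      by (simp only: case_prod_unfold, intro regmap_intros)
  qed (auto simp: power_divide power_mult_distrib)
  then have 5: "mot {(x::complex, D::complex, y::complex, w::complex). w \<noteq> 0 \<and> y^2 - D * w^2 = 0 \<and> D \<noteq> 0 \<and> D - x^2 \<noteq> 0} = \<T> * (\<L> * \<T> - \<T> - \<T>)"
    by (simp only: mot_Times lc_simps lcL mot_off_lines mot_punctured_line)
  have "mot ?T1 = mot ?T - mot ?V" using 1 by simp
  then show ?thesis unfolding 2 3 4 5 by (simp add: algebra_simps)
qed

text \<open>
  For \<open>2 \<times> 2\<close> matrices with \<open>x = tr A\<close>, \<open>d = det A\<close>, \<open>y = tr B\<close>, \<open>e = det B\<close>, \<open>z = tr (A * B)\<close> this is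
  \<open>d * e * (tr [A, B] - 2)\<close>; it vanishes iff \<open>A\<close> and \<open>B\<close> have a common eigenvector.
\<close>

definition reducible_discr :: "complex \<Rightarrow> complex \<Rightarrow> complex \<Rightarrow> complex \<Rightarrow> complex \<Rightarrow> complex" where
  "reducible_discr x d y e z = x^2 * e + y^2 * d + z^2 - x * y * z - 4 * d * e"

text \<open>Completing the square: \<open>x^2 - 4 * d\<close> and \<open>y^2 - 4 * e\<close> are the
  discriminants of the characteristic polynomials, and \<open>2 * z - x * y\<close> is twice the
  trace of the product of the traceless parts of \<open>A\<close> and \<open>B\<close>.\<close>

lemma reducible_discr_discriminants: "4 * reducible_discr x d y e z = (2 * z - x * y)^2 - (x^2 - 4 * d) * (y^2 - 4 * e)"
  by (simp add: reducible_discr_def power2_eq_square algebra_simps)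

text \<open>In terms of the discriminants the locus is the quadric \<open>w^2 = D * E\<close>, with
  \<open>D \<noteq> x^2\<close> and \<open>E \<noteq> y^2\<close> because
  \<open>4 * d = x^2 - D\<close> and \<open>4 * e = y^2 - E\<close> are nonzero. For
  \<open>D = 0\<close> the coordinate \<open>E\<close> is free; otherwise it is determined by the
  rest.\<close>

lemma mot_reducible:
  "mot {(x::complex, d::complex, y::complex, e::complex, z::complex). d \<noteq> 0 \<and> e \<noteq> 0 \<and> reducible_discr x d y e z = 0} = \<T> * \<T> * (\<L> * \<L> + 1)"
proof -
  let ?K = "{(x::complex, y::complex, D::complex, E::complex, w::complex). w^2 - D * E = 0 \<and> D - x^2 \<noteq> 0 \<and> E - y^2 \<noteq> 0}"
  have lcK: "loc_closed ?K" by (simp only: case_prod_unfold, intro loc_closed_Collect regmap_intros)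
  have 0: "mot {(x::complex, d::complex, y::complex, e::complex, z::complex). d \<noteq> 0 \<and> e \<noteq> 0 \<and> reducible_discr x d y e z = 0} = mot ?K"
  proof (rule mot_iso[where \<phi> = "\<lambda>(x::complex, d::complex, y::complex, e::complex, z::complex). (x, y, x^2 - 4 * d, y^2 - 4 * e, 2 * z - x * y)" and
        \<psi> = "\<lambda>(x::complex, y::complex, D::complex, E::complex, w::complex). (x, (x^2 - D) / 4, y, (y^2 - E) / 4, (w + x * y) / 2)"])
    show "regmap {(x::complex, d::complex, y::complex, e::complex, z::complex). d \<noteq> 0 \<and> e \<noteq> 0 \<and> reducible_discr x d y e z = 0}
        (\<lambda>(x::complex, d::complex, y::complex, e::complex, z::complex). (x, y, x^2 - 4 * d, y^2 - 4 * e, 2 * z - x * y))"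
      by (simp only: case_prod_unfold, intro regmap_intros)
    show "regmap ?K (\<lambda>(x::complex, y::complex, D::complex, E::complex, w::complex). (x, (x^2 - D) / 4, y, (y^2 - E) / 4, (w + x * y) / 2))"
      by (simp only: case_prod_unfold, intro regmap_intros) auto
    have "4 * reducible_discr x ((x^2 - D) / 4) y ((y^2 - E) / 4) ((w + x * y) / 2) = w^2 - D * E" for x y D E w
    proof -
      have "2 * ((w + x * y) / 2) - x * y = w" "x^2 - 4 * ((x^2 - D) / 4) = D" "y^2 - 4 * ((y^2 - E) / 4) = E"
        by (simp_all add: field_simps)
      then show ?thesis unfolding reducible_discr_discriminants by simp
    qed
    then have "reducible_discr x ((x^2 - D) / 4) y ((y^2 - E) / 4) ((w + x * y) / 2) = 0 \<longleftrightarrow> w^2 - D * E = 0" for x y D E w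
      by (metis mult_eq_0_iff zero_neq_numeral)
    then show "(case v of (x, y, D, E, w) \<Rightarrow> (x, (x^2 - D) / 4, y, (y^2 - E) / 4, (w + x * y) / 2))
        \<in> {(x::complex, d::complex, y::complex, e::complex, z::complex). d \<noteq> 0 \<and> e \<noteq> 0 \<and> reducible_discr x d y e z = 0}" if "v \<in> ?K" for v
      using that by auto
    show "(case v of (x, d, y, e, z) \<Rightarrow> (x, y, x^2 - 4 * d, y^2 - 4 * e, 2 * z - x * y)) \<in> ?K"
      if "v \<in> {(x::complex, d::complex, y::complex, e::complex, z::complex). d \<noteq> 0 \<and> e \<noteq> 0 \<and> reducible_discr x d y e z = 0}" for v
    proof -
      obtain x d y e z where v: "v = (x, d, y, e, z)" by (cases v)
      then have "(2 * z - x * y)^2 - (x^2 - 4 * d) * (y^2 - 4 * e) = 0"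
        using that by (simp flip: reducible_discr_discriminants)
      then show ?thesis using that v by simp
    qed
  qed (auto simp: diff_divide_distrib add_divide_distrib)
  have 1: "mot ?K = mot {(x::complex, y::complex, D::complex, E::complex, w::complex). D = 0 \<and> w = 0 \<and> x \<noteq> 0 \<and> E - y^2 \<noteq> 0}
     + mot {(x::complex, y::complex, D::complex, E::complex, w::complex). D \<noteq> 0 \<and> w^2 - D * E = 0 \<and> D - x^2 \<noteq> 0 \<and> E - y^2 \<noteq> 0}"
    by (rule mot_splitI[OF lcK, where f = "\<lambda>(x::complex, y::complex, D::complex, E::complex, w::complex). D"])
      (simp_all only: case_prod_unfold, auto intro!: regmap_intros)
  let ?P = "{(y::complex, E::complex). E - y^2 \<noteq> 0}"
  have lcP: "loc_closed ?P" by (simp only: case_prod_unfold, intro loc_closed_Collect regmap_intros)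
  have "mot {(x::complex, y::complex, D::complex, E::complex, w::complex). D = 0 \<and> w = 0 \<and> x \<noteq> 0 \<and> E - y^2 \<noteq> 0} = mot (punctured_line \<times> ?P)"
    by (rule mot_iso[where \<phi> = "\<lambda>(x::complex, y::complex, D::complex, E::complex, w::complex). (x, (y, E))" and \<psi> = "\<lambda>(x::complex, (y::complex, E::complex)). (x, y, 0::complex, E, 0::complex)"])
      (auto simp only: case_prod_unfold intro!: regmap_intros, auto)
  then have 2: "mot {(x::complex, y::complex, D::complex, E::complex, w::complex). D = 0 \<and> w = 0 \<and> x \<noteq> 0 \<and> E - y^2 \<noteq> 0} = \<T> * (\<L> * \<T>)"
    by (simp only: mot_Times lc_simps lcP mot_off_parabola mot_punctured_line)
  \<comment> \<open>For \<open>D \<noteq> 0\<close> put \<open>w = D * v\<close>, with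
    \<open>v\<close> again called \<open>w\<close> on the right. Then \<open>E = D * v^2\<close>,
    and the condition on \<open>E\<close> describes the complement of a quadratic cone.\<close>
  have 3: "mot {(x::complex, y::complex, D::complex, E::complex, w::complex). D \<noteq> 0 \<and> w^2 - D * E = 0 \<and> D - x^2 \<noteq> 0 \<and> E - y^2 \<noteq> 0} =
     mot {(x::complex, D::complex, y::complex, w::complex). D \<noteq> 0 \<and> D - x^2 \<noteq> 0 \<and> y^2 - D * w^2 \<noteq> 0}"
  proof (rule mot_iso[where \<phi> = "\<lambda>(x::complex, y::complex, D::complex, E::complex, w::complex). (x, D, y, w / D)" and \<psi> = "\<lambda>(x::complex, D::complex, y::complex, w::complex). (x, y, D, D * w^2, D * w)"])
    show "regmap {(x::complex, y::complex, D::complex, E::complex, w::complex). D \<noteq> 0 \<and> w^2 - D * E = 0 \<and> D - x^2 \<noteq> 0 \<and> E - y^2 \<noteq> 0}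
        (\<lambda>(x::complex, y::complex, D::complex, E::complex, w::complex). (x, D, y, w / D))"
      by (simp only: case_prod_unfold, intro regmap_intros) auto
    show "regmap {(x::complex, D::complex, y::complex, w::complex). D \<noteq> 0 \<and> D - x^2 \<noteq> 0 \<and> y^2 - D * w^2 \<noteq> 0}
       (\<lambda>(x::complex, D::complex, y::complex, w::complex). (x, y, D, D * w^2, D * w))"
      by (simp only: case_prod_unfold, intro regmap_intros)
  qed (auto simp: power2_eq_square field_simps)
  show ?thesis unfolding 0 1 2 3 mot_quadric_cone by (simp add: algebra_simps)
qed

text \<open>The surface \<open>E = w^2\<close> is subtracted. On it the other condition reads
  \<open>w^2 \<noteq> y^2\<close>, which describes the plane without two lines that share only the
  origin.\<close>

lemma mot_two_parabolas: "mot {(y::complex, E::complex, w::complex). E - y^2 \<noteq> 0 \<and> E - w^2 \<noteq> 0} = \<T> * (\<L> * \<L> - \<L> + 1)"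
proof -
  let ?P = "{(y::complex, E::complex, w::complex). E - y^2 \<noteq> 0}"
  let ?W = "{(y::complex, E::complex). E - y^2 \<noteq> 0}"
  have lcP: "loc_closed ?P" by (simp only: case_prod_unfold, intro loc_closed_Collect regmap_intros)
  have lcW: "loc_closed ?W" by (simp only: case_prod_unfold, intro loc_closed_Collect regmap_intros)
  have 1: "mot ?P = mot {(y::complex, E::complex, w::complex). E - y^2 \<noteq> 0 \<and> E - w^2 = 0} + mot {(y::complex, E::complex, w::complex). E - y^2 \<noteq> 0 \<and> E - w^2 \<noteq> 0}"
    by (rule mot_splitI[OF lcP, where f = "\<lambda>(y::complex, E::complex, w::complex). E - w^2"])
      (simp_all only: case_prod_unfold, auto intro!: regmap_intros)
  have "mot ?P = mot (?W \<times> affine_line)"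
    by (rule mot_iso[where \<phi> = "\<lambda>(y::complex, E::complex, w::complex). ((y, E), w)" and \<psi> = "\<lambda>((y::complex, E::complex), w::complex). (y, E, w)"])
      (auto simp only: case_prod_unfold intro!: regmap_intros, auto)
  then have 2: "mot ?P = \<L> * \<T> * \<L>" by (simp only: mot_Times lc_simps lcW mot_off_parabola)
  have 3: "mot {(y::complex, E::complex, w::complex). E - y^2 \<noteq> 0 \<and> E - w^2 = 0} = mot {(y::complex, w::complex). w^2 - y^2 \<noteq> 0}"
    by (rule mot_iso[where \<phi> = "\<lambda>(y::complex, E::complex, w::complex). (y, w)" and \<psi> = "\<lambda>(y::complex, w::complex). (y, w^2, w)"])
      (auto simp only: case_prod_unfold intro!: regmap_intros, auto)
  have lc: "loc_closed {(y::complex, w::complex). w^2 - y^2 = 0}"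
    by (simp only: case_prod_unfold, intro loc_closed_Collect regmap_intros)
  have "mot (UNIV :: (complex \<times> complex) set) = mot {(y::complex, w::complex). w^2 - y^2 = 0} + mot {(y::complex, w::complex). w^2 - y^2 \<noteq> 0}"
    by (rule mot_splitI[where f = "\<lambda>(y::complex, w::complex). w^2 - y^2"])
      (simp_all only: case_prod_unfold, auto intro!: regmap_intros simp: lc_simps)
  moreover have "mot (UNIV :: (complex \<times> complex) set) = \<L> * \<L>"
    using mot_Times[OF loc_closed_UNIV loc_closed_UNIV, where 'a = complex and 'b = complex] by (simp add: UNIV_Times_UNIV)
  moreover have "mot {(y::complex, w::complex). w^2 - y^2 = 0} = mot {(y::complex, w::complex). w - y = 0} + mot {(y::complex, w::complex). w \<noteq> 0 \<and> w + y = 0}"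
  proof (rule mot_splitI[OF lc, where f = "\<lambda>(y::complex, w::complex). w - y"])
    show "regmap {(y::complex, w::complex). w^2 - y^2 = 0} (\<lambda>(y::complex, w::complex). w - y)"
      by (simp only: case_prod_unfold, intro regmap_intros)
    have sq: "v^2 - x^2 = (v - x) * (v + x)" for v x :: complex by (simp add: power2_eq_square algebra_simps)
    show "{(y::complex, w::complex). w - y = 0} = {z \<in> {(y::complex, w::complex). w^2 - y^2 = 0}. (case z of (y, w) \<Rightarrow> w - y) = 0}" by auto
    show "{(y::complex, w::complex). w \<noteq> 0 \<and> w + y = 0} = {z \<in> {(y::complex, w::complex). w^2 - y^2 = 0}. (case z of (y, w) \<Rightarrow> w - y) \<noteq> 0}"
      unfolding sq by (auto simp: add_eq_0_iff)
  qed
  moreover have "mot {(y::complex, w::complex). w - y = 0} = \<L>"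
    by (rule mot_iso[where \<phi> = snd and \<psi> = "\<lambda>v. (v, v)"]) (auto intro!: regmap_intros)
  moreover have "mot {(y::complex, w::complex). w \<noteq> 0 \<and> w + y = 0} = mot punctured_line"
    by (rule mot_iso[where \<phi> = snd and \<psi> = "\<lambda>v. (-v, v)"]) (auto intro!: regmap_intros simp: add_eq_0_iff)
  ultimately have 4: "mot {(y::complex, w::complex). w^2 - y^2 \<noteq> 0} = \<L> * \<L> - \<L> - \<T>" by (simp add: mot_punctured_line algebra_simps)
  have "mot {(y::complex, E::complex, w::complex). E - y^2 \<noteq> 0 \<and> E - w^2 \<noteq> 0} = mot ?P - mot {(y::complex, E::complex, w::complex). E - y^2 \<noteq> 0 \<and> E - w^2 = 0}"
    using 1 by simp
  then show ?thesis unfolding 2 3 4 by (simp add: algebra_simps)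
qed

definition irr_stratum :: "complex \<Rightarrow> (complex \<times> complex \<times> complex \<times> complex \<times> complex) set" where
  "irr_stratum c = {(x::complex, d::complex, y::complex, e::complex, z::complex). d \<noteq> 0 \<and> e \<noteq> 0 \<and> reducible_discr x d y e z \<noteq> 0 \<and> x^2 - c * d = 0}"

text \<open>Since \<open>c \<noteq> 0\<close>, on the stratum \<open>x \<noteq> 0\<close> and
  \<open>d = x^2 / c\<close>, so the discriminant of \<open>A\<close> is the square
  \<open>(x * s)^2\<close> with a constant \<open>s\<close>, nonzero because
  \<open>c \<noteq> 4\<close>. Dividing \<open>2 * z - x * y\<close> by \<open>x * s\<close> turns
  irreducibility into \<open>E \<noteq> w^2\<close>, independently of \<open>x\<close>.\<close>

lemma mot_irr_stratum:
  assumes "c \<noteq> 0" "c \<noteq> 4" shows "mot (irr_stratum c) = \<T> * \<T> * (\<L> * \<L> - \<L> + 1)"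
proof -
  define s where "s = csqrt (1 - 4 / c)"
  have s2: "s^2 = 1 - 4 / c" by (simp add: s_def)
  have s0: "s \<noteq> 0" using assms s2 by auto
  let ?P = "{(y::complex, E::complex, w::complex). E - y^2 \<noteq> 0 \<and> E - w^2 \<noteq> 0}"
  have lcP: "loc_closed ?P" by (simp only: case_prod_unfold, intro loc_closed_Collect regmap_intros)
  have x0: "x \<noteq> 0" "d = x^2 / c" if "(x, d, y, e, z) \<in> irr_stratum c" for x d y e z
    using that assms by (auto simp: irr_stratum_def field_simps)
  have k: "4 * reducible_discr x (x^2 / c) y ((y^2 - E) / 4) ((x * s * w + x * y) / 2) = x^2 * s^2 * (w^2 - E)" for x y E w
  proof -
    have 1: "2 * ((x * s * w + x * y) / 2) - x * y = x * s * w" by (simp add: field_simps)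
    have 2: "x^2 - 4 * (x^2 / c) = x^2 * s^2" unfolding s2 by (simp add: algebra_simps)
    have 3: "y^2 - 4 * ((y^2 - E) / 4) = E" by (simp add: field_simps)
    show ?thesis unfolding reducible_discr_discriminants 1 2 3 by (simp add: power_mult_distrib algebra_simps)
  qed
  have k0: "reducible_discr x (x^2 / c) y ((y^2 - E) / 4) ((x * s * w + x * y) / 2) \<noteq> 0 \<longleftrightarrow> x \<noteq> 0 \<and> E - w^2 \<noteq> 0" for x y E w
  proof -
    have "reducible_discr x (x^2 / c) y ((y^2 - E) / 4) ((x * s * w + x * y) / 2) \<noteq> 0 \<longleftrightarrow> x^2 * s^2 * (w^2 - E) \<noteq> 0"
      by (subst k[of x y E w, symmetric]) simp
    then show ?thesis using s0 by auto
  qed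
  have "mot (irr_stratum c) = mot (punctured_line \<times> ?P)"
  proof (rule mot_iso[where \<phi> = "\<lambda>(x::complex, d::complex, y::complex, e::complex, z::complex). (x, (y, y^2 - 4 * e, (2 * z - x * y) / (x * s)))" and
       \<psi> = "\<lambda>(x::complex, (y::complex, E::complex, w::complex)). (x, x^2 / c, y, (y^2 - E) / 4, (x * s * w + x * y) / 2)"])
    show "regmap (irr_stratum c) (\<lambda>(x::complex, d::complex, y::complex, e::complex, z::complex). (x, (y, y^2 - 4 * e, (2 * z - x * y) / (x * s))))"
      using s0 x0 by (simp only: case_prod_unfold, intro regmap_intros) auto
    show "regmap (punctured_line \<times> ?P) (\<lambda>(x::complex, (y::complex, E::complex, w::complex)). (x, x^2 / c, y, (y^2 - E) / 4, (x * s * w + x * y) / 2))"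
      using assms by (simp only: case_prod_unfold, intro regmap_intros) auto
    show "(case v of (x, y, E, w) \<Rightarrow> (x, x^2 / c, y, (y^2 - E) / 4, (x * s * w + x * y) / 2)) \<in> irr_stratum c"
      if "v \<in> punctured_line \<times> ?P" for v
      using that k0 assms by (auto simp: irr_stratum_def)
    have *: "(x, (y, y^2 - 4 * e, (2 * z - x * y) / (x * s))) \<in> punctured_line \<times> ?P"
      if "(x, d, y, e, z) \<in> irr_stratum c" for x d y e z
    proof -
      have "x * s * ((2 * z - x * y) / (x * s)) = 2 * z - x * y" using x0(1)[OF that] s0 by simp
      then have "reducible_discr x (x^2 / c) y ((y^2 - (y^2 - 4 * e)) / 4) ((x * s * ((2 * z - x * y) / (x * s)) + x * y) / 2) = reducible_discr x d y e z"
        using x0(2)[OF that] by simp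
      then show ?thesis using k0[of x y "y^2 - 4 * e" "(2 * z - x * y) / (x * s)"] that by (auto simp: irr_stratum_def)
    qed
    show "(case v of (x, d, y, e, z) \<Rightarrow> (x, (y, y^2 - 4 * e, (2 * z - x * y) / (x * s)))) \<in> punctured_line \<times> ?P" if "v \<in> irr_stratum c" for v
      using that by (cases v) (simp only: prod.case *)
    show "(case (case v of (x, d, y, e, z) \<Rightarrow> (x, (y, y^2 - 4 * e, (2 * z - x * y) / (x * s)))) of (x, y, E, w) \<Rightarrow>
       (x, x^2 / c, y, (y^2 - E) / 4, (x * s * w + x * y) / 2)) = v" if "v \<in> irr_stratum c" for v
      using that s0 x0 by (cases v) auto
    show "(case (case v of (x, y, E, w) \<Rightarrow> (x, x^2 / c, y, (y^2 - E) / 4, (x * s * w + x * y) / 2)) of (x, d, y, e, z) \<Rightarrow>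
      (x, (y, y^2 - 4 * e, (2 * z - x * y) / (x * s)))) = v" if "v \<in> punctured_line \<times> ?P" for v
      using that s0 by (cases v) (auto simp: diff_divide_distrib add_divide_distrib)
  qed
  then show ?thesis by (simp only: mot_Times lc_simps lcP mot_two_parabolas mot_punctured_line mult.assoc)
qed

text \<open>For \<open>c = 0\<close> the trace of \<open>A\<close> vanishes, and its discriminant
  \<open>D = - 4 * d\<close> is a free unit without a regular square root. The quadric
  \<open>w^2 = D * E\<close> is removed by solving for \<open>E\<close>; a square root of
  \<open>D\<close> then appears only on the locus \<open>D * v^2 = y^2\<close> with
  \<open>v \<noteq> 0\<close>, as \<open>y / v\<close>.\<close>

lemma mot_irr_stratum_0: "mot (irr_stratum 0) = \<T> * \<T> * (\<L> * \<L> - \<L>)"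
proof -
  let ?P = "{(D::complex, y::complex, E::complex, w::complex). D \<noteq> 0 \<and> E - y^2 \<noteq> 0}"
  let ?P1 = "{(D::complex, y::complex, E::complex, w::complex). D \<noteq> 0 \<and> E - y^2 \<noteq> 0 \<and> w^2 - D * E \<noteq> 0}"
  let ?W = "{(D::complex, y::complex, E::complex, w::complex). D \<noteq> 0 \<and> E - y^2 \<noteq> 0 \<and> w^2 - D * E = 0}"
  let ?Q = "{(y::complex, E::complex). E - y^2 \<noteq> 0}"
  have lcQ: "loc_closed ?Q" by (simp only: case_prod_unfold, intro loc_closed_Collect regmap_intros)
  have lcP: "loc_closed ?P" by (simp only: case_prod_unfold, intro loc_closed_Collect regmap_intros)
  have k: "reducible_discr 0 d y e z \<noteq> 0 \<longleftrightarrow> (2 * z)^2 - (- (4 * d)) * (y^2 - 4 * e) \<noteq> 0" for d y e z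
  proof -
    have "4 * reducible_discr 0 d y e z = (2 * z)^2 - (- (4 * d)) * (y^2 - 4 * e)" using reducible_discr_discriminants[of 0 d y e z] by simp
    then show ?thesis by (metis mult_eq_0_iff zero_neq_numeral)
  qed
  have 0: "mot (irr_stratum 0) = mot ?P1"
  proof (rule mot_iso[where \<phi> = "\<lambda>(x::complex, d::complex, y::complex, e::complex, z::complex). (- (4 * d), y, y^2 - 4 * e, 2 * z)" and
      \<psi> = "\<lambda>(D::complex, y::complex, E::complex, w::complex). (0, - (D / 4), y, (y^2 - E) / 4, w / 2)"])
    show "regmap (irr_stratum 0) (\<lambda>(x::complex, d::complex, y::complex, e::complex, z::complex). (- (4 * d), y, y^2 - 4 * e, 2 * z))"
      by (simp only: case_prod_unfold, intro regmap_intros)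
    show "regmap ?P1 (\<lambda>(D::complex, y::complex, E::complex, w::complex). (0::complex, - (D / 4), y, (y^2 - E) / 4, w / 2))"
      by (simp only: case_prod_unfold, intro regmap_intros) auto
    show "(case v of (x, d, y, e, z) \<Rightarrow> (- (4 * d), y, y^2 - 4 * e, 2 * z)) \<in> ?P1" if "v \<in> irr_stratum 0" for v
      using that by (cases v) (auto simp only: irr_stratum_def k prod.case mem_Collect_eq, auto simp: k)
    show "(case v of (D, y, E, w) \<Rightarrow> (0, - (D / 4), y, (y^2 - E) / 4, w / 2)) \<in> irr_stratum 0" if "v \<in> ?P1" for v
      using that by (cases v) (auto simp: irr_stratum_def k power_divide field_simps)
  qed (auto simp: irr_stratum_def diff_divide_distrib)
  have 1: "mot ?P = mot ?W + mot ?P1"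
    by (rule mot_splitI[OF lcP, where f = "\<lambda>(D::complex, y::complex, E::complex, w::complex). w^2 - D * E"])
      (simp_all only: case_prod_unfold, auto intro!: regmap_intros)
  have "mot ?P = mot (punctured_line \<times> (?Q \<times> affine_line))"
    by (rule mot_iso[where \<phi> = "\<lambda>(D::complex, y::complex, E::complex, w::complex). (D, ((y, E), w))" and \<psi> = "\<lambda>(D::complex, ((y::complex, E::complex), w::complex)). (D, y, E, w)"])
      (auto simp only: case_prod_unfold intro!: regmap_intros, auto)
  then have 2: "mot ?P = \<T> * (\<L> * \<T> * \<L>)" by (simp only: mot_Times lc_simps lcQ mot_off_parabola mot_punctured_line)
  let ?R = "{(D::complex, y::complex, v::complex). D \<noteq> 0}"
  let ?R1 = "{(D::complex, y::complex, v::complex). D \<noteq> 0 \<and> D * v^2 - y^2 \<noteq> 0}"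
  let ?X = "{(D::complex, y::complex, v::complex). D \<noteq> 0 \<and> D * v^2 - y^2 = 0}"
  have lcX: "loc_closed ?X" by (simp only: case_prod_unfold, intro loc_closed_Collect regmap_intros)
  have 3: "mot ?W = mot ?R1"
  proof (rule mot_iso[where \<phi> = "\<lambda>(D::complex, y::complex, E::complex, w::complex). (D, y, w / D)" and \<psi> = "\<lambda>(D::complex, y::complex, v::complex). (D, y, D * v^2, D * v)"])
    show "regmap ?W (\<lambda>(D::complex, y::complex, E::complex, w::complex). (D, y, w / D))" by (simp only: case_prod_unfold, intro regmap_intros) auto
    show "regmap ?R1 (\<lambda>(D::complex, y::complex, v::complex). (D, y, D * v^2, D * v))" by (simp only: case_prod_unfold, intro regmap_intros)
  qed (auto simp: power2_eq_square field_simps)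
  have "mot (punctured_line \<times> (affine_line \<times> affine_line)) = mot ?X + mot ?R1"
    by (rule mot_splitI[where f = "\<lambda>(D::complex, y::complex, v::complex). D * v^2 - y^2"])
      (simp_all only: case_prod_unfold, auto intro!: regmap_intros simp: loc_closed_Times loc_closed_UNIV loc_closed_punctured_line simp del: UNIV_Times_UNIV)
  then have 4: "\<T> * (\<L> * \<L>) = mot ?X + mot ?R1"
    by (simp only: mot_Times lc_simps mot_punctured_line)
  have "mot ?X = mot {(D::complex, y::complex, v::complex). v = 0 \<and> y = 0 \<and> D \<noteq> 0} +
      mot {(D::complex, y::complex, v::complex). v \<noteq> 0 \<and> D \<noteq> 0 \<and> D * v^2 - y^2 = 0}"
    by (rule mot_splitI[OF lcX, where f = "\<lambda>(D::complex, y::complex, v::complex). v"])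
      (simp_all only: case_prod_unfold, auto intro!: regmap_intros)
  moreover have "mot {(D::complex, y::complex, v::complex). v = 0 \<and> y = 0 \<and> D \<noteq> 0} = mot punctured_line"
    by (rule mot_iso[where \<phi> = fst and \<psi> = "\<lambda>D. (D, 0, 0)"]) (auto intro!: regmap_intros)
  moreover have "mot {(D::complex, y::complex, v::complex). v \<noteq> 0 \<and> D \<noteq> 0 \<and> D * v^2 - y^2 = 0} = mot (punctured_line \<times> punctured_line)"
  proof (rule mot_iso[where \<phi> = "\<lambda>(D::complex, y::complex, v::complex). (y / v, v)" and \<psi> = "\<lambda>(t::complex, v::complex). (t^2, t * v, v)"])
    show "regmap {(D::complex, y::complex, v::complex). v \<noteq> 0 \<and> D \<noteq> 0 \<and> D * v^2 - y^2 = 0} (\<lambda>(D::complex, y::complex, v::complex). (y / v, v))"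
      by (simp only: case_prod_unfold, intro regmap_intros) auto
    show "regmap (punctured_line \<times> punctured_line) (\<lambda>(t::complex, v::complex). (t^2, t * v, v))" by (simp only: case_prod_unfold, intro regmap_intros)
  qed (auto simp: power2_eq_square field_simps)
  ultimately have 5: "mot ?X = \<T> + \<T> * \<T>" by (simp only: mot_Times lc_simps mot_punctured_line)
  have 6: "mot ?P1 = mot ?P - mot ?W" using 1 by simp
  have 7: "mot ?R1 = \<T> * (\<L> * \<L>) - mot ?X" using 4 by simp
  show ?thesis unfolding 0 6 2 3 7 5 by (simp add: algebra_simps)
qed


section \<open>The image of the representation variety in the space of traces\<close>

text \<open>
  \<open>A\<^sup>n = upoly n (tr A) (det A) A + c\<close> with a scalar \<open>c\<close>, for \<open>2 \<times> 2\<close> matrices \<open>A\<close>. The recursion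
  comes from the theorem of Cayley and Hamilton.
\<close>

fun upoly :: "nat \<Rightarrow> complex \<Rightarrow> complex \<Rightarrow> complex" where
  "upoly 0 x d = 0"
| "upoly (Suc 0) x d = 1"
| "upoly (Suc (Suc n)) x d = x * upoly (Suc n) x d - d * upoly n x d"

text \<open>\<open>upoly n\<close> is \<open>(l^n - m^n) / (l - m)\<close>, written as a polynomial
  in the symmetric functions of \<open>l\<close> and \<open>m\<close>. Without division the identity
  also makes sense for \<open>l = m\<close>.\<close>

lemma upoly_roots: "upoly n (l + m) (l * m) * (l - m) = l ^ n - m ^ n"
proof (induction n rule: induct_nat_012)
  case (ge2 n)
  have "upoly (Suc (Suc n)) (l + m) (l * m) * (l - m) =
      (l + m) * (upoly (Suc n) (l + m) (l * m) * (l - m)) - l * m * (upoly n (l + m) (l * m) * (l - m))"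
    by (simp add: algebra_simps)
  then show ?case unfolding ge2 by (simp add: algebra_simps)
qed auto

text \<open>The value at \<open>l = m\<close> is nonzero for \<open>l \<noteq> 0\<close>, so the
  vanishing of \<open>upoly\<close> forces distinct eigenvalues.\<close>

lemma upoly_double_root: "upoly (Suc n) (l + l) (l * l) = of_nat (Suc n) * l ^ n"
proof (induction n rule: less_induct)
  case (less n)
  consider "n = 0" | "n = 1" | k where "n = Suc (Suc k)" by (metis One_nat_def not0_implies_Suc)
  then show ?case
  proof cases
    case 3
    then show ?thesis using less[of k] less[of "Suc k"] by (simp add: algebra_simps)
  qed auto
qed

lemma quadratic_roots: "\<exists>l m::complex. l + m = x \<and> l * m = d"
proof -
  let ?r = "csqrt (x^2 - 4 * d)"
  have "?r * ?r = x * x - 4 * d" by (metis power2_csqrt power2_eq_square)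
  then have "((x + ?r) / 2) * ((x - ?r) / 2) = d" by (simp add: field_simps)
  moreover have "(x + ?r) / 2 + (x - ?r) / 2 = x" by (simp add: field_simps)
  ultimately show ?thesis by blast
qed

text \<open>The value of \<open>x\<^sup>2 / d\<close> when the ratio of the eigenvalues is the \<open>k\<close>-th power of \<open>exp (2 \<pi> i / n)\<close>.\<close>

definition trace_ratio :: "nat \<Rightarrow> nat \<Rightarrow> complex" where
  "trace_ratio n k = of_real (2 + 2 * cos (2 * pi * real k / real n))"

text \<open>Eigenvalues \<open>l\<close> and \<open>\<zeta> * l\<close> have \<open>x^2 / d = (1 +
  \<zeta>)^2 / \<zeta> = 2 + \<zeta> + 1 / \<zeta>\<close>.\<close>

lemma trace_ratio_cis:
  "trace_ratio n k * cis (2 * pi * real k / real n) = (1 + cis (2 * pi * real k / real n))^2"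
proof -
  let ?t = "2 * pi * real k / real n"
  have "of_real (2 + 2 * cos ?t) = 2 + cis ?t + cis (- ?t)"
    by (simp add: complex_eq_iff)
  moreover have "cis (- ?t) * cis ?t = 1" by (simp add: cis_mult)
  ultimately show ?thesis unfolding trace_ratio_def
    by (simp only: distrib_right power2_eq_square distrib_left) simp
qed

text \<open>Replacing \<open>k\<close> by \<open>n - k\<close> inverts the root of unity, that is,
  exchanges the two eigenvalues. Hence the indices up to \<open>n div 2\<close> suffice.\<close>

lemma trace_ratio_reflect: "k \<le> n \<Longrightarrow> n \<noteq> 0 \<Longrightarrow> trace_ratio n (n - k) = trace_ratio n k"
proof -
  assume "k \<le> n" "n \<noteq> 0"
  then have "2 * pi * real (n - k) / real n = 2 * pi - 2 * pi * real k / real n" by (simp add: of_nat_diff field_simps)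
  then show ?thesis by (simp add: trace_ratio_def cos_diff)
qed

text \<open>By \<open>upoly_roots\<close> and \<open>upoly_double_root\<close>, vanishing means that
  the eigenvalues are distinct with equal \<open>n\<close>-th powers, so that their ratio is a
  nontrivial \<open>n\<close>-th root of unity.\<close>

lemma upoly_zero_iff:
  assumes n: "n \<ge> 1" and d: "d \<noteq> 0"
  shows "upoly n x d = 0 \<longleftrightarrow> (\<exists>k\<in>{1..n div 2}. x^2 = trace_ratio n k * d)"
proof -
  obtain l m where lm: "l + m = x" "l * m = d" using quadratic_roots by blast
  have punctured_line: "l \<noteq> 0" "m \<noteq> 0" using lm d by auto
  show ?thesis
  proof
    assume u: "upoly n x d = 0"
    have "l \<noteq> m"
    proof
      assume "l = m"
      then have "upoly n x d = of_nat n * l ^ (n - 1)" using upoly_double_root[of "n - 1" l] lm n by simp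
      then show False using u punctured_line n by simp
    qed
    have "l ^ n = m ^ n" using upoly_roots[of n l m] u lm by simp
    then have "(m / l) ^ n = 1" using punctured_line by (simp add: power_divide)
    moreover have "bij_betw (\<lambda>k. cis (2 * pi * real k / real n)) {..<n} {z. z ^ n = 1}"
      by (rule bij_betw_roots_unity) (use n in simp)
    ultimately obtain j where j: "j < n" "m / l = cis (2 * pi * real j / real n)"
      by (auto simp: bij_betw_def)
    have "j \<noteq> 0" using j \<open>l \<noteq> m\<close> punctured_line by (auto intro: ccontr simp: field_simps)
    define \<zeta> where "\<zeta> = cis (2 * pi * real j / real n)"
    have "m = \<zeta> * l" using j punctured_line by (simp add: \<zeta>_def field_simps)
    then have "x^2 = (1 + \<zeta>)^2 * (l * l)" "d = \<zeta> * (l * l)" using lm by (auto simp: power2_eq_square algebra_simps)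
    then have x: "x^2 = trace_ratio n j * d" using trace_ratio_cis[of n j] by (simp add: \<zeta>_def mult.assoc)
    show "\<exists>k\<in>{1..n div 2}. x^2 = trace_ratio n k * d"
    proof (cases "j \<le> n div 2")
      case True then show ?thesis using x \<open>j \<noteq> 0\<close> by (intro bexI[of _ j]) auto
    next
      case False
      then show ?thesis using x j trace_ratio_reflect[of j n] by (intro bexI[of _ "n - j"]) auto
    qed
  next
    assume "\<exists>k\<in>{1..n div 2}. x^2 = trace_ratio n k * d"
    then obtain k where k: "1 \<le> k" "k \<le> n div 2" "x^2 = trace_ratio n k * d" by auto
    have kn: "k < n" using k by auto
    define \<zeta> where "\<zeta> = cis (2 * pi * real k / real n)"
    have "\<zeta> ^ n = cis (2 * pi * real k)" using n unfolding \<zeta>_def by (simp add: DeMoivre)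
    also have "\<dots> = 1" by (simp add: complex_eq_iff)
    finally have z: "\<zeta> ^ n = 1" .
    have "inj_on (\<lambda>k. cis (2 * pi * real k / real n)) {..<n}"
      using bij_betw_roots_unity[of n] n by (auto simp: bij_betw_def)
    from inj_onD[OF this, of k 0] have z1: "\<zeta> \<noteq> 1" using k kn n by (auto simp: \<zeta>_def)
    have "\<zeta> * (l + m)^2 = (1 + \<zeta>)^2 * (l * m)" using k lm trace_ratio_cis[of n k] by (simp add: \<zeta>_def algebra_simps)
    \<comment> \<open>The relation is quadratic in \<open>m / l\<close>, with roots \<zeta> and
      \<open>1 / \<zeta>\<close>.\<close>
    then have "(m - \<zeta> * l) * (\<zeta> * m - l) = 0" by (simp add: power2_eq_square algebra_simps)
    then consider "m = \<zeta> * l" | "l = \<zeta> * m" by auto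
    then have "l ^ n = m ^ n \<and> l \<noteq> m"
      by cases (use z z1 punctured_line in \<open>auto simp: power_mult_distrib\<close>)
    then show "upoly n x d = 0" using upoly_roots[of n l m] lm by auto
  qed
qed

text \<open>For \<open>k \<le> n div 2\<close> the angle lies between 0 and \<open>pi\<close>, where
  the cosine is injective.\<close>

lemma inj_on_trace_ratio: "inj_on (trace_ratio n) {1..n div 2}"
proof (rule inj_onI)
  fix j k assume jk: "j \<in> {1..n div 2}" "k \<in> {1..n div 2}" "trace_ratio n j = trace_ratio n k"
  have n: "n > 0" using jk by auto
  have rng: "2 * pi * real i / real n \<in> {0..pi}" if "i \<in> {1..n div 2}" for i
  proof -
    have "2 * i \<le> n" using that by auto
    then have "2 * real i \<le> real n" by linarith
    then show ?thesis using n by (simp add: field_simps)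
  qed
  have "cos (2 * pi * real j / real n) = cos (2 * pi * real k / real n)"
    using jk(3) unfolding trace_ratio_def of_real_eq_iff by simp
  then have "2 * pi * real j / real n = 2 * pi * real k / real n"
    using cos_inj_pi[of "2 * pi * real j / real n" "2 * pi * real k / real n"] rng[OF jk(1)] rng[OF jk(2)]
    by (simp only: atLeastAtMost_iff)
  then show "j = k" using n by simp
qed

text \<open>The value 4 belongs to the ratio 1 and the value 0 to the ratio -1, which is an
  \<open>n\<close>-th root of unity for even \<open>n\<close> only.\<close>

lemma trace_ratio_values:
  assumes "k \<in> {1..n div 2}" shows "trace_ratio n k \<noteq> 4" "trace_ratio n k = 0 \<longleftrightarrow> 2 * k = n"
proof -
  have n: "n > 0" and k: "k \<ge> 1" "2 * k \<le> n" using assms by auto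
  have *: "0 < 2 * pi * real k / real n" "2 * pi * real k / real n \<le> pi"
  proof -
    have "2 * real k \<le> real n" using k by linarith
    then show "2 * pi * real k / real n \<le> pi" using n by (simp add: field_simps)
  qed (use n k in simp)
  have "cos (2 * pi * real k / real n) < cos 0" using * by (intro cos_monotone_0_pi) auto
  then have "2 + 2 * cos (2 * pi * real k / real n) \<noteq> 4" by simp
  then show "trace_ratio n k \<noteq> 4" unfolding trace_ratio_def by (metis of_real_eq_iff of_real_numeral)
  have "trace_ratio n k = 0 \<longleftrightarrow> cos (2 * pi * real k / real n) = cos pi"
    unfolding trace_ratio_def of_real_eq_0_iff by auto
  also have "\<dots> \<longleftrightarrow> 2 * pi * real k / real n = pi" 
    using cos_inj_pi[of "2 * pi * real k / real n" pi] * by auto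
  also have "\<dots> \<longleftrightarrow> 2 * real k = real n" using n by (simp add: field_simps)
  also have "\<dots> \<longleftrightarrow> 2 * k = n" by linarith
  finally show "trace_ratio n k = 0 \<longleftrightarrow> 2 * k = n" .
qed

text \<open>Equations for the image of the representation variety under the five traces and
  determinants; that they describe exactly the image is the content of
  \<open>traces_in_image\<close> and \<open>traces_surj\<close>.\<close>

definition trace_image :: "nat \<Rightarrow> (complex \<times> complex \<times> complex \<times> complex \<times> complex) set" where
  "trace_image n = {(x, d, y, e, z). d \<noteq> 0 \<and> e \<noteq> 0 \<and> upoly n x d * reducible_discr x d y e z = 0}"

lemma regmap_upoly: "regmap S f \<Longrightarrow> regmap S g \<Longrightarrow> regmap S (\<lambda>v. upoly n (f v) (g v))"
proof (induction n rule: less_induct)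
  case (less n)
  consider "n = 0" | "n = Suc 0" | k where "n = Suc (Suc k)" by (metis not0_implies_Suc)
  then show ?case
    by cases (use less in \<open>auto intro!: regmap_const regmap_diff regmap_mult\<close>)
qed

text \<open>Strata for different \<open>c\<close> are disjoint, since \<open>x^2 = c * d\<close>
  with \<open>d \<noteq> 0\<close> determines \<open>c\<close>.\<close>

lemma mot_irr_union:
  assumes "finite C"
  defines "S \<equiv> \<lambda>C. {v. \<exists>c\<in>C. v \<in> irr_stratum c}"
  shows "loc_closed (S C) \<and> mot (S C) = (\<Sum>c\<in>C. mot (irr_stratum c))"
  using assms(1)
proof (induction C)
  case empty
  have e: "S {} = {v. (1::complex) = 0}" by (auto simp: S_def)
  \<comment> \<open>The empty set splits into two copies of itself, which forces its class to be
    0.\<close>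
  have "mot (S {}) = mot (S {}) + mot (S {})"
    by (rule mot_splitI[where f = "\<lambda>_. 0"])
      (unfold e, intro loc_closed_Collect regmap_const, auto intro: regmap_const)
  moreover have "loc_closed (S {})" unfolding e by (intro loc_closed_Collect regmap_const)
  ultimately show ?case by simp
next
  case (insert c C)
  define W :: "(complex \<times> complex \<times> complex \<times> complex \<times> complex) set" where
    "W = {(x, d, y, e, z). d \<noteq> 0 \<and> e \<noteq> 0 \<and> reducible_discr x d y e z \<noteq> 0}"
  have lcW: "loc_closed W"
    unfolding W_def reducible_discr_def by (simp only: case_prod_unfold, intro loc_closed_Collect regmap_intros)
  \<comment> \<open>Inside the irreducible locus a finite union of strata is the zero set of one
    product, hence \<open>loc_closed\<close>.\<close>
  have S: "S D = {v \<in> W. (\<Prod>c\<in>D. (fst v)^2 - c * fst (snd v)) = 0}" if "finite D" for D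
    using that by (auto simp: S_def W_def irr_stratum_def prod_zero_iff)
  have "regmap W (\<lambda>v. \<Prod>c\<in>D. (fst v)^2 - c * fst (snd v))" if "finite D" for D
    using that by (induction D) (auto intro!: regmap_const regmap_mult regmap_diff regmap_power regmap_fst regmap_snd regmap_id)
  then have lc: "loc_closed (S D)" if "finite D" for D
    unfolding S[OF that] using loc_closed_zero[OF lcW] that by blast
  have "mot (S (insert c C)) = mot (irr_stratum c) + mot (S C)"
  proof (rule mot_splitI[where f = "\<lambda>v. (fst v)^2 - c * fst (snd v)"])
    show "loc_closed (S (insert c C))" using lc insert by simp
    show "regmap (S (insert c C)) (\<lambda>v. (fst v)^2 - c * fst (snd v))" by (intro regmap_intros)
    show "irr_stratum c = {v \<in> S (insert c C). (fst v)^2 - c * fst (snd v) = 0}"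
      by (auto simp: S_def irr_stratum_def)
    show "S C = {v \<in> S (insert c C). (fst v)^2 - c * fst (snd v) \<noteq> 0}"
      using insert by (auto simp: S_def irr_stratum_def)
  qed
  then show ?case using insert lc by simp
qed

lemma sum_const_K0: "finite K \<Longrightarrow> (\<Sum>k\<in>K. a) = int_K0 (int (card K)) * (a :: K0)"
  by (induction K rule: finite_induct) (simp_all add: int_K0_simps algebra_simps)

lemma int_K0_2: "int_K0 2 = 1 + 1"
  using int_K0_simps(3)[of 1 1] by (simp add: int_K0_simps(2))

lemma mot_trace_image:
  assumes n: "n \<ge> 1"
  shows "mot (trace_image n) = \<T> * \<T> * ((int_K0 (int (n div 2)) + 1) * (\<L> * \<L>)
    - int_K0 (int (n div 2)) * \<L> + int_K0 (int n - int (n div 2)))"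
proof -
  let ?m = "n div 2"
  let ?f = "\<lambda>v::complex\<times>complex\<times>complex\<times>complex\<times>complex.
    reducible_discr (fst v) (fst (snd v)) (fst (snd (snd v))) (fst (snd (snd (snd v)))) (snd (snd (snd (snd v))))"
  have "mot (trace_image n) = mot {(x, d, y, e, z). d \<noteq> 0 \<and> e \<noteq> 0 \<and> reducible_discr x d y e z = 0} +
      mot {v. \<exists>c\<in>trace_ratio n ` {1..?m}. v \<in> irr_stratum c}"
  proof (rule mot_splitI[where f = ?f])
    show "loc_closed (trace_image n)" unfolding trace_image_def reducible_discr_def
      by (simp only: case_prod_unfold, intro loc_closed_Collect regmap_intros regmap_upoly)
    show "regmap (trace_image n) ?f" unfolding reducible_discr_def by (intro regmap_intros)
    show "{v. \<exists>c\<in>trace_ratio n ` {1..?m}. v \<in> irr_stratum c} = {v \<in> trace_image n. ?f v \<noteq> 0}"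
      using upoly_zero_iff[OF n] by (auto simp: trace_image_def irr_stratum_def)
  qed (auto simp: trace_image_def)
  also have "mot {v. \<exists>c\<in>trace_ratio n ` {1..?m}. v \<in> irr_stratum c} = (\<Sum>k\<in>{1..?m}. mot (irr_stratum (trace_ratio n k)))"
    using mot_irr_union[of "trace_ratio n ` {1..?m}"] inj_on_trace_ratio by (simp add: sum.reindex)
  \<comment> \<open>The correction term accounts for the ratio -1:
    \<open>2 * (n div 2) - n + 1\<close> is 1 for even \<open>n\<close> and 0 for odd
    \<open>n\<close>. Together with the reducible locus it produces the constant term
    \<open>n - n div 2\<close>.\<close>
  also have "\<dots> = int_K0 (int ?m) * (\<T> * \<T> * (\<L> * \<L> - \<L> + 1)) - int_K0 (int ?m - (int n - int ?m) + 1) * (\<T> * \<T>)"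
  proof (cases "even n")
    case False
    then have "mot (irr_stratum (trace_ratio n k)) = \<T> * \<T> * (\<L> * \<L> - \<L> + 1)" if "k \<in> {1..?m}" for k
      using trace_ratio_values[OF that] by (intro mot_irr_stratum) auto
    then have "(\<Sum>k\<in>{1..?m}. mot (irr_stratum (trace_ratio n k))) = (\<Sum>k\<in>{1..?m}. \<T> * \<T> * (\<L> * \<L> - \<L> + 1))"
      by (intro sum.cong) auto
    moreover have "int ?m - (int n - int ?m) + 1 = 0" using False by presburger
    ultimately show ?thesis by (simp add: sum_const_K0 int_K0_simps)
  next
    case True
    then have m: "?m \<in> {1..?m}" "2 * ?m = n" using n by auto
    have "mot (irr_stratum (trace_ratio n k)) = \<T> * \<T> * (\<L> * \<L> - \<L> + 1)" if "k \<in> {1..?m} - {?m}" for k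
      using trace_ratio_values[of k n] that m(2) by (intro mot_irr_stratum) auto
    then have "(\<Sum>k\<in>{1..?m} - {?m}. mot (irr_stratum (trace_ratio n k))) = (\<Sum>k\<in>{1..?m} - {?m}. \<T> * \<T> * (\<L> * \<L> - \<L> + 1))"
      by (intro sum.cong) auto
    also have "\<dots> = int_K0 (int ?m - 1) * (\<T> * \<T> * (\<L> * \<L> - \<L> + 1))"
      using m by (subst sum_const_K0) (auto simp: of_nat_diff)
    finally have rest: "(\<Sum>k\<in>{1..?m} - {?m}. mot (irr_stratum (trace_ratio n k))) =
      int_K0 (int ?m - 1) * (\<T> * \<T> * (\<L> * \<L> - \<L> + 1))" .
    have last: "mot (irr_stratum (trace_ratio n ?m)) = \<T> * \<T> * (\<L> * \<L> - \<L>)"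
      using trace_ratio_values(2)[OF m(1)] m(2) mot_irr_stratum_0 by simp
    have e: "int ?m - (int n - int ?m) + 1 = 1" using True by presburger
    have "(\<Sum>k\<in>{1..?m}. mot (irr_stratum (trace_ratio n k))) =
        mot (irr_stratum (trace_ratio n ?m)) + (\<Sum>k\<in>{1..?m} - {?m}. mot (irr_stratum (trace_ratio n k)))"
      by (rule sum.remove[OF _ m(1)]) simp
    then show ?thesis unfolding rest last e by (simp add: int_K0_simps algebra_simps)
  qed
  finally show ?thesis unfolding mot_reducible by (simp add: int_K0_simps int_K0_2 algebra_simps)
qed

section \<open>Hilbert's basis theorem\<close>

text \<open>Rings are carried by subsets of an ambient ring, because the rings in question consist
  of functions on one set. Containing -1 gives closure under negation.\<close>

definition is_subring :: "'r::comm_ring_1 set \<Rightarrow> bool" where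
  "is_subring A \<longleftrightarrow> 1 \<in> A \<and> -1 \<in> A \<and> (\<forall>a\<in>A. \<forall>b\<in>A. a + b \<in> A \<and> a * b \<in> A)"

lemma is_subringD:
  assumes "is_subring A"
  shows "1 \<in> A" "a \<in> A \<Longrightarrow> b \<in> A \<Longrightarrow> a + b \<in> A" "a \<in> A \<Longrightarrow> b \<in> A \<Longrightarrow> a * b \<in> A"
    "0 \<in> A" "a \<in> A \<Longrightarrow> - a \<in> A" "a \<in> A \<Longrightarrow> b \<in> A \<Longrightarrow> a - b \<in> A" "a \<in> A \<Longrightarrow> a ^ n \<in> A"
proof -
  show 1: "1 \<in> A" and 2: "a \<in> A \<Longrightarrow> b \<in> A \<Longrightarrow> a + b \<in> A" and 3: "a \<in> A \<Longrightarrow> b \<in> A \<Longrightarrow> a * b \<in> A" for a b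
    using assms by (auto simp: is_subring_def)
  have m: "-1 \<in> A" using assms by (simp add: is_subring_def)
  show "0 \<in> A" using 2[OF 1 m] by simp
  show 4: "a \<in> A \<Longrightarrow> - a \<in> A" for a using 3[OF m, of a] by simp
  show "a \<in> A \<Longrightarrow> b \<in> A \<Longrightarrow> a - b \<in> A" using 2[OF _ 4, of a b] by simp
  show "a \<in> A \<Longrightarrow> a ^ n \<in> A" by (induction n) (auto intro: 1 3)
qed

lemma is_subring_sum: "is_subring A \<Longrightarrow> (\<And>i. i \<in> S \<Longrightarrow> f i \<in> A) \<Longrightarrow> sum f S \<in> A"
  by (induction S rule: infinite_finite_induct) (auto intro: is_subringD)

inductive_set idl :: "'r::comm_ring_1 set \<Rightarrow> 'r set \<Rightarrow> 'r set" for A G where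
  zero: "0 \<in> idl A G"
| step: "p \<in> idl A G \<Longrightarrow> a \<in> A \<Longrightarrow> g \<in> G \<Longrightarrow> p + a * g \<in> idl A G"

lemma idl_gen: "is_subring A \<Longrightarrow> g \<in> G \<Longrightarrow> g \<in> idl A G"
  using idl.step[OF idl.zero, of 1 A g G] by (simp add: is_subringD)

lemma idl_add: "p \<in> idl A G \<Longrightarrow> r \<in> idl A G \<Longrightarrow> p + r \<in> idl A G"
proof (induction p rule: idl.induct)
  case (step p a g)
  then have "(p + r) + a * g \<in> idl A G" by (intro idl.step) auto
  then show ?case by (simp add: algebra_simps)
qed simp

lemma idl_mult:
  assumes "is_subring A" "p \<in> idl A G" "b \<in> A" shows "b * p \<in> idl A G"
  using assms(2)
proof (induction p rule: idl.induct)
  case (step p a g)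
  then have "b * p + (b * a) * g \<in> idl A G" using assms by (intro idl.step) (auto intro: is_subringD)
  then show ?case by (simp add: algebra_simps)
qed (simp add: idl.zero)

lemma idl_diff: "is_subring A \<Longrightarrow> p \<in> idl A G \<Longrightarrow> r \<in> idl A G \<Longrightarrow> p - r \<in> idl A G"
  using idl_add[of p A G "- r"] idl_mult[of A r G "-1"] by (simp add: is_subringD)

lemma idl_trans: "is_subring A \<Longrightarrow> G \<subseteq> idl A F \<Longrightarrow> p \<in> idl A G \<Longrightarrow> p \<in> idl A F"
  by (rotate_tac 2, induction p rule: idl.induct) (auto intro: idl.zero idl_add idl_mult)

lemma idl_mono: "F \<subseteq> G \<Longrightarrow> p \<in> idl A F \<Longrightarrow> p \<in> idl A G"
  by (rotate_tac 1, induction p rule: idl.induct) (auto intro: idl.intros)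

lemma idl_finite: "p \<in> idl A G \<Longrightarrow> \<exists>F. finite F \<and> F \<subseteq> G \<and> p \<in> idl A F"
proof (induction p rule: idl.induct)
  case zero show ?case by (rule exI[of _ "{}"]) (simp add: idl.zero)
next
  case (step p a g)
  then obtain F where F: "finite F" "F \<subseteq> G" "p \<in> idl A F" by blast
  have "p + a * g \<in> idl A (insert g F)" using step idl_mono[of F "insert g F"] F by (intro idl.step) auto
  then show ?case using F step by (intro exI[of _ "insert g F"]) auto
qed

lemma idl_finite_set:
  assumes "finite W" "W \<subseteq> idl A G" shows "\<exists>F. finite F \<and> F \<subseteq> G \<and> W \<subseteq> idl A F"
  using assms
proof (induction W)
  case empty show ?case by (rule exI[of _ "{}"]) simp
next
  case (insert w W)
  then obtain F where F: "finite F" "F \<subseteq> G" "W \<subseteq> idl A F" by auto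
  have "w \<in> idl A G" using insert.prems by auto
  from idl_finite[OF this] obtain F' where F': "finite F'" "F' \<subseteq> G" "w \<in> idl A F'" by blast
  show ?case using F F' idl_mono[of F "F \<union> F'"] idl_mono[of F' "F \<union> F'"]
    by (intro exI[of _ "F \<union> F'"]) auto
qed

text \<open>The finite generating set is taken from the given generators: Hilbert's argument wants
  generators of an ideal that are themselves homogeneous invariants.\<close>

definition noeth :: "'r::comm_ring_1 set \<Rightarrow> bool" where
  "noeth A \<longleftrightarrow> (\<forall>G\<subseteq>A. \<exists>F\<subseteq>G. finite F \<and> G \<subseteq> idl A F)"

lemma noethD: "noeth A \<Longrightarrow> G \<subseteq> A \<Longrightarrow> \<exists>F\<subseteq>G. finite F \<and> G \<subseteq> idl A F"
  unfolding noeth_def by blast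

lemma sum_shift_power:
  "x ^ k * (\<Sum>i<d. c i * x ^ i) = (\<Sum>i<d + k. (if i < k then 0 else c (i - k)) * (x::'r::comm_ring_1) ^ i)"
proof (induction k)
  case (Suc k)
  have "x ^ Suc k * (\<Sum>i<d. c i * x ^ i) = x * (x ^ k * (\<Sum>i<d. c i * x ^ i))" by (simp add: mult.assoc)
  also have "\<dots> = (\<Sum>i<d + k. (if i < k then 0 else c (i - k)) * x ^ Suc i)"
    unfolding Suc by (simp add: sum_distrib_left mult.left_commute)
  also have "\<dots> = (\<Sum>i<Suc (d + k). (if i < Suc k then 0 else c (i - Suc k)) * x ^ i)"
    by (subst sum.lessThan_Suc_shift) (simp cong: if_cong)
  finally show ?case by simp
qed simp

text \<open>The leading coefficient argument, with \<open>x\<close> possibly algebraic over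
  \<open>A\<close>: elements of \<open>B\<close> may have several expressions as polynomials in
  \<open>x\<close>, and \<open>L d\<close> collects the coefficients of \<open>x^d\<close> from all
  those of degree at most \<open>d\<close>.\<close>

theorem noeth_adjoin:
  assumes A: "is_subring A" "noeth A" and B: "is_subring B" "A \<subseteq> B" "x \<in> B"
    and rep: "\<And>b. b \<in> B \<Longrightarrow> \<exists>d c. (\<forall>i. c i \<in> A) \<and> b = (\<Sum>i<(d::nat). c i * x ^ i)"
  shows "noeth B"
  unfolding noeth_def
proof (intro allI impI)
  fix G assume GB: "G \<subseteq> B"
  define L where "L d = {a \<in> A. \<exists>c. (\<forall>i. c i \<in> A) \<and> a * x ^ d + (\<Sum>i<d. c i * x ^ i) \<in> idl B G}" for d
  have L_Suc: "L d \<subseteq> L (Suc d)" for d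
  proof
    fix a assume "a \<in> L d"
    then obtain c where c: "a \<in> A" "\<forall>i. c i \<in> A" "a * x ^ d + (\<Sum>i<d. c i * x ^ i) \<in> idl B G" by (auto simp: L_def)
    have "x * (a * x ^ d + (\<Sum>i<d. c i * x ^ i)) \<in> idl B G" by (rule idl_mult[OF B(1) c(3) B(3)])
    also have "x * (a * x ^ d + (\<Sum>i<d. c i * x ^ i)) = a * x ^ Suc d + x ^ 1 * (\<Sum>i<d. c i * x ^ i)"
      by (simp add: algebra_simps)
    also have "\<dots> = a * x ^ Suc d + (\<Sum>i<Suc d. (if i < 1 then 0 else c (i - 1)) * x ^ i)"
      unfolding sum_shift_power by simp
    finally show "a \<in> L (Suc d)" unfolding L_def using c is_subringD(4)[OF A(1)]
      by (intro CollectI conjI exI[of _ "\<lambda>i. if i < 1 then 0 else c (i - 1)"]) auto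
  qed
  have L_mono: "L d \<subseteq> L e" if "d \<le> e" for d e
    using that by (induction rule: dec_induct) (use L_Suc in blast)+
  have LA: "L d \<subseteq> A" for d by (auto simp: L_def)
  \<comment> \<open>The sets \<open>L d\<close> increase. Finitely many elements generate everything
    in their union, and these already lie in one \<open>L D\<close>, so above \<open>D\<close> no
    new generators are wanted.\<close>
  obtain Fi where Fi: "Fi \<subseteq> (\<Union>d. L d)" "finite Fi" "(\<Union>d. L d) \<subseteq> idl A Fi"
    using noethD[OF A(2), of "\<Union>d. L d"] LA by blast
  have "\<exists>D. Fi \<subseteq> L D" using Fi(2,1)
  proof (induction Fi)
    case (insert f F)
    then obtain D d where "F \<subseteq> L D" "f \<in> L d" by auto
    then have "insert f F \<subseteq> L (max D d)" using L_mono[of D "max D d"] L_mono[of d "max D d"] by auto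
    then show ?case by blast
  qed simp
  then obtain D where D: "Fi \<subseteq> L D" by blast
  have "\<forall>d. \<exists>F\<subseteq>L d. finite F \<and> L d \<subseteq> idl A F" using noethD[OF A(2)] LA by blast
  then obtain F0 where F0: "\<And>d. F0 d \<subseteq> L d" "\<And>d. finite (F0 d)" "\<And>d. L d \<subseteq> idl A (F0 d)" by metis
  define F where "F d = (if d < D then F0 d else Fi)" for d
  have F: "F d \<subseteq> L d" "finite (F d)" "L e \<subseteq> idl A (F d)" if "d = min e D" for d e
  proof -
    show "F d \<subseteq> L d" using F0 D that by (auto simp: F_def)
    show "finite (F d)" using F0 Fi by (simp add: F_def)
    show "L e \<subseteq> idl A (F d)" using F0[of d] Fi(3) that by (auto simp: F_def min_def split: if_splits)
  qed
  define w where "w d f = (SOME c. (\<forall>i. c i \<in> A) \<and> f * x ^ d + (\<Sum>i<d. c i * x ^ i) \<in> idl B G)" for d f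
  have w: "w d f i \<in> A" "f * x ^ d + (\<Sum>i<d. w d f i * x ^ i) \<in> idl B G" if fd: "f \<in> L d" for d f i
  proof -
    have "\<exists>c. (\<forall>i. c i \<in> A) \<and> f * x ^ d + (\<Sum>i<d. c i * x ^ i) \<in> idl B G" using fd by (auto simp: L_def)
    then have "(\<forall>i. w d f i \<in> A) \<and> f * x ^ d + (\<Sum>i<d. w d f i * x ^ i) \<in> idl B G"
      unfolding w_def by (rule someI_ex)
    then show "w d f i \<in> A" "f * x ^ d + (\<Sum>i<d. w d f i * x ^ i) \<in> idl B G" by auto
  qed
  define W where "W = (\<Union>d\<le>D. (\<lambda>f. f * x ^ d + (\<Sum>i<d. w d f i * x ^ i)) ` F d)"
  have FL: "F d \<subseteq> L d" if "d \<le> D" for d using F(1)[of d d] that by simp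
  have finW: "finite W" unfolding W_def using F(2)[OF refl] F0 Fi by (auto simp: F_def)
  have WG: "W \<subseteq> idl B G" unfolding W_def using w FL by blast
  have xB: "a * x ^ k \<in> B" if "a \<in> A" for a k using that B by (auto intro!: is_subringD)
  \<comment> \<open>A generator of leading coefficients in degree \<open>min d D\<close> is lifted
    to a member of \<open>W\<close> and multiplied by a power of \<open>x\<close>; so every leading
    coefficient in degree \<open>d\<close> is attained within the ideal of the finite set
    \<open>W\<close>.\<close>
  have lead: "\<exists>r e. r \<in> idl B W \<and> (\<forall>i. e i \<in> A) \<and> r = a * x ^ d + (\<Sum>i<d. e i * x ^ i)"
    if "a \<in> idl A (F (min d D))" for a d
    using that
  proof (induction rule: idl.induct)
    case zero
    show ?case by (rule exI[of _ 0], rule exI[of _ "\<lambda>_. 0"]) (simp add: idl.zero is_subringD(4)[OF A(1)])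
  next
    case (step p a f)
    then obtain r e where r: "r \<in> idl B W" "\<forall>i. e i \<in> A" "r = p * x ^ d + (\<Sum>i<d. e i * x ^ i)" by blast
    let ?m = "min d D" and ?k = "d - min d D"
    let ?p = "f * x ^ ?m + (\<Sum>i<?m. w ?m f i * x ^ i)"
    have fL: "f \<in> L ?m" using FL[of ?m] step by auto
    have "?p \<in> W" unfolding W_def using step by (intro UN_I[of ?m]) auto
    then have "r + (a * x ^ ?k) * ?p \<in> idl B W" using r xB step by (intro idl.step) auto
    moreover have "(a * x ^ ?k) * ?p = a * f * x ^ d + a * (x ^ ?k * (\<Sum>i<?m. w ?m f i * x ^ i))"
    proof -
      have "x ^ d = x ^ ?k * x ^ ?m" by (simp flip: power_add)
      then show ?thesis by (simp add: algebra_simps)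
    qed
    moreover have "a * (x ^ ?k * (\<Sum>i<?m. w ?m f i * x ^ i)) =
        (\<Sum>i<d. a * (if i < ?k then 0 else w ?m f (i - ?k)) * x ^ i)"
    proof -
      have "?m + ?k = d" by simp
      then show ?thesis unfolding sum_shift_power by (simp only: sum_distrib_left mult.assoc)
    qed
    moreover define e' where "e' i = e i + a * (if i < ?k then 0 else w ?m f (i - ?k))" for i
    ultimately have "(p + a * f) * x ^ d + (\<Sum>i<d. e' i * x ^ i) \<in> idl B W"
      unfolding r(3) by (simp add: sum.distrib distrib_right add.assoc add.left_commute)
    moreover have "\<forall>i. e' i \<in> A"
      using r(2) w(1)[OF fL] step A(1) by (auto simp: e'_def intro!: is_subringD(2,3,4))
    ultimately show ?case by blast
  qed
  \<comment> \<open>Subtracting an element of the ideal of \<open>W\<close> with the same leading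
    coefficient lowers the degree.\<close>
  have all: "p \<in> idl B W" if "p \<in> idl B G" "\<forall>i. c i \<in> A" "p = (\<Sum>i<d. c i * x ^ i)" for p c d
    using that
  proof (induction d arbitrary: p c)
    case 0 then show ?case by (simp add: idl.zero)
  next
    case (Suc d)
    have "c d \<in> L d" using Suc.prems by (auto simp: L_def add.commute)
    then have "c d \<in> idl A (F (min d D))" using F(3)[OF refl] by blast
    then obtain r e where r: "r \<in> idl B W" "\<forall>i. e i \<in> A" "r = c d * x ^ d + (\<Sum>i<d. e i * x ^ i)" using lead by blast
    have "r \<in> idl B G" using idl_trans[OF B(1) WG r(1)] .
    then have "p - r \<in> idl B G" using Suc.prems idl_diff[OF B(1)] by blast
    moreover have "p - r = (\<Sum>i<d. (c i - e i) * x ^ i)"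
      using Suc.prems(3) r(3) by (simp add: sum_subtractf left_diff_distrib)
    moreover have "\<forall>i. c i - e i \<in> A" using Suc.prems r A(1) by (auto intro: is_subringD)
    ultimately have "p - r \<in> idl B W" using Suc.IH[of "p - r" "\<lambda>i. c i - e i"] by blast
    from idl_add[OF this r(1)] show ?case by simp
  qed
  have GW: "G \<subseteq> idl B W"
  proof
    fix g assume g: "g \<in> G"
    then obtain d c where "\<forall>i. c i \<in> A" "g = (\<Sum>i<d. c i * x ^ i)" using rep GB by blast
    then show "g \<in> idl B W" using all idl_gen[OF B(1) g] by blast
  qed
  \<comment> \<open>\<open>W\<close> need not lie in \<open>G\<close>, but its members involve only
    finitely many elements of \<open>G\<close>, and those generate.\<close>
  obtain E where E: "finite E" "E \<subseteq> G" "W \<subseteq> idl B E" using idl_finite_set[OF finW WG] by blast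
  have "G \<subseteq> idl B E" using GW idl_trans[OF B(1) E(3)] by blast
  then show "\<exists>F\<subseteq>G. finite F \<and> G \<subseteq> idl B F" using E by blast
qed

section \<open>Finitely generated extensions of rings\<close>

inductive_set adjoin :: "'r::comm_ring_1 set \<Rightarrow> 'r set \<Rightarrow> 'r set" for K X where
  base: "k \<in> K \<Longrightarrow> k \<in> adjoin K X"
| gen: "x \<in> X \<Longrightarrow> x \<in> adjoin K X"
| add: "a \<in> adjoin K X \<Longrightarrow> b \<in> adjoin K X \<Longrightarrow> a + b \<in> adjoin K X"
| mult: "a \<in> adjoin K X \<Longrightarrow> b \<in> adjoin K X \<Longrightarrow> a * b \<in> adjoin K X"

lemma is_subring_adjoin: "is_subring K \<Longrightarrow> is_subring (adjoin K X)"
  unfolding is_subring_def by (auto intro: adjoin.intros)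

lemma adjoin_insert_rep:
  assumes "is_subring K" "b \<in> adjoin K (insert x X)"
  shows "\<exists>p. (\<forall>i. coeff p i \<in> adjoin K X) \<and> b = poly p x"
  using assms(2)
proof (induction rule: adjoin.induct)
  note S = is_subringD[OF is_subring_adjoin[OF assms(1), of X]]
  {
    case (base k)
    then show ?case using S(4) by (intro exI[of _ "[:k:]"]) (auto intro: adjoin.base simp: coeff_pCons split: nat.split)
  next
    case (gen y)
    show ?case
    proof (cases "y = x")
      case True
      then show ?thesis using S(1,4) by (intro exI[of _ "[:0, 1:]"]) (auto simp: coeff_pCons split: nat.split)
    next
      case False
      then show ?thesis using gen S(4) by (intro exI[of _ "[:y:]"]) (auto intro: adjoin.gen simp: coeff_pCons split: nat.split)
    qed
  next
    case (add a b)
    then obtain p r where "\<forall>i. coeff p i \<in> adjoin K X" "a = poly p x" "\<forall>i. coeff r i \<in> adjoin K X" "b = poly r x" by blast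
    then show ?case using S(2) by (intro exI[of _ "p + r"]) auto
  next
    case (mult a b)
    then obtain p r where "\<forall>i. coeff p i \<in> adjoin K X" "a = poly p x" "\<forall>i. coeff r i \<in> adjoin K X" "b = poly r x" by blast
    then show ?case using S(3)
      by (intro exI[of _ "p * r"]) (auto simp: coeff_mult intro!: is_subring_sum is_subring_adjoin assms(1))
  }
qed

theorem Hilbert_basis:
  assumes K: "is_subring K" "noeth K" and "finite X" shows "noeth (adjoin K X)"
  using assms(3)
proof (induction X)
  case empty
  have "adjoin K {} = K"
  proof (intro equalityI subsetI)
    fix a assume "a \<in> adjoin K {}"
    then show "a \<in> K" by induction (auto intro: is_subringD[OF K(1)])
  qed (rule adjoin.base)
  then show ?case using K by simp
next
  case (insert x X)
  show ?case
  proof (rule noeth_adjoin[OF is_subring_adjoin[OF K(1)] insert.IH is_subring_adjoin[OF K(1)]])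
    show "adjoin K X \<subseteq> adjoin K (insert x X)"
    proof
      fix a assume "a \<in> adjoin K X"
      then show "a \<in> adjoin K (insert x X)" by induction (auto intro: adjoin.intros)
    qed
    show "x \<in> adjoin K (insert x X)" by (auto intro: adjoin.gen)
    fix b assume "b \<in> adjoin K (insert x X)"
    then obtain p where p: "\<forall>i. coeff p i \<in> adjoin K X" "b = poly p x" using adjoin_insert_rep[OF K(1)] by blast
    then show "\<exists>d c. (\<forall>i. c i \<in> adjoin K X) \<and> b = (\<Sum>i<(d::nat). c i * x ^ i)"
      by (intro exI[of _ "Suc (degree p)"] exI[of _ "coeff p"]) (simp add: poly_altdef lessThan_Suc_atMost)
  qed
qed

definition const_funs :: "('a \<Rightarrow> complex) set" where
  "const_funs = range (\<lambda>c x. c)"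

lemma is_subring_const: "is_subring const_funs"
  by (auto simp: is_subring_def const_funs_def plus_fun_def times_fun_def one_fun_def fun_Compl_def uminus_apply image_iff fun_eq_iff)

lemma noeth_const: "noeth (const_funs :: ('a \<Rightarrow> complex) set)"
  unfolding noeth_def
proof (intro allI impI)
  fix G :: "('a \<Rightarrow> complex) set" assume G: "G \<subseteq> const_funs"
  show "\<exists>F\<subseteq>G. finite F \<and> G \<subseteq> idl const_funs F"
  proof (cases "G \<subseteq> {0}")
    case True
    then show ?thesis by (intro exI[of _ "{}"]) (auto intro: idl.zero)
  next
    case False
    then obtain g where g: "g \<in> G" "g \<noteq> 0" by blast
    then obtain c where c: "g = (\<lambda>x. c)" using G by (auto simp: const_funs_def)
    have c0: "c \<noteq> 0" using g c by (auto simp: zero_fun_def)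
    have "h \<in> idl const_funs {g}" if h: "h \<in> G" for h
    proof -
      obtain b where b: "h = (\<lambda>x. b)" using G h by (auto simp: const_funs_def)
      have "(\<lambda>x::'a. b / c) \<in> const_funs" by (auto simp: const_funs_def)
      then have "0 + (\<lambda>x. b / c) * g \<in> idl const_funs {g}" by (intro idl.step idl.zero) auto
      moreover have "0 + (\<lambda>x. b / c) * g = h" using b c c0 by (auto simp: fun_eq_iff)
      ultimately show ?thesis by simp
    qed
    then show ?thesis using g by (intro exI[of _ "{g}"]) auto
  qed
qed

section \<open>Lifting invariants for families of operators closed under adjoints\<close>

definition hermitian_prod :: "'j set \<Rightarrow> ('j \<Rightarrow> complex) \<Rightarrow> ('j \<Rightarrow> complex) \<Rightarrow> complex" where
  "hermitian_prod J u v = (\<Sum>j\<in>J. u j * cnj (v j))"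

definition complex_subspace :: "('j \<Rightarrow> complex) set \<Rightarrow> bool" where
  "complex_subspace K \<longleftrightarrow> 0 \<in> K \<and> (\<forall>u\<in>K. \<forall>v\<in>K. u + v \<in> K) \<and> (\<forall>a. \<forall>u\<in>K. (\<lambda>j. a * u j) \<in> K)"

lemma complex_subspace_diff: "complex_subspace K \<Longrightarrow> u \<in> K \<Longrightarrow> v \<in> K \<Longrightarrow> u - v \<in> K"
proof -
  assume K: "complex_subspace K" "u \<in> K" "v \<in> K"
  then have "u + (\<lambda>j. (-1) * v j) \<in> K" unfolding complex_subspace_def by blast
  moreover have "u + (\<lambda>j. (-1) * v j) = u - v" by (auto simp: fun_eq_iff)
  ultimately show ?thesis by simp
qed

lemma hermitian_prod_simps:
  "hermitian_prod J (u + u') v = hermitian_prod J u v + hermitian_prod J u' v" "hermitian_prod J (u - u') v = hermitian_prod J u v - hermitian_prod J u' v"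
  "hermitian_prod J u (v + v') = hermitian_prod J u v + hermitian_prod J u v'" "hermitian_prod J u (v - v') = hermitian_prod J u v - hermitian_prod J u v'"
  "hermitian_prod J (\<lambda>j. a * u j) v = a * hermitian_prod J u v" "hermitian_prod J u (\<lambda>j. a * v j) = cnj a * hermitian_prod J u v"
  by (simp_all add: hermitian_prod_def sum.distrib sum_subtractf sum_distrib_left algebra_simps)

lemma hermitian_prod_self_eq_0:
  assumes "finite J" "hermitian_prod J u u = 0" "j \<in> J" shows "u j = 0"
proof -
  have "hermitian_prod J u u = of_real (\<Sum>j\<in>J. (cmod (u j))^2)"
    unfolding of_real_sum complex_norm_square hermitian_prod_def ..
  then have "(\<Sum>j\<in>J. (cmod (u j))^2) = 0" using assms by (metis of_real_eq_0_iff)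
  then have "(cmod (u j))^2 = 0" using assms by (subst (asm) sum_nonneg_eq_0_iff) auto
  then show ?thesis by simp
qed

text \<open>Induction over the index set, one coordinate at a time: the vectors of \<open>K\<close>
  with \<open>u j = 0\<close> form a subspace \<open>K'\<close> of codimension at most one, and a
  vector \<open>u0\<close> of \<open>K\<close> orthogonal to \<open>K'\<close> corrects the
  projection in the remaining direction.\<close>

lemma orthogonal_decomposition:
  assumes "finite J" "complex_subspace K" shows "\<exists>k\<in>K. \<forall>u\<in>K. hermitian_prod J (c - k) u = 0"
  using assms
proof (induction J arbitrary: K c)
  case empty
  then show ?case by (intro bexI[of _ 0]) (auto simp: hermitian_prod_def complex_subspace_def)
next
  case (insert j J)
  define K' where "K' = {u\<in>K. u j = 0}"
  have K': "complex_subspace K'" using insert.prems unfolding complex_subspace_def K'_def by auto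
  have ext: "hermitian_prod (insert j J) u v = hermitian_prod J u v" if "v j = 0" for u v
    using insert.hyps that by (simp add: hermitian_prod_def)
  have IH: "\<exists>k\<in>K'. \<forall>u\<in>K'. hermitian_prod (insert j J) (c - k) u = 0" for c
  proof -
    obtain k where k: "k \<in> K'" "\<forall>u\<in>K'. hermitian_prod J (c - k) u = 0" using insert.IH[OF K'] by blast
    then show ?thesis using ext by (intro bexI[of _ k]) (auto simp: K'_def)
  qed
  show ?case
  proof (cases "K = K'")
    case True
    show ?thesis using IH[of c] unfolding True[symmetric] .
  next
    case False
    then obtain k0 where k0: "k0 \<in> K" "k0 j \<noteq> 0" by (auto simp: K'_def)
    obtain k1 where k1: "k1 \<in> K'" "\<forall>u\<in>K'. hermitian_prod (insert j J) (k0 - k1) u = 0" using IH by blast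
    define u0 where "u0 = k0 - k1"
    have u0: "u0 \<in> K" "u0 j \<noteq> 0" "\<forall>u\<in>K'. hermitian_prod (insert j J) u0 u = 0"
      using k0 k1 complex_subspace_diff[OF insert.prems] by (auto simp: u0_def K'_def)
    let ?N = "hermitian_prod (insert j J) u0 u0"
    have N: "?N \<noteq> 0" using hermitian_prod_self_eq_0[of "insert j J" u0 j] insert.hyps u0 by auto
    obtain k' where k': "k' \<in> K'" "\<forall>u\<in>K'. hermitian_prod (insert j J) (c - k') u = 0" using IH by blast
    define a where "a = hermitian_prod (insert j J) (c - k') u0 / ?N"
    define k where "k = k' + (\<lambda>i. a * u0 i)"
    have kK: "k \<in> K" using insert.prems k' u0 by (auto simp: k_def complex_subspace_def K'_def)
    have ck: "c - k = (c - k') - (\<lambda>i. a * u0 i)" by (auto simp: k_def fun_eq_iff)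
    have "hermitian_prod (insert j J) (c - k) u = 0" if u: "u \<in> K" for u
    proof -
      define b where "b = u j / u0 j"
      define u' where "u' = u - (\<lambda>i. b * u0 i)"
      have "(\<lambda>i. b * u0 i) \<in> K" using insert.prems u0 by (auto simp: complex_subspace_def)
      then have "u' \<in> K" unfolding u'_def by (rule complex_subspace_diff[OF insert.prems u])
      then have u': "u' \<in> K'" using u0 by (simp add: K'_def u'_def b_def)
      have uu: "u = u' + (\<lambda>i. b * u0 i)" by (auto simp: u'_def fun_eq_iff)
      have "hermitian_prod (insert j J) (c - k) u' = 0" using k' u0 u' unfolding ck by (simp add: hermitian_prod_simps)
      moreover have "hermitian_prod (insert j J) (c - k) u0 = 0" unfolding ck hermitian_prod_simps(2) hermitian_prod_simps(5) using N by (simp add: a_def hermitian_prod_simps(2))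
      ultimately show ?thesis by (subst uu) (simp add: hermitian_prod_simps(3,6))
    qed
    then show ?thesis using kK by blast
  qed
qed

text \<open>The matrix acts through its transpose: applying \<open>M\<close> to the monomials of a
  form amounts to this action on its coefficients.\<close>

definition kernel_act :: "'j set \<Rightarrow> ('j \<Rightarrow> 'j \<Rightarrow> complex) \<Rightarrow> ('j \<Rightarrow> complex) \<Rightarrow> 'j \<Rightarrow> complex" where
  "kernel_act J M c v = (\<Sum>w\<in>J. M w v * c w)"

text \<open>
  Weyl's unitary trick without integration: since the family is closed under adjoints, the orthogonal
  complement of \<open>K\<close> is invariant as well, and the component of \<open>c\<close> orthogonal to \<open>K\<close> is fixed.
\<close>

lemma lift_invariant_vector:
  assumes J: "finite J" and K: "complex_subspace K" and cong: "\<And>u v. u \<in> K \<Longrightarrow> (\<And>j. j \<in> J \<Longrightarrow> u j = v j) \<Longrightarrow> v \<in> K"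
    and adj: "\<And>M. M \<in> Ms \<Longrightarrow> \<exists>M'\<in>Ms. \<forall>v\<in>J. \<forall>w\<in>J. M' v w = cnj (M w v)"
    and inv: "\<And>M u. M \<in> Ms \<Longrightarrow> u \<in> K \<Longrightarrow> kernel_act J M u \<in> K"
    and c: "\<And>M. M \<in> Ms \<Longrightarrow> kernel_act J M c - c \<in> K"
  shows "\<exists>c0. c - c0 \<in> K \<and> (\<forall>M\<in>Ms. \<forall>v\<in>J. kernel_act J M c0 v = c0 v)"
proof -
  obtain k where k: "k \<in> K" "\<And>u. u \<in> K \<Longrightarrow> hermitian_prod J (c - k) u = 0" using orthogonal_decomposition[OF J K] by blast
  let ?c = "c - k"
  have "kernel_act J M ?c v = ?c v" if M: "M \<in> Ms" and v: "v \<in> J" for M v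
  proof -
    have lin: "kernel_act J M (c - k) = kernel_act J M c - kernel_act J M k"
      by (auto simp: kernel_act_def fun_eq_iff sum_subtractf algebra_simps)
    \<comment> \<open>\<open>e\<close> lies in \<open>K\<close>, because \<open>M\<close> moves
      \<open>c\<close> only by an element of \<open>K\<close> and maps \<open>k\<close> into
      \<open>K\<close>. It is also orthogonal to \<open>K\<close>: \<open>?c\<close> is, and
      \<open>M\<close> can be moved to the other side as \<open>M'\<close>, which preserves
      \<open>K\<close>. Hence \<open>e\<close> vanishes on \<open>J\<close>.\<close>
    define e where "e = kernel_act J M ?c - ?c"
    have "e = (kernel_act J M c - c) - (kernel_act J M k - k)" unfolding e_def lin by simp
    then have eK: "e \<in> K" using c[OF M] inv[OF M k(1)] k(1) complex_subspace_diff[OF K] by simp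
    obtain M' where M': "M' \<in> Ms" "\<forall>v\<in>J. \<forall>w\<in>J. M' v w = cnj (M w v)" using adj[OF M] by blast
    have "hermitian_prod J (kernel_act J M ?c) e = (\<Sum>v\<in>J. \<Sum>w\<in>J. M w v * ?c w * cnj (e v))"
      by (simp add: hermitian_prod_def kernel_act_def sum_distrib_right)
    also have "\<dots> = (\<Sum>w\<in>J. \<Sum>v\<in>J. M w v * ?c w * cnj (e v))" by (rule sum.swap)
    also have "\<dots> = hermitian_prod J ?c (kernel_act J M' e)"
      unfolding hermitian_prod_def kernel_act_def cnj_sum sum_distrib_left
      by (intro sum.cong refl) (use M'(2) in \<open>simp add: algebra_simps\<close>)
    also have "\<dots> = 0" by (rule k(2)[OF inv[OF M'(1) eK]])
    finally have "hermitian_prod J e e = 0" using k(2)[OF eK] by (simp add: e_def hermitian_prod_simps(2))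
    from hermitian_prod_self_eq_0[OF J this v] show ?thesis by (simp add: e_def)
  qed
  moreover have "c - ?c \<in> K" using k by simp
  ultimately show ?thesis by blast
qed

section \<open>Finite generation of invariants\<close>

text \<open>Ordered words, that is tensors, stand for monomials: the action in degree
  \<open>e\<close> is then a tensor power of the given matrix, and its adjoint can be read off
  factor by factor. That a monomial is spelled by several words only adds to an ambiguity of
  coefficients which is dealt with in any case.\<close>

definition words :: "'i set \<Rightarrow> nat \<Rightarrow> 'i list set" where
  "words I e = {w. set w \<subseteq> I \<and> length w = e}"

lemma finite_words: "finite I \<Longrightarrow> finite (words I e)"
  unfolding words_def by (rule finite_lists_length_eq)

lemma words_0: "words I 0 = {[]}"
  by (auto simp: words_def)

lemma sum_words_Suc: "(\<Sum>v\<in>words I (Suc e). F v) = (\<Sum>j\<in>I. \<Sum>v\<in>words I e. F (j # v))"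
proof -
  have "words I (Suc e) = (\<lambda>(j, v). j # v) ` (I \<times> words I e)"
    by (auto simp: words_def length_Suc_conv image_iff)
  moreover have "inj_on (\<lambda>(j, v). j # v) (I \<times> words I e)" by (auto simp: inj_on_def)
  ultimately have "(\<Sum>v\<in>words I (Suc e). F v) = (\<Sum>(j, v)\<in>I \<times> words I e. F (j # v))"
    by (simp add: sum.reindex case_prod_unfold)
  then show ?thesis by (simp add: sum.cartesian_product)
qed

definition word_monomial :: "('i \<Rightarrow> 'a \<Rightarrow> complex) \<Rightarrow> 'i list \<Rightarrow> 'a \<Rightarrow> complex" where
  "word_monomial \<xi> w x = prod_list (map (\<lambda>i. \<xi> i x) w)"

lemma word_monomial_simps: "word_monomial \<xi> [] x = 1" "word_monomial \<xi> (i # w) x = \<xi> i x * word_monomial \<xi> w x" "word_monomial \<xi> (w @ v) x = word_monomial \<xi> w x * word_monomial \<xi> v x"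
  by (simp_all add: word_monomial_def)

text \<open>Matrix entries of the tensor powers of \<rho>.\<close>

fun word_kernel :: "('i \<Rightarrow> 'i \<Rightarrow> complex) \<Rightarrow> 'i list \<Rightarrow> 'i list \<Rightarrow> complex" where
  "word_kernel \<rho> [] [] = 1"
| "word_kernel \<rho> (i # w) (j # v) = \<rho> i j * word_kernel \<rho> w v"
| "word_kernel \<rho> _ _ = 0"

lemma word_monomial_act:
  assumes "\<And>i. i \<in> I \<Longrightarrow> \<xi> i y' = (\<Sum>j\<in>I. \<rho> i j * \<xi> j y)" "w \<in> words I e"
  shows "word_monomial \<xi> w y' = (\<Sum>v\<in>words I e. word_kernel \<rho> w v * word_monomial \<xi> v y)"
  using assms(2)
proof (induction w arbitrary: e)
  case Nil
  then have "e = 0" by (simp add: words_def)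
  then show ?case by (simp add: words_0 word_monomial_simps)
next
  case (Cons i w)
  then obtain e' where e: "e = Suc e'" "w \<in> words I e'" "i \<in> I" by (auto simp: words_def)
  have "word_monomial \<xi> (i # w) y' = (\<Sum>j\<in>I. \<rho> i j * \<xi> j y) * (\<Sum>v\<in>words I e'. word_kernel \<rho> w v * word_monomial \<xi> v y)"
    using Cons.IH[OF e(2)] assms(1)[OF e(3)] by (simp add: word_monomial_simps)
  also have "\<dots> = (\<Sum>v\<in>words I e. word_kernel \<rho> (i # w) v * word_monomial \<xi> v y)"
    by (simp add: e sum_words_Suc sum_product word_monomial_simps algebra_simps)
  finally show ?case .
qed

lemma word_kernel_adjoint:
  assumes "\<And>i j. i \<in> I \<Longrightarrow> j \<in> I \<Longrightarrow> \<rho>' i j = cnj (\<rho> j i)" "v \<in> words I e" "w \<in> words I e"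
  shows "word_kernel \<rho>' v w = cnj (word_kernel \<rho> w v)"
  using assms(2,3)
proof (induction e arbitrary: v w)
  case 0 then show ?case by (simp add: words_0)
next
  case (Suc e)
  obtain i v' where v: "v = i # v'" "i \<in> I" "v' \<in> words I e" using Suc.prems(1) by (cases v) (auto simp: words_def)
  obtain j w' where w: "w = j # w'" "j \<in> I" "w' \<in> words I e" using Suc.prems(2) by (cases w) (auto simp: words_def)
  show ?case using Suc.IH[OF v(3) w(3)] assms(1)[OF v(2) w(2)] by (simp add: v w)
qed

definition homog :: "'i set \<Rightarrow> ('i \<Rightarrow> 'a \<Rightarrow> complex) \<Rightarrow> nat \<Rightarrow> ('i list \<Rightarrow> complex) \<Rightarrow> 'a \<Rightarrow> complex" where
  "homog I \<xi> e c x = (\<Sum>w\<in>words I e. c w * word_monomial \<xi> w x)"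

text \<open>A single \<open>c\<close> serves for all degrees, since a word determines its
  degree.\<close>

definition polyon :: "'i set \<Rightarrow> ('i \<Rightarrow> 'a \<Rightarrow> complex) \<Rightarrow> 'a set \<Rightarrow> ('a \<Rightarrow> complex) \<Rightarrow> bool" where
  "polyon I \<xi> X f \<longleftrightarrow> (\<exists>d c. \<forall>x\<in>X. f x = (\<Sum>e<d. homog I \<xi> e c x))"

lemma homog_tensor_invariant:
  assumes "\<And>i. i \<in> I \<Longrightarrow> \<xi> i y' = (\<Sum>j\<in>I. \<rho> i j * \<xi> j y)"
    and "\<And>v. v \<in> words I e \<Longrightarrow> (\<Sum>w\<in>words I e. word_kernel \<rho> w v * c w) = c v"
  shows "homog I \<xi> e c y' = homog I \<xi> e c y"
proof -
  have "homog I \<xi> e c y' = (\<Sum>w\<in>words I e. \<Sum>v\<in>words I e. word_kernel \<rho> w v * c w * word_monomial \<xi> v y)"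
    unfolding homog_def using word_monomial_act[OF assms(1)]
    by (intro sum.cong refl) (simp add: sum_distrib_left algebra_simps)
  also have "\<dots> = (\<Sum>v\<in>words I e. (\<Sum>w\<in>words I e. word_kernel \<rho> w v * c w) * word_monomial \<xi> v y)"
    unfolding sum_distrib_right by (rule sum.swap)
  finally show ?thesis using assms(2) by (simp add: homog_def)
qed

lemma polyon_single:
  assumes "finite I" "set u \<subseteq> I" shows "polyon I \<xi> X (\<lambda>x. a * word_monomial \<xi> u x)"
  unfolding polyon_def
proof (intro exI ballI)
  fix x
  have h: "homog I \<xi> e (\<lambda>w. if w = u then a else 0) x = (if e = length u then a * word_monomial \<xi> u x else 0)" for e
  proof -
    have "homog I \<xi> e (\<lambda>w. if w = u then a else 0) x = (\<Sum>w\<in>words I e. if w = u then a * word_monomial \<xi> w x else 0)"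
      unfolding homog_def by (intro sum.cong) auto
    then show ?thesis using assms finite_words[OF assms(1), of e] by (auto simp: sum.delta' words_def)
  qed
  show "a * word_monomial \<xi> u x = (\<Sum>e<Suc (length u). homog I \<xi> e (\<lambda>w. if w = u then a else 0) x)"
    unfolding h by simp
qed

lemma polyon_add:
  assumes "polyon I \<xi> X f" "polyon I \<xi> X g" shows "polyon I \<xi> X (\<lambda>x. f x + g x)"
proof -
  obtain d c where 1: "\<forall>x\<in>X. f x = (\<Sum>e<d. homog I \<xi> e c x)" using assms(1) by (auto simp: polyon_def)
  obtain d' c' where 2: "\<forall>x\<in>X. g x = (\<Sum>e<d'. homog I \<xi> e c' x)" using assms(2) by (auto simp: polyon_def)
  \<comment> \<open>The coefficient functions are arbitrary beyond degrees \<open>d\<close> and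
    \<open>d'\<close>, so they are cut off before being added.\<close>
  define t where "t d c w = (if length w < d then c w else 0)" for d and c :: "'a list \<Rightarrow> complex" and w
  have t: "homog I \<xi> e (t d c) x = (if e < d then homog I \<xi> e c x else 0)" for e d c x
    unfolding homog_def by (auto simp: t_def words_def intro!: sum.cong sum.neutral)
  have s: "(\<Sum>e<max d d'. homog I \<xi> e (t k c) x) = (\<Sum>e<k. homog I \<xi> e c x)" if "k \<le> max d d'" for k c x
  proof -
    have "(\<Sum>e<max d d'. homog I \<xi> e (t k c) x) = (\<Sum>e<k. homog I \<xi> e (t k c) x)"
      using that by (intro sum.mono_neutral_right) (auto simp: t)
    then show ?thesis by (simp add: t)
  qed
  have a: "homog I \<xi> e (\<lambda>w. t d c w + t d' c' w) x = homog I \<xi> e (t d c) x + homog I \<xi> e (t d' c') x" for e x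
    by (simp add: homog_def sum.distrib algebra_simps)
  have "\<forall>x\<in>X. f x + g x = (\<Sum>e<max d d'. homog I \<xi> e (\<lambda>w. t d c w + t d' c' w) x)"
    unfolding a sum.distrib using 1 2 s[of d c] s[of d' c'] by simp
  then show ?thesis unfolding polyon_def by blast
qed

lemma polyon_zero: "polyon I \<xi> X (\<lambda>x. 0)"
  unfolding polyon_def by (intro exI[of _ 0]) simp

lemma polyon_sum: "(\<And>i. i \<in> S \<Longrightarrow> polyon I \<xi> X (f i)) \<Longrightarrow> polyon I \<xi> X (\<lambda>x. \<Sum>i\<in>S. f i x)"
  by (induction S rule: infinite_finite_induct) (auto intro: polyon_zero polyon_add)

lemma polyon_cong: "polyon I \<xi> X f \<Longrightarrow> (\<And>x. x \<in> X \<Longrightarrow> g x = f x) \<Longrightarrow> polyon I \<xi> X g"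
  unfolding polyon_def by simp

lemma polyon_mult:
  assumes I: "finite I" and "polyon I \<xi> X f" "polyon I \<xi> X g" shows "polyon I \<xi> X (\<lambda>x. f x * g x)"
proof -
  obtain d c where 1: "\<forall>x\<in>X. f x = (\<Sum>e<d. homog I \<xi> e c x)" using assms(2) by (auto simp: polyon_def)
  obtain d' c' where 2: "\<forall>x\<in>X. g x = (\<Sum>e<d'. homog I \<xi> e c' x)" using assms(3) by (auto simp: polyon_def)
  have "polyon I \<xi> X (\<lambda>x. \<Sum>e<d. \<Sum>e'<d'. \<Sum>w\<in>words I e. \<Sum>v\<in>words I e'. c w * c' v * word_monomial \<xi> (w @ v) x)"
    by (intro polyon_sum polyon_single[OF I]) (auto simp: words_def)
  then show ?thesis
  proof (rule polyon_cong)
    fix x assume x: "x \<in> X"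
    show "f x * g x = (\<Sum>e<d. \<Sum>e'<d'. \<Sum>w\<in>words I e. \<Sum>v\<in>words I e'. c w * c' v * word_monomial \<xi> (w @ v) x)"
      unfolding 1[rule_format, OF x] 2[rule_format, OF x] homog_def sum_product word_monomial_simps
      by (intro sum.cong refl) (simp add: mult_ac)
  qed
qed

lemma polyon_const: "finite I \<Longrightarrow> polyon I \<xi> X (\<lambda>x. a)"
  using polyon_single[of I "[]" \<xi> X a] by (simp add: word_monomial_simps)

lemma polyon_coord: "finite I \<Longrightarrow> i \<in> I \<Longrightarrow> polyon I \<xi> X (\<xi> i)"
  using polyon_single[of I "[i]" \<xi> X 1] by (simp add: word_monomial_simps)

lemma polyon_prod:
  "finite I \<Longrightarrow> (\<And>i. i \<in> S \<Longrightarrow> polyon I \<xi> X (f i)) \<Longrightarrow> polyon I \<xi> X (\<lambda>x. \<Prod>i\<in>S. f i x)"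
  by (induction S rule: infinite_finite_induct) (auto intro: polyon_const polyon_mult)

lemma polyon_adjoin:
  assumes "finite I" "f \<in> adjoin const_funs (\<xi> ` I)" shows "polyon I \<xi> X f"
  using assms(2)
proof (induction rule: adjoin.induct)
  case (base k) then show ?case using polyon_const[OF assms(1)] by (auto simp: const_funs_def)
next
  case (gen x) then show ?case using polyon_coord[OF assms(1)] by auto
next
  case (add a b) then show ?case using polyon_add[of I \<xi> X a b] by (simp add: plus_fun_def)
next
  case (mult a b) then show ?case using polyon_mult[OF assms(1), of \<xi> X a b] by (simp add: times_fun_def)
qed

lemma sum_apply: "(\<Sum>i\<in>S. f i) x = (\<Sum>i\<in>S. (f i x :: complex))"
  by (induction S rule: infinite_finite_induct) auto

lemma homog_adjoin:
  assumes I: "finite I" shows "homog I \<xi> e c \<in> adjoin const_funs (\<xi> ` I)"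
proof -
  note S = is_subring_adjoin[OF is_subring_const]
  have k: "(\<lambda>x. a) \<in> adjoin const_funs (\<xi> ` I)" for a by (rule adjoin.base) (auto simp: const_funs_def)
  have m: "word_monomial \<xi> w \<in> adjoin const_funs (\<xi> ` I)" if "set w \<subseteq> I" for w
    using that
  proof (induction w)
    case Nil
    have "word_monomial \<xi> [] = (\<lambda>x. 1)" by (auto simp: word_monomial_simps)
    then show ?case using k by simp
  next
    case (Cons i w)
    then have "\<xi> i * word_monomial \<xi> w \<in> adjoin const_funs (\<xi> ` I)" by (auto intro: adjoin.intros)
    moreover have "word_monomial \<xi> (i # w) = \<xi> i * word_monomial \<xi> w" by (auto simp: word_monomial_simps)
    ultimately show ?case by (simp only:)
  qed
  have "(\<Sum>w\<in>words I e. (\<lambda>x. c w) * word_monomial \<xi> w) \<in> adjoin const_funs (\<xi> ` I)"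
    by (intro is_subring_sum[OF S] adjoin.mult k m) (auto simp: words_def)
  moreover have "(\<Sum>w\<in>words I e. (\<lambda>x. c w) * word_monomial \<xi> w) = homog I \<xi> e c"
    by (rule ext) (simp add: sum_apply homog_def)
  ultimately show ?thesis by simp
qed

lemma idl_finite_rep:
  assumes A: "is_subring A" and F: "finite F" and "p \<in> idl A F"
  shows "\<exists>a. (\<forall>f\<in>F. a f \<in> A) \<and> p = (\<Sum>f\<in>F. a f * f)"
  using assms(3)
proof (induction rule: idl.induct)
  case zero
  show ?case using is_subringD(4)[OF A] by (intro exI[of _ "\<lambda>_. 0"]) simp
next
  case (step p b g)
  then obtain a where a: "\<forall>f\<in>F. a f \<in> A" "p = (\<Sum>f\<in>F. a f * f)" by blast
  have "(\<Sum>f\<in>F. (a f + (if f = g then b else 0)) * f) = p + b * g"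
  proof -
    have "(\<Sum>f\<in>F. (a f + (if f = g then b else 0)) * f) = (\<Sum>f\<in>F. a f * f + (if f = g then b * f else 0))"
      by (intro sum.cong) (auto simp: algebra_simps)
    then show ?thesis using F step a by (simp add: sum.distrib sum.delta)
  qed
  moreover have "\<forall>f\<in>F. a f + (if f = g then b else 0) \<in> A" using a step is_subringD(2,4)[OF A] by auto
  ultimately show ?case by (intro exI[of _ "\<lambda>f. a f + (if f = g then b else 0)"] conjI) simp_all
qed

text \<open>Two polynomials in \<open>t\<close> that agree for all \<open>t \<noteq> 0\<close> have
  the same coefficient of \<open>t^e\<close>. This isolates homogeneous parts of functions that are
  known only on a set stable under scaling.\<close>

lemma scaling_coefficient:
  fixes B :: "'p \<Rightarrow> complex"
  assumes "finite S" "\<And>t. t \<noteq> 0 \<Longrightarrow> (\<Sum>p\<in>S. t ^ \<epsilon> p * B p) = t ^ e * H"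
  shows "H = (\<Sum>p\<in>S. if \<epsilon> p = e then B p else 0)"
proof -
  define P where "P = (\<Sum>p\<in>S. monom (B p) (\<epsilon> p)) - monom H e"
  have P: "poly P t = 0" if "t \<noteq> 0" for t
    using assms(2)[OF that] by (simp add: P_def poly_sum poly_monom mult.commute)
  have "P = 0"
  proof (rule ccontr)
    assume "P \<noteq> 0"
    then have "finite {t. poly P t = 0}" by (rule poly_roots_finite)
    moreover have "UNIV - {0} \<subseteq> {t. poly P t = 0}" using P by auto
    moreover have "infinite (UNIV - {0 :: complex})" by (simp add: infinite_UNIV_char_0)
    ultimately show False using finite_subset by blast
  qed
  then have "coeff P e = 0" by simp
  then show ?thesis by (simp add: P_def coeff_sum)
qed

text \<open>\<open>X\<close> is a subset of a linear representation, later the representation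
  variety inside the pairs of matrices. Closure under \<open>star\<close> does the work of
  integration over a compact group, and the scalings \<open>sc\<close> provide the grading.\<close>

locale linear_action =
  fixes I :: "'i set" and \<xi> :: "'i \<Rightarrow> 'a \<Rightarrow> complex" and X :: "'a set"
    and G :: "'g set" and \<rho> :: "'g \<Rightarrow> 'i \<Rightarrow> 'i \<Rightarrow> complex" and act :: "'g \<Rightarrow> 'a \<Rightarrow> 'a" and star :: "'g \<Rightarrow> 'g"
    and sc :: "complex \<Rightarrow> 'a \<Rightarrow> 'a"
  assumes I: "finite I"
    and act_X: "g \<in> G \<Longrightarrow> x \<in> X \<Longrightarrow> act g x \<in> X"
    and act_coord: "g \<in> G \<Longrightarrow> x \<in> X \<Longrightarrow> i \<in> I \<Longrightarrow> \<xi> i (act g x) = (\<Sum>j\<in>I. \<rho> g i j * \<xi> j x)"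
    and star_G: "g \<in> G \<Longrightarrow> star g \<in> G"
    and star: "g \<in> G \<Longrightarrow> i \<in> I \<Longrightarrow> j \<in> I \<Longrightarrow> \<rho> (star g) i j = cnj (\<rho> g j i)"
    and sc_X: "t \<noteq> 0 \<Longrightarrow> x \<in> X \<Longrightarrow> sc t x \<in> X"
    and sc_coord: "x \<in> X \<Longrightarrow> i \<in> I \<Longrightarrow> \<xi> i (sc t x) = t * \<xi> i x"
begin

definition invar :: "('a \<Rightarrow> complex) \<Rightarrow> bool" where
  "invar f \<longleftrightarrow> (\<forall>g\<in>G. \<forall>x\<in>X. f (act g x) = f x)"

text \<open>The substitute for the Reynolds operator. Coefficient vectors are indexed by pairs of
  some \<open>s\<close> and a word, and \<open>K\<close> consists of those that give the zero
  function on \<open>X\<close>. As \<open>f\<close> and all \<open>fs s\<close> are invariant, the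
  action changes the coefficients of \<open>f\<close> by elements of \<open>K\<close>, so
  \<open>lift_invariant_vector\<close> finds coefficients of \<open>f\<close> that are
  fixed.\<close>

lemma lift_tensor:
  fixes T :: "'s set" and fs :: "'s \<Rightarrow> 'a \<Rightarrow> complex"
  assumes T: "finite T" and f: "invar f" and fs: "\<And>s. s \<in> T \<Longrightarrow> invar (fs s)"
    and rep: "\<And>x. x \<in> X \<Longrightarrow> f x = (\<Sum>s\<in>T. homog I \<xi> (l s) (c s) x * fs s x)"
  shows "\<exists>c0. (\<forall>x\<in>X. f x = (\<Sum>s\<in>T. homog I \<xi> (l s) (c0 s) x * fs s x)) \<and>
    (\<forall>g\<in>G. \<forall>s\<in>T. \<forall>v\<in>words I (l s). (\<Sum>w\<in>words I (l s). word_kernel (\<rho> g) w v * c0 s w) = c0 s v)"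
proof -
  define J where "J = Sigma T (\<lambda>s. words I (l s))"
  have finJ: "finite J" unfolding J_def using T finite_words[OF I] by auto
  have sumJ: "(\<Sum>p\<in>J. F (fst p) (snd p)) = (\<Sum>s\<in>T. \<Sum>w\<in>words I (l s). F s w)"
    for F :: "'s \<Rightarrow> 'i list \<Rightarrow> complex"
    unfolding J_def using T finite_words[OF I] by (subst sum.Sigma) (auto simp: case_prod_unfold)
  define \<Phi> where "\<Phi> c x = (\<Sum>p\<in>J. c p * word_monomial \<xi> (snd p) x * fs (fst p) x)" for c x
  have \<Phi>: "\<Phi> c x = (\<Sum>s\<in>T. homog I \<xi> (l s) (\<lambda>w. c (s, w)) x * fs s x)" for c x
    unfolding \<Phi>_def homog_def sum_distrib_right
    using sumJ[of "\<lambda>s w. c (s, w) * word_monomial \<xi> w x * fs s x"] by simp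
  define M where "M g p r = (if fst p = fst r then word_kernel (\<rho> g) (snd p) (snd r) else 0)" for g and p r :: "'s \<times> 'i list"
  define K where "K = {c. \<forall>x\<in>X. \<Phi> c x = 0}"
  have delta: "(\<Sum>p\<in>J. if s = fst p then F (snd p) else 0) = (\<Sum>w\<in>words I (l s). F w)" if "s \<in> T"
    for s and F :: "'i list \<Rightarrow> complex"
  proof -
    have "(\<Sum>p\<in>J. if s = fst p then F (snd p) else 0) = (\<Sum>s'\<in>T. \<Sum>w\<in>words I (l s'). if s = s' then F w else 0)"
      by (rule sumJ)
    also have "\<dots> = (\<Sum>s'\<in>T. if s = s' then \<Sum>w\<in>words I (l s'). F w else 0)" by (intro sum.cong) auto
    finally show ?thesis using T that by (simp add: sum.delta)
  qed
  \<comment> \<open>Since each \<open>fs s\<close> is invariant, the action falls on the words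
    alone.\<close>
  have equiv: "\<Phi> (kernel_act J (M g) c) x = \<Phi> c (act g x)" if g: "g \<in> G" and x: "x \<in> X" for g c x
  proof -
    have "\<Phi> c (act g x) = (\<Sum>p\<in>J. \<Sum>r\<in>J. M g p r * c p * word_monomial \<xi> (snd r) x * fs (fst r) x)"
      unfolding \<Phi>_def
    proof (rule sum.cong[OF refl])
      fix p assume p: "p \<in> J"
      then have pT: "fst p \<in> T" "snd p \<in> words I (l (fst p))" by (auto simp: J_def)
      have "word_monomial \<xi> (snd p) (act g x) = (\<Sum>v\<in>words I (l (fst p)). word_kernel (\<rho> g) (snd p) v * word_monomial \<xi> v x)"
        by (rule word_monomial_act[OF act_coord[OF g x] pT(2)])
      moreover have "fs (fst p) (act g x) = fs (fst p) x" using fs[OF pT(1)] g x by (simp add: invar_def)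
      ultimately have "c p * word_monomial \<xi> (snd p) (act g x) * fs (fst p) (act g x) =
         (\<Sum>v\<in>words I (l (fst p)). word_kernel (\<rho> g) (snd p) v * c p * word_monomial \<xi> v x * fs (fst p) x)"
        by (simp add: sum_distrib_left sum_distrib_right mult_ac)
      also have "\<dots> = (\<Sum>r\<in>J. if fst p = fst r then word_kernel (\<rho> g) (snd p) (snd r) * c p * word_monomial \<xi> (snd r) x * fs (fst p) x else 0)"
        by (rule delta[OF pT(1), symmetric])
      also have "\<dots> = (\<Sum>r\<in>J. M g p r * c p * word_monomial \<xi> (snd r) x * fs (fst r) x)"
        by (rule sum.cong) (auto simp: M_def)
      finally show "c p * word_monomial \<xi> (snd p) (act g x) * fs (fst p) (act g x) =
         (\<Sum>r\<in>J. M g p r * c p * word_monomial \<xi> (snd r) x * fs (fst r) x)" .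
    qed
    also have "\<dots> = (\<Sum>r\<in>J. \<Sum>p\<in>J. M g p r * c p * word_monomial \<xi> (snd r) x * fs (fst r) x)" by (rule sum.swap)
    also have "\<dots> = \<Phi> (kernel_act J (M g) c) x" unfolding \<Phi>_def kernel_act_def by (simp only: sum_distrib_right)
    finally show ?thesis ..
  qed
  have lin: "\<Phi> (u - v) x = \<Phi> u x - \<Phi> v x" "\<Phi> (u + v) x = \<Phi> u x + \<Phi> v x" "\<Phi> (\<lambda>p. a * u p) x = a * \<Phi> u x" for u v a x
    by (simp_all add: \<Phi>_def sum_subtractf sum.distrib sum_distrib_left algebra_simps)
  let ?c = "\<lambda>p. c (fst p) (snd p)"
  have fc: "f x = \<Phi> ?c x" if "x \<in> X" for x using rep[OF that] unfolding \<Phi> by simp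
  have "\<exists>c0. ?c - c0 \<in> K \<and> (\<forall>m\<in>M ` G. \<forall>v\<in>J. kernel_act J m c0 v = c0 v)"
  proof (rule lift_invariant_vector[OF finJ])
    show "complex_subspace K" unfolding complex_subspace_def K_def by (auto simp: lin \<Phi>_def[of 0])
    show "v \<in> K" if "u \<in> K" "\<And>j. j \<in> J \<Longrightarrow> u j = v j" for u v
    proof -
      have "\<Phi> v x = \<Phi> u x" for x unfolding \<Phi>_def using that(2) by (intro sum.cong) auto
      then show ?thesis using that(1) by (simp add: K_def)
    qed
    show "\<exists>M'\<in>M ` G. \<forall>v\<in>J. \<forall>w\<in>J. M' v w = cnj (m w v)" if m: "m \<in> M ` G" for m
    proof -
      obtain g where g: "g \<in> G" "m = M g" using m by blast
      have "M (star g) v w = cnj (M g w v)" if "v \<in> J" "w \<in> J" for v w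
      proof (cases "fst v = fst w")
        case True
        have "word_kernel (\<rho> (star g)) (snd v) (snd w) = cnj (word_kernel (\<rho> g) (snd w) (snd v))"
          by (rule word_kernel_adjoint[OF star[OF g(1)], where e = "l (fst v)"]) (use that True in \<open>auto simp: J_def\<close>)
        then show ?thesis using True by (simp add: M_def)
      qed (auto simp: M_def)
      then show ?thesis using g star_G by blast
    qed
    show "kernel_act J m u \<in> K" if "m \<in> M ` G" "u \<in> K" for m u
      using that equiv act_X by (auto simp: K_def)
    show "kernel_act J m ?c - ?c \<in> K" if "m \<in> M ` G" for m
    proof -
      obtain g where g: "g \<in> G" "m = M g" using \<open>m \<in> M ` G\<close> by blast
      have "\<Phi> (kernel_act J m ?c - ?c) x = 0" if x: "x \<in> X" for x
      proof -
        have "\<Phi> (kernel_act J m ?c - ?c) x = f (act g x) - f x"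
          using fc[OF x] fc[OF act_X[OF g(1) x]] by (simp only: lin g(2) equiv[OF g(1) x])
        then show ?thesis using f g x by (simp add: invar_def)
      qed
      then show ?thesis by (simp add: K_def)
    qed
  qed
  then obtain c0 where c0: "?c - c0 \<in> K" "\<And>g v. g \<in> G \<Longrightarrow> v \<in> J \<Longrightarrow> kernel_act J (M g) c0 v = c0 v" by blast
  have "f x = \<Phi> c0 x" if "x \<in> X" for x
  proof -
    have "\<Phi> (?c - c0) x = 0" using c0(1) that by (simp add: K_def)
    then show ?thesis using fc[OF that] by (simp only: lin right_minus_eq)
  qed
  moreover have "(\<Sum>w\<in>words I (l s). word_kernel (\<rho> g) w v * c0 (s, w)) = c0 (s, v)"
    if "g \<in> G" "s \<in> T" "v \<in> words I (l s)" for g s v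
  proof -
    have "kernel_act J (M g) c0 (s, v) = (\<Sum>p\<in>J. if s = fst p then word_kernel (\<rho> g) (snd p) v * c0 (s, snd p) else 0)"
      unfolding kernel_act_def by (rule sum.cong) (auto simp: M_def)
    also have "\<dots> = (\<Sum>w\<in>words I (l s). word_kernel (\<rho> g) w v * c0 (s, w))" by (rule delta[OF that(2)])
    finally show ?thesis using c0(2)[of g "(s, v)"] that by (simp add: J_def)
  qed
  ultimately show ?thesis unfolding \<Phi> by (intro exI[of _ "\<lambda>s w. c0 (s, w)"]) auto
qed

text \<open>The case of \<open>lift_tensor\<close> with the degrees as index set and each
  \<open>fs s\<close> equal to 1. The gain is outside \<open>X\<close>: fixed coefficients make the
  same expression invariant at any two points whose coordinates are related by the matrices, in
  \<open>X\<close> or not.\<close>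

theorem lift_invariant:
  assumes "polyon I \<xi> X f" "invar f"
  shows "\<exists>d c. (\<forall>x\<in>X. f x = (\<Sum>e<d. homog I \<xi> e c x)) \<and>
    (\<forall>g\<in>G. \<forall>y y'. (\<forall>i\<in>I. \<xi> i y' = (\<Sum>j\<in>I. \<rho> g i j * \<xi> j y)) \<longrightarrow>
       (\<Sum>e<d. homog I \<xi> e c y') = (\<Sum>e<d. homog I \<xi> e c y))"
proof -
  obtain d c where dc: "\<forall>x\<in>X. f x = (\<Sum>e<d. homog I \<xi> e c x)" using assms(1) by (auto simp: polyon_def)
  have "\<exists>c0. (\<forall>x\<in>X. f x = (\<Sum>s\<in>{..<d}. homog I \<xi> s (c0 s) x * (\<lambda>_ _. 1) s x)) \<and>
    (\<forall>g\<in>G. \<forall>s\<in>{..<d}. \<forall>v\<in>words I s. (\<Sum>w\<in>words I s. word_kernel (\<rho> g) w v * c0 s w) = c0 s v)"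
    by (rule lift_tensor[where c = "\<lambda>_. c"]) (use assms dc in \<open>auto simp: invar_def\<close>)
  then obtain c0 where c0: "\<forall>x\<in>X. f x = (\<Sum>s<d. homog I \<xi> s (c0 s) x)"
    "\<forall>g\<in>G. \<forall>s\<in>{..<d}. \<forall>v\<in>words I s. (\<Sum>w\<in>words I s. word_kernel (\<rho> g) w v * c0 s w) = c0 s v" by auto
  define b where "b w = c0 (length w) w" for w
  have b: "b w = c0 e w" if "w \<in> words I e" for e w using that by (simp add: b_def words_def)
  have hb: "homog I \<xi> e b x = homog I \<xi> e (c0 e) x" for e x
    unfolding homog_def by (rule sum.cong) (auto simp: b)
  show ?thesis
  proof (intro exI conjI ballI allI impI)
    show "f x = (\<Sum>e<d. homog I \<xi> e b x)" if "x \<in> X" for x using c0(1) that by (simp add: hb)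
    fix g y y' assume g: "g \<in> G" and y: "\<forall>i\<in>I. \<xi> i y' = (\<Sum>j\<in>I. \<rho> g i j * \<xi> j y)"
    show "(\<Sum>e<d. homog I \<xi> e b y') = (\<Sum>e<d. homog I \<xi> e b y)"
      unfolding hb by (intro sum.cong refl homog_tensor_invariant[where \<rho> = "\<rho> g"]) (use y c0(2) g in auto)
  qed
qed

lemma word_monomial_sc: "x \<in> X \<Longrightarrow> set w \<subseteq> I \<Longrightarrow> word_monomial \<xi> w (sc t x) = t ^ length w * word_monomial \<xi> w x"
  by (induction w) (auto simp: word_monomial_simps sc_coord)

lemma homog_sc: "x \<in> X \<Longrightarrow> homog I \<xi> e c (sc t x) = t ^ e * homog I \<xi> e c x"
  unfolding homog_def sum_distrib_left by (rule sum.cong) (auto simp: words_def word_monomial_sc)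

text \<open>Scaling commutes with the linear action, so invariance of \<open>f\<close> at all
  multiples of \<open>x\<close> is an identity between polynomials in \<open>t\<close>, and it holds
  degree by degree.\<close>

lemma homog_component_invar:
  assumes f: "invar f" "\<And>x. x \<in> X \<Longrightarrow> f x = (\<Sum>e<d. homog I \<xi> e c x)" and e: "e < d"
  shows "invar (homog I \<xi> e c)"
  unfolding invar_def
proof (intro ballI)
  fix g x assume g: "g \<in> G" and x: "x \<in> X"
  have gx: "act g x \<in> X" by (rule act_X[OF g x])
  have "0 = (\<Sum>k<d. if k = e then homog I \<xi> k c (act g x) - homog I \<xi> k c x else 0)"
  proof (rule scaling_coefficient)
    fix t :: complex assume t: "t \<noteq> 0"
    \<comment> \<open>\<open>act\<close> and \<open>sc\<close> are known through coordinates only,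
      so they commute as far as monomials can see.\<close>
    have eq: "word_monomial \<xi> w (sc t (act g x)) = word_monomial \<xi> w (act g (sc t x))" if "set w \<subseteq> I" for w
      using that
    proof (induction w)
      case (Cons i w)
      then have i: "i \<in> I" by simp
      have "\<xi> i (sc t (act g x)) = t * (\<Sum>j\<in>I. \<rho> g i j * \<xi> j x)" by (simp add: sc_coord[OF gx i] act_coord[OF g x i])
      also have "\<dots> = \<xi> i (act g (sc t x))"
        unfolding act_coord[OF g sc_X[OF t x] i] by (simp add: sum_distrib_left sc_coord[OF x] mult_ac)
      finally show ?case using Cons by (simp add: word_monomial_simps)
    qed (simp add: word_monomial_simps)
    have "homog I \<xi> k c (sc t (act g x)) = homog I \<xi> k c (act g (sc t x))" for k
      unfolding homog_def by (rule sum.cong) (auto simp: words_def eq)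
    then have "f (sc t (act g x)) = f (act g (sc t x))"
      by (simp add: f(2)[OF sc_X[OF t gx]] f(2)[OF act_X[OF g sc_X[OF t x]]])
    also have "\<dots> = f (sc t x)" using f(1) g sc_X[OF t x] by (simp add: invar_def)
    finally have "(\<Sum>k<d. t ^ k * homog I \<xi> k c (act g x)) = (\<Sum>k<d. t ^ k * homog I \<xi> k c x)"
      by (simp add: f(2)[OF sc_X[OF t gx]] f(2)[OF sc_X[OF t x]] homog_sc[OF gx] homog_sc[OF x])
    then show "(\<Sum>k<d. t ^ k * (homog I \<xi> k c (act g x) - homog I \<xi> k c x)) = t ^ e * 0"
      by (simp add: right_diff_distrib sum_subtractf)
  qed simp
  then show "homog I \<xi> e c (act g x) = homog I \<xi> e c x" using e by (simp add: sum.delta)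
qed

text \<open>Hilbert's induction: finitely many members \<open>F\<close> generate the ideal of all
  homogeneous invariants of positive degree. An invariant of degree \<open>e\<close> is a
  combination of elements of \<open>F\<close>; the coefficients can be taken homogeneous of degree
  \<open>e - dg f\<close> and then, by \<open>lift_tensor\<close>, invariant. Their degree is
  smaller, so the induction applies to them.\<close>

theorem invariants_finitely_generated:
  "\<exists>F. finite F \<and> (\<forall>f\<in>F. polyon I \<xi> X f \<and> invar f) \<and>
     (\<forall>f. polyon I \<xi> X f \<longrightarrow> invar f \<longrightarrow> restrict f X \<in> generated_algebra X F)"
proof -
  let ?P = "adjoin const_funs (\<xi> ` I)"
  note P = is_subring_adjoin[OF is_subring_const, of "\<xi> ` I"]
  define H where "H = {f. \<exists>e c. e \<ge> 1 \<and> f = homog I \<xi> e c \<and> invar f}"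
  have HP: "H \<subseteq> ?P" using homog_adjoin[OF I] by (auto simp: H_def)
  have "noeth ?P" by (rule Hilbert_basis[OF is_subring_const noeth_const]) (use I in simp)
  from noethD[OF this HP] obtain F where F: "F \<subseteq> H" "finite F" "H \<subseteq> idl ?P F" by blast
  have "\<forall>f\<in>F. \<exists>e c. e \<ge> 1 \<and> f = homog I \<xi> e c \<and> invar f" using F(1) by (auto simp: H_def)
  then obtain dg cf where dg: "\<And>f. f \<in> F \<Longrightarrow> dg f \<ge> 1 \<and> f = homog I \<xi> (dg f) (cf f) \<and> invar f" by metis
  have main: "restrict (homog I \<xi> e c) X \<in> generated_algebra X F" if "invar (homog I \<xi> e c)" for e c
    using that
  proof (induction e arbitrary: c rule: less_induct)
    case (less e)
    let ?h = "homog I \<xi> e c"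
    show ?case
    proof (cases "e = 0")
      case True
      have "restrict ?h X = (\<lambda>x\<in>X. c [])" by (auto simp: True homog_def words_0 word_monomial_simps restrict_def)
      then show ?thesis by (simp only: generated_algebra.const)
    next
      case False
      then have "?h \<in> H" using less.prems unfolding H_def by (intro CollectI exI[of _ e] exI[of _ c]) auto
      then have "?h \<in> idl ?P F" using F(3) by blast
      from idl_finite_rep[OF P F(2) this] obtain a where a: "\<forall>f\<in>F. a f \<in> ?P" "?h = (\<Sum>f\<in>F. a f * f)" by blast
      have "\<forall>f\<in>F. polyon I \<xi> X (a f)" using a(1) polyon_adjoin[OF I] by blast
      then obtain N b where N: "\<And>f x. f \<in> F \<Longrightarrow> x \<in> X \<Longrightarrow> a f x = (\<Sum>k<N f. homog I \<xi> k (b f) x)"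
        unfolding polyon_def by metis
      \<comment> \<open>Terms without a component in degree \<open>e - dg f\<close> are dropped by
        replacing \<open>f\<close> with 0; the test \<open>dg f \<le> e\<close> guards the truncated
        subtraction.\<close>
      define fs where "fs f = (if dg f \<le> e \<and> e - dg f < N f then f else (\<lambda>_. 0))" for f
      \<comment> \<open>The expression for \<open>?h\<close> is evaluated at \<open>sc t x\<close>;
        as \<open>?h\<close> and the members of \<open>F\<close> are homogeneous, comparing
        coefficients of \<open>t^e\<close> leaves one degree of each coefficient.\<close>
      have rep: "?h x = (\<Sum>f\<in>F. homog I \<xi> (e - dg f) (b f) x * fs f x)" if x: "x \<in> X" for x
      proof -
        have "?h x = (\<Sum>p\<in>Sigma F (\<lambda>f. {..<N f}).
            if snd p + dg (fst p) = e then homog I \<xi> (snd p) (b (fst p)) x * fst p x else 0)"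
        proof (rule scaling_coefficient)
          show "finite (Sigma F (\<lambda>f. {..<N f}))" using F(2) by simp
          fix t :: complex assume t: "t \<noteq> 0"
          have sx: "sc t x \<in> X" by (rule sc_X[OF t x])
          have "t ^ e * ?h x = ?h (sc t x)" by (simp add: homog_sc[OF x])
          also have "\<dots> = (\<Sum>f\<in>F. a f (sc t x) * f (sc t x))" by (subst a(2)) (simp add: sum_apply)
          also have "\<dots> = (\<Sum>f\<in>F. \<Sum>k<N f. t ^ (k + dg f) * (homog I \<xi> k (b f) x * f x))"
          proof (rule sum.cong[OF refl])
            fix f assume f: "f \<in> F"
            have "f (sc t x) = t ^ dg f * f x" using dg[OF f] homog_sc[OF x] by metis
            then show "a f (sc t x) * f (sc t x) = (\<Sum>k<N f. t ^ (k + dg f) * (homog I \<xi> k (b f) x * f x))"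
              using N[OF f sx] by (simp add: homog_sc[OF x] sum_distrib_right sum_distrib_left power_add mult_ac)
          qed
          also have "\<dots> = (\<Sum>p\<in>Sigma F (\<lambda>f. {..<N f}). t ^ (snd p + dg (fst p)) * (homog I \<xi> (snd p) (b (fst p)) x * fst p x))"
            using F(2) by (subst sum.Sigma) (auto simp: case_prod_unfold)
          finally show "(\<Sum>p\<in>Sigma F (\<lambda>f. {..<N f}). t ^ (snd p + dg (fst p)) * (homog I \<xi> (snd p) (b (fst p)) x * fst p x))
            = t ^ e * ?h x" ..
        qed
        also have "\<dots> = (\<Sum>f\<in>F. \<Sum>k<N f. if k + dg f = e then homog I \<xi> k (b f) x * f x else 0)"
          using F(2) by (subst sum.Sigma) (auto simp: case_prod_unfold)
        also have "\<dots> = (\<Sum>f\<in>F. homog I \<xi> (e - dg f) (b f) x * fs f x)"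
        proof (rule sum.cong[OF refl])
          fix f assume f: "f \<in> F"
          have "(\<Sum>k<N f. if k + dg f = e then homog I \<xi> k (b f) x * f x else 0) =
              (\<Sum>k<N f. if k = e - dg f then (if dg f \<le> e then homog I \<xi> k (b f) x * f x else 0) else 0)"
            using dg[OF f] by (intro sum.cong) auto
          then show "(\<Sum>k<N f. if k + dg f = e then homog I \<xi> k (b f) x * f x else 0) =
              homog I \<xi> (e - dg f) (b f) x * fs f x"
            by (simp add: sum.delta fs_def)
        qed
        finally show ?thesis .
      qed
      have fsi: "invar (fs f)" if "f \<in> F" for f using dg[OF that] by (auto simp: fs_def invar_def)
      have "\<exists>c0. (\<forall>x\<in>X. ?h x = (\<Sum>f\<in>F. homog I \<xi> (e - dg f) (c0 f) x * fs f x)) \<and>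
          (\<forall>g\<in>G. \<forall>f\<in>F. \<forall>v\<in>words I (e - dg f). (\<Sum>w\<in>words I (e - dg f). word_kernel (\<rho> g) w v * c0 f w) = c0 f v)"
        by (rule lift_tensor[OF F(2) less.prems fsi rep])
      then obtain c0 where c0: "\<forall>x\<in>X. ?h x = (\<Sum>f\<in>F. homog I \<xi> (e - dg f) (c0 f) x * fs f x)"
        "\<And>g f v. g \<in> G \<Longrightarrow> f \<in> F \<Longrightarrow> v \<in> words I (e - dg f) \<Longrightarrow>
          (\<Sum>w\<in>words I (e - dg f). word_kernel (\<rho> g) w v * c0 f w) = c0 f v" by blast
      have coeff_inv: "invar (homog I \<xi> (e - dg f) (c0 f))" if f: "f \<in> F" for f
        unfolding invar_def
      proof (intro ballI)
        fix g x assume g: "g \<in> G" and x: "x \<in> X"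
        show "homog I \<xi> (e - dg f) (c0 f) (act g x) = homog I \<xi> (e - dg f) (c0 f) x"
          by (rule homog_tensor_invariant[OF act_coord[OF g x] c0(2)[OF g f]])
      qed
      have alg: "restrict (homog I \<xi> (e - dg f) (c0 f)) X \<in> generated_algebra X F" if f: "f \<in> F" for f
        by (rule less.IH[OF _ coeff_inv[OF f]]) (use dg[OF f] False in auto)
      have fsa: "restrict (fs f) X \<in> generated_algebra X F" if "f \<in> F" for f
        using generated_algebra.gen[OF that, of X] generated_algebra.const[of 0 X F] by (auto simp: fs_def)
      have sums: "(\<lambda>x\<in>X. \<Sum>f\<in>F'. u f x) \<in> generated_algebra X F"
        if "finite F'" "\<And>f. f \<in> F' \<Longrightarrow> restrict (u f) X \<in> generated_algebra X F"
        for F' :: "('a \<Rightarrow> complex) set" and u :: "('a \<Rightarrow> complex) \<Rightarrow> 'a \<Rightarrow> complex"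
        using that
      proof (induction F')
        case empty then show ?case by (simp del: restrict_apply add: generated_algebra.const)
      next
        case (insert f F')
        have "(\<lambda>x\<in>X. restrict (u f) X x + (\<lambda>x\<in>X. \<Sum>f\<in>F'. u f x) x) \<in> generated_algebra X F"
          using insert by (intro generated_algebra.add) (auto simp del: restrict_apply)
        moreover have "(\<lambda>x\<in>X. restrict (u f) X x + (\<lambda>x\<in>X. \<Sum>f\<in>F'. u f x) x) = (\<lambda>x\<in>X. \<Sum>f\<in>insert f F'. u f x)"
          using insert by (auto simp: restrict_def fun_eq_iff)
        ultimately show ?case by (simp del: restrict_apply)
      qed
      have "(\<lambda>x\<in>X. \<Sum>f\<in>F. homog I \<xi> (e - dg f) (c0 f) x * fs f x) \<in> generated_algebra X F"
      proof (rule sums[OF F(2)])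
        fix f assume f: "f \<in> F"
        have "(\<lambda>x\<in>X. restrict (homog I \<xi> (e - dg f) (c0 f)) X x * restrict (fs f) X x) \<in> generated_algebra X F"
          by (rule generated_algebra.mult[OF alg[OF f] fsa[OF f]])
        moreover have "(\<lambda>x\<in>X. restrict (homog I \<xi> (e - dg f) (c0 f)) X x * restrict (fs f) X x) =
            (\<lambda>x\<in>X. homog I \<xi> (e - dg f) (c0 f) x * fs f x)" by (auto simp: restrict_def fun_eq_iff)
        ultimately show "(\<lambda>x\<in>X. homog I \<xi> (e - dg f) (c0 f) x * fs f x) \<in> generated_algebra X F" by (simp del: restrict_apply)
      qed
      moreover have "restrict ?h X = (\<lambda>x\<in>X. \<Sum>f\<in>F. homog I \<xi> (e - dg f) (c0 f) x * fs f x)"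
        using c0(1) by (auto simp: restrict_def fun_eq_iff)
      ultimately show ?thesis by (simp del: restrict_apply)
    qed
  qed
  have "restrict f X \<in> generated_algebra X F" if f: "polyon I \<xi> X f" "invar f" for f
  proof -
    obtain d c where dc: "\<And>x. x \<in> X \<Longrightarrow> f x = (\<Sum>e<d. homog I \<xi> e c x)" using f(1) by (auto simp: polyon_def)
    have "(\<lambda>x\<in>X. \<Sum>e<k. homog I \<xi> e c x) \<in> generated_algebra X F" if "k \<le> d" for k
      using that
    proof (induction k)
      case 0 then show ?case by (simp del: restrict_apply add: generated_algebra.const)
    next
      case (Suc k)
      have "restrict (homog I \<xi> k c) X \<in> generated_algebra X F"
        using Suc.prems by (intro main homog_component_invar[OF f(2) dc]) auto
      then have "(\<lambda>x\<in>X. (\<lambda>x\<in>X. \<Sum>e<k. homog I \<xi> e c x) x + restrict (homog I \<xi> k c) X x) \<in> generated_algebra X F"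
        using Suc by (intro generated_algebra.add) (auto simp del: restrict_apply)
      moreover have "(\<lambda>x\<in>X. (\<lambda>x\<in>X. \<Sum>e<k. homog I \<xi> e c x) x + restrict (homog I \<xi> k c) X x) =
         (\<lambda>x\<in>X. \<Sum>e<Suc k. homog I \<xi> e c x)" by (auto simp: restrict_def fun_eq_iff)
      ultimately show ?case by (simp del: restrict_apply)
    qed
    from this[of d] have "(\<lambda>x\<in>X. \<Sum>e<d. homog I \<xi> e c x) \<in> generated_algebra X F" by (simp del: restrict_apply)
    moreover have "restrict f X = (\<lambda>x\<in>X. \<Sum>e<d. homog I \<xi> e c x)" using dc by (auto simp: restrict_def fun_eq_iff)
    ultimately show ?thesis by (simp del: restrict_apply)
  qed
  moreover have "\<forall>f\<in>F. polyon I \<xi> X f \<and> invar f"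
    using dg polyon_adjoin[OF I] F(1) HP by blast
  ultimately show ?thesis using F(2) by blast
qed

end

section \<open>Representation varieties and conjugation\<close>

context group
begin

lemma conj_mult:
  assumes "g \<in> carrier G" "a \<in> carrier G" "b \<in> carrier G"
  shows "(g \<otimes> a \<otimes> inv g) \<otimes> (g \<otimes> b \<otimes> inv g) = g \<otimes> (a \<otimes> b) \<otimes> inv g"
proof -
  have "(g \<otimes> a \<otimes> inv g) \<otimes> (g \<otimes> b \<otimes> inv g) = g \<otimes> a \<otimes> (inv g \<otimes> g) \<otimes> b \<otimes> inv g"
    using assms by (simp only: m_assoc m_closed inv_closed)
  then show ?thesis using assms by (simp add: m_assoc)
qed

lemma conj_pow:
  assumes "g \<in> carrier G" "a \<in> carrier G"
  shows "(g \<otimes> a \<otimes> inv g) [^] (n::nat) = g \<otimes> (a [^] n) \<otimes> inv g"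
proof (induction n)
  case (Suc n) then show ?case using assms conj_mult[of g "a [^] n" a] by simp
qed (use assms in simp)

lemma commutator_eq_one:
  assumes "a \<in> carrier G" "b \<in> carrier G"
  shows "a \<otimes> b \<otimes> inv a \<otimes> inv b = \<one> \<longleftrightarrow> a \<otimes> b = b \<otimes> a"
proof -
  have "a \<otimes> b \<otimes> inv a \<otimes> inv b = (a \<otimes> b) \<otimes> inv (b \<otimes> a)" using assms by (simp add: inv_mult_group m_assoc)
  moreover have "(a \<otimes> b) \<otimes> inv (b \<otimes> a) = \<one> \<longleftrightarrow> a \<otimes> b = b \<otimes> a"
    using assms by (metis inv_closed inv_inv inv_equality m_closed r_inv)
  ultimately show ?thesis by simp
qed

end

lemma rep_variety_iff:
  assumes "group G" shows "(A, B) \<in> rep_variety n G \<longleftrightarrow> A \<in> carrier G \<and> B \<in> carrier G \<and>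
    (A [^]\<^bsub>G\<^esub> n) \<otimes>\<^bsub>G\<^esub> B = B \<otimes>\<^bsub>G\<^esub> (A [^]\<^bsub>G\<^esub> n)"
proof -
  interpret group G by fact
  show ?thesis using commutator_eq_one by (auto simp: rep_variety_def)
qed

lemma conj_rep_variety:
  assumes "group G" "g \<in> carrier G" "(A, B) \<in> rep_variety n G"
  shows "(g \<otimes>\<^bsub>G\<^esub> A \<otimes>\<^bsub>G\<^esub> inv\<^bsub>G\<^esub> g, g \<otimes>\<^bsub>G\<^esub> B \<otimes>\<^bsub>G\<^esub> inv\<^bsub>G\<^esub> g) \<in> rep_variety n G"
proof -
  interpret group G by fact
  have AB: "A \<in> carrier G" "B \<in> carrier G" "(A [^]\<^bsub>G\<^esub> n) \<otimes>\<^bsub>G\<^esub> B = B \<otimes>\<^bsub>G\<^esub> (A [^]\<^bsub>G\<^esub> n)"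
    using assms(3) by (auto simp: rep_variety_iff[OF assms(1)])
  show ?thesis unfolding rep_variety_iff[OF assms(1)]
    using AB assms(2) by (simp add: conj_pow conj_mult)
qed

lemma rep_ring_gens:
  assumes "i < N" "j < N"
  shows "(\<lambda>z\<in>rep_variety n G. fst z $$ (i, j)) \<in> rep_ring n N G"
    "(\<lambda>z\<in>rep_variety n G. snd z $$ (i, j)) \<in> rep_ring n N G"
  unfolding rep_ring_def using assms
  by (intro generated_algebra.gen UnI1, auto simp: case_prod_unfold)+

lemma rep_ring_dets:
  shows "(\<lambda>z\<in>rep_variety n G. 1 / det (fst z)) \<in> rep_ring n N G"
    "(\<lambda>z\<in>rep_variety n G. 1 / det (snd z)) \<in> rep_ring n N G"
  unfolding rep_ring_def
  by (intro generated_algebra.gen UnI2, auto simp: case_prod_unfold)+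

lemma subalg_rep_ring: "subalg (rep_variety n G) (rep_ring n N G)"
  unfolding rep_ring_def by (rule subalg_generated)

text \<open>Structural induction on the coordinate ring in the form of an inclusion: later arguments
  exhibit a subalgebra and check the generators.\<close>

lemma rep_ring_subset:
  assumes A: "subalg (rep_variety n G) A"
    and "\<And>i j. i < N \<Longrightarrow> j < N \<Longrightarrow> (\<lambda>z\<in>rep_variety n G. fst z $$ (i, j)) \<in> A"
    and "\<And>i j. i < N \<Longrightarrow> j < N \<Longrightarrow> (\<lambda>z\<in>rep_variety n G. snd z $$ (i, j)) \<in> A"
    and "(\<lambda>z\<in>rep_variety n G. 1 / det (fst z)) \<in> A" "(\<lambda>z\<in>rep_variety n G. 1 / det (snd z)) \<in> A"
  shows "rep_ring n N G \<subseteq> A"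
proof
  fix f assume "f \<in> rep_ring n N G"
  then show "f \<in> A" unfolding rep_ring_def
  proof (induction rule: generated_algebra.induct)
    case (gen g)
    then consider i j where "i < N" "j < N" "g = (\<lambda>z. fst z $$ (i, j))" | i j where "i < N" "j < N" "g = (\<lambda>z. snd z $$ (i, j))"
      | "g = (\<lambda>z. 1 / det (fst z))" | "g = (\<lambda>z. 1 / det (snd z))"
      by (auto simp: case_prod_unfold)
    then show "restrict g (rep_variety n G) \<in> A" by cases (use assms(2-5) in \<open>simp_all del: restrict_apply\<close>)
  qed (use subalgD[OF A] in \<open>simp_all del: restrict_apply\<close>)
qed

lemma invariant_ringI:
  assumes "f \<in> rep_ring n N G"
    and "\<And>g A B. g \<in> carrier G \<Longrightarrow> (A, B) \<in> rep_variety n G \<Longrightarrow>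
      f (g \<otimes>\<^bsub>G\<^esub> A \<otimes>\<^bsub>G\<^esub> inv\<^bsub>G\<^esub> g, g \<otimes>\<^bsub>G\<^esub> B \<otimes>\<^bsub>G\<^esub> inv\<^bsub>G\<^esub> g) = f (A, B)"
  shows "f \<in> invariant_ring n N G"
  using assms unfolding invariant_ring_def by blast

lemma invariant_ringD:
  assumes "f \<in> invariant_ring n N G"
  shows "f \<in> rep_ring n N G"
    and "g \<in> carrier G \<Longrightarrow> (A, B) \<in> rep_variety n G \<Longrightarrow>
      f (g \<otimes>\<^bsub>G\<^esub> A \<otimes>\<^bsub>G\<^esub> inv\<^bsub>G\<^esub> g, g \<otimes>\<^bsub>G\<^esub> B \<otimes>\<^bsub>G\<^esub> inv\<^bsub>G\<^esub> g) = f (A, B)"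
  using assms unfolding invariant_ring_def by blast+

lemma subalg_invariant_ring:
  assumes "group G" shows "subalg (rep_variety n G) (invariant_ring n N G)"
proof -
  let ?X = "rep_variety n G" and ?R = "rep_ring n N G"
  note R = subalgD[OF subalg_rep_ring[of n G N]] and X = conj_rep_variety[OF assms]
  have "f \<in> extensional ?X" if "f \<in> invariant_ring n N G" for f
    using invariant_ringD(1)[OF that] R(1) by blast
  moreover have "(\<lambda>x\<in>?X. c) \<in> invariant_ring n N G" for c
    by (rule invariant_ringI[OF R(2)]) (simp add: X)
  moreover have "(\<lambda>x\<in>?X. f x + h x) \<in> invariant_ring n N G" "(\<lambda>x\<in>?X. f x * h x) \<in> invariant_ring n N G"
    if fh: "f \<in> invariant_ring n N G" "h \<in> invariant_ring n N G" for f h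
  proof -
    note f = invariant_ringD[OF fh(1)] and h = invariant_ringD[OF fh(2)]
    show "(\<lambda>x\<in>?X. f x + h x) \<in> invariant_ring n N G"
      by (rule invariant_ringI[OF R(3)[OF f(1) h(1)]]) (simp add: X f(2) h(2))
    show "(\<lambda>x\<in>?X. f x * h x) \<in> invariant_ring n N G"
      by (rule invariant_ringI[OF R(4)[OF f(1) h(1)]]) (simp add: X f(2) h(2))
  qed
  ultimately show ?thesis unfolding subalg_def by blast
qed

section \<open>Invertible matrices and their adjoints\<close>

lemma carrier_GL_mat: "A \<in> carrier (GL r) \<Longrightarrow> A \<in> carrier_mat r r"
  by (auto simp: carrier_GL)

lemma GL_inv:
  assumes "A \<in> carrier (GL r)"
  shows "inv\<^bsub>GL r\<^esub> A \<in> carrier (GL r)" "inv\<^bsub>GL r\<^esub> A \<in> carrier_mat r r"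
    "A * inv\<^bsub>GL r\<^esub> A = 1\<^sub>m r" "inv\<^bsub>GL r\<^esub> A * A = 1\<^sub>m r"
proof -
  interpret group "GL r" by (rule group_GL)
  show 1: "inv\<^bsub>GL r\<^esub> A \<in> carrier (GL r)" using assms by simp
  then show "inv\<^bsub>GL r\<^esub> A \<in> carrier_mat r r" by (rule carrier_GL_mat)
  show "A * inv\<^bsub>GL r\<^esub> A = 1\<^sub>m r" "inv\<^bsub>GL r\<^esub> A * A = 1\<^sub>m r"
    using r_inv[OF assms] l_inv[OF assms] by (simp_all add: GL_simps)
qed

lemma GL_I: "A \<in> carrier_mat r r \<Longrightarrow> B \<in> carrier_mat r r \<Longrightarrow> A * B = 1\<^sub>m r \<Longrightarrow> B * A = 1\<^sub>m r \<Longrightarrow> A \<in> carrier (GL r)"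
  by (auto simp: carrier_GL)

lemma GL_inv_eq:
  assumes "A \<in> carrier_mat r r" "B \<in> carrier_mat r r" "A * B = 1\<^sub>m r" "B * A = 1\<^sub>m r"
  shows "inv\<^bsub>GL r\<^esub> A = B"
proof -
  interpret group "GL r" by (rule group_GL)
  show ?thesis using assms GL_I[of A r B] GL_I[of B r A] by (intro inv_equality) (auto simp: GL_simps)
qed

lemma GL_pow: "A \<in> carrier (GL r) \<Longrightarrow> A [^]\<^bsub>GL r\<^esub> (n::nat) = A ^\<^sub>m n"
proof (induction n)
  case (Suc n)
  interpret group "GL r" by (rule group_GL)
  show ?case using Suc by (simp add: GL_simps)
qed (use carrier_GL_mat[of A r] in \<open>simp add: GL_simps\<close>)

lemma rep_variety_GL: "(A, B) \<in> rep_variety n (GL r) \<longleftrightarrow>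
   A \<in> carrier (GL r) \<and> B \<in> carrier (GL r) \<and> A ^\<^sub>m n * B = B * A ^\<^sub>m n"
  unfolding rep_variety_iff[OF group_GL] by (auto simp: GL_pow GL_simps)

lemma det_GL:
  assumes "A \<in> carrier (GL r)" shows "det A \<noteq> 0" "det (inv\<^bsub>GL r\<^esub> A) = 1 / det A"
proof -
  have d: "det A * det (inv\<^bsub>GL r\<^esub> A) = 1"
    using det_mult[OF carrier_GL_mat[OF assms] GL_inv(2)[OF assms]] GL_inv(3)[OF assms] by simp
  then show "det A \<noteq> 0" by auto
  then show "det (inv\<^bsub>GL r\<^esub> A) = 1 / det A" using d by (simp add: field_simps)
qed

lemma det_conj:
  assumes "g \<in> carrier (GL r)" "A \<in> carrier_mat r r" shows "det (g * A * inv\<^bsub>GL r\<^esub> g) = det A"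
proof -
  have "det (g * A * inv\<^bsub>GL r\<^esub> g) = det g * det A * det (inv\<^bsub>GL r\<^esub> g)"
    using assms carrier_GL_mat[OF assms(1)] GL_inv(2)[OF assms(1)] by (simp add: det_mult[of _ r])
  then show ?thesis using det_GL[OF assms(1)] by simp
qed

lemma smult_smult_times_mat: "a \<cdot>\<^sub>m (b \<cdot>\<^sub>m A) = (a * b) \<cdot>\<^sub>m (A :: complex mat)"
  by (rule eq_matI) auto

lemma one_smult_mat: "1 \<cdot>\<^sub>m A = (A :: complex mat)"
  by (rule eq_matI) auto

lemma det_nonzero_GL:
  fixes A :: "complex mat"
  assumes "A \<in> carrier_mat r r" "det A \<noteq> 0" shows "A \<in> carrier (GL r)"
proof -
  have "A * ((1 / det A) \<cdot>\<^sub>m adj_mat A) = 1\<^sub>m r" "((1 / det A) \<cdot>\<^sub>m adj_mat A) * A = 1\<^sub>m r"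
    using adj_mat[OF assms(1)] assms by (simp_all add: one_smult_mat mult_smult_distrib[of _ r r _ r] mult_smult_assoc_mat[of _ r r _ r] smult_smult_times_mat)
  then show ?thesis using adj_mat(1)[OF assms(1)] assms(1) by (intro GL_I) auto
qed

lemma mat_mult_entry:
  "A \<in> carrier_mat r r \<Longrightarrow> B \<in> carrier_mat r r \<Longrightarrow> i < r \<Longrightarrow> j < r \<Longrightarrow>
     (A * B) $$ (i, j) = (\<Sum>k<r. A $$ (i, k) * B $$ (k, j))"
  by (simp add: scalar_prod_def atLeast0LessThan)

definition mat_star :: "complex mat \<Rightarrow> complex mat" where
  "mat_star A = mat (dim_col A) (dim_row A) (\<lambda>(i, j). cnj (A $$ (j, i)))"

lemma mat_star_mult:
  assumes "A \<in> carrier_mat r r" "B \<in> carrier_mat r r"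
  shows "mat_star (A * B) = mat_star B * mat_star A"
proof (rule eq_matI)
  have AB: "mat_star B \<in> carrier_mat r r" "mat_star A \<in> carrier_mat r r" "A * B \<in> carrier_mat r r"
    using assms by (auto simp: mat_star_def)
  fix i j assume "i < dim_row (mat_star B * mat_star A)" "j < dim_col (mat_star B * mat_star A)"
  then have ij: "i < r" "j < r" using AB by auto
  have "mat_star (A * B) $$ (i, j) = cnj ((A * B) $$ (j, i))" using ij assms by (simp add: mat_star_def)
  also have "\<dots> = (\<Sum>k<r. mat_star B $$ (i, k) * mat_star A $$ (k, j))"
    unfolding mat_mult_entry[OF assms ij(2,1)] using assms ij by (simp add: mat_star_def mult.commute)
  finally show "mat_star (A * B) $$ (i, j) = (mat_star B * mat_star A) $$ (i, j)"
    unfolding mat_mult_entry[OF AB(1,2) ij] .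
qed (use assms in \<open>auto simp: mat_star_def\<close>)

lemma mat_star_one: "mat_star (1\<^sub>m r) = 1\<^sub>m r"
  by (rule eq_matI) (auto simp: mat_star_def)

lemma mat_star_carrier: "A \<in> carrier_mat r r \<Longrightarrow> mat_star A \<in> carrier_mat r r"
  by (simp add: mat_star_def)

lemma mat_star_GL:
  assumes "A \<in> carrier (GL r)"
  shows "mat_star A \<in> carrier (GL r)" "inv\<^bsub>GL r\<^esub> (mat_star A) = mat_star (inv\<^bsub>GL r\<^esub> A)"
proof -
  note A = carrier_GL_mat[OF assms] and B = GL_inv[OF assms]
  have "mat_star A * mat_star (inv\<^bsub>GL r\<^esub> A) = 1\<^sub>m r" "mat_star (inv\<^bsub>GL r\<^esub> A) * mat_star A = 1\<^sub>m r"
    unfolding mat_star_mult[OF B(2) A, symmetric] mat_star_mult[OF A B(2), symmetric] B(3,4)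
    by (rule mat_star_one)+
  then show "mat_star A \<in> carrier (GL r)" "inv\<^bsub>GL r\<^esub> (mat_star A) = mat_star (inv\<^bsub>GL r\<^esub> A)"
    using mat_star_carrier A B(2) by (auto intro: GL_I GL_inv_eq)
qed

section \<open>Conjugation as a linear action on matrix entries\<close>

definition entry :: "bool \<times> nat \<times> nat \<Rightarrow> complex mat \<times> complex mat \<Rightarrow> complex" where
  "entry p z = (if fst p then fst z else snd z) $$ snd p"

definition entries :: "nat \<Rightarrow> (bool \<times> nat \<times> nat) set" where
  "entries r = UNIV \<times> {..<r} \<times> {..<r}"

text \<open>The matrix of conjugation by \<open>g\<close> with respect to the entries. Its conjugate
  transpose belongs to \<open>mat_star g\<close>, so the family given by \<open>GL r\<close> is
  closed under adjoints.\<close>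

definition conj_kernel :: "nat \<Rightarrow> complex mat \<Rightarrow> bool \<times> nat \<times> nat \<Rightarrow> bool \<times> nat \<times> nat \<Rightarrow> complex" where
  "conj_kernel r g p p' = (if fst p = fst p'
     then g $$ (fst (snd p), fst (snd p')) * (inv\<^bsub>GL r\<^esub> g) $$ (snd (snd p'), snd (snd p)) else 0)"

definition conj_pair :: "nat \<Rightarrow> complex mat \<Rightarrow> complex mat \<times> complex mat \<Rightarrow> complex mat \<times> complex mat" where
  "conj_pair r g z = (g * fst z * inv\<^bsub>GL r\<^esub> g, g * snd z * inv\<^bsub>GL r\<^esub> g)"

lemma conj_pair_entry:
  assumes g: "g \<in> carrier (GL r)" and z: "fst z \<in> carrier_mat r r" "snd z \<in> carrier_mat r r" and p: "p \<in> entries r"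
  shows "entry p (conj_pair r g z) = (\<Sum>p'\<in>entries r. conj_kernel r g p p' * entry p' z)"
proof -
  obtain b i j where pe: "p = (b, i, j)" "i < r" "j < r" using p by (cases p) (auto simp: entries_def)
  define C where "C = (if b then fst z else snd z)"
  have C: "C \<in> carrier_mat r r" using z by (simp add: C_def)
  note gm = carrier_GL_mat[OF g] and gi = GL_inv(2)[OF g]
  have gC: "g * C \<in> carrier_mat r r" using gm C by simp
  have "entry p (conj_pair r g z) = (g * C * inv\<^bsub>GL r\<^esub> g) $$ (i, j)" by (simp add: entry_def pe conj_pair_def C_def)
  also have "\<dots> = (\<Sum>l<r. \<Sum>k<r. g $$ (i, k) * C $$ (k, l) * (inv\<^bsub>GL r\<^esub> g) $$ (l, j))"
    unfolding mat_mult_entry[OF gC gi pe(2,3)] using pe by (simp add: mat_mult_entry[OF gm C] sum_distrib_right)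
  also have "\<dots> = (\<Sum>k<r. \<Sum>l<r. g $$ (i, k) * C $$ (k, l) * (inv\<^bsub>GL r\<^esub> g) $$ (l, j))" by (rule sum.swap)
  also have "\<dots> = (\<Sum>b'\<in>UNIV. \<Sum>k<r. \<Sum>l<r. conj_kernel r g p (b', k, l) * entry (b', k, l) z)"
    by (cases b) (auto simp: UNIV_bool conj_kernel_def pe entry_def C_def mult_ac)
  also have "\<dots> = (\<Sum>p'\<in>entries r. conj_kernel r g p p' * entry p' z)"
    unfolding entries_def by (simp add: sum.cartesian_product case_prod_unfold)
  finally show ?thesis .
qed

lemma finite_entries: "finite (entries r)"
  by (simp add: entries_def)

lemma pow_mat_smult:
  assumes "(A :: complex mat) \<in> carrier_mat r r" shows "(t \<cdot>\<^sub>m A) ^\<^sub>m n = t ^ n \<cdot>\<^sub>m (A ^\<^sub>m n)"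
proof (induction n)
  case 0 then show ?case using assms by (auto intro: eq_matI)
next
  case (Suc n)
  have "A ^\<^sub>m n \<in> carrier_mat r r" using assms by simp
  then show ?case using Suc assms
    by (simp add: mult_smult_distrib[of _ r r _ r] mult_smult_assoc_mat[of _ r r _ r] smult_smult_times_mat mult.commute)
qed

lemma smult_GL: "A \<in> carrier (GL r) \<Longrightarrow> t \<noteq> 0 \<Longrightarrow> t \<cdot>\<^sub>m A \<in> carrier (GL r)"
  by (rule det_nonzero_GL) (use carrier_GL_mat[of A r] det_GL(1)[of A r] in auto)

text \<open>Simultaneous scaling preserves the representation variety because both sides of
  \<open>A^n B = B A^n\<close> are homogeneous of the same degree. Adjoints come from conjugate
  transposes, which stay in \<open>GL r\<close>.\<close>

lemma linear_action_GL:
  "linear_action (entries r) entry (rep_variety n (GL r)) (carrier (GL r)) (conj_kernel r) (conj_pair r) mat_star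
    (\<lambda>t z. (t \<cdot>\<^sub>m fst z, t \<cdot>\<^sub>m snd z))"
proof
  show "finite (entries r)" by (rule finite_entries)
  fix g :: "complex mat" and z i j t
  show "conj_pair r g z \<in> rep_variety n (GL r)" if "g \<in> carrier (GL r)" "z \<in> rep_variety n (GL r)"
    using conj_rep_variety[OF group_GL that(1), of "fst z" "snd z"] that(2) by (simp add: conj_pair_def GL_simps)
  show "entry i (conj_pair r g z) = (\<Sum>p'\<in>entries r. conj_kernel r g i p' * entry p' z)"
    if "g \<in> carrier (GL r)" "z \<in> rep_variety n (GL r)" "i \<in> entries r"
    using that by (cases z) (auto intro!: conj_pair_entry simp: rep_variety_GL carrier_GL_mat)
  show "mat_star g \<in> carrier (GL r)" if "g \<in> carrier (GL r)" using mat_star_GL that by blast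
  show "conj_kernel r (mat_star g) i j = cnj (conj_kernel r g j i)"
    if g: "g \<in> carrier (GL r)" and ij: "i \<in> entries r" "j \<in> entries r"
  proof -
    have "dim_row g = r" "dim_col g = r" "dim_row (inv\<^bsub>GL r\<^esub> g) = r" "dim_col (inv\<^bsub>GL r\<^esub> g) = r"
      using carrier_GL_mat[OF g] GL_inv(2)[OF g] by auto
    then show ?thesis using ij unfolding conj_kernel_def mat_star_GL(2)[OF g]
      by (auto simp: mat_star_def entries_def)
  qed
  show "(t \<cdot>\<^sub>m fst z, t \<cdot>\<^sub>m snd z) \<in> rep_variety n (GL r)" if t: "t \<noteq> 0" and z: "z \<in> rep_variety n (GL r)"
  proof -
    obtain A B where z': "z = (A, B)" "A \<in> carrier (GL r)" "B \<in> carrier (GL r)" "A ^\<^sub>m n * B = B * A ^\<^sub>m n"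
      using z by (cases z) (auto simp: rep_variety_GL)
    have c: "A \<in> carrier_mat r r" "B \<in> carrier_mat r r" "A ^\<^sub>m n \<in> carrier_mat r r"
      using z' carrier_GL_mat by auto
    have "(t \<cdot>\<^sub>m A) ^\<^sub>m n * (t \<cdot>\<^sub>m B) = (t \<cdot>\<^sub>m B) * (t \<cdot>\<^sub>m A) ^\<^sub>m n"
      using c z'(4) by (simp add: pow_mat_smult mult_smult_distrib[of _ r r _ r] mult_smult_assoc_mat[of _ r r _ r] smult_smult_times_mat mult.commute)
    then show ?thesis using z' t by (simp add: rep_variety_GL smult_GL)
  qed
  show "entry i (t \<cdot>\<^sub>m fst z, t \<cdot>\<^sub>m snd z) = t * entry i z" if "z \<in> rep_variety n (GL r)" "i \<in> entries r"
  proof -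
    have "fst z \<in> carrier_mat r r" "snd z \<in> carrier_mat r r"
      using that(1) by (cases z; auto simp: rep_variety_GL carrier_GL_mat)+
    then show ?thesis using that(2) by (auto simp: entry_def entries_def)
  qed
qed

lemma polyon_det:
  assumes "\<And>z. z \<in> X \<Longrightarrow> fst z \<in> carrier_mat r r \<and> snd z \<in> carrier_mat r r"
  shows "polyon (entries r) entry X (\<lambda>z. det (fst z))" "polyon (entries r) entry X (\<lambda>z. det (snd z))"
proof -
  have p: "polyon (entries r) entry X (\<lambda>z. \<Sum>p \<in> {p. p permutes {0 ..< r}}. signof p * (\<Prod>i = 0 ..< r. entry (b, i, p i) z))" for b
    by (intro polyon_sum polyon_mult polyon_prod polyon_const polyon_coord finite_entries)
      (auto simp: entries_def)
  show "polyon (entries r) entry X (\<lambda>z. det (fst z))"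
    by (rule polyon_cong[OF p[of True]]) (use assms in \<open>simp add: det_def'[of _ r] entry_def\<close>)
  show "polyon (entries r) entry X (\<lambda>z. det (snd z))"
    by (rule polyon_cong[OF p[of False]]) (use assms in \<open>simp add: det_def'[of _ r] entry_def\<close>)
qed

lemma subalg_sum:
  assumes A: "subalg X A" and "finite K" "\<And>k. k \<in> K \<Longrightarrow> (\<lambda>x\<in>X. u k x) \<in> A"
  shows "(\<lambda>x\<in>X. \<Sum>k\<in>K. u k x) \<in> A"
  using assms(2,3)
proof (induction K)
  case empty then show ?case using subalgD(2)[OF A] by (simp del: restrict_apply)
next
  case (insert k K)
  then have "(\<lambda>x\<in>X. (\<lambda>x\<in>X. u k x) x + (\<lambda>x\<in>X. \<Sum>k\<in>K. u k x) x) \<in> A" by (intro subalgD(3)[OF A]) auto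
  moreover have "(\<lambda>x\<in>X. (\<lambda>x\<in>X. u k x) x + (\<lambda>x\<in>X. \<Sum>k\<in>K. u k x) x) = (\<lambda>x\<in>X. \<Sum>k\<in>insert k K. u k x)"
    using insert by auto
  ultimately show ?case by (simp del: restrict_apply)
qed

lemma polyon_generated:
  assumes I: "finite I" and f: "polyon I \<xi> X f" and A: "subalg X A" and g: "\<And>i. i \<in> I \<Longrightarrow> restrict (\<xi> i) X \<in> A"
  shows "restrict f X \<in> A"
proof -
  have m: "(\<lambda>x\<in>X. a * word_monomial \<xi> w x) \<in> A" if "set w \<subseteq> I" for w a
    using that
  proof (induction w)
    case Nil then show ?case using subalgD(2)[OF A] by (simp add: word_monomial_simps del: restrict_apply)
  next
    case (Cons i w)
    then have "(\<lambda>x\<in>X. restrict (\<xi> i) X x * (\<lambda>x\<in>X. a * word_monomial \<xi> w x) x) \<in> A" 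
      using g by (intro subalgD(4)[OF A, of "restrict (\<xi> i) X" "\<lambda>x\<in>X. a * word_monomial \<xi> w x"]) (auto simp del: restrict_apply)
    moreover have "(\<lambda>x\<in>X. restrict (\<xi> i) X x * (\<lambda>x\<in>X. a * word_monomial \<xi> w x) x) = (\<lambda>x\<in>X. a * word_monomial \<xi> (i # w) x)"
      by (auto simp: word_monomial_simps mult_ac)
    ultimately show ?case by (simp del: restrict_apply)
  qed
  obtain d c where dc: "\<forall>x\<in>X. f x = (\<Sum>e<d. homog I \<xi> e c x)" using f by (auto simp: polyon_def)
  have "(\<lambda>x\<in>X. \<Sum>e<d. homog I \<xi> e c x) \<in> A"
    unfolding homog_def
    by (intro subalg_sum[OF A] m finite_words I) (auto simp: words_def)
  moreover have "restrict f X = (\<lambda>x\<in>X. \<Sum>e<d. homog I \<xi> e c x)" using dc by auto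
  ultimately show ?thesis by (simp del: restrict_apply)
qed

lemma rep_GL_carrier: "z \<in> rep_variety n (GL r) \<Longrightarrow> fst z \<in> carrier (GL r) \<and> snd z \<in> carrier (GL r) \<and>
    fst z \<in> carrier_mat r r \<and> snd z \<in> carrier_mat r r"
  by (cases z) (auto simp: rep_variety_GL carrier_GL_mat)

lemma polyon_rep_ring:
  assumes "polyon (entries r) entry (rep_variety n (GL r)) f"
  shows "restrict f (rep_variety n (GL r)) \<in> rep_ring n r (GL r)"
proof (rule polyon_generated[OF finite_entries assms subalg_rep_ring])
  fix i assume "i \<in> entries r"
  then obtain b k l where "i = (b, k, l)" "k < r" "l < r" by (auto simp: entries_def)
  then show "restrict (entry i) (rep_variety n (GL r)) \<in> rep_ring n r (GL r)"
    using rep_ring_gens[of k r l n "GL r"] by (cases b) (simp_all add: entry_def[abs_def] del: restrict_apply)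
qed

text \<open>Powers of the determinants clear all denominators, which leads back to polynomial
  functions, where the grading is available.\<close>

lemma rep_ring_denominator:
  assumes "f \<in> rep_ring n r (GL r)"
  shows "\<exists>k p. polyon (entries r) entry (rep_variety n (GL r)) p \<and>
    (\<forall>z\<in>rep_variety n (GL r). p z = f z * (det (fst z) * det (snd z)) ^ k)"
proof -
  let ?X = "rep_variety n (GL r)" and ?D = "\<lambda>z. det (fst z) * det (snd z)"
  let ?P = "polyon (entries r) entry ?X"
  note I = finite_entries[of r]
  have D1: "?P (\<lambda>z. det (fst z))" "?P (\<lambda>z. det (snd z))" using polyon_det[of ?X r] rep_GL_carrier by blast+
  have D: "?P ?D" by (rule polyon_mult[OF I D1])
  have Dk: "?P (\<lambda>z. ?D z ^ k)" for k
    by (induction k) (use polyon_const[OF I] polyon_mult[OF I D] in auto)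
  let ?A = "{f \<in> extensional ?X. \<exists>k p. ?P p \<and> (\<forall>z\<in>?X. p z = f z * ?D z ^ k)}"
  have base: "restrict g ?X \<in> ?A" if "?P p" "\<And>z. z \<in> ?X \<Longrightarrow> p z = g z * ?D z ^ k" for g p k
    using that by (intro CollectI conjI exI[of _ k] exI[of _ p]) auto
  have "subalg ?X ?A"
    unfolding subalg_def
  proof (intro conjI allI ballI)
    show "(\<lambda>x\<in>?X. c) \<in> ?A" for c by (rule base[of "\<lambda>_. c" _ 0]) (use polyon_const[OF I] in auto)
    fix f g assume "f \<in> ?A" "g \<in> ?A"
    then obtain k p l r' where *: "?P p" "\<forall>z\<in>?X. p z = f z * ?D z ^ k" "?P r'" "\<forall>z\<in>?X. r' z = g z * ?D z ^ l" by blast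
    show "(\<lambda>x\<in>?X. f x + g x) \<in> ?A"
    proof (rule base)
      show "?P (\<lambda>z. p z * ?D z ^ l + r' z * ?D z ^ k)" by (intro polyon_add polyon_mult[OF I] Dk *)
      show "p z * ?D z ^ l + r' z * ?D z ^ k = (f z + g z) * ?D z ^ (k + l)" if "z \<in> ?X" for z
        using * that by (simp add: power_add algebra_simps)
    qed
    show "(\<lambda>x\<in>?X. f x * g x) \<in> ?A"
      by (rule base[of "\<lambda>z. p z * r' z" _ "k + l"])
        (use * in \<open>auto intro!: polyon_mult[OF I] simp: power_add algebra_simps\<close>)
  qed auto
  then have "rep_ring n r (GL r) \<subseteq> ?A"
  proof (rule rep_ring_subset)
    fix i j assume ij: "i < r" "j < r"
    have e: "?P (entry (b, i, j))" for b by (rule polyon_coord[OF I]) (use ij in \<open>simp add: entries_def\<close>)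
    show "(\<lambda>z\<in>?X. fst z $$ (i, j)) \<in> ?A" by (rule base[OF e[of True], of _ 0]) (simp add: entry_def)
    show "(\<lambda>z\<in>?X. snd z $$ (i, j)) \<in> ?A" by (rule base[OF e[of False], of _ 0]) (simp add: entry_def)
  next
    have punctured_line: "det (fst z) \<noteq> 0" "det (snd z) \<noteq> 0" if "z \<in> ?X" for z using rep_GL_carrier[OF that] det_GL(1) by blast+
    \<comment> \<open>With exponent 1 the numerator of \<open>1 / det A\<close> is
      \<open>det B\<close>, and conversely.\<close>
    show "(\<lambda>z\<in>?X. 1 / det (fst z)) \<in> ?A" by (rule base[OF D1(2), of _ 1]) (use punctured_line in simp)
    show "(\<lambda>z\<in>?X. 1 / det (snd z)) \<in> ?A" by (rule base[OF D1(1), of _ 1]) (use punctured_line in simp)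
  qed
  then show ?thesis using assms by blast
qed

text \<open>Determinants are invariant, so clearing denominators turns an invariant function into an
  invariant polynomial, to which \<open>invariants_finitely_generated\<close> applies. The two
  inverse determinants complete the set of generators.\<close>

theorem invariant_ring_GL_fg: "finitely_generated (rep_variety n (GL r)) (invariant_ring n r (GL r))"
proof -
  let ?X = "rep_variety n (GL r)" and ?D = "\<lambda>z. det (fst z) * det (snd z)"
  let ?R = "invariant_ring n r (GL r)"
  interpret linear_action "entries r" entry ?X "carrier (GL r)" "conj_kernel r" "conj_pair r" mat_star
    "\<lambda>t z. (t \<cdot>\<^sub>m fst z, t \<cdot>\<^sub>m snd z)"
    by (rule linear_action_GL)
  obtain F where F: "finite F" "\<forall>f\<in>F. polyon (entries r) entry ?X f \<and> invar f"
    "\<forall>f. polyon (entries r) entry ?X f \<longrightarrow> invar f \<longrightarrow> restrict f ?X \<in> generated_algebra ?X F"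
    using invariants_finitely_generated by blast
  have cp: "(g \<otimes>\<^bsub>GL r\<^esub> A \<otimes>\<^bsub>GL r\<^esub> inv\<^bsub>GL r\<^esub> g, g \<otimes>\<^bsub>GL r\<^esub> B \<otimes>\<^bsub>GL r\<^esub> inv\<^bsub>GL r\<^esub> g) = conj_pair r g (A, B)" for g A B
    by (simp add: conj_pair_def GL_simps)
  have detc: "det (fst (conj_pair r g z)) = det (fst z)" "det (snd (conj_pair r g z)) = det (snd z)"
    if "g \<in> carrier (GL r)" "z \<in> ?X" for g z
    using that rep_GL_carrier[OF that(2)] by (simp_all add: conj_pair_def det_conj)
  define d1 d2 where "d1 = (\<lambda>z\<in>?X. 1 / det (fst z))" and "d2 = (\<lambda>z\<in>?X. 1 / det (snd z))"
  have d: "d1 \<in> ?R" "d2 \<in> ?R"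
    unfolding d1_def d2_def
    by (rule invariant_ringI[OF rep_ring_dets(1)], use cp act_X detc in simp)
      (rule invariant_ringI[OF rep_ring_dets(2)], use cp act_X detc in simp)
  let ?F = "(\<lambda>f. restrict f ?X) ` F \<union> {d1, d2}"
  have FR: "?F \<subseteq> ?R"
  proof -
    have "restrict f ?X \<in> ?R" if f: "f \<in> F" for f
    proof (rule invariant_ringI)
      show "restrict f ?X \<in> rep_ring n r (GL r)" using polyon_rep_ring F(2) f by blast
      show "restrict f ?X (g \<otimes>\<^bsub>GL r\<^esub> A \<otimes>\<^bsub>GL r\<^esub> inv\<^bsub>GL r\<^esub> g, g \<otimes>\<^bsub>GL r\<^esub> B \<otimes>\<^bsub>GL r\<^esub> inv\<^bsub>GL r\<^esub> g) = restrict f ?X (A, B)"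
        if "g \<in> carrier (GL r)" "(A, B) \<in> ?X" for g A B
        unfolding cp using act_X[OF that] F(2) f that by (simp add: invar_def)
    qed
    then show ?thesis using d by blast
  qed
  have SR: "subalg ?X ?R" by (rule subalg_invariant_ring[OF group_GL])
  have "?R \<subseteq> generated_algebra ?X ?F"
  proof
    fix f assume f: "f \<in> ?R"
    note f1 = invariant_ringD[OF f]
    obtain k p where p: "polyon (entries r) entry ?X p" "\<forall>z\<in>?X. p z = f z * ?D z ^ k"
      using rep_ring_denominator[OF f1(1)] by blast
    have "invar p" unfolding invar_def
    proof (intro ballI)
      fix g z assume g: "g \<in> carrier (GL r)" and z: "z \<in> ?X"
      have "f (conj_pair r g z) = f z" using f1(2)[OF g, of "fst z" "snd z"] z unfolding cp by simp
      then show "p (conj_pair r g z) = p z" using p(2) z act_X[OF g z] detc[OF g z] by simp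
    qed
    then have "restrict p ?X \<in> generated_algebra ?X F" using F(3) p(1) by blast
    also have "generated_algebra ?X F \<subseteq> generated_algebra ?X ?F"
    proof
      fix h assume "h \<in> generated_algebra ?X F"
      then show "h \<in> generated_algebra ?X ?F"
      proof (induction rule: generated_algebra.induct)
        case (gen g)
        then have "restrict (restrict g ?X) ?X \<in> generated_algebra ?X ?F" by (intro generated_algebra.gen) auto
        then show "restrict g ?X \<in> generated_algebra ?X ?F" by (simp del: restrict_apply)
      qed (simp_all add: generated_algebra.intros del: restrict_apply)
    qed
    finally have P: "restrict p ?X \<in> generated_algebra ?X ?F" .
    note GA = subalgD[OF subalg_generated[of ?X ?F]]
    have dg: "d1 \<in> generated_algebra ?X ?F" "d2 \<in> generated_algebra ?X ?F"
      using generated_algebra.gen[of d1 ?F ?X] generated_algebra.gen[of d2 ?F ?X]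
      by (simp_all add: d1_def d2_def del: restrict_apply)
    have pw: "(\<lambda>z\<in>?X. p z * (1 / det (fst z)) ^ m * (1 / det (snd z)) ^ m) \<in> generated_algebra ?X ?F" for m
    proof (induction m)
      case 0 then show ?case using P by (simp del: restrict_apply)
    next
      case (Suc m)
      let ?u = "\<lambda>z\<in>?X. p z * (1 / det (fst z)) ^ m * (1 / det (snd z)) ^ m"
      have "(\<lambda>z\<in>?X. (\<lambda>z\<in>?X. ?u z * d1 z) z * d2 z) \<in> generated_algebra ?X ?F" by (intro GA(4) Suc dg)
      moreover have "(\<lambda>z\<in>?X. (\<lambda>z\<in>?X. ?u z * d1 z) z * d2 z) =
          (\<lambda>z\<in>?X. p z * (1 / det (fst z)) ^ Suc m * (1 / det (snd z)) ^ Suc m)"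
        by (rule restrict_ext) (simp add: d1_def d2_def)
      ultimately show ?case by (simp del: restrict_apply)
    qed
    have "f = (\<lambda>z\<in>?X. p z * (1 / det (fst z)) ^ k * (1 / det (snd z)) ^ k)"
    proof (rule extensionalityI)
      show "f \<in> extensional ?X" using subalgD(1)[OF SR f] .
      fix z assume z: "z \<in> ?X"
      have "det (fst z) \<noteq> 0" "det (snd z) \<noteq> 0" using rep_GL_carrier[OF z] det_GL(1) by blast+
      then show "f z = (\<lambda>z\<in>?X. p z * (1 / det (fst z)) ^ k * (1 / det (snd z)) ^ k) z"
        using p(2) z by (simp add: power_mult_distrib power_divide)
    qed simp
    then show "f \<in> generated_algebra ?X ?F" using pw[of k] by (simp del: restrict_apply)
  qed
  moreover have "generated_algebra ?X ?F \<subseteq> ?R" by (rule generated_algebra_subset[OF SR FR])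
  ultimately show ?thesis unfolding finitely_generated_def using F(1) FR by (intro exI[of _ ?F]) auto
qed

section \<open>From affine groups to linear groups\<close>

lemma (in group) hom_conj:
  assumes "group H" "h \<in> hom G H" "g \<in> carrier G" "a \<in> carrier G"
  shows "h (g \<otimes> a \<otimes> inv g) = h g \<otimes>\<^bsub>H\<^esub> h a \<otimes>\<^bsub>H\<^esub> inv\<^bsub>H\<^esub> (h g)"
proof -
  interpret group_hom G H h using assms(1,2) is_group by (simp add: group_hom_def group_hom_axioms_def)
  show ?thesis using assms(3,4) by simp
qed

lemma hom_rep_variety:
  assumes "group G" "group H" "h \<in> hom G H" "(A, B) \<in> rep_variety n G"
  shows "(h A, h B) \<in> rep_variety n H"
proof -
  interpret group_hom G H h using assms(1-3) by (simp add: group_hom_def group_hom_axioms_def)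
  have AB: "A \<in> carrier G" "B \<in> carrier G" "(A [^]\<^bsub>G\<^esub> n) \<otimes>\<^bsub>G\<^esub> B = B \<otimes>\<^bsub>G\<^esub> (A [^]\<^bsub>G\<^esub> n)"
    using assms(4) by (auto simp: rep_variety_iff[OF assms(1)])
  have "h ((A [^]\<^bsub>G\<^esub> n) \<otimes>\<^bsub>G\<^esub> B) = h (B \<otimes>\<^bsub>G\<^esub> (A [^]\<^bsub>G\<^esub> n))" using AB by simp
  then have "(h A [^]\<^bsub>H\<^esub> n) \<otimes>\<^bsub>H\<^esub> h B = h B \<otimes>\<^bsub>H\<^esub> (h A [^]\<^bsub>H\<^esub> n)" using AB(1,2) by (simp add: hom_nat_pow)
  then show ?thesis unfolding rep_variety_iff[OF assms(2)] using AB by simp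
qed

section \<open>Affine transformations as block matrices\<close>

definition affine_block :: "nat \<Rightarrow> complex mat \<Rightarrow> complex mat \<Rightarrow> complex mat" where
  "affine_block r \<alpha> A = four_block_mat (1\<^sub>m 1) (0\<^sub>m 1 r) \<alpha> A"

lemma mult_block:
  assumes "\<alpha> \<in> carrier_mat r 1" "\<beta> \<in> carrier_mat r 1" "A \<in> carrier_mat r r" "B \<in> carrier_mat r r"
  shows "affine_block r \<alpha> A * affine_block r \<beta> B = affine_block r (\<alpha> + A * \<beta>) (A * B)"
  unfolding affine_block_def by (rule mult_affine_block[OF assms])

definition lin_part :: "nat \<Rightarrow> complex mat \<Rightarrow> complex mat" where
  "lin_part r P = mat r r (\<lambda>(i, j). P $$ (Suc i, Suc j))"

definition trans_part :: "nat \<Rightarrow> complex mat \<Rightarrow> complex mat" where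
  "trans_part r P = mat r 1 (\<lambda>(i, j). P $$ (Suc i, 0))"

definition lin_incl :: "nat \<Rightarrow> complex mat \<Rightarrow> complex mat" where
  "lin_incl r A = affine_block r (0\<^sub>m r 1) A"

lemma lin_part_affine_block: "\<alpha> \<in> carrier_mat r 1 \<Longrightarrow> A \<in> carrier_mat r r \<Longrightarrow> lin_part r (affine_block r \<alpha> A) = A"
  by (rule eq_matI) (auto simp: lin_part_def affine_block_def)

lemma trans_part_affine_block: "\<alpha> \<in> carrier_mat r 1 \<Longrightarrow> A \<in> carrier_mat r r \<Longrightarrow> trans_part r (affine_block r \<alpha> A) = \<alpha>"
  by (rule eq_matI) (auto simp: trans_part_def affine_block_def)

lemma carrier_AGL: "carrier (AGL r) = {affine_block r \<alpha> A | \<alpha> A. \<alpha> \<in> carrier_mat r 1 \<and> A \<in> carrier (GL r)}"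
  by (simp add: AGL_def affine_block_def)

lemma AGL_simps: "x \<otimes>\<^bsub>AGL r\<^esub> y = x * y" "\<one>\<^bsub>AGL r\<^esub> = 1\<^sub>m (r + 1)"
  by (simp_all add: AGL_def GL_simps)

lemma AGL_parts:
  assumes "P \<in> carrier (AGL r)"
  shows "P = affine_block r (trans_part r P) (lin_part r P)" "trans_part r P \<in> carrier_mat r 1" "lin_part r P \<in> carrier (GL r)"
    "lin_part r P \<in> carrier_mat r r"
proof -
  obtain \<alpha> A where *: "P = affine_block r \<alpha> A" "\<alpha> \<in> carrier_mat r 1" "A \<in> carrier (GL r)"
    using assms by (auto simp: carrier_AGL)
  note A = carrier_GL_mat[OF *(3)]
  show "P = affine_block r (trans_part r P) (lin_part r P)" "trans_part r P \<in> carrier_mat r 1" "lin_part r P \<in> carrier (GL r)"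
    "lin_part r P \<in> carrier_mat r r"
    using * A by (simp_all add: lin_part_affine_block trans_part_affine_block)
qed

lemma lin_part_hom: "lin_part r \<in> hom (AGL r) (GL r)"
proof (rule homI)
  fix P Q assume PQ: "P \<in> carrier (AGL r)" "Q \<in> carrier (AGL r)"
  note P = AGL_parts[OF PQ(1)] and Q = AGL_parts[OF PQ(2)]
  have "P * Q = affine_block r (trans_part r P + lin_part r P * trans_part r Q) (lin_part r P * lin_part r Q)"
    by (subst P(1), subst Q(1), rule mult_block[OF P(2) Q(2) P(4) Q(4)])
  moreover have "trans_part r P + lin_part r P * trans_part r Q \<in> carrier_mat r 1" "lin_part r P * lin_part r Q \<in> carrier_mat r r"
    using P Q by auto
  ultimately show "lin_part r (P \<otimes>\<^bsub>AGL r\<^esub> Q) = lin_part r P \<otimes>\<^bsub>GL r\<^esub> lin_part r Q"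
    by (simp add: AGL_simps GL_simps lin_part_affine_block)
qed (rule AGL_parts(3))

lemma lin_incl_hom: "lin_incl r \<in> hom (GL r) (AGL r)"
proof (rule homI)
  show "lin_incl r A \<in> carrier (AGL r)" if "A \<in> carrier (GL r)" for A
    unfolding lin_incl_def carrier_AGL using that by (intro CollectI exI[of _ "0\<^sub>m r 1"] exI[of _ A]) simp
  fix A B assume "A \<in> carrier (GL r)" "B \<in> carrier (GL r)"
  then have c: "A \<in> carrier_mat r r" "B \<in> carrier_mat r r" by (auto simp: carrier_GL_mat)
  have "lin_incl r A * lin_incl r B = affine_block r (0\<^sub>m r 1 + A * 0\<^sub>m r 1) (A * B)"
    unfolding lin_incl_def by (rule mult_block) (use c in auto)
  also have "0\<^sub>m r 1 + A * 0\<^sub>m r 1 = 0\<^sub>m r 1" using c by simp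
  finally show "lin_incl r (A \<otimes>\<^bsub>GL r\<^esub> B) = lin_incl r A \<otimes>\<^bsub>AGL r\<^esub> lin_incl r B"
    by (simp add: AGL_simps GL_simps lin_incl_def)
qed

lemma lin_part_incl: "A \<in> carrier (GL r) \<Longrightarrow> lin_part r (lin_incl r A) = A"
  unfolding lin_incl_def by (rule lin_part_affine_block) (auto simp: carrier_GL_mat)

lemma det_affine_block: "\<alpha> \<in> carrier_mat r 1 \<Longrightarrow> A \<in> carrier_mat r r \<Longrightarrow> det (affine_block r \<alpha> A) = det A"
  unfolding affine_block_def by (subst det_four_block_mat_upper_right_zero[of _ 1 _ r]) auto

lemma affine_block_entry:
  assumes "\<alpha> \<in> carrier_mat r 1" "A \<in> carrier_mat r r" "i < r + 1" "j < r + 1"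
  shows "affine_block r \<alpha> A $$ (i, j) =
    (if i = 0 then (if j = 0 then 1 else 0) else if j = 0 then \<alpha> $$ (i - 1, 0) else A $$ (i - 1, j - 1))"
  unfolding affine_block_def using assms by auto

text \<open>A closed formula for conjugation by the homothety of ratio \<open>t\<close>, which also
  makes sense for \<open>t = 0\<close>.\<close>

definition shrink :: "nat \<Rightarrow> complex \<Rightarrow> complex mat \<Rightarrow> complex mat" where
  "shrink r t P = affine_block r (t \<cdot>\<^sub>m trans_part r P) (lin_part r P)"

lemma shrink_conj:
  assumes P: "P \<in> carrier (AGL r)" and t: "t \<noteq> 0"
  defines "s \<equiv> lin_incl r (t \<cdot>\<^sub>m 1\<^sub>m r)"
  shows "s \<in> carrier (AGL r)" "s \<otimes>\<^bsub>AGL r\<^esub> P \<otimes>\<^bsub>AGL r\<^esub> inv\<^bsub>AGL r\<^esub> s = shrink r t P"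
proof -
  interpret G: group "AGL r" by (rule group_AGL)
  interpret L: group "GL r" by (rule group_GL)
  have one: "1\<^sub>m r \<in> carrier (GL r)" using L.one_closed by (simp add: GL_simps)
  have T: "t \<cdot>\<^sub>m 1\<^sub>m r \<in> carrier (GL r)" by (rule smult_GL[OF one t])
  note P' = AGL_parts[OF P]
  show s: "s \<in> carrier (AGL r)" unfolding s_def using lin_incl_hom T by (auto simp: hom_def)
  have "s * P = s * affine_block r (trans_part r P) (lin_part r P)" by (rule arg_cong[OF P'(1)])
  also have "\<dots> = affine_block r (0\<^sub>m r 1 + (t \<cdot>\<^sub>m 1\<^sub>m r) * trans_part r P) ((t \<cdot>\<^sub>m 1\<^sub>m r) * lin_part r P)"
    unfolding s_def lin_incl_def by (rule mult_block) (use P' in auto)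
  also have "(t \<cdot>\<^sub>m 1\<^sub>m r) * trans_part r P = t \<cdot>\<^sub>m trans_part r P" using P' by (simp add: mult_smult_assoc_mat[of _ r r _ 1])
  also have "0\<^sub>m r 1 + t \<cdot>\<^sub>m trans_part r P = t \<cdot>\<^sub>m trans_part r P" using P' by simp
  also have "(t \<cdot>\<^sub>m 1\<^sub>m r) * lin_part r P = t \<cdot>\<^sub>m lin_part r P" using P' by (simp add: mult_smult_assoc_mat[of _ r r _ r])
  finally have 1: "s * P = affine_block r (t \<cdot>\<^sub>m trans_part r P) (t \<cdot>\<^sub>m lin_part r P)" .
  have "shrink r t P * s = affine_block r (t \<cdot>\<^sub>m trans_part r P + lin_part r P * 0\<^sub>m r 1) (lin_part r P * (t \<cdot>\<^sub>m 1\<^sub>m r))"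
    unfolding s_def lin_incl_def shrink_def by (rule mult_block) (use P' in auto)
  also have "t \<cdot>\<^sub>m trans_part r P + lin_part r P * 0\<^sub>m r 1 = t \<cdot>\<^sub>m trans_part r P" using P' by simp
  also have "lin_part r P * (t \<cdot>\<^sub>m 1\<^sub>m r) = t \<cdot>\<^sub>m lin_part r P" using P' by (simp add: mult_smult_distrib[of _ r r _ r])
  finally have e: "s \<otimes>\<^bsub>AGL r\<^esub> P = shrink r t P \<otimes>\<^bsub>AGL r\<^esub> s" using 1 by (simp add: AGL_simps)
  have sh: "shrink r t P \<in> carrier (AGL r)" unfolding shrink_def carrier_AGL
    by (intro CollectI exI[of _ "t \<cdot>\<^sub>m trans_part r P"] exI[of _ "lin_part r P"] conjI refl)
      (use P'(2,3) in auto)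
  show "s \<otimes>\<^bsub>AGL r\<^esub> P \<otimes>\<^bsub>AGL r\<^esub> inv\<^bsub>AGL r\<^esub> s = shrink r t P"
    unfolding e using s sh by (simp add: G.m_assoc)
qed

lemma shrink_0: "P \<in> carrier (AGL r) \<Longrightarrow> shrink r 0 P = lin_incl r (lin_part r P)"
proof -
  assume "P \<in> carrier (AGL r)"
  then have "0 \<cdot>\<^sub>m trans_part r P = 0\<^sub>m r 1" using AGL_parts(2)[of P r] by (intro eq_matI) auto
  then show ?thesis by (simp add: shrink_def lin_incl_def)
qed

text \<open>Lets \<open>rep_ring_subset\<close> show that pullback maps one coordinate ring into
  another: only generators have to be inspected.\<close>

lemma subalg_vimage:
  assumes A: "subalg S A" and u: "\<And>s. s \<in> S \<Longrightarrow> u s \<in> T"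
  shows "subalg T {b \<in> extensional T. pullback S u b \<in> A}"
  unfolding subalg_def
proof (intro conjI allI ballI)
  fix c
  have "pullback S u (\<lambda>x\<in>T. c) = (\<lambda>x\<in>S. c)" using u by (auto simp: pullback_def)
  then show "(\<lambda>x\<in>T. c) \<in> {b \<in> extensional T. pullback S u b \<in> A}" using subalgD(2)[OF A] by simp
next
  fix f g assume fg: "f \<in> {b \<in> extensional T. pullback S u b \<in> A}" "g \<in> {b \<in> extensional T. pullback S u b \<in> A}"
  have "pullback S u (\<lambda>x\<in>T. f x + g x) = (\<lambda>x\<in>S. pullback S u f x + pullback S u g x)"
    "pullback S u (\<lambda>x\<in>T. f x * g x) = (\<lambda>x\<in>S. pullback S u f x * pullback S u g x)"
    using u by (auto simp: pullback_def)
  then show "(\<lambda>x\<in>T. f x + g x) \<in> {b \<in> extensional T. pullback S u b \<in> A}"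
    "(\<lambda>x\<in>T. f x * g x) \<in> {b \<in> extensional T. pullback S u b \<in> A}"
    using subalgD(3,4)[OF A, of "pullback S u f" "pullback S u g"] fg by (simp_all del: restrict_apply)
qed auto

lemma poly_eq_const:
  assumes "\<And>t. t \<noteq> 0 \<Longrightarrow> poly p t = (c :: complex)" shows "poly p 0 = c"
proof -
  have "p - [:c:] = 0"
  proof (rule ccontr)
    assume "p - [:c:] \<noteq> 0"
    then have "finite {t. poly (p - [:c:]) t = 0}" by (rule poly_roots_finite)
    moreover have "UNIV - {0} \<subseteq> {t. poly (p - [:c:]) t = 0}" using assms by auto
    moreover have "infinite (UNIV - {0 :: complex})" by (simp add: infinite_UNIV_char_0)
    ultimately show False using finite_subset by blast
  qed
  then show ?thesis by simp
qed

text \<open>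
  Conjugation by the homothety of ratio \<open>t\<close> multiplies the translation part by \<open>t\<close>; letting \<open>t\<close> tend
  to \<open>0\<close>, an invariant function does not see the translation part.
\<close>

lemma invariant_AGL_lin:
  assumes a: "a \<in> invariant_ring n (r + 1) (AGL r)" and z: "z \<in> rep_variety n (AGL r)"
  shows "a (lin_incl r (lin_part r (fst z)), lin_incl r (lin_part r (snd z))) = a z"
proof -
  let ?S = "rep_variety n (AGL r)"
  define sh where "sh t z = (shrink r t (fst z), shrink r t (snd z))" for t z
  have zc: "fst z \<in> carrier (AGL r)" "snd z \<in> carrier (AGL r)" if "z \<in> ?S" for z
    using that by (cases z; simp add: rep_variety_iff[OF group_AGL])+
  have sh0: "sh 0 z = (lin_incl r (lin_part r (fst z)), lin_incl r (lin_part r (snd z)))" if "z \<in> ?S" for z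
    using zc[OF that] by (simp add: sh_def shrink_0)
  \<comment> \<open>No group element realises \<open>t = 0\<close>; there the pair is a
    representation because it arises from the homomorphisms \<open>lin_part\<close> and
    \<open>lin_incl\<close>.\<close>
  have shS: "sh t z \<in> ?S" if "z \<in> ?S" for t z
  proof (cases "t = 0")
    case True
    have "(lin_part r (fst z), lin_part r (snd z)) \<in> rep_variety n (GL r)"
      by (rule hom_rep_variety[OF group_AGL group_GL lin_part_hom]) (use that in simp)
    from hom_rep_variety[OF group_GL group_AGL lin_incl_hom this] show ?thesis using True sh0[OF that] by simp
  next
    case False
    show ?thesis
      using conj_rep_variety[OF group_AGL shrink_conj(1)[OF zc(1)[OF that] False], of "fst z" "snd z" n] that
        shrink_conj(2)[OF zc(1)[OF that] False] shrink_conj(2)[OF zc(2)[OF that] False]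
      by (simp add: sh_def)
  qed
  \<comment> \<open>Regular functions are polynomial along the path, not merely rational: the
    determinant of \<open>shrink r t P\<close> does not depend on \<open>t\<close>, so even the
    inverse determinants are constant. This is what makes the passage to \<open>t = 0\<close>
    legitimate.\<close>
  let ?A = "{f \<in> extensional ?S. \<forall>z\<in>?S. \<exists>p. \<forall>t. f (sh t z) = poly p t}"
  have base: "restrict f ?S \<in> ?A" if "\<And>z. z \<in> ?S \<Longrightarrow> \<exists>p. \<forall>t. f (sh t z) = poly p t" for f
    using that shS by simp
  have "subalg ?S ?A"
    unfolding subalg_def
  proof (intro conjI allI ballI)
    show "(\<lambda>x\<in>?S. c) \<in> ?A" for c by (rule base) (auto intro: exI[of _ "[:c:]"])
    fix f g assume fg: "f \<in> ?A" "g \<in> ?A"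
    show "(\<lambda>x\<in>?S. f x + g x) \<in> ?A"
    proof (rule base)
      fix z assume "z \<in> ?S"
      then obtain p p' where "\<forall>t. f (sh t z) = poly p t" "\<forall>t. g (sh t z) = poly p' t" using fg by blast
      then show "\<exists>p. \<forall>t. f (sh t z) + g (sh t z) = poly p t" by (intro exI[of _ "p + p'"]) simp
    qed
    show "(\<lambda>x\<in>?S. f x * g x) \<in> ?A"
    proof (rule base)
      fix z assume "z \<in> ?S"
      then obtain p p' where "\<forall>t. f (sh t z) = poly p t" "\<forall>t. g (sh t z) = poly p' t" using fg by blast
      then show "\<exists>p. \<forall>t. f (sh t z) * g (sh t z) = poly p t" by (intro exI[of _ "p * p'"]) simp
    qed
  qed auto
  then have "rep_ring n (r + 1) (AGL r) \<subseteq> ?A"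
  proof (rule rep_ring_subset)
    have ent: "\<exists>p. \<forall>t. shrink r t P $$ (i, j) = poly p t" if P: "P \<in> carrier (AGL r)" and ij: "i < r + 1" "j < r + 1" for P i j
    proof -
      note P' = AGL_parts[OF P]
      have "shrink r t P $$ (i, j) = poly (if i = 0 then (if j = 0 then 1 else 0) else
          if j = 0 then [:0, trans_part r P $$ (i - 1, 0):] else [:lin_part r P $$ (i - 1, j - 1):]) t" for t
        unfolding shrink_def using P' ij by (subst affine_block_entry) auto
      then show ?thesis by blast
    qed
    have det: "det (shrink r t P) = det (lin_part r P)" if P: "P \<in> carrier (AGL r)" for P t
      unfolding shrink_def using AGL_parts[OF P] by (intro det_affine_block) auto
    show "(\<lambda>z\<in>?S. fst z $$ (i, j)) \<in> ?A" if "i < r + 1" "j < r + 1" for i j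
      by (rule base) (use ent[OF zc(1) that] in \<open>simp add: sh_def\<close>)
    show "(\<lambda>z\<in>?S. snd z $$ (i, j)) \<in> ?A" if "i < r + 1" "j < r + 1" for i j
      by (rule base) (use ent[OF zc(2) that] in \<open>simp add: sh_def\<close>)
    show "(\<lambda>z\<in>?S. 1 / det (fst z)) \<in> ?A"
      by (rule base) (use det[OF zc(1)] in \<open>auto simp: sh_def intro!: exI[of _ "[:_:]"]\<close>)
    show "(\<lambda>z\<in>?S. 1 / det (snd z)) \<in> ?A"
      by (rule base) (use det[OF zc(2)] in \<open>auto simp: sh_def intro!: exI[of _ "[:_:]"]\<close>)
  qed
  then have "a \<in> ?A" using invariant_ringD(1)[OF a] by blast
  then obtain p where p: "\<forall>t. a (sh t z) = poly p t" using z by blast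
  have "poly p t = a z" if t: "t \<noteq> 0" for t
  proof -
    have "a (sh t z) = a (fst z, snd z)"
      using invariant_ringD(2)[OF a shrink_conj(1)[OF zc(1)[OF z] t], of "fst z" "snd z"] z
        shrink_conj(2)[OF zc(1)[OF z] t] shrink_conj(2)[OF zc(2)[OF z] t] by (simp add: sh_def)
    then show ?thesis using p by simp
  qed
  then have "poly p 0 = a z" by (rule poly_eq_const)
  then show ?thesis using p sh0[OF z] by metis
qed

text \<open>\<open>lin_part\<close> after \<open>lin_incl\<close> is the identity, and the other
  composition is invisible to invariants by \<open>invariant_AGL_lin\<close>. Both maps are
  homomorphisms with polynomial entries that preserve determinants, so pullback respects coordinate
  rings and invariance in both directions.\<close>

theorem AGL_GL:
  shows "isomorphic (character_variety n (r + 1) (AGL r)) (character_variety n r (GL r))"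
    and "finitely_generated (rep_variety n (AGL r)) (invariant_ring n (r + 1) (AGL r))"
proof -
  let ?S = "rep_variety n (AGL r)" and ?T = "rep_variety n (GL r)"
  let ?A = "invariant_ring n (r + 1) (AGL r)" and ?B = "invariant_ring n r (GL r)"
  define u where "u z = (lin_part r (fst z), lin_part r (snd z))" for z
  define v where "v z = (lin_incl r (fst z), lin_incl r (snd z))" for z
  interpret G: group "AGL r" by (rule group_AGL)
  interpret L: group "GL r" by (rule group_GL)
  have zc: "fst z \<in> carrier (AGL r)" "snd z \<in> carrier (AGL r)" if "z \<in> ?S" for z
    using that by (cases z; simp add: rep_variety_iff[OF group_AGL])+
  have u: "u z \<in> ?T" if "z \<in> ?S" for z
    unfolding u_def by (rule hom_rep_variety[OF group_AGL group_GL lin_part_hom]) (use that in simp)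
  have v: "v z \<in> ?S" if "z \<in> ?T" for z
    unfolding v_def by (rule hom_rep_variety[OF group_GL group_AGL lin_incl_hom]) (use that in simp)
  have A: "subalg ?S ?A" by (rule subalg_invariant_ring[OF group_AGL])
  have B: "subalg ?T ?B" by (rule subalg_invariant_ring[OF group_GL])
  have "rep_ring n r (GL r) \<subseteq> {b \<in> extensional ?T. pullback ?S u b \<in> rep_ring n (r + 1) (AGL r)}"
  proof (rule rep_ring_subset[OF subalg_vimage[OF subalg_rep_ring u]])
    show "(\<lambda>z\<in>?T. fst z $$ (i, j)) \<in> {b \<in> extensional ?T. pullback ?S u b \<in> rep_ring n (r + 1) (AGL r)}"
      "(\<lambda>z\<in>?T. snd z $$ (i, j)) \<in> {b \<in> extensional ?T. pullback ?S u b \<in> rep_ring n (r + 1) (AGL r)}"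
      if "i < r" "j < r" for i j
    proof -
      have "pullback ?S u (\<lambda>z\<in>?T. fst z $$ (i, j)) = (\<lambda>z\<in>?S. fst z $$ (Suc i, Suc j))"
        "pullback ?S u (\<lambda>z\<in>?T. snd z $$ (i, j)) = (\<lambda>z\<in>?S. snd z $$ (Suc i, Suc j))"
        unfolding pullback_def using u that by (auto intro!: restrict_ext simp: u_def lin_part_def)
      then show "(\<lambda>z\<in>?T. fst z $$ (i, j)) \<in> {b \<in> extensional ?T. pullback ?S u b \<in> rep_ring n (r + 1) (AGL r)}"
        "(\<lambda>z\<in>?T. snd z $$ (i, j)) \<in> {b \<in> extensional ?T. pullback ?S u b \<in> rep_ring n (r + 1) (AGL r)}"
        using rep_ring_gens[of "Suc i" "r + 1" "Suc j" n "AGL r"] that by (simp_all del: restrict_apply)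
    qed
    have det: "det (lin_part r P) = det P" if P: "P \<in> carrier (AGL r)" for P
      using AGL_parts[OF P] det_affine_block[of "trans_part r P" r "lin_part r P"] by simp
    have "pullback ?S u (\<lambda>z\<in>?T. 1 / det (fst z)) = (\<lambda>z\<in>?S. 1 / det (fst z))"
      "pullback ?S u (\<lambda>z\<in>?T. 1 / det (snd z)) = (\<lambda>z\<in>?S. 1 / det (snd z))"
      unfolding pullback_def using u det zc by (auto intro!: restrict_ext simp: u_def)
    then show "(\<lambda>z\<in>?T. 1 / det (fst z)) \<in> {b \<in> extensional ?T. pullback ?S u b \<in> rep_ring n (r + 1) (AGL r)}"
      "(\<lambda>z\<in>?T. 1 / det (snd z)) \<in> {b \<in> extensional ?T. pullback ?S u b \<in> rep_ring n (r + 1) (AGL r)}"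
      using rep_ring_dets[where N = "r + 1" and G = "AGL r" and n = n] by (simp_all del: restrict_apply)
  qed
  then have pu0: "pullback ?S u b \<in> rep_ring n (r + 1) (AGL r)" if "b \<in> rep_ring n r (GL r)" for b using that by blast
  have pu: "pullback ?S u b \<in> ?A" if b: "b \<in> ?B" for b
  proof (rule invariant_ringI[OF pu0[OF invariant_ringD(1)[OF b]]])
    fix g P Q assume g: "g \<in> carrier (AGL r)" and z: "(P, Q) \<in> ?S"
    have PQ: "P \<in> carrier (AGL r)" "Q \<in> carrier (AGL r)" using zc[OF z] by auto
    have "b (u (g \<otimes>\<^bsub>AGL r\<^esub> P \<otimes>\<^bsub>AGL r\<^esub> inv\<^bsub>AGL r\<^esub> g, g \<otimes>\<^bsub>AGL r\<^esub> Q \<otimes>\<^bsub>AGL r\<^esub> inv\<^bsub>AGL r\<^esub> g)) = b (u (P, Q))"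
      using invariant_ringD(2)[OF b AGL_parts(3)[OF g], of "lin_part r P" "lin_part r Q"] u[OF z]
      by (simp add: u_def G.hom_conj[OF group_GL lin_part_hom g] PQ)
    then show "pullback ?S u b (g \<otimes>\<^bsub>AGL r\<^esub> P \<otimes>\<^bsub>AGL r\<^esub> inv\<^bsub>AGL r\<^esub> g, g \<otimes>\<^bsub>AGL r\<^esub> Q \<otimes>\<^bsub>AGL r\<^esub> inv\<^bsub>AGL r\<^esub> g) = pullback ?S u b (P, Q)"
      using conj_rep_variety[OF group_AGL g z] z by (simp add: pullback_def)
  qed
  have inclc: "lin_incl r g \<in> carrier (AGL r)" if "g \<in> carrier (GL r)" for g
    using lin_incl_hom that by (auto simp: hom_def)
  have "rep_ring n (r + 1) (AGL r) \<subseteq> {a \<in> extensional ?S. pullback ?T v a \<in> rep_ring n r (GL r)}"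
  proof (rule rep_ring_subset[OF subalg_vimage[OF subalg_rep_ring v]])
    note R = subalgD[OF subalg_rep_ring[of n "GL r" r]]
    have TG: "fst z \<in> carrier_mat r r" "snd z \<in> carrier_mat r r" if "z \<in> ?T" for z using rep_GL_carrier[OF that] by blast+
    have ent: "lin_incl r C $$ (i, j) = (if i = 0 then (if j = 0 then 1 else 0) else if j = 0 then 0 else C $$ (i - 1, j - 1))"
      if "C \<in> carrier_mat r r" "i < r + 1" "j < r + 1" for C i j
      unfolding lin_incl_def using that by (subst affine_block_entry) auto
    show "(\<lambda>z\<in>?S. fst z $$ (i, j)) \<in> {a \<in> extensional ?S. pullback ?T v a \<in> rep_ring n r (GL r)}"
      "(\<lambda>z\<in>?S. snd z $$ (i, j)) \<in> {a \<in> extensional ?S. pullback ?T v a \<in> rep_ring n r (GL r)}"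
      if ij: "i < r + 1" "j < r + 1" for i j
    proof -
      have "pullback ?T v (\<lambda>z\<in>?S. fst z $$ (i, j)) = (if i = 0 then (if j = 0 then (\<lambda>z\<in>?T. 1) else (\<lambda>z\<in>?T. 0)) else
          if j = 0 then (\<lambda>z\<in>?T. 0) else (\<lambda>z\<in>?T. fst z $$ (i - 1, j - 1)))"
        "pullback ?T v (\<lambda>z\<in>?S. snd z $$ (i, j)) = (if i = 0 then (if j = 0 then (\<lambda>z\<in>?T. 1) else (\<lambda>z\<in>?T. 0)) else
          if j = 0 then (\<lambda>z\<in>?T. 0) else (\<lambda>z\<in>?T. snd z $$ (i - 1, j - 1)))"
        unfolding pullback_def using v TG ij by (auto intro!: restrict_ext simp: v_def ent)
      moreover have "(\<lambda>z\<in>?T. fst z $$ (i - 1, j - 1)) \<in> rep_ring n r (GL r)" "(\<lambda>z\<in>?T. snd z $$ (i - 1, j - 1)) \<in> rep_ring n r (GL r)"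
        if "i \<noteq> 0" "j \<noteq> 0" using rep_ring_gens[of "i - 1" r "j - 1" n "GL r"] ij that by auto
      ultimately show "(\<lambda>z\<in>?S. fst z $$ (i, j)) \<in> {a \<in> extensional ?S. pullback ?T v a \<in> rep_ring n r (GL r)}"
        "(\<lambda>z\<in>?S. snd z $$ (i, j)) \<in> {a \<in> extensional ?S. pullback ?T v a \<in> rep_ring n r (GL r)}"
        using R(2) by (simp_all del: restrict_apply)
    qed
    have det: "det (lin_incl r C) = det C" if "C \<in> carrier_mat r r" for C
      unfolding lin_incl_def using that by (intro det_affine_block) auto
    have "pullback ?T v (\<lambda>z\<in>?S. 1 / det (fst z)) = (\<lambda>z\<in>?T. 1 / det (fst z))"
      "pullback ?T v (\<lambda>z\<in>?S. 1 / det (snd z)) = (\<lambda>z\<in>?T. 1 / det (snd z))"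
      unfolding pullback_def using v det TG by (auto intro!: restrict_ext simp: v_def)
    then show "(\<lambda>z\<in>?S. 1 / det (fst z)) \<in> {a \<in> extensional ?S. pullback ?T v a \<in> rep_ring n r (GL r)}"
      "(\<lambda>z\<in>?S. 1 / det (snd z)) \<in> {a \<in> extensional ?S. pullback ?T v a \<in> rep_ring n r (GL r)}"
      using rep_ring_dets[where N = r and G = "GL r" and n = n] by (simp_all del: restrict_apply)
  qed
  then have pv0: "pullback ?T v a \<in> rep_ring n r (GL r)" if "a \<in> rep_ring n (r + 1) (AGL r)" for a using that by blast
  have pv: "pullback ?T v a \<in> ?B" if a: "a \<in> ?A" for a
  proof (rule invariant_ringI[OF pv0[OF invariant_ringD(1)[OF a]]])
    fix g P Q assume g: "g \<in> carrier (GL r)" and z: "(P, Q) \<in> ?T"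
    have PQ: "P \<in> carrier (GL r)" "Q \<in> carrier (GL r)" using rep_GL_carrier[OF z] by auto
    have "a (v (g \<otimes>\<^bsub>GL r\<^esub> P \<otimes>\<^bsub>GL r\<^esub> inv\<^bsub>GL r\<^esub> g, g \<otimes>\<^bsub>GL r\<^esub> Q \<otimes>\<^bsub>GL r\<^esub> inv\<^bsub>GL r\<^esub> g)) = a (v (P, Q))"
      using invariant_ringD(2)[OF a inclc[OF g], of "lin_incl r P" "lin_incl r Q"] v[OF z]
      by (simp add: v_def L.hom_conj[OF group_AGL lin_incl_hom g] PQ)
    then show "pullback ?T v a (g \<otimes>\<^bsub>GL r\<^esub> P \<otimes>\<^bsub>GL r\<^esub> inv\<^bsub>GL r\<^esub> g, g \<otimes>\<^bsub>GL r\<^esub> Q \<otimes>\<^bsub>GL r\<^esub> inv\<^bsub>GL r\<^esub> g) = pullback ?T v a (P, Q)"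
      using conj_rep_variety[OF group_GL g z] z by (simp add: pullback_def)
  qed
  have vu: "a (v (u z)) = a z" if "a \<in> ?A" "z \<in> ?S" for a z
    using invariant_AGL_lin[OF that] by (simp add: u_def v_def)
  have uv: "b (u (v z)) = b z" if "z \<in> ?T" for b :: "complex mat \<times> complex mat \<Rightarrow> complex" and z
    using rep_GL_carrier[OF that] by (simp add: u_def v_def lin_part_incl)
  show "isomorphic (character_variety n (r + 1) (AGL r)) (character_variety n r (GL r))"
    unfolding character_variety_def by (rule Spec_pullback(1)[OF A B u v pu pv vu uv])
  show "finitely_generated ?S ?A"
    by (rule Spec_pullback(2)[OF A B u v pu pv vu uv invariant_ring_GL_fg])
qed

section \<open>Invariants of pairs of two by two matrices\<close>

type_synonym c5 = "complex \<times> complex \<times> complex \<times> complex \<times> complex"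

lemma coords_c5: "set (coords :: (c5 \<Rightarrow> complex) list) =
    {\<lambda>v. fst v, \<lambda>v. fst (snd v), \<lambda>v. fst (snd (snd v)), \<lambda>v. fst (snd (snd (snd v))), \<lambda>v. snd (snd (snd (snd v)))}"
  by (simp add: coords_prod_def coords_complex_def)

lemma polys_id: "(\<lambda>x::complex. x) \<in> polys"
  by (rule polys_intros(2)) (simp add: coords_complex_def)

lemma polys_c5:
  "(\<lambda>v::c5. fst v) \<in> polys" "(\<lambda>v::c5. fst (snd v)) \<in> polys" "(\<lambda>v::c5. fst (snd (snd v))) \<in> polys"
  "(\<lambda>v::c5. fst (snd (snd (snd v)))) \<in> polys" "(\<lambda>v::c5. snd (snd (snd (snd v)))) \<in> polys"
  by (rule polys_intros(2), simp add: coords_c5)+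

lemma polys_power: "f \<in> polys \<Longrightarrow> (\<lambda>x. f x ^ k) \<in> polys"
  by (induction k) (auto intro: polys_intros)

lemma polys_uminus: "f \<in> polys \<Longrightarrow> (\<lambda>x. - f x) \<in> polys"
  using polys_diff[OF polys_intros(1)[of 0], of f] by simp

lemmas polys_rules = polys_intros(1,3,4) polys_diff polys_power polys_uminus polys_id polys_c5

lemma polys_comp:
  assumes "p \<in> polys" "\<And>g. g \<in> set coords \<Longrightarrow> (\<lambda>t. g (\<phi> t)) \<in> polys" shows "(\<lambda>t. p (\<phi> t)) \<in> polys"
  using assms(1)
proof (induction rule: polys_induct)
  case (gen g) then show ?case by (rule assms(2))
qed (auto intro: polys_intros)

lemma polys_comp_c5:
  assumes "p \<in> polys" "f1 \<in> polys" "f2 \<in> polys" "f3 \<in> polys" "f4 \<in> polys" "f5 \<in> polys"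
  shows "(\<lambda>t. p (f1 t, f2 t, f3 t, f4 t, f5 t)) \<in> polys"
  by (rule polys_comp[OF assms(1)]) (use assms in \<open>auto simp: coords_c5\<close>)

lemma polys_complex_poly: "f \<in> polys \<Longrightarrow> \<exists>P. \<forall>t::complex. f t = poly P t"
proof (induction rule: polys_induct)
  case (const c) show ?case by (rule exI[of _ "[:c:]"]) simp
next
  case (gen g) then show ?case by (intro exI[of _ "[:0, 1:]"]) (simp add: coords_complex_def)
next
  case (add f g)
  then obtain P Q where "\<forall>t. f t = poly P t" "\<forall>t. g t = poly Q t" by blast
  then show ?case by (intro exI[of _ "P + Q"]) simp
next
  case (mult f g)
  then obtain P Q where "\<forall>t. f t = poly P t" "\<forall>t. g t = poly Q t" by blast
  then show ?case by (intro exI[of _ "P * Q"]) simp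
qed

text \<open>Density along a line: the exceptional parameters are zeros of a nonzero polynomial
  \<open>h\<close>, so \<open>f * h\<close> vanishes identically, and then so does
  \<open>f\<close>.\<close>

lemma polys_complex_identity:
  fixes f h :: "complex \<Rightarrow> complex"
  assumes "f \<in> polys" "h \<in> polys" "h t0 \<noteq> 0" "\<And>t. h t \<noteq> 0 \<Longrightarrow> f t = 0" shows "f t = 0"
proof -
  obtain P where P: "\<forall>t. f t = poly P t" using polys_complex_poly[OF assms(1)] by blast
  obtain H where H: "\<forall>t. h t = poly H t" using polys_complex_poly[OF assms(2)] by blast
  have "poly (P * H) t = 0" for t using assms(4)[of t] P H by (cases "h t = 0") auto
  then have "P * H = 0" using poly_all_0_iff_0 by blast
  moreover have "H \<noteq> 0" using assms(3) H by auto
  ultimately have "P = 0" by simp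
  then show ?thesis using P by simp
qed

text \<open>Over the symmetric polynomials, those in \<open>b\<close> and \<open>b'\<close> are
  spanned by 1 and \<open>b - b'\<close>; products stay of this form because
  \<open>(b - b')^2 = (b + b')^2 - 4 * b * b'\<close> is symmetric.\<close>

lemma polys_symmetric_rep:
  fixes F :: "c5 \<Rightarrow> complex"
  assumes "F \<in> polys"
  shows "\<exists>G0\<in>polys. \<exists>G1\<in>polys. \<forall>x d b b' z.
    F (x, d, b, b', z) = G0 (x, d, b + b', b * b', z) + (b - b') * G1 (x, d, b + b', b * b', z)"
  using assms
proof (induction rule: polys_induct)
  case (const c)
  show ?case by (rule bexI[of _ "\<lambda>_. c"], rule bexI[of _ "\<lambda>_. 0"]) (auto intro: polys_rules)
next
  case (gen g)
  have h: "(\<lambda>v::c5. 1 / 2 * fst (snd (snd v))) \<in> polys" by (intro polys_rules)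
  have c: "(\<lambda>v::c5. a) \<in> polys" for a :: complex by (rule polys_rules)
  from gen consider "g = (\<lambda>v. fst v)" | "g = (\<lambda>v. fst (snd v))" | "g = (\<lambda>v. fst (snd (snd v)))"
    | "g = (\<lambda>v. fst (snd (snd (snd v))))" | "g = (\<lambda>v. snd (snd (snd (snd v))))" unfolding coords_c5 by blast
  then show ?case
  proof cases
    case 1 then show ?thesis by (intro bexI[OF _ polys_c5(1)] bexI[OF _ c[of 0]]) simp
  next
    case 2 then show ?thesis by (intro bexI[OF _ polys_c5(2)] bexI[OF _ c[of 0]]) simp
  next
    case 3 then show ?thesis by (intro bexI[OF _ h] bexI[OF _ c[of "1/2"]]) (simp add: field_simps)
  next
    case 4 then show ?thesis by (intro bexI[OF _ h] bexI[OF _ c[of "-1/2"]]) (simp add: field_simps)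
  next
    case 5 then show ?thesis by (intro bexI[OF _ polys_c5(5)] bexI[OF _ c[of 0]]) simp
  qed
next
  case (add f g)
  then obtain a0 a1 b0 b1 where *: "a0 \<in> polys" "a1 \<in> polys" "b0 \<in> polys" "b1 \<in> polys"
    "\<forall>x d b b' z. f (x, d, b, b', z) = a0 (x, d, b + b', b * b', z) + (b - b') * a1 (x, d, b + b', b * b', z)"
    "\<forall>x d b b' z. g (x, d, b, b', z) = b0 (x, d, b + b', b * b', z) + (b - b') * b1 (x, d, b + b', b * b', z)"
    by blast
  show ?case
    by (rule bexI[of _ "\<lambda>v. a0 v + b0 v"], rule bexI[of _ "\<lambda>v. a1 v + b1 v"])
      (use * in \<open>auto intro: polys_rules simp: algebra_simps\<close>)
next
  case (mult f g)
  then obtain a0 a1 b0 b1 where *: "a0 \<in> polys" "a1 \<in> polys" "b0 \<in> polys" "b1 \<in> polys"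
    "\<forall>x d b b' z. f (x, d, b, b', z) = a0 (x, d, b + b', b * b', z) + (b - b') * a1 (x, d, b + b', b * b', z)"
    "\<forall>x d b b' z. g (x, d, b, b', z) = b0 (x, d, b + b', b * b', z) + (b - b') * b1 (x, d, b + b', b * b', z)"
    by blast
  let ?D = "\<lambda>v::c5. fst (snd (snd v)) ^ 2 - 4 * fst (snd (snd (snd v)))"
  have e: "(A0 + D * A1) * (B0 + D * B1) = (A0 * B0 + ((b + b')^2 - 4 * (b * b')) * (A1 * B1)) + D * (A0 * B1 + A1 * B0)"
    if "D = b - b'" for A0 A1 B0 B1 b b' D :: complex
    unfolding that by (simp add: power2_eq_square algebra_simps)
  have p1: "(\<lambda>v. a0 v * b0 v + ?D v * (a1 v * b1 v)) \<in> polys" by (intro polys_rules *)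
  have p2: "(\<lambda>v. a0 v * b1 v + a1 v * b0 v) \<in> polys" by (intro polys_rules *)
  show ?case
    by (rule bexI[OF _ p1], rule bexI[OF _ p2]) (simp add: *(5,6) e[OF refl])
qed

section \<open>Two by two matrices and their traces\<close>

definition m2 :: "complex \<Rightarrow> complex \<Rightarrow> complex \<Rightarrow> complex \<Rightarrow> complex mat" where
  "m2 a b c d = mat 2 2 (\<lambda>(i, j). if i = 0 then (if j = 0 then a else b) else (if j = 0 then c else d))"

lemma m2_carrier: "m2 a b c d \<in> carrier_mat 2 2"
  by (simp add: m2_def)

lemma m2_entries: "m2 a b c d $$ (0, 0) = a" "m2 a b c d $$ (0, Suc 0) = b" "m2 a b c d $$ (Suc 0, 0) = c" "m2 a b c d $$ (Suc 0, Suc 0) = d"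
  by (simp_all add: m2_def)

lemma m2_eqI:
  assumes "A \<in> carrier_mat 2 2" shows "A = m2 (A $$ (0, 0)) (A $$ (0, 1)) (A $$ (1, 0)) (A $$ (1, 1))"
proof (rule eq_matI)
  fix i j assume "i < dim_row (m2 (A $$ (0, 0)) (A $$ (0, 1)) (A $$ (1, 0)) (A $$ (1, 1)))"
    "j < dim_col (m2 (A $$ (0, 0)) (A $$ (0, 1)) (A $$ (1, 0)) (A $$ (1, 1)))"
  then have "i = 0 \<or> i = 1" "j = 0 \<or> j = 1" by (auto simp: m2_def)
  then show "A $$ (i, j) = m2 (A $$ (0, 0)) (A $$ (0, 1)) (A $$ (1, 0)) (A $$ (1, 1)) $$ (i, j)"
    by (auto simp: m2_entries)
qed (use assms in \<open>auto simp: m2_def\<close>)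

lemma m2_cases:
  assumes "A \<in> carrier_mat 2 2" obtains a b c d where "A = m2 a b c d"
  using m2_eqI[OF assms] by blast

lemma m2_inject: "m2 a b c d = m2 a' b' c' d' \<longleftrightarrow> a = a' \<and> b = b' \<and> c = c' \<and> d = d'"
  by (metis m2_entries)

lemma m2_mult: "m2 a b c d * m2 a' b' c' d' = m2 (a * a' + b * c') (a * b' + b * d') (c * a' + d * c') (c * b' + d * d')"
proof -
  have "m2 a b c d * m2 a' b' c' d' \<in> carrier_mat 2 2" by (rule mult_carrier_mat[OF m2_carrier m2_carrier])
  from m2_eqI[OF this] show ?thesis
    by (simp add: mat_mult_entry[OF m2_carrier m2_carrier] m2_entries lessThan_nat_numeral numeral_2_eq_2)
qed

lemma m2_one: "1\<^sub>m 2 = m2 1 0 0 1"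
  by (rule eq_matI) (auto simp: m2_def)

lemma m2_det: "det (m2 a b c d) = a * d - b * c"
proof -
  have "det (m2 a b c d) = (\<Sum>j<2. m2 a b c d $$ (0, j) * cofactor (m2 a b c d) 0 j)"
    by (rule laplace_expansion_row[OF m2_carrier]) simp
  also have "\<dots> = a * d - b * c"
    by (simp add: numeral_2_eq_2 m2_entries cofactor_def mat_delete_def m2_def det_single)
  finally show ?thesis .
qed

definition tr2 :: "complex mat \<Rightarrow> complex" where
  "tr2 A = A $$ (0, 0) + A $$ (1, 1)"

lemma tr2_m2: "tr2 (m2 a b c d) = a + d"
  by (simp add: tr2_def m2_entries)

definition traces :: "complex mat \<times> complex mat \<Rightarrow> c5" where
  "traces z = (tr2 (fst z), det (fst z), tr2 (snd z), det (snd z), tr2 (fst z * snd z))"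

lemma traces_m2: "traces (m2 a b c d, m2 a' b' c' d') =
  (a + d, a * d - b * c, a' + d', a' * d' - b' * c', a * a' + b * c' + (c * b' + d * d'))"
  by (simp add: traces_def m2_mult tr2_m2 m2_det)

text \<open>The pair in the basis \<open>v, A v\<close>, where \<open>v\<close> is an eigenvector of
  \<open>B\<close> for \<open>b\<close>: \<open>A\<close> becomes the companion matrix with trace
  \<open>x\<close> and determinant \<open>d\<close>, and \<open>B\<close> becomes triangular, with
  its corner fixed by \<open>tr (A * B) = z\<close>.\<close>

definition slice :: "c5 \<Rightarrow> complex mat \<times> complex mat" where
  "slice v = (case v of (x, d, b, b', z) \<Rightarrow> (m2 0 (- d) 1 x, m2 b (z - x * b') 0 b'))"

lemma homog_polys:
  assumes "\<And>i. i \<in> I \<Longrightarrow> (\<lambda>t. \<xi> i (\<phi> t)) \<in> polys" shows "(\<lambda>t. homog I \<xi> e c (\<phi> t)) \<in> polys"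
proof -
  have "(\<lambda>t. word_monomial \<xi> w (\<phi> t)) \<in> polys" if "set w \<subseteq> I" for w
    using that by (induction w) (auto simp: word_monomial_simps intro: polys_intros assms)
  then show ?thesis unfolding homog_def by (intro polys_sum polys_intros(1,4)) (auto simp: words_def)
qed

lemma entries_2: "i \<in> entries 2 \<longleftrightarrow> i \<in> UNIV \<times> {0, 1} \<times> {0, 1}"
  by (auto simp: entries_def)

lemma entry_polys:
  assumes "a \<in> polys" "b \<in> polys" "c \<in> polys" "d \<in> polys" "a' \<in> polys" "b' \<in> polys" "c' \<in> polys" "d' \<in> polys"
    and "i \<in> entries 2"
  shows "(\<lambda>t. entry i (m2 (a t) (b t) (c t) (d t), m2 (a' t) (b' t) (c' t) (d' t))) \<in> polys"
  using assms unfolding entries_2 by (cases "fst i") (auto simp: entry_def m2_entries)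

text \<open>
  A pair \<open>(A, B)\<close> such that \<open>B\<close> has an eigenvector \<open>v\<close> with \<open>v, A v\<close> independent is conjugate to a
  point of the slice; polynomiality in the eigenvalue and symmetry under exchanging the two eigenvalues
  of \<open>B\<close> make an invariant a polynomial in the traces.
\<close>

theorem invariants_two_by_two:
  fixes p :: "complex mat \<times> complex mat \<Rightarrow> complex"
  assumes p: "p = (\<lambda>y. \<Sum>e<k. homog (entries 2) entry e c y)"
    and inv: "\<And>g z. g \<in> carrier (GL 2) \<Longrightarrow> fst z \<in> carrier_mat 2 2 \<Longrightarrow> snd z \<in> carrier_mat 2 2 \<Longrightarrow> p (conj_pair 2 g z) = p z"
  shows "\<exists>G\<in>polys. \<forall>A\<in>carrier_mat 2 2. \<forall>B\<in>carrier_mat 2 2. p (A, B) = G (traces (A, B))"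
proof -
  have pp: "(\<lambda>t. p (m2 (a t) (b t) (c t) (d t), m2 (a' t) (b' t) (c' t) (d' t))) \<in> polys"
    if "a \<in> polys" "b \<in> polys" "c \<in> polys" "d \<in> polys" "a' \<in> polys" "b' \<in> polys" "c' \<in> polys" "d' \<in> polys"
    for a b c d a' b' c' d' :: "'t::affine_coords \<Rightarrow> complex"
    unfolding p by (intro polys_sum homog_polys entry_polys that)
  define F where "F v = p (slice v)" for v
  have F: "F \<in> polys"
  proof -
    have "F = (\<lambda>v. p (m2 0 (- fst (snd v)) 1 (fst v), m2 (fst (snd (snd v)))
        (snd (snd (snd (snd v))) - fst v * fst (snd (snd (snd v)))) 0 (fst (snd (snd (snd v))))))"
      by (rule ext) (simp add: F_def slice_def case_prod_unfold)
    then show ?thesis by (simp only:) (intro pp polys_rules)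
  qed
  have sim: "p (A, B) = p (A', B')" if g: "g \<in> carrier (GL 2)" and AB: "A' \<in> carrier_mat 2 2" "B' \<in> carrier_mat 2 2"
    "A \<in> carrier_mat 2 2" "B \<in> carrier_mat 2 2" and e: "A * g = g * A'" "B * g = g * B'" for g A B A' B'
  proof -
    note g' = carrier_GL_mat[OF g] GL_inv[OF g]
    have "C = g * C' * inv\<^bsub>GL 2\<^esub> g" if "C \<in> carrier_mat 2 2" "C' \<in> carrier_mat 2 2" "C * g = g * C'" for C C'
    proof -
      have "g * C' * inv\<^bsub>GL 2\<^esub> g = C * (g * inv\<^bsub>GL 2\<^esub> g)"
        unfolding that(3)[symmetric] by (rule assoc_mult_mat[OF that(1) g'(1) g'(3)])
      then show ?thesis using g'(4) that(1) by simp
    qed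
    then have "(A, B) = conj_pair 2 g (A', B')" using AB e by (simp add: conj_pair_def)
    then show ?thesis using inv[OF g, of "(A', B')"] AB by simp
  qed
  have generic: "p (m2 a11 a12 a21 a22, m2 b11 b12 b21 b22) =
      F (a11 + a22, a11 * a22 - a12 * a21, b, b11 + b22 - b, a11 * b11 + a12 * b21 + (a21 * b12 + a22 * b22))"
    if ev: "b11 * v1 + b12 * v2 = b * v1" "b21 * v1 + b22 * v2 = b * v2"
      and ind: "v1 * (a21 * v1 + a22 * v2) - (a11 * v1 + a12 * v2) * v2 \<noteq> 0"
    for a11 a12 a21 a22 b11 b12 b21 b22 v1 v2 b
    unfolding F_def slice_def prod.case
  proof (rule sim)
    \<comment> \<open>The columns are the eigenvector \<open>v\<close> of the second matrix and the
      image of \<open>v\<close> under the first; \<open>ind\<close> says that they are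
      independent.\<close>
    let ?g = "m2 v1 (a11 * v1 + a12 * v2) v2 (a21 * v1 + a22 * v2)"
    show "?g \<in> carrier (GL 2)" by (rule det_nonzero_GL[OF m2_carrier]) (use ind in \<open>simp add: m2_det\<close>)
    show "m2 a11 a12 a21 a22 * ?g = ?g * m2 0 (- (a11 * a22 - a12 * a21)) 1 (a11 + a22)"
      unfolding m2_mult m2_inject by (simp add: algebra_simps)
    show "m2 b11 b12 b21 b22 * ?g = ?g * m2 b (a11 * b11 + a12 * b21 + (a21 * b12 + a22 * b22) - (a11 + a22) * (b11 + b22 - b)) 0 (b11 + b22 - b)"
      unfolding m2_mult m2_inject
    proof (intro conjI)
      \<comment> \<open>\<open>?E1\<close> and \<open>?E2\<close> are the components of
        \<open>(B - b) v\<close>. The identities for the second column hold up to linear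
        combinations of these, which are written out below.\<close>
      let ?E1 = "b11 * v1 + b12 * v2 - b * v1" and ?E2 = "b21 * v1 + b22 * v2 - b * v2"
      have E: "?E1 = 0" "?E2 = 0" using ev by simp_all
      show "b11 * v1 + b12 * v2 = v1 * b + (a11 * v1 + a12 * v2) * 0" using ev by (simp add: mult.commute)
      show "b21 * v1 + b22 * v2 = v2 * b + (a21 * v1 + a22 * v2) * 0" using ev by (simp add: mult.commute)
      have "b11 * (a11 * v1 + a12 * v2) + b12 * (a21 * v1 + a22 * v2) =
        v1 * (a11 * b11 + a12 * b21 + (a21 * b12 + a22 * b22) - (a11 + a22) * (b11 + b22 - b)) + (a11 * v1 + a12 * v2) * (b11 + b22 - b)
        + ((a11 + a22) * ?E1 - (a11 * ?E1 + a12 * ?E2))" by (simp add: algebra_simps)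
      then show "b11 * (a11 * v1 + a12 * v2) + b12 * (a21 * v1 + a22 * v2) =
        v1 * (a11 * b11 + a12 * b21 + (a21 * b12 + a22 * b22) - (a11 + a22) * (b11 + b22 - b)) + (a11 * v1 + a12 * v2) * (b11 + b22 - b)"
        unfolding E by simp
      have "b21 * (a11 * v1 + a12 * v2) + b22 * (a21 * v1 + a22 * v2) =
        v2 * (a11 * b11 + a12 * b21 + (a21 * b12 + a22 * b22) - (a11 + a22) * (b11 + b22 - b)) + (a21 * v1 + a22 * v2) * (b11 + b22 - b)
        + ((a11 + a22) * ?E2 - (a21 * ?E1 + a22 * ?E2))" by (simp add: algebra_simps)
      then show "b21 * (a11 * v1 + a12 * v2) + b22 * (a21 * v1 + a22 * v2) =
        v2 * (a11 * b11 + a12 * b21 + (a21 * b12 + a22 * b22) - (a11 + a22) * (b11 + b22 - b)) + (a21 * v1 + a22 * v2) * (b11 + b22 - b)"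
        unfolding E by simp
    qed
  qed (rule m2_carrier)+
  have sym: "F (x, d, b, b', z) = F (x, d, b', b, z)" for x d b b' z
  proof (cases "b = b'")
    case False
    \<comment> \<open>\<open>(z - x * b', b' - b)\<close> is an eigenvector of the second slice
      matrix for \<open>b'\<close>, and \<open>?h z\<close> is the determinant that has to be
      nonzero for \<open>generic\<close>. In that basis the slice point appears with
      \<open>b\<close> and \<open>b'\<close> exchanged.\<close>
    let ?h = "\<lambda>z. (z - x * b') * ((z - x * b') + x * (b' - b)) + d * (b' - b)^2"
    have "F (x, d, b, b', z) - F (x, d, b', b, z) = 0" if "?h z \<noteq> 0" for z
    proof -
      have "p (m2 0 (- d) 1 x, m2 b (z - x * b') 0 b') =
        F (0 + x, 0 * x - (- d) * 1, b', b + b' - b', 0 * b + - d * 0 + (1 * (z - x * b') + x * b'))"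
        by (rule generic[of b "z - x * b'" "z - x * b'" "b' - b" b' 0 b' 1 x 0 "- d"])
          (use that in \<open>simp_all add: algebra_simps power2_eq_square\<close>)
      then show ?thesis by (simp add: F_def slice_def)
    qed
    moreover have "\<exists>z. ?h z \<noteq> 0"
    proof (rule ccontr)
      assume n: "\<not> (\<exists>z. ?h z \<noteq> 0)"
      have h: "?h z = 0" for z using n by blast
      \<comment> \<open>\<open>?h\<close> is a monic quadratic polynomial in \<open>z\<close>, and
        its second difference is twice the leading coefficient.\<close>
      have "?h (x * b' + 1) + ?h (x * b' - 1) - 2 * ?h (x * b') = 2" by (simp add: algebra_simps)
      then show False unfolding h by simp
    qed
    then obtain z0 where "?h z0 \<noteq> 0" by blast
    moreover have "?h \<in> polys" by (intro polys_rules)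
    moreover have "(\<lambda>z. F (x, d, b, b', z) - F (x, d, b', b, z)) \<in> polys"
      by (intro polys_diff polys_comp_c5[OF F] polys_rules)
    ultimately have "F (x, d, b, b', z) - F (x, d, b', b, z) = 0"
      using polys_complex_identity[of "\<lambda>z. F (x, d, b, b', z) - F (x, d, b', b, z)" ?h z0 z] by blast
    then show ?thesis by simp
  qed simp
  obtain G G1 where G: "G \<in> polys" "G1 \<in> polys" "\<And>x d b b' z. F (x, d, b, b', z) =
      G (x, d, b + b', b * b', z) + (b - b') * G1 (x, d, b + b', b * b', z)"
    using polys_symmetric_rep[OF F] by metis
  \<comment> \<open>Exchanging \<open>b\<close> and \<open>b'\<close> changes the sign of the second
    term only, so by \<open>sym\<close> that term vanishes.\<close>
  have FG: "F (x, d, b, b', z) = G (x, d, b + b', b * b', z)" for x d b b' z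
  proof -
    have "F (x, d, b', b, z) = G (x, d, b + b', b * b', z) + (b' - b) * G1 (x, d, b + b', b * b', z)"
      using G(3)[of x d b' b z] by (simp add: add.commute mult.commute)
    then have "(b - b') * G1 (x, d, b + b', b * b', z) = (b' - b) * G1 (x, d, b + b', b * b', z)"
      using sym[of x d b b' z] G(3)[of x d b b' z] by simp
    then have "2 * ((b - b') * G1 (x, d, b + b', b * b', z)) = 0" by (simp add: algebra_simps)
    then show ?thesis using G(3)[of x d b b' z] by simp
  qed
  have gen2: "p (m2 a11 a12 a21 a22, m2 b11 b12 b21 b22) = G (traces (m2 a11 a12 a21 a22, m2 b11 b12 b21 b22))"
    if ev: "b11 * v1 + b12 * v2 = b * v1" "b21 * v1 + b22 * v2 = b * v2" and chr: "b * b - (b11 + b22) * b + (b11 * b22 - b12 * b21) = 0"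
      and ind: "v1 * (a21 * v1 + a22 * v2) - (a11 * v1 + a12 * v2) * v2 \<noteq> 0"
    for a11 a12 a21 a22 b11 b12 b21 b22 v1 v2 b
  proof -
    have "b * (b11 + b22 - b) = b11 * b22 - b12 * b21" using chr by (simp add: algebra_simps)
    then show ?thesis unfolding generic[OF ev ind] FG traces_m2 by simp
  qed
  have "p (m2 a11 a12 a21 a22, m2 b11 b12 b21 b22) = G (traces (m2 a11 a12 a21 a22, m2 b11 b12 b21 b22))"
    for a11 a12 a21 a22 b11 b12 b21 b22
  proof -
    obtain b b' where bb: "b + b' = b11 + b22" "b * b' = b11 * b22 - b12 * b21" using quadratic_roots by blast
    have chr: "b * b - (b11 + b22) * b + (b11 * b22 - b12 * b21) = 0"
      unfolding bb[symmetric] by (simp add: algebra_simps)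
    have "\<exists>v1 v2. (v1 \<noteq> 0 \<or> v2 \<noteq> 0) \<and> b11 * v1 + b12 * v2 = b * v1 \<and> b21 * v1 + b22 * v2 = b * v2"
    \<comment> \<open>A nonzero vector annihilated by a nonzero row of \<open>B - b\<close> is an
      eigenvector by the characteristic equation; if both rows vanish, any nonzero vector will
      do.\<close>
    proof (cases "b12 = 0 \<and> b11 = b")
      case True
      show ?thesis
      proof (cases "b21 = 0 \<and> b22 = b")
        case T: True
        show ?thesis by (rule exI[of _ 1], rule exI[of _ 0]) (use True T in simp)
      next
        case F: False
        show ?thesis by (rule exI[of _ "b - b22"], rule exI[of _ b21]) (use True F in \<open>auto simp: algebra_simps\<close>)
      qed
    next
      case False
      show ?thesis by (rule exI[of _ b12], rule exI[of _ "b - b11"]) (use False chr in \<open>auto simp: algebra_simps\<close>)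
    qed
    then obtain v1 v2 where v: "v1 \<noteq> 0 \<or> v2 \<noteq> 0" "b11 * v1 + b12 * v2 = b * v1" "b21 * v1 + b22 * v2 = b * v2" by blast
    \<comment> \<open>A direction in which to perturb \<open>A\<close> such that \<open>v\<close>
      and \<open>A v\<close> are independent except for special \<open>t\<close>: the affine
      function \<open>?h\<close> gets slope \<open>v1^2\<close> or \<open>- v2^2\<close>, whichever
      is known to be nonzero. Both sides of the claim are polynomial in \<open>t\<close>, so the
      case \<open>t = 0\<close> follows.\<close>
    define c21 c12 :: complex where "c21 = (if v1 \<noteq> 0 then 1 else 0)" and "c12 = (if v1 \<noteq> 0 then 0 else 1)"
    let ?A = "\<lambda>t. m2 a11 (a12 + t * c12) (a21 + t * c21) a22" and ?B = "m2 b11 b12 b21 b22"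
    let ?h = "\<lambda>t. v1 * ((a21 + t * c21) * v1 + a22 * v2) - (a11 * v1 + (a12 + t * c12) * v2) * v2"
    let ?f = "\<lambda>t. p (?A t, ?B) - G (traces (?A t, ?B))"
    have "?f t = 0" if "?h t \<noteq> 0" for t using gen2[OF v(2,3) chr that] by simp
    moreover have "\<exists>t. ?h t \<noteq> 0"
    proof (rule ccontr)
      assume n: "\<not> (\<exists>t. ?h t \<noteq> 0)"
      have h: "?h t = 0" for t using n by blast
      have "?h 1 - ?h 0 = v1 * (c21 * v1) - c12 * v2 * v2" by (simp add: algebra_simps)
      then have "v1 * (c21 * v1) - c12 * v2 * v2 = 0" unfolding h by simp
      then show False using v(1) by (auto simp: c21_def c12_def split: if_splits)
    qed
    then obtain t0 where "?h t0 \<noteq> 0" by blast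
    moreover have "?h \<in> polys" by (intro polys_rules)
    moreover have "?f \<in> polys"
      unfolding traces_m2 by (intro polys_diff pp polys_comp_c5[OF G(1)] polys_rules)
    ultimately have "?f 0 = 0" using polys_complex_identity[of ?f ?h t0 0] by blast
    then show ?thesis by simp
  qed
  then have "\<forall>A\<in>carrier_mat 2 2. \<forall>B\<in>carrier_mat 2 2. p (A, B) = G (traces (A, B))"
    by (metis m2_cases)
  then show ?thesis using G(1) by blast
qed

section \<open>The character variety for two by two matrices\<close>

text \<open>Cayley-Hamilton in closed form: \<open>A^(n+1) = u A - d u'\<close>, where
  \<open>u\<close> and \<open>u'\<close> are the values of \<open>upoly\<close> at
  \<open>n + 1\<close> and \<open>n\<close>.\<close>

lemma m2_power:
  fixes a b c e :: complex
  defines "x \<equiv> a + e" and "d \<equiv> a * e - b * c"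
  shows "m2 a b c e ^\<^sub>m Suc n = m2 (upoly (Suc n) x d * a - d * upoly n x d) (upoly (Suc n) x d * b)
    (upoly (Suc n) x d * c) (upoly (Suc n) x d * e - d * upoly n x d)"
proof (induction n)
  case 0
  have "dim_row (m2 a b c e) = 2" by (simp add: m2_def)
  then show ?case by (simp add: m2_one m2_mult)
next
  case (Suc n)
  have "m2 a b c e ^\<^sub>m Suc (Suc n) = m2 a b c e ^\<^sub>m Suc n * m2 a b c e" by simp
  then show ?case unfolding Suc m2_mult m2_inject upoly.simps(3) x_def d_def by (simp add: algebra_simps)
qed

lemma m2_GL: "a * e - b * c \<noteq> 0 \<Longrightarrow> m2 a b c e \<in> carrier (GL 2)"
  by (rule det_nonzero_GL[OF m2_carrier]) (simp add: m2_det)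

text \<open>The terms on the right are entries of \<open>A B - B A\<close>, a matrix of trace 0, and
  their combination is \<open>- det (A B - B A)\<close>.\<close>

lemma reducible_discr_commutator:
  "reducible_discr (a + e) (a * e - b * c) (a' + e') (a' * e' - b' * c') (a * a' + b * c' + (c * b' + e * e')) =
    (b * c' - b' * c)^2 + ((a - e) * b' - b * (a' - e')) * (c * (a' - e') - c' * (a - e))"
  by (simp add: reducible_discr_def power2_eq_square algebra_simps)

text \<open>\<open>A^n B - B A^n = u (A B - B A)\<close>, so \<open>u\<close> annihilates every
  entry of the commutator, and the discriminant is a quadratic form in these entries.\<close>

lemma traces_in_image:
  assumes n: "n \<ge> 1" and z: "z \<in> rep_variety n (GL 2)" shows "traces z \<in> trace_image n"
proof -
  have c: "fst z \<in> carrier_mat 2 2" "snd z \<in> carrier_mat 2 2" and gl: "fst z \<in> carrier (GL 2)" "snd z \<in> carrier (GL 2)"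
    using rep_GL_carrier[OF z] by auto
  obtain a b c e where A: "fst z = m2 a b c e" using m2_cases[OF c(1)] .
  obtain a' b' c' e' where B: "snd z = m2 a' b' c' e'" using m2_cases[OF c(2)] .
  have zz: "z = (m2 a b c e, m2 a' b' c' e')" using A B by (metis prod.collapse)
  have det: "a * e - b * c \<noteq> 0" "a' * e' - b' * c' \<noteq> 0" using det_GL(1) gl by (auto simp: A B m2_det dest: det_GL(1))
  obtain m where m: "n = Suc m" using n by (cases n) auto
  let ?u = "upoly n (a + e) (a * e - b * c)"
  have "m2 a b c e ^\<^sub>m n * m2 a' b' c' e' = m2 a' b' c' e' * m2 a b c e ^\<^sub>m n"
    using z unfolding zz rep_variety_GL by blast
  then have 1: "?u * (b * c' - b' * c) = 0" "?u * ((a - e) * b' - b * (a' - e')) = 0"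
    unfolding m m2_power m2_mult m2_inject by (simp_all add: algebra_simps)
  have "?u * reducible_discr (a + e) (a * e - b * c) (a' + e') (a' * e' - b' * c') (a * a' + b * c' + (c * b' + e * e')) =
    (?u * (b * c' - b' * c)) * (b * c' - b' * c) + (?u * ((a - e) * b' - b * (a' - e'))) * (c * (a' - e') - c' * (a - e))"
    unfolding reducible_discr_commutator by (simp only: power2_eq_square distrib_left mult.assoc)
  then show ?thesis unfolding zz traces_m2 trace_image_def 1 using det by simp
qed

text \<open>If \<open>upoly\<close> vanishes, \<open>A^n\<close> is scalar and every
  \<open>B\<close> is allowed, so the pair from the slice works. On the reducible locus diagonal
  matrices work, since the traces see only the eigenvalues and how those of \<open>A\<close> are
  matched with those of \<open>B\<close>.\<close>

lemma traces_surj: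
  assumes n: "n \<ge> 1" and v: "v \<in> trace_image n" shows "\<exists>z\<in>rep_variety n (GL 2). traces z = v"
proof -
  obtain x d y e z where v': "v = (x, d, y, e, z)" "d \<noteq> 0" "e \<noteq> 0" "upoly n x d = 0 \<or> reducible_discr x d y e z = 0"
    using v by (cases v) (auto simp: trace_image_def)
  obtain m where m: "n = Suc m" using n by (cases n) auto
  obtain b b' where b: "b + b' = y" "b * b' = e" using quadratic_roots by blast
  from v'(4) show ?thesis
  proof
    assume u: "upoly n x d = 0"
    let ?A = "m2 0 (- d) 1 x" and ?B = "m2 b (z - x * b') 0 b'"
    have "?A ^\<^sub>m n * ?B = ?B * ?A ^\<^sub>m n"
      unfolding m m2_power m2_mult m2_inject using u by (simp add: m)
    then have "(?A, ?B) \<in> rep_variety n (GL 2)" unfolding rep_variety_GL using v' b by (simp add: m2_GL)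
    moreover have "traces (?A, ?B) = v" unfolding traces_m2 v'(1) using b by simp
    ultimately show ?thesis by blast
  next
    assume k: "reducible_discr x d y e z = 0"
    obtain a a' where a: "a + a' = x" "a * a' = d" using quadratic_roots by blast
    \<comment> \<open>The quadratic equation for \<open>z\<close> has one solution for each of the
      two ways to match the eigenvalues.\<close>
    have "reducible_discr x d y e z = (z - (a * b + a' * b')) * (z - (a * b' + a' * b))"
      unfolding a[symmetric] b[symmetric] by (simp add: reducible_discr_def power2_eq_square algebra_simps)
    then have "z = a * b + a' * b' \<or> z = a * b' + a' * b" using k by auto
    then obtain c c' where c: "c + c' = y" "c * c' = e" "z = a * c + a' * c'" using b by (metis add.commute mult.commute)
    let ?A = "m2 a 0 0 a'" and ?B = "m2 c 0 0 c'"
    have "?A ^\<^sub>m n * ?B = ?B * ?A ^\<^sub>m n"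
      unfolding m m2_power m2_mult m2_inject by simp
    then have "(?A, ?B) \<in> rep_variety n (GL 2)" unfolding rep_variety_GL using v' a c by (simp add: m2_GL)
    moreover have "traces (?A, ?B) = v" unfolding traces_m2 v'(1) using a c by simp
    ultimately show ?thesis by blast
  qed
qed

lemma tr2_mult_commute: "A \<in> carrier_mat 2 2 \<Longrightarrow> B \<in> carrier_mat 2 2 \<Longrightarrow> tr2 (A * B) = tr2 (B * A)"
  by (erule m2_cases, erule m2_cases) (simp add: m2_mult tr2_m2 algebra_simps)

lemma tr2_conj:
  assumes g: "g \<in> carrier (GL 2)" and A: "A \<in> carrier_mat 2 2" shows "tr2 (g * A * inv\<^bsub>GL 2\<^esub> g) = tr2 A"
proof -
  note g' = carrier_GL_mat[OF g] GL_inv[OF g]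
  have "tr2 (g * A * inv\<^bsub>GL 2\<^esub> g) = tr2 (inv\<^bsub>GL 2\<^esub> g * (g * A))" using g' A by (intro tr2_mult_commute) auto
  also have "inv\<^bsub>GL 2\<^esub> g * (g * A) = inv\<^bsub>GL 2\<^esub> g * g * A" by (rule assoc_mult_mat[OF g'(3,1) A, symmetric])
  finally show ?thesis using g' A by simp
qed

lemma traces_conj:
  assumes g: "g \<in> carrier (GL 2)" and A: "A \<in> carrier_mat 2 2" and B: "B \<in> carrier_mat 2 2"
  shows "traces (g * A * inv\<^bsub>GL 2\<^esub> g, g * B * inv\<^bsub>GL 2\<^esub> g) = traces (A, B)"
proof -
  note g' = carrier_GL_mat[OF g] GL_inv[OF g]
  let ?h = "inv\<^bsub>GL 2\<^esub> g"
  have "(g * A * ?h) * (g * B * ?h) = g * A * (?h * (g * (B * ?h)))"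
    using g' A B by (simp add: assoc_mult_mat[of _ 2 2 _ 2 _ 2])
  also have "?h * (g * (B * ?h)) = B * ?h"
    using g' B by (simp flip: assoc_mult_mat[of ?h 2 2 g 2 "B * ?h" 2])
  also have "g * A * (B * ?h) = g * (A * B) * ?h"
    using g' A B by (simp add: assoc_mult_mat[of _ 2 2 _ 2 _ 2])
  finally have "tr2 ((g * A * ?h) * (g * B * ?h)) = tr2 (A * B)" using tr2_conj[OF g, of "A * B"] A B by simp
  then show ?thesis using tr2_conj[OF g] det_conj[OF g] A B by (simp add: traces_def)
qed

section \<open>The coordinate ring of the trace image\<close>

definition trace_algebra :: "nat \<Rightarrow> (c5 \<Rightarrow> complex) set" where
  "trace_algebra n = generated_algebra (trace_image n)
    (set coords \<union> {\<lambda>v. 1 / fst (snd v), \<lambda>v. 1 / fst (snd (snd (snd v)))})"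

lemma subalg_trace_algebra: "subalg (trace_image n) (trace_algebra n)"
  unfolding trace_algebra_def by (rule subalg_generated)

lemma trace_algebra_polys: "f \<in> polys \<Longrightarrow> restrict f (trace_image n) \<in> trace_algebra n"
proof (induction rule: polys_induct)
  note A = subalgD[OF subalg_trace_algebra[of n]]
  {
    case (const c) show ?case by (rule A(2))
  next
    case (gen g) then show ?case unfolding trace_algebra_def by (intro generated_algebra.gen) simp
  next
    case (add f g)
    have "(\<lambda>x\<in>trace_image n. f x + g x) =
        (\<lambda>x\<in>trace_image n. restrict f (trace_image n) x + restrict g (trace_image n) x)" by (rule restrict_ext) simp
    then show ?case using A(3)[OF add(3,4)] by (simp del: restrict_apply)
  next
    case (mult f g)
    have "(\<lambda>x\<in>trace_image n. f x * g x) =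
        (\<lambda>x\<in>trace_image n. restrict f (trace_image n) x * restrict g (trace_image n) x)" by (rule restrict_ext) simp
    then show ?case using A(4)[OF mult(3,4)] by (simp del: restrict_apply)
  }
qed

lemma trace_algebra_inverses:
  "(\<lambda>v\<in>trace_image n. 1 / fst (snd v)) \<in> trace_algebra n"
  "(\<lambda>v\<in>trace_image n. 1 / fst (snd (snd (snd v)))) \<in> trace_algebra n"
  unfolding trace_algebra_def by (intro generated_algebra.gen, simp)+

lemma upoly_reducible_discr_polys: "(\<lambda>v::c5. upoly n (fst v) (fst (snd v)) *
    reducible_discr (fst v) (fst (snd v)) (fst (snd (snd v))) (fst (snd (snd (snd v)))) (snd (snd (snd (snd v))))) \<in> polys"
proof -
  have "(\<lambda>v::c5. upoly n (fst v) (fst (snd v))) \<in> polys"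
  proof (induction n rule: less_induct)
    case (less n)
    consider "n = 0" | "n = Suc 0" | k where "n = Suc (Suc k)" by (metis not0_implies_Suc)
    then show ?case by cases (use less in \<open>auto intro!: polys_rules\<close>)
  qed
  moreover have "(\<lambda>v::c5. reducible_discr (fst v) (fst (snd v)) (fst (snd (snd v))) (fst (snd (snd (snd v)))) (snd (snd (snd (snd v))))) \<in> polys"
    unfolding reducible_discr_def by (intro polys_rules)
  ultimately show ?thesis by (rule polys_intros(4))
qed

lemma trace_image_iff: "v \<in> trace_image n \<longleftrightarrow> fst (snd v) \<noteq> 0 \<and> fst (snd (snd (snd v))) \<noteq> 0 \<and>
   upoly n (fst v) (fst (snd v)) *
    reducible_discr (fst v) (fst (snd v)) (fst (snd (snd v))) (fst (snd (snd (snd v)))) (snd (snd (snd (snd v)))) = 0"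
  by (auto simp: trace_image_def)

text \<open>A character is determined by its values \<open>t\<close> on the five coordinates. It
  sends the invertible elements \<open>d\<close> and \<open>e\<close> to nonzero numbers and
  respects the defining equation, so \<open>t\<close> lies in the trace image and the character is
  evaluation at \<open>t\<close>.\<close>

lemma Spec_trace_algebra:
  "isomorphic (Spec (trace_image n) (trace_algebra n)) (zar (trace_image n))"
proof -
  let ?M = "trace_image n" and ?B = "trace_algebra n"
  note B = subalgD[OF subalg_trace_algebra[of n]]
  have "isomorphic (Spec ?M ?B) (zariski_space ?M ?B)"
  proof (rule Spec_points[OF subalg_trace_algebra])
    fix \<chi> assume \<chi>: "\<chi> \<in> characters ?M ?B"
    have \<chi>c: "\<chi> (\<lambda>x\<in>?M. c) = c" for c using \<chi> by (simp add: characters_def)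
    have \<chi>a: "\<chi> (\<lambda>x\<in>?M. f x + g x) = \<chi> f + \<chi> g" "\<chi> (\<lambda>x\<in>?M. f x * g x) = \<chi> f * \<chi> g"
      if "f \<in> ?B" "g \<in> ?B" for f g using \<chi> that by (simp_all add: characters_def)
    let ?r = "\<lambda>f. \<chi> (restrict f ?M)"
    define t :: c5 where "t = (?r (\<lambda>v. fst v), ?r (\<lambda>v. fst (snd v)), ?r (\<lambda>v. fst (snd (snd v))),
      ?r (\<lambda>v. fst (snd (snd (snd v)))), ?r (\<lambda>v. snd (snd (snd (snd v)))))"
    have poly: "?r f = f t" if "f \<in> polys" for f
      using that
    proof (induction rule: polys_induct)
      case (const c) show ?case by (rule \<chi>c)
    next
      case (gen g) then show ?case unfolding coords_c5 by (auto simp: t_def simp del: restrict_apply)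
    next
      case (add f g)
      have "(\<lambda>x\<in>?M. f x + g x) = (\<lambda>x\<in>?M. restrict f ?M x + restrict g ?M x)" by (rule restrict_ext) simp
      then show ?case using \<chi>a(1)[OF trace_algebra_polys[OF add(1)] trace_algebra_polys[OF add(2)]] add
        by (simp del: restrict_apply)
    next
      case (mult f g)
      have "(\<lambda>x\<in>?M. f x * g x) = (\<lambda>x\<in>?M. restrict f ?M x * restrict g ?M x)" by (rule restrict_ext) simp
      then show ?case using \<chi>a(2)[OF trace_algebra_polys[OF mult(1)] trace_algebra_polys[OF mult(2)]] mult
        by (simp del: restrict_apply)
    qed
    have inv: "f t \<noteq> 0 \<and> ?r (\<lambda>v. 1 / f v) = 1 / f t"
      if f: "f \<in> polys" "\<And>v. v \<in> ?M \<Longrightarrow> f v \<noteq> 0" "(\<lambda>v\<in>?M. 1 / f v) \<in> ?B" for f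
    proof -
      have "(\<lambda>x\<in>?M. restrict f ?M x * (\<lambda>v\<in>?M. 1 / f v) x) = (\<lambda>x\<in>?M. 1)" by (rule restrict_ext) (use f(2) in simp)
      then have "f t * ?r (\<lambda>v. 1 / f v) = 1"
        using \<chi>a(2)[OF trace_algebra_polys[OF f(1)] f(3)] \<chi>c[of 1] poly[OF f(1)] by (simp del: restrict_apply)
      then have "f t \<noteq> 0" "?r (\<lambda>v. 1 / f v) * f t = 1" by (auto simp: mult.commute simp del: restrict_apply)
      then show ?thesis by (simp add: nonzero_eq_divide_eq del: restrict_apply)
    qed
    have d: "fst (snd t) \<noteq> 0 \<and> ?r (\<lambda>v. 1 / fst (snd v)) = 1 / fst (snd t)"
      by (rule inv[OF polys_c5(2) _ trace_algebra_inverses(1)]) (simp add: trace_image_iff)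
    have e: "fst (snd (snd (snd t))) \<noteq> 0 \<and> ?r (\<lambda>v. 1 / fst (snd (snd (snd v)))) = 1 / fst (snd (snd (snd t)))"
      by (rule inv[OF polys_c5(4) _ trace_algebra_inverses(2)]) (simp add: trace_image_iff)
    have "restrict (\<lambda>v::c5. upoly n (fst v) (fst (snd v)) *
        reducible_discr (fst v) (fst (snd v)) (fst (snd (snd v))) (fst (snd (snd (snd v)))) (snd (snd (snd (snd v))))) ?M = (\<lambda>x\<in>?M. 0)"
      by (rule restrict_ext) (simp only: trace_image_iff)
    then have tM: "t \<in> ?M" unfolding trace_image_iff using d e poly[OF upoly_reducible_discr_polys[of n]] \<chi>c[of 0]
      by (simp del: restrict_apply mult_eq_0_iff)
    have "\<chi> b = b t" if "b \<in> ?B" for b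
      using that unfolding trace_algebra_def
    proof (induction rule: generated_algebra.induct)
      case (const c) show "\<chi> (\<lambda>x\<in>?M. c) = (\<lambda>x\<in>?M. c) t" using \<chi>c tM by simp
    next
      case (gen g)
      then have "?r g = g t" using d e poly[OF polys_intros(2)] by auto
      then show "\<chi> (restrict g ?M) = restrict g ?M t" using tM by simp
    next
      case (add f g)
      then show "\<chi> (\<lambda>x\<in>?M. f x + g x) = (\<lambda>x\<in>?M. f x + g x) t"
        using \<chi>a(1)[of f g] tM by (simp add: trace_algebra_def)
    next
      case (mult f g)
      then show "\<chi> (\<lambda>x\<in>?M. f x * g x) = (\<lambda>x\<in>?M. f x * g x) t"
        using \<chi>a(2)[of f g] tM by (simp add: trace_algebra_def)
    qed
    then show "\<exists>t\<in>?M. \<forall>b\<in>?B. \<chi> b = b t" using tM by blast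
  next
    fix t t' :: c5 assume t: "t \<in> ?M" "t' \<in> ?M" "\<And>b. b \<in> ?B \<Longrightarrow> b t = b t'"
    have eq: "f t = f t'" if "f \<in> polys" for f using t(3)[OF trace_algebra_polys[OF that]] t(1,2) by simp
    show "t = t'" using eq[OF polys_c5(1)] eq[OF polys_c5(2)] eq[OF polys_c5(3)] eq[OF polys_c5(4)] eq[OF polys_c5(5)]
      by (simp add: prod_eq_iff)
  qed
  \<comment> \<open>The inverses of \<open>d\<close> and \<open>e\<close> are global fractions of
    polynomials, so adjoining them changes neither the topology nor the regular functions.\<close>
  moreover have "isomorphic (zariski_space ?M ?B) (zar ?M)"
    unfolding zar_def
  proof (rule isomorphic_zariskiI[where \<phi> = "\<lambda>v. v" and \<psi> = "\<lambda>v. v"])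
    show "falg ?M ?B" unfolding trace_algebra_def by (rule falg_generated)
    show "falg ?M (polys :: (c5 \<Rightarrow> complex) set)" by (rule falg_polys)
    show "\<exists>a\<in>?B. \<exists>c\<in>?B. \<forall>x\<in>?M. c x \<noteq> 0 \<and> b x = a x / c x" if "b \<in> polys" for b :: "c5 \<Rightarrow> complex"
      by (rule bexI[OF _ trace_algebra_polys[OF that]], rule bexI[OF _ trace_algebra_polys[OF polys_intros(1)[of 1]]]) simp
    show "\<exists>b\<in>polys. \<exists>c\<in>polys. \<forall>x\<in>?M. c x \<noteq> 0 \<and> a x = b x / c x" if "a \<in> ?B" for a
    proof -
      have "regfun ?M a" using that unfolding trace_algebra_def
      proof (induction rule: generated_algebra.induct)
        case (const c) show ?case
          by (rule regfunI[OF polys_intros(1)[of c] polys_intros(1)[of 1]]) simp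
      next
        case (gen g)
        have "regfun ?M g"
        proof (cases "g \<in> set coords")
          case True then show ?thesis by (intro regfun_poly polys_intros(2))
        next
          case False
          then have "g = (\<lambda>v. 1 / fst (snd v)) \<or> g = (\<lambda>v. 1 / fst (snd (snd (snd v))))" using gen by blast
          then show ?thesis
            using regfunI[OF polys_intros(1)[of 1] polys_c5(2), of ?M] regfunI[OF polys_intros(1)[of 1] polys_c5(4), of ?M]
            by (auto simp: trace_image_iff)
        qed
        then show ?case by (auto simp: regfun_def)
      next
        case (add f g)
        from regfun_add[OF add.IH] show ?case by (auto simp: regfun_def)
      next
        case (mult f g)
        from regfun_mult[OF mult.IH] show ?case by (auto simp: regfun_def)
      qed
      then show ?thesis by (simp add: regfun_def)
    qed
  qed auto
  ultimately show ?thesis by (rule isomorphic_trans)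
qed

text \<open>The perturbations in \<open>invariants_two_by_two\<close> leave the representation
  variety. So the invariant, cleared of denominators, is first extended by
  \<open>lift_invariant\<close> to an invariant of all pairs of matrices.\<close>

lemma invariant_GL2_traces:
  assumes a: "a \<in> invariant_ring n 2 (GL 2)"
  shows "\<exists>G\<in>polys. \<exists>k. \<forall>z\<in>rep_variety n (GL 2). a z = G (traces z) * (1 / (det (fst z) * det (snd z))) ^ k"
proof -
  let ?X = "rep_variety n (GL 2)"
  interpret linear_action "entries 2" entry ?X "carrier (GL 2)" "conj_kernel 2" "conj_pair 2" mat_star
    "\<lambda>t z. (t \<cdot>\<^sub>m fst z, t \<cdot>\<^sub>m snd z)"
    by (rule linear_action_GL)
  obtain k p where p: "polyon (entries 2) entry ?X p" "\<And>z. z \<in> ?X \<Longrightarrow> p z = a z * (det (fst z) * det (snd z)) ^ k"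
    using rep_ring_denominator[OF invariant_ringD(1)[OF a]] by blast
  have "invar p" unfolding invar_def
  proof (intro ballI)
    fix g z assume g: "g \<in> carrier (GL 2)" and z: "z \<in> ?X"
    have "a (conj_pair 2 g z) = a z"
      using invariant_ringD(2)[OF a g, of "fst z" "snd z"] z by (simp add: conj_pair_def GL_simps)
    moreover have "det (fst (conj_pair 2 g z)) = det (fst z)" "det (snd (conj_pair 2 g z)) = det (snd z)"
      using rep_GL_carrier[OF z] g by (simp_all add: conj_pair_def det_conj)
    ultimately show "p (conj_pair 2 g z) = p z" using p(2)[OF z] p(2)[OF act_X[OF g z]] by simp
  qed
  from lift_invariant[OF p(1) this] obtain d c where dc:
    "\<forall>z\<in>?X. p z = (\<Sum>e<d. homog (entries 2) entry e c z)"
    "\<forall>g\<in>carrier (GL 2). \<forall>y y'. (\<forall>i\<in>entries 2. entry i y' = (\<Sum>j\<in>entries 2. conj_kernel 2 g i j * entry j y)) \<longrightarrow>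
       (\<Sum>e<d. homog (entries 2) entry e c y') = (\<Sum>e<d. homog (entries 2) entry e c y)" by blast
  define p' where "p' = (\<lambda>y. \<Sum>e<d. homog (entries 2) entry e c y)"
  have "p' (conj_pair 2 g z) = p' z"
    if "g \<in> carrier (GL 2)" "fst z \<in> carrier_mat 2 2" "snd z \<in> carrier_mat 2 2" for g z
    unfolding p'_def using dc(2) that(1) conj_pair_entry[OF that] by blast
  from invariants_two_by_two[OF p'_def this] obtain G where G: "G \<in> polys"
    "\<forall>A\<in>carrier_mat 2 2. \<forall>B\<in>carrier_mat 2 2. p' (A, B) = G (traces (A, B))" by blast
  have "a z = G (traces z) * (1 / (det (fst z) * det (snd z))) ^ k" if z: "z \<in> ?X" for z
  proof -
    have c: "fst z \<in> carrier_mat 2 2" "snd z \<in> carrier_mat 2 2" "det (fst z) * det (snd z) \<noteq> 0"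
      using rep_GL_carrier[OF z] det_GL(1) by auto
    have "a z * (det (fst z) * det (snd z)) ^ k = G (traces z)"
      using p(2)[OF z] dc(1) z G(2) c by (simp add: p'_def) (metis prod.collapse)
    then show ?thesis using c(3) by (simp add: power_divide field_simps)
  qed
  then show ?thesis using G(1) by blast
qed

text \<open>\<open>v\<close> picks any pair with the given traces. Only the functions
  \<open>a (v t)\<close> matter, and by \<open>invariant_GL2_traces\<close> they are polynomials in
  the traces divided by powers of \<open>d * e\<close>, whatever the choice.\<close>

theorem character_variety_GL2:
  assumes n: "n \<ge> 1" shows "isomorphic (character_variety n 2 (GL 2)) (zar (trace_image n))"
proof -
  let ?X = "rep_variety n (GL 2)" and ?M = "trace_image n" and ?A = "invariant_ring n 2 (GL 2)" and ?B = "trace_algebra n"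
  note B = subalgD[OF subalg_trace_algebra[of n]]
  define v where "v t = (SOME z. z \<in> ?X \<and> traces z = t)" for t
  have v: "v t \<in> ?X" "traces (v t) = t" if t: "t \<in> ?M" for t
  proof -
    have "\<exists>z. z \<in> ?X \<and> traces z = t" using traces_surj[OF n t] by blast
    then have "v t \<in> ?X \<and> traces (v t) = t" unfolding v_def by (rule someI_ex)
    then show "v t \<in> ?X" "traces (v t) = t" by blast+
  qed
  have u: "traces z \<in> ?M" if "z \<in> ?X" for z by (rule traces_in_image[OF n that])
  have XA: "subalg ?X ?A" by (rule subalg_invariant_ring[OF group_GL])
  have inv: "f (traces (g \<otimes>\<^bsub>GL 2\<^esub> A \<otimes>\<^bsub>GL 2\<^esub> inv\<^bsub>GL 2\<^esub> g, g \<otimes>\<^bsub>GL 2\<^esub> B \<otimes>\<^bsub>GL 2\<^esub> inv\<^bsub>GL 2\<^esub> g)) = f (traces (A, B))"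
    if "g \<in> carrier (GL 2)" "(A, B) \<in> ?X" for f :: "c5 \<Rightarrow> complex" and g A B
    using traces_conj[OF that(1)] rep_GL_carrier[OF that(2)] by (simp add: GL_simps)
  have invI: "(\<lambda>z\<in>?X. f (traces z)) \<in> ?A" if "(\<lambda>z\<in>?X. f (traces z)) \<in> rep_ring n 2 (GL 2)" for f
    by (rule invariant_ringI[OF that]) (simp add: inv conj_rep_variety[OF group_GL])
  let ?P = "polyon (entries 2) entry ?X"
  have ent: "?P (entry (b, i, j))" if "i < 2" "j < 2" for b i j
    by (rule polyon_coord[OF finite_entries]) (use that in \<open>simp add: entries_def\<close>)
  have e0: "?P (\<lambda>z. fst z $$ (i, j))" "?P (\<lambda>z. snd z $$ (i, j))" if "i < 2" "j < 2" for i j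
    using ent[OF that, of True] ent[OF that, of False] by (simp_all add: entry_def[abs_def])
  have carr: "fst z \<in> carrier_mat 2 2 \<and> snd z \<in> carrier_mat 2 2" if "z \<in> ?X" for z using rep_GL_carrier[OF that] by blast
  have t12: "?P (\<lambda>z. tr2 (fst z))" "?P (\<lambda>z. tr2 (snd z))"
    unfolding tr2_def by (intro polyon_add e0; simp)+
  have "?P (\<lambda>z. fst z $$ (0, 0) * snd z $$ (0, 0) + fst z $$ (0, 1) * snd z $$ (1, 0) +
     (fst z $$ (1, 0) * snd z $$ (0, 1) + fst z $$ (1, 1) * snd z $$ (1, 1)))"
    by (intro polyon_add polyon_mult finite_entries e0) simp_all
  then have t3: "?P (\<lambda>z. tr2 (fst z * snd z))"
  proof (rule polyon_cong)
    fix z assume "z \<in> ?X"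
    then obtain a b c e a' b' c' e' where "fst z = m2 a b c e" "snd z = m2 a' b' c' e'"
      using carr m2_cases by metis
    then show "tr2 (fst z * snd z) = fst z $$ (0, 0) * snd z $$ (0, 0) + fst z $$ (0, 1) * snd z $$ (1, 0) +
     (fst z $$ (1, 0) * snd z $$ (0, 1) + fst z $$ (1, 1) * snd z $$ (1, 1))"
      by (simp add: m2_mult tr2_m2 m2_entries)
  qed
  have gens: "(\<lambda>z\<in>?X. g (traces z)) \<in> ?A"
    if "g \<in> set coords \<union> {\<lambda>v. 1 / fst (snd v), \<lambda>v. 1 / fst (snd (snd (snd v)))}" for g
  proof (rule invI)
    have "?P (\<lambda>z. g (traces z))" if "g \<in> set coords"
      using that t12 t3 polyon_det[of ?X 2] carr unfolding coords_c5 by (auto simp: traces_def)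
    then show "(\<lambda>z\<in>?X. g (traces z)) \<in> rep_ring n 2 (GL 2)"
      using that polyon_rep_ring[of 2 n "\<lambda>z. g (traces z)"] rep_ring_dets[of n "GL 2" 2]
      by (cases "g \<in> set coords") (auto simp: traces_def simp del: restrict_apply)
  qed
  have pu: "pullback ?X traces b \<in> ?A" if "b \<in> ?B" for b
  proof -
    let ?C = "{b \<in> extensional ?M. pullback ?X traces b \<in> ?A}"
    have "subalg ?M ?C" by (rule subalg_vimage[OF XA u])
    note C = subalgD[OF this]
    have "b \<in> ?C"
      using that unfolding trace_algebra_def
    proof (induction rule: generated_algebra.induct)
      case (const c) show "(\<lambda>x\<in>?M. c) \<in> ?C" by (rule C(2))
    next
      case (gen g)
      have "pullback ?X traces (restrict g ?M) = (\<lambda>z\<in>?X. g (traces z))"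
        unfolding pullback_def by (rule restrict_ext) (simp add: u)
      then show "restrict g ?M \<in> ?C"
        using gens[OF gen] by (simp del: restrict_apply)
    next
      case (add f g) show "(\<lambda>x\<in>?M. f x + g x) \<in> ?C" by (rule C(3)[OF add.IH])
    next
      case (mult f g) show "(\<lambda>x\<in>?M. f x * g x) \<in> ?C" by (rule C(4)[OF mult.IH])
    qed
    then show ?thesis by blast
  qed
  \<comment> \<open>Both determinants are among the components of \<open>traces\<close>, so the
    formula for \<open>a\<close> takes the same value at any two pairs with equal traces.\<close>
  have fac: "a (v (traces z)) = a z" if a: "a \<in> ?A" and z: "z \<in> ?X" for a z
  proof -
    obtain G k where G: "\<forall>z\<in>?X. a z = G (traces z) * (1 / (det (fst z) * det (snd z))) ^ k"
      using invariant_GL2_traces[OF a] by blast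
    have e: "traces (v (traces z)) = traces z" "v (traces z) \<in> ?X" using v u[OF z] by auto
    have "det (fst (v (traces z))) = det (fst z)" "det (snd (v (traces z))) = det (snd z)"
      using e(1) by (simp_all add: traces_def)
    then show ?thesis using G e z by simp
  qed
  have pv: "pullback ?M v a \<in> ?B" if a: "a \<in> ?A" for a
  proof -
    obtain G k where G: "G \<in> polys" "\<forall>z\<in>?X. a z = G (traces z) * (1 / (det (fst z) * det (snd z))) ^ k"
      using invariant_GL2_traces[OF a] by blast
    have "(\<lambda>t\<in>?M. G t * (1 / (fst (snd t) * fst (snd (snd (snd t))))) ^ j) \<in> ?B" for j
    proof (induction j)
      case 0 then show ?case using trace_algebra_polys[OF G(1)] by (simp del: restrict_apply)
    next
      case (Suc j)
      let ?h = "\<lambda>t\<in>?M. G t * (1 / (fst (snd t) * fst (snd (snd (snd t))))) ^ j"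
      let ?d = "\<lambda>v\<in>?M. 1 / fst (snd v)" and ?e = "\<lambda>v\<in>?M. 1 / fst (snd (snd (snd v)))"
      have "(\<lambda>t\<in>?M. (\<lambda>t\<in>?M. ?h t * ?d t) t * ?e t) \<in> ?B" by (intro B(4) Suc trace_algebra_inverses)
      moreover have "(\<lambda>t\<in>?M. (\<lambda>t\<in>?M. ?h t * ?d t) t * ?e t) =
        (\<lambda>t\<in>?M. G t * (1 / (fst (snd t) * fst (snd (snd (snd t))))) ^ Suc j)"
        by (rule restrict_ext) simp
      ultimately show ?case by (simp del: restrict_apply)
    qed
    moreover have "pullback ?M v a = (\<lambda>t\<in>?M. G t * (1 / (fst (snd t) * fst (snd (snd (snd t))))) ^ k)"
      unfolding pullback_def
    proof (rule restrict_ext)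
      fix t assume t: "t \<in> ?M"
      have "det (fst (v t)) = fst (snd t)" "det (snd (v t)) = fst (snd (snd (snd t)))"
        using arg_cong[OF v(2)[OF t], of "\<lambda>v. fst (snd v)"] arg_cong[OF v(2)[OF t], of "\<lambda>v. fst (snd (snd (snd v)))"]
        by (simp_all add: traces_def)
      then show "a (v t) = G t * (1 / (fst (snd t) * fst (snd (snd (snd t))))) ^ k"
        using G(2) v[OF t] by simp
    qed
    ultimately show ?thesis by (simp del: restrict_apply)
  qed
  have "isomorphic (Spec ?X ?A) (Spec ?M ?B)"
    by (rule Spec_pullback(1)[OF XA subalg_trace_algebra u v(1) pu pv fac]) (simp_all add: v)
  then show ?thesis unfolding character_variety_def using Spec_trace_algebra by (rule isomorphic_trans)
qed

theorem theorem2: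
  fixes n :: nat
  assumes "n \<ge> 1"
  defines "q \<equiv> motive (affine_space 1)"
  shows "(\<forall>r\<ge>1.
            finitely_generated (rep_variety n (AGL r)) (invariant_ring n (r + 1) (AGL r)) \<and>
            affine_variety (character_variety n (r + 1) (AGL r)) \<and>
            isomorphic (character_variety n (r + 1) (AGL r)) (character_variety n r (GL r))) \<and>
         motive (character_variety n 3 (AGL 2)) =
           (q - 1)^2 * ((int_K0 \<lfloor>real n / 2\<rfloor> + 1) * q^2 - int_K0 \<lfloor>real n / 2\<rfloor> * q
             + int_K0 (int n - \<lfloor>real n / 2\<rfloor>))"
proof (intro conjI allI impI)
  fix r :: nat assume "r \<ge> 1"
  show "finitely_generated (rep_variety n (AGL r)) (invariant_ring n (r + 1) (AGL r))" by (rule AGL_GL(2))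
  then show "affine_variety (character_variety n (r + 1) (AGL r))"
    unfolding character_variety_def by (rule affine_variety_Spec)
  show "isomorphic (character_variety n (r + 1) (AGL r)) (character_variety n r (GL r))" by (rule AGL_GL(1))
next
  have q: "q = \<L>" unfolding q_def by (rule motive_affine_line)
  have "isomorphic (character_variety n 3 (AGL 2)) (zar (trace_image n))"
    using isomorphic_trans[OF AGL_GL(1)[of n 2] character_variety_GL2[OF assms(1)]] by simp
  then have "motive (character_variety n 3 (AGL 2)) = mot (trace_image n)"
    unfolding mot_def by (rule motive_cong)
  moreover have "\<lfloor>real n / 2\<rfloor> = int (n div 2)" using floor_divide_of_nat_eq[of n 2] by simp
  ultimately show "motive (character_variety n 3 (AGL 2)) =
      (q - 1)^2 * ((int_K0 \<lfloor>real n / 2\<rfloor> + 1) * q^2 - int_K0 \<lfloor>real n / 2\<rfloor> * q + int_K0 (int n - \<lfloor>real n / 2\<rfloor>))"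
    using mot_trace_image[OF assms(1)] by (simp add: q power2_eq_square)
qed

end
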